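(* Let $M$ be a complete connected Riemannian manifold without boundary, $p\in(1,+\infty)$, $\mu\in[0,p]$, $\lambda>0$, and let $V:M\to(0,+\infty)$ be a continuous function such that \[ V\ge\lambda \ \text{ on } M \quad\text{if } \mu=0,\qquad \liminf_{x\to\infty}\,[\operatorname{dist}(x,o)^\mu V(x)]\ge\lambda \ \text{ for some } o\in M\quad\text{if } \mu>0. \] Let $u\in W^{1,p}_{\mathrm{loc}}(M)$. If $\Omega_+:=\{x\in M: u(x)>0\}$ has positive measure and \[ \Delta_p u\ge V u^{p-1}\qquad\text{weakly on }\Omega_+ , \] then for any $x_0\in M$ and any $q\in(p-1,+\infty)$ we have \[ \liminf_{R\to+\infty}\frac{1}{R^{1-\frac{\mu}{p}}}\log\int_{B_R(x_0)}u_+^q\ \ge\ \frac{C_0}{1-\frac{\mu}{p}}>0\qquad\text{if }\mu\in[0,p), \] \[ \liminf_{R\to+\infty}\frac{1}{\log R}\log\int_{B_R(x_0)}u_+^q\ \ge\ C_1>p\qquad\text{if }\mu=p, \] where, with $p'=\frac{p}{p-1}$, \[ C_0=\frac{p(q-p+1)^{1/p'}}{(p-1)^{1/p'}}\lambda^{1/p} \] and $C_1$ is the unique number in $(p,+\infty)$ satisfying $C_1^{1/p}(C_1-p)^{1/p'}=C_0$. Moreover, in case $\mu=p$, \[ \lim_{R\to+\infty}\frac{1}{\log R}\log\int_{B_R(x_0)}u_+^q\ \ge\ C_0+p \] whenever the limit on the left-hand side exists.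
   Context: All integrals over $M$ or its subsets are with respect to the Riemannian volume measure; $\langle\cdot,\cdot\rangle$ is the Riemannian metric. $u_+:=\max\{u,0\}$; $B_R(x_0)$ is the geodesic ball of radius $R$ centered at $x_0$; $\operatorname{dist}$ is the Riemannian distance. $W^{1,p}_{\mathrm{loc}}(M)$ is the space of functions whose restriction to every relatively compact set $\Omega\subseteq M$ belongs to $W^{1,p}(\Omega)$, and $W^{1,p}_c(M)$ is its subspace of compactly supported functions. Integrals of non-negative functions may equal $+\infty$, with $\log(+\infty)=+\infty$, $\log 0=-\infty$; limits are understood in the extended sense. $\Delta_p u=\operatorname{div}(|\nabla u|^{p-2}\nabla u)$ is the $p$-Laplacian. "$\Delta_p u\ge Vu^{p-1}$ weakly on $\Omega_+$" means \[ -\int_M\langle|\nabla u|^{p-2}\nabla u,\nabla\varphi\rangle\ \ge\ \int_M V u^{p-1}\varphi\qquad\forall\,\varphi\in D^+(\Omega_+), \] where $D^+(\Omega_+):=\{\varphi\in W^{1,p}_c(M):\ \varphi\ge0\text{ on }M,\ \varphi=0\text{ and }\nabla\varphi=0\text{ a.e. on }M\setminus\Omega_+\}$. *)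

theory Defs
  imports "HOL-Analysis.Analysis"
begin

section \<open>Smooth maps between open sets of normed spaces\<close>

primrec C_k_on ::
  "nat \<Rightarrow> 'a::real_normed_vector set \<Rightarrow> ('a \<Rightarrow> 'b::real_normed_vector) \<Rightarrow> bool" where
  "C_k_on 0 S f \<longleftrightarrow> continuous_on S f"
| "C_k_on (Suc k) S f \<longleftrightarrow>
     (\<forall>x\<in>S. f differentiable (at x)) \<and>
     (\<forall>v. C_k_on k S (\<lambda>x. frechet_derivative f (at x) v))"

definition smooth_on :: "'a::real_normed_vector set \<Rightarrow> ('a \<Rightarrow> 'b::real_normed_vector) \<Rightarrow> bool" where
  "smooth_on S f \<longleftrightarrow> (\<forall>k. C_k_on k S f)"


section \<open>Riemannian manifolds\<close>

text \<open>
  The underlying topological space of the manifold is the whole type \<open>'a\<close>, and the dimension is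
  \<open>CARD('n)\<close>. A chart is a pair of its domain and its coordinate map; the values of the
  coordinate map outside the domain are irrelevant. Tensors are given by their components in the
  charts of the atlas, subject to the usual transformation rules:
  \<open>metric M c x v w\<close> is the metric at the point \<open>x\<close>, applied to the two tangent vectors whose
  components in the chart \<open>c\<close> are \<open>v\<close> and \<open>w\<close>.
\<close>

type_synonym ('a, 'n) chart = "'a set \<times> ('a \<Rightarrow> real ^ 'n)"

record ('a, 'n) riemannian =
  atlas :: "('a, 'n::finite) chart set"
  metric :: "('a, 'n::finite) chart \<Rightarrow> 'a \<Rightarrow> real ^ 'n \<Rightarrow> real ^ 'n \<Rightarrow> real"

abbreviation cdom :: "('a, 'n::finite) chart \<Rightarrow> 'a set" where
  "cdom c \<equiv> fst c"

abbreviation coord :: "('a, 'n::finite) chart \<Rightarrow> 'a \<Rightarrow> real ^ 'n" where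
  "coord c \<equiv> snd c"

definition inv_coord :: "('a, 'n::finite) chart \<Rightarrow> real ^ 'n \<Rightarrow> 'a" where
  "inv_coord c = inv_into (cdom c) (coord c)"

definition transition ::
  "('a, 'n::finite) chart \<Rightarrow> ('a, 'n) chart \<Rightarrow> real ^ 'n \<Rightarrow> real ^ 'n" where
  "transition c d = coord d \<circ> inv_coord c"

text \<open>Change of the components of a tangent vector at \<open>x\<close> from the chart \<open>c\<close> to the chart \<open>d\<close>.\<close>

definition change_comp ::
  "('a, 'n::finite) chart \<Rightarrow> ('a, 'n) chart \<Rightarrow> 'a \<Rightarrow> real ^ 'n \<Rightarrow> real ^ 'n" where
  "change_comp c d x = frechet_derivative (transition c d) (at (coord c x))"

definition smooth_atlas :: "('a::topological_space, 'n::finite) chart set \<Rightarrow> bool" where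
  "smooth_atlas A \<longleftrightarrow>
     (\<Union>c\<in>A. cdom c) = UNIV \<and>
     (\<forall>c\<in>A. open (cdom c) \<and> open (coord c ` cdom c) \<and>
        homeomorphism (cdom c) (coord c ` cdom c) (coord c) (inv_coord c)) \<and>
     (\<forall>c\<in>A. \<forall>d\<in>A. smooth_on (coord c ` (cdom c \<inter> cdom d)) (transition c d))"

definition riemannian_manifold ::
  "('a::{t2_space, second_countable_topology}, 'n::finite) riemannian \<Rightarrow> bool" where
  "riemannian_manifold M \<longleftrightarrow>
     smooth_atlas (atlas M) \<and>
     (\<forall>c\<in>atlas M. \<forall>x\<in>cdom c.
        bilinear (metric M c x) \<and>
        (\<forall>v w. metric M c x v w = metric M c x w v) \<and>
        (\<forall>v. v \<noteq> 0 \<longrightarrow> metric M c x v v > 0)) \<and>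
     (\<forall>c\<in>atlas M. \<forall>v w. smooth_on (coord c ` cdom c) (\<lambda>y. metric M c (inv_coord c y) v w)) \<and>
     (\<forall>c\<in>atlas M. \<forall>d\<in>atlas M. \<forall>x\<in>cdom c \<inter> cdom d. \<forall>v w.
        metric M c x v w = metric M d x (change_comp c d x v) (change_comp c d x w))"

text \<open>By the transformation rules, the choice of the chart at a point is immaterial below.\<close>

definition chart_at :: "('a, 'n::finite) riemannian \<Rightarrow> 'a \<Rightarrow> ('a, 'n) chart" where
  "chart_at M x = (SOME c. c \<in> atlas M \<and> x \<in> cdom c)"


subsection \<open>Distance and completeness\<close>

definition C1_curve_on ::
  "('a, 'n::finite) riemannian \<Rightarrow> real set \<Rightarrow> (real \<Rightarrow> 'a) \<Rightarrow> bool" where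
  "C1_curve_on M I \<gamma> \<longleftrightarrow>
     (\<forall>c\<in>atlas M. \<exists>D. continuous_on (I \<inter> \<gamma> -` cdom c) D \<and>
        (\<forall>t\<in>I \<inter> \<gamma> -` cdom c. (coord c \<circ> \<gamma> has_vector_derivative D t) (at t within I)))"

definition piecewise_C1_curve ::
  "('a::topological_space, 'n::finite) riemannian \<Rightarrow> (real \<Rightarrow> 'a) \<Rightarrow> bool" where
  "piecewise_C1_curve M \<gamma> \<longleftrightarrow> path \<gamma> \<and>
     (\<exists>(n::nat) t. t 0 = 0 \<and> t n = 1 \<and>
        (\<forall>i<n. t i < t (Suc i) \<and> C1_curve_on M {t i..t (Suc i)} \<gamma>))"

definition speed :: "('a, 'n::finite) riemannian \<Rightarrow> (real \<Rightarrow> 'a) \<Rightarrow> real \<Rightarrow> real" where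
  "speed M \<gamma> t =
     (let c = chart_at M (\<gamma> t); v = vector_derivative (coord c \<circ> \<gamma>) (at t within {0..1})
      in sqrt (metric M c (\<gamma> t) v v))"

definition curve_length :: "('a, 'n::finite) riemannian \<Rightarrow> (real \<Rightarrow> 'a) \<Rightarrow> real" where
  "curve_length M \<gamma> = integral {0..1} (speed M \<gamma>)"

definition riem_dist ::
  "('a::topological_space, 'n::finite) riemannian \<Rightarrow> 'a \<Rightarrow> 'a \<Rightarrow> real" where
  "riem_dist M x y =
     Inf {curve_length M \<gamma> | \<gamma>. piecewise_C1_curve M \<gamma> \<and> pathstart \<gamma> = x \<and> pathfinish \<gamma> = y}"

definition riem_ball ::
  "('a::topological_space, 'n::finite) riemannian \<Rightarrow> 'a \<Rightarrow> real \<Rightarrow> 'a set" where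
  "riem_ball M x r = {y. riem_dist M x y < r}"

definition riem_complete :: "('a::topological_space, 'n::finite) riemannian \<Rightarrow> bool" where
  "riem_complete M \<longleftrightarrow>
     (\<forall>s :: nat \<Rightarrow> 'a.
        (\<forall>e>0. \<exists>N. \<forall>m\<ge>N. \<forall>n\<ge>N. riem_dist M (s m) (s n) < e) \<longrightarrow>
        (\<exists>l. (\<lambda>n. riem_dist M (s n) l) \<longlonglongrightarrow> 0))"


subsection \<open>Volume\<close>

definition vol_density :: "('a, 'n::finite) riemannian \<Rightarrow> ('a, 'n) chart \<Rightarrow> 'a \<Rightarrow> real" where
  "vol_density M c x = sqrt (det (\<chi> i j. metric M c x (axis i 1) (axis j 1)))"

text \<open>This determines the measure uniquely, since countably many charts cover the manifold.\<close>

definition riemannian_volume ::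
  "('a::topological_space, 'n::finite) riemannian \<Rightarrow> 'a measure \<Rightarrow> bool" where
  "riemannian_volume M vol \<longleftrightarrow>
     sets vol = sets borel \<and>
     (\<forall>c\<in>atlas M. \<forall>E\<in>sets borel. E \<subseteq> cdom c \<longrightarrow>
        emeasure vol E =
          (\<integral>\<^sup>+y\<in>coord c ` E. ennreal (vol_density M c (inv_coord c y)) \<partial>lborel))"


section \<open>Vector fields and Sobolev functions\<close>

text \<open>A vector field is given by its components: \<open>X c x\<close> are those of \<open>X\<close> at \<open>x\<close> in the chart \<open>c\<close>.\<close>

type_synonym ('a, 'n) vfield = "('a, 'n) chart \<Rightarrow> 'a \<Rightarrow> real ^ 'n"

definition measurable_vfield_on ::
  "('a::topological_space, 'n::finite) riemannian \<Rightarrow> 'a set \<Rightarrow> ('a, 'n) vfield \<Rightarrow> bool" where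
  "measurable_vfield_on M \<Omega> X \<longleftrightarrow>
     (\<forall>c\<in>atlas M. \<forall>d\<in>atlas M. \<forall>x\<in>\<Omega> \<inter> cdom c \<inter> cdom d. X d x = change_comp c d x (X c x)) \<and>
     (\<forall>c\<in>atlas M. X c \<in> borel_measurable (restrict_space borel (\<Omega> \<inter> cdom c)))"

definition riem_inner ::
  "('a, 'n::finite) riemannian \<Rightarrow> ('a, 'n) vfield \<Rightarrow> ('a, 'n) vfield \<Rightarrow> 'a \<Rightarrow> real" where
  "riem_inner M X Y x = (let c = chart_at M x in metric M c x (X c x) (Y c x))"

definition riem_norm ::
  "('a, 'n::finite) riemannian \<Rightarrow> ('a, 'n) vfield \<Rightarrow> 'a \<Rightarrow> real" where
  "riem_norm M X x = sqrt (riem_inner M X X x)"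

definition test_function_on :: "(real ^ 'n::finite) set \<Rightarrow> (real ^ 'n \<Rightarrow> real) \<Rightarrow> bool" where
  "test_function_on W \<eta> \<longleftrightarrow>
     smooth_on UNIV \<eta> \<and> compact (closure {y. \<eta> y \<noteq> 0}) \<and> closure {y. \<eta> y \<noteq> 0} \<subseteq> W"

text \<open>
  \<open>in_W1p M vol p \<Omega> u X\<close>: on the open set \<open>\<Omega>\<close>, \<open>u\<close> is in W^{1,p} and its weak gradient is
  \<open>X\<close>. In each chart the differential of \<open>u\<close> is the covector field \<open>v \<mapsto> metric M c x (X c x) v\<close>, and
  it has to be the distributional differential of the coordinate expression of \<open>u\<close>. The integrands
  in the last condition are integrable because \<open>u\<close> and \<open>X\<close> are in L^p and \<open>p \<ge> 1\<close>.
\<close>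

definition in_W1p ::
  "('a::topological_space, 'n::finite) riemannian \<Rightarrow> 'a measure \<Rightarrow> real \<Rightarrow> 'a set \<Rightarrow>
     ('a \<Rightarrow> real) \<Rightarrow> ('a, 'n) vfield \<Rightarrow> bool" where
  "in_W1p M vol p \<Omega> u X \<longleftrightarrow>
     u \<in> borel_measurable (restrict_space borel \<Omega>) \<and>
     measurable_vfield_on M \<Omega> X \<and>
     set_integrable vol \<Omega> (\<lambda>x. \<bar>u x\<bar> powr p) \<and>
     set_integrable vol \<Omega> (\<lambda>x. riem_norm M X x powr p) \<and>
     (\<forall>c\<in>atlas M. \<forall>\<eta> v. test_function_on (coord c ` (\<Omega> \<inter> cdom c)) \<eta> \<longrightarrow>
        (LINT y|lborel. u (inv_coord c y) * frechet_derivative \<eta> (at y) v) =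
        - (LINT y|lborel. metric M c (inv_coord c y) (X c (inv_coord c y)) v * \<eta> y))"

definition in_W1p_loc ::
  "('a::topological_space, 'n::finite) riemannian \<Rightarrow> 'a measure \<Rightarrow> real \<Rightarrow>
     ('a \<Rightarrow> real) \<Rightarrow> ('a, 'n) vfield \<Rightarrow> bool" where
  "in_W1p_loc M vol p u X \<longleftrightarrow>
     (\<forall>\<Omega>. open \<Omega> \<and> compact (closure \<Omega>) \<longrightarrow> in_W1p M vol p \<Omega> u X)"

definition W1p_loc ::
  "('a::topological_space, 'n::finite) riemannian \<Rightarrow> 'a measure \<Rightarrow> real \<Rightarrow> ('a \<Rightarrow> real) set" where
  "W1p_loc M vol p = {u. \<exists>X. in_W1p_loc M vol p u X}"

text \<open>The test functions, each paired with its weak gradient, which is unique almost everywhere.\<close>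

definition D_plus ::
  "('a::topological_space, 'n::finite) riemannian \<Rightarrow> 'a measure \<Rightarrow> real \<Rightarrow> 'a set \<Rightarrow>
     (('a \<Rightarrow> real) \<times> ('a, 'n) vfield) set" where
  "D_plus M vol p \<Omega> =
     {(\<phi>, Y). in_W1p_loc M vol p \<phi> Y \<and> compact (closure {x. \<phi> x \<noteq> 0}) \<and>
        (\<forall>x. \<phi> x \<ge> 0) \<and>
        (AE x in vol. x \<notin> \<Omega> \<longrightarrow> \<phi> x = 0 \<and> riem_norm M Y x = 0)}"

text \<open>
  The inequality \<open>\<Delta>\<^sub>p u \<ge> V u\<^bsup>p-1\<^esup>\<close> weakly on \<open>\<Omega>\<close>. As the weak gradient of \<open>u\<close> is unique
  almost everywhere, it does not matter that all its versions \<open>X\<close> are considered.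
  Note that \<open>0 powr (p - 2) = 0\<close>, so that the first integrand vanishes where \<open>X\<close> does.
\<close>

definition p_laplacian_ge_weakly_on ::
  "('a::topological_space, 'n::finite) riemannian \<Rightarrow> 'a measure \<Rightarrow> real \<Rightarrow> ('a \<Rightarrow> real) \<Rightarrow>
     ('a \<Rightarrow> real) \<Rightarrow> 'a set \<Rightarrow> bool" where
  "p_laplacian_ge_weakly_on M vol p V u \<Omega> \<longleftrightarrow>
     (\<forall>X. in_W1p_loc M vol p u X \<longrightarrow>
        (\<forall>(\<phi>, Y)\<in>D_plus M vol p \<Omega>.
           - (LINT x|vol. riem_norm M X x powr (p - 2) * riem_inner M X Y x)
           \<ge> (LINT x|vol. V x * u x powr (p - 1) * \<phi> x)))"


section \<open>Limits and logarithms in the extended sense\<close>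

text \<open>The filter of \<open>x \<longrightarrow> \<infinity>\<close> in a topological space (trivial if the space is compact).\<close>

definition at_infty :: "'a::topological_space filter" where
  "at_infty = (INF K\<in>{K. compact K}. principal (- K))"

definition elog :: "ennreal \<Rightarrow> ereal" where
  "elog a = (if a = 0 then - \<infinity> else if a = \<infinity> then \<infinity> else ereal (ln (enn2real a)))"


section \<open>The constants and the growth integral\<close>

definition growth_integral ::
  "('a::topological_space, 'n::finite) riemannian \<Rightarrow> 'a measure \<Rightarrow> real \<Rightarrow> ('a \<Rightarrow> real) \<Rightarrow>
     'a \<Rightarrow> real \<Rightarrow> ennreal" where
  "growth_integral M vol q u x0 R =
     (\<integral>\<^sup>+x\<in>riem_ball M x0 R. ennreal (max (u x) 0 powr q) \<partial>vol)"

definition conj_exp :: "real \<Rightarrow> real" where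
  "conj_exp p = p / (p - 1)"

definition const_C0 :: "real \<Rightarrow> real \<Rightarrow> real \<Rightarrow> real" where
  "const_C0 p q lam =
     p * (q - p + 1) powr (1 / conj_exp p) / (p - 1) powr (1 / conj_exp p) * lam powr (1 / p)"

definition is_const_C1 :: "real \<Rightarrow> real \<Rightarrow> real \<Rightarrow> real \<Rightarrow> bool" where
  "is_const_C1 p q lam C \<longleftrightarrow>
     C > p \<and> C powr (1 / p) * (C - p) powr (1 / conj_exp p) = const_C0 p q lam"

definition const_C1 :: "real \<Rightarrow> real \<Rightarrow> real \<Rightarrow> real" where
  "const_C1 p q lam = (THE C. is_const_C1 p q lam C)"

end

theory Submission
  imports Defs
begin

text \<open>Put s = q - p + 1. Formally, the weak inequality is tested with u_+^s \<psi>^p for a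
  cut-off \<psi>. Pointwise the gradient of u occurs once with a good sign and once mixed with the
  gradient of \<psi>; Young's inequality in its sharp form (\<open>Youngs_inequality_scaled\<close>)
  removes it and leaves the Caccioppoli inequality \<open>caccioppoli\<close>: the integral of V
  u_+^q \<psi>^p is at most ((p-1)/s)^(p-1) times the integral of u_+^q |grad \<psi>|^p.

  The cut-off is adapted to the potential. Far out, V is at least l r^(-\<mu>) for any l <
  \<lambda>, where r is the distance from x0. Fix \<gamma> < C_0, let \<beta> = \<gamma>/p and let g
  > 0 solve g' = - \<beta> t^(-\<mu>/p) g, up to a shift of t. For \<psi> = (g(r) - g(R))_+ the
  right integrand is a constant times r^(-\<mu>) g(r)^p u_+^q. Where g(r) \<ge> m g(R), the cut-off
  \<psi> is nearly g(r) for large m, and the choice \<gamma> < C_0 makes the right integrand at most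
  a fraction a < 1 of the left one, so it is absorbed. What remains lives where g(r) < m g(R) and is
  at most a constant times g(R)^p W times the growth integral, W being a bound of r^(-\<mu>) there.
  The left side is bounded below independently of R because u is positive on a set of positive
  measure. Hence the growth integral is at least c / (g(R)^p W): this is
  \<open>growth_estimate\<close>.

  For \<mu> < p, g is an exponential of - R^(1-\<mu>/p), W = 1 suffices, and the growth is exp
  (\<gamma>/(1-\<mu>/p) R^(1-\<mu>/p)) (\<open>exponential_growth\<close>). For \<mu> = p, g is the
  power R^(-\<beta>); the leftover region consists of points with r comparable to R, so W is of
  order R^(-p) and the growth is R^(\<gamma>+p) (\<open>polynomial_growth\<close>). Letting \<gamma>
  tend to C_0 gives the rates. For \<mu> = p already the lower limit is at least C_0 + p, which
  gives the claim on the limit, and also the one on C_1 because C_1 \<le> C_0 + p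
  (\<open>const_C1_properties\<close>).

  Three things have to be supplied. The test function must be in W^{1,p} with a known gradient:
  u_+^s is replaced by \<open>truncated_power\<close>, which has a bounded derivative, and
  \<open>weak_chain_product_rule\<close> differentiates h(u) \<kappa> for h and \<kappa> of class
  C^1, by means of difference quotients converging in L^1. Its support must be compact: closed balls
  are compact by the argument of Hopf and Rinow (\<open>compact_riem_cball\<close>). And r must be
  differentiable: \<open>ex_C1_distance\<close> builds a C^1 function within distance 1 of r on a
  large ball whose gradient is at most 1 + \<epsilon>, as a soft minimum of finitely many
  cones.\<close>

section \<open>Rules for functions of class C^k\<close>

lemma C_k_on_Suc_D: "C_k_on (Suc k) S f \<Longrightarrow> C_k_on k S f"
proof (induction k arbitrary: f)
  case 0
  then show ?case
    by (auto intro!: continuous_at_imp_continuous_on differentiable_imp_continuous_within)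
next
  case (Suc k)
  then show ?case by (metis C_k_on.simps(2))
qed

lemma C_k_on_cong:
  assumes "open S" "\<And>x. x \<in> S \<Longrightarrow> f x = g x" "C_k_on k S f"
  shows "C_k_on k S g"
  using assms
proof (induction k arbitrary: f g)
  case 0
  then show ?case using continuous_on_cong by (metis C_k_on.simps(1))
next
  case (Suc k)
  have D: "(g has_derivative frechet_derivative f (at x)) (at x)" if "x \<in> S" for x
  proof (rule has_derivative_transform_within_open)
    show "(f has_derivative frechet_derivative f (at x)) (at x)"
      using Suc.prems(3) that frechet_derivative_works[of f "at x"] by simp
  qed (use Suc.prems that in simp_all)
  have E: "frechet_derivative g (at x) = frechet_derivative f (at x)" if "x \<in> S" for x
    using D[OF that] frechet_derivative_at by fastforce
  show ?case
    unfolding C_k_on.simps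
  proof (intro conjI ballI allI)
    show "g differentiable at x" if "x \<in> S" for x
      using D[OF that] by (auto simp: differentiable_def)
    show "C_k_on k S (\<lambda>x. frechet_derivative g (at x) v)" for v
    proof (rule Suc.IH[OF Suc.prems(1)])
      show "C_k_on k S (\<lambda>x. frechet_derivative f (at x) v)"
        using Suc.prems(3) by simp
    qed (simp add: E)
  qed
qed

lemma C_k_on_const: "C_k_on k S (\<lambda>x. c)"
  by (induction k arbitrary: c) auto

lemma C_k_on_add:
  assumes "open S" "C_k_on k S f" "C_k_on k S g"
  shows "C_k_on k S (\<lambda>x. f x + g x)"
  using assms(2,3)
proof (induction k arbitrary: f g)
  case 0
  then show ?case by (auto intro: continuous_intros)
next
  case (Suc k)
  have E: "frechet_derivative f (at x) v + frechet_derivative g (at x) v =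
      frechet_derivative (\<lambda>x. f x + g x) (at x) v" if "x \<in> S" for x v
    using Suc.prems that
    by (subst frechet_derivative_at[symmetric,
          OF has_derivative_add[OF frechet_derivative_works[THEN iffD1] frechet_derivative_works[THEN iffD1]]]) auto
  have "C_k_on k S (\<lambda>x. frechet_derivative f (at x) v + frechet_derivative g (at x) v)" for v
    using Suc.prems by (intro Suc.IH) simp_all
  from C_k_on_cong[OF \<open>open S\<close> E this] show ?case
    using Suc.prems by simp
qed

lemma C_k_on_mult:
  fixes f g :: "'a::real_normed_vector \<Rightarrow> real"
  assumes "open S" "C_k_on k S f" "C_k_on k S g"
  shows "C_k_on k S (\<lambda>x. f x * g x)"
  using assms(2,3)
proof (induction k arbitrary: f g)
  case 0
  then show ?case by (auto intro: continuous_intros)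
next
  case (Suc k)
  have E: "f x * frechet_derivative g (at x) v + frechet_derivative f (at x) v * g x =
      frechet_derivative (\<lambda>x. f x * g x) (at x) v" if "x \<in> S" for x v
    using Suc.prems that
    by (subst frechet_derivative_at[symmetric,
          OF has_derivative_mult[OF frechet_derivative_works[THEN iffD1] frechet_derivative_works[THEN iffD1]]]) auto
  have "C_k_on k S (\<lambda>x. f x * frechet_derivative g (at x) v + frechet_derivative f (at x) v * g x)" for v
    by (intro C_k_on_add[OF \<open>open S\<close>] Suc.IH C_k_on_Suc_D[OF Suc.prems(1)]
          C_k_on_Suc_D[OF Suc.prems(2)])
       (use Suc.prems in simp_all)
  from C_k_on_cong[OF \<open>open S\<close> E this] show ?case
    using Suc.prems by simp
qed

lemma C_k_on_prod:
  fixes f :: "'i \<Rightarrow> 'a::real_normed_vector \<Rightarrow> real"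
  assumes "open S" "finite I" "\<And>i. i \<in> I \<Longrightarrow> C_k_on k S (f i)"
  shows "C_k_on k S (\<lambda>x. \<Prod>i\<in>I. f i x)"
  using assms(2,3)
  by (induction I rule: finite_induct) (auto intro: C_k_on_const C_k_on_mult[OF assms(1)])

text \<open>Differentiating raises the index \<open>n\<close> and multiplies by a constant, so the
  induction on \<open>k\<close> runs for all \<open>n\<close> at once. This transfers smoothness of
  a function of one real variable, given with the sequence of its derivatives, to several
  variables.\<close>

lemma C_k_on_ridge:
  fixes D :: "nat \<Rightarrow> real \<Rightarrow> real" and a :: "'a::real_inner"
  assumes D: "\<And>n x. (D n has_real_derivative D (Suc n) x) (at x)"
  shows "C_k_on k UNIV (\<lambda>y. D n (a \<bullet> y + c))"
proof (induction k arbitrary: n)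
  case 0
  have "continuous_on UNIV (D n)"
    using D by (meson DERIV_continuous continuous_at_imp_continuous_on)
  then show ?case
    by (auto intro!: continuous_intros continuous_on_compose2[of UNIV "D n"])
next
  case (Suc k)
  have *: "((\<lambda>y. D n (a \<bullet> y + c)) has_derivative (\<lambda>v. D (Suc n) (a \<bullet> y + c) * (a \<bullet> v))) (at y)" for y
  proof -
    have "((\<lambda>y. a \<bullet> y + c) has_derivative (\<lambda>v. a \<bullet> v)) (at y)"
      by (auto intro!: derivative_eq_intros)
    from has_derivative_compose[OF this D[unfolded has_field_derivative_def]] show ?thesis
      by simp
  qed
  have "frechet_derivative (\<lambda>y. D n (a \<bullet> y + c)) (at y) = (\<lambda>v. D (Suc n) (a \<bullet> y + c) * (a \<bullet> v))" for y
    using frechet_derivative_at[OF *] by auto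
  then show ?case
    using * Suc by (auto simp: differentiable_def intro!: C_k_on_mult C_k_on_const)
qed

section \<open>Smooth bumps supported in boxes\<close>

text \<open>The derivative of P(1/x) exp(-1/x) is x^(-2) (P - P')(1/x) exp(-1/x). So
  \<open>flat n\<close> below is the n-th derivative of the function exp(-1/x), extended by 0 to x
  \<le> 0.\<close>

primrec flat_poly :: "nat \<Rightarrow> real poly" where
  "flat_poly 0 = 1"
| "flat_poly (Suc n) = monom 1 2 * (flat_poly n - pderiv (flat_poly n))"

definition flat :: "nat \<Rightarrow> real \<Rightarrow> real" where
  "flat n x = (if x \<le> 0 then 0 else poly (flat_poly n) (1 / x) * exp (- 1 / x))"

lemma poly_exp_tendsto_0: "((\<lambda>s. poly (P :: real poly) s * exp (- s)) \<longlongrightarrow> 0) at_top"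
proof -
  have "((\<lambda>s. \<Sum>i\<le>degree P. coeff P i * (s ^ i / exp s)) \<longlongrightarrow> (\<Sum>i\<le>degree P. coeff P i * 0)) at_top"
    by (intro tendsto_intros tendsto_power_div_exp_0)
  then show ?thesis
    by (simp add: poly_altdef sum_distrib_right exp_minus divide_inverse mult.assoc)
qed

lemma flat_deriv: "(flat n has_real_derivative flat (Suc n) x) (at x)"
proof -
  consider "x < 0" | "x > 0" | "x = 0" by linarith
  then show ?thesis
  proof cases
    case 1
    have "(flat n has_real_derivative 0) (at x)"
      using 1 by (intro DERIV_cong_ev[THEN iffD2, OF refl _ refl DERIV_const[of 0]])
        (auto simp: flat_def eventually_nhds intro!: exI[of _ "{..<0}"])
    then show ?thesis using 1 by (simp add: flat_def)
  next
    case 2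
    have "((\<lambda>x. poly (flat_poly n) (1 / x) * exp (- 1 / x)) has_real_derivative flat (Suc n) x) (at x)"
      using 2 by (auto intro!: derivative_eq_intros DERIV_chain2[OF poly_DERIV]
          simp: flat_def poly_monom field_simps power2_eq_square)
    then show ?thesis
      using 2 by (subst DERIV_cong_ev[OF refl _ refl])
        (auto simp: flat_def eventually_nhds intro!: exI[of _ "{0<..}"])
  next
    case 3
    \<comment> \<open>In the variable s = 1/h, the difference quotient at 0 from the right is a
      polynomial times exp(-s); the factor \<open>monom 1 1\<close> stands for the division by
      h.\<close>
    have "((\<lambda>s. poly (monom 1 1 * flat_poly n) s * exp (- s)) \<longlongrightarrow> 0) at_top"
      by (rule poly_exp_tendsto_0)
    then have "((\<lambda>h. poly (monom 1 1 * flat_poly n) (inverse h) * exp (- inverse h)) \<longlongrightarrow> 0) (at_right 0)"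
      by (rule filterlim_compose) (rule filterlim_inverse_at_top_right)
    then have R: "((\<lambda>h. flat n h / h) \<longlongrightarrow> 0) (at_right 0)"
      by (rule Lim_transform_eventually)
         (auto simp: flat_def eventually_at_right_field poly_monom field_simps intro!: exI[of _ 1])
    have L: "((\<lambda>h. flat n h / h) \<longlongrightarrow> 0) (at_left 0)"
      by (rule Lim_transform_eventually[OF tendsto_const])
         (auto simp: flat_def eventually_at_left_field intro!: exI[of _ "-1"])
    show ?thesis
      using filterlim_split_at[OF L R] 3
      by (simp add: has_field_derivative_iff flat_def)
  qed
qed

lemma flat_0_bounds: "0 \<le> flat 0 x" "flat 0 x \<le> 1" "x \<le> 0 \<Longrightarrow> flat 0 x = 0"
  by (auto simp: flat_def)

text \<open>Increasing \<open>k\<close> steepens the flanks, so that these bumps, which vanish off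
  the open box, converge to its indicator. They are the only test functions to which the definition
  of the weak derivative has to be applied before indicators of boxes can be used.\<close>

definition box_bump :: "real ^ 'n::finite \<Rightarrow> real ^ 'n \<Rightarrow> nat \<Rightarrow> real ^ 'n \<Rightarrow> real" where
  "box_bump a b k y =
     (\<Prod>i\<in>UNIV. flat 0 (real (Suc k) * (y $ i - a $ i)) * flat 0 (real (Suc k) * (b $ i - y $ i)))"

lemma smooth_box_bump:
  fixes a b :: "real ^ 'n::finite"
  shows "smooth_on UNIV (box_bump a b k)"
  unfolding smooth_on_def
proof
  fix m
  have 1: "C_k_on m UNIV (\<lambda>y. flat 0 (real (Suc k) * (y $ i - a $ i)))" for i
    using C_k_on_ridge[of flat m 0 "real (Suc k) *\<^sub>R (axis i 1 :: real ^ 'n)" "- real (Suc k) * a $ i", OF flat_deriv]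
    by (simp add: inner_axis' algebra_simps cart_eq_inner_axis[symmetric] del: of_nat_Suc)
  have 2: "C_k_on m UNIV (\<lambda>y. flat 0 (real (Suc k) * (b $ i - y $ i)))" for i
    using C_k_on_ridge[of flat m 0 "- real (Suc k) *\<^sub>R (axis i 1 :: real ^ 'n)" "real (Suc k) * b $ i", OF flat_deriv]
    by (simp add: inner_axis' algebra_simps cart_eq_inner_axis[symmetric] del: of_nat_Suc)
  have "C_k_on m UNIV (\<lambda>y. \<Prod>i\<in>UNIV.
     flat 0 (real (Suc k) * (y $ i - a $ i)) * flat 0 (real (Suc k) * (b $ i - y $ i)))"
    by (intro C_k_on_prod C_k_on_mult 1 2) auto
  then show "C_k_on m UNIV (box_bump a b k)"
    by (subst C_k_on_cong[OF open_UNIV, of _ "box_bump a b k"]) (auto simp: box_bump_def)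
qed

lemma box_bump_bounds: "0 \<le> box_bump a b k y" "box_bump a b k y \<le> 1"
  unfolding box_bump_def using flat_0_bounds
  by (auto intro!: prod_nonneg prod_le_1 mult_nonneg_nonneg mult_le_one)

lemma box_bump_eq_0: "y \<notin> box a b \<Longrightarrow> box_bump a b k y = 0"
proof -
  assume "y \<notin> box a b"
  then obtain i where "\<not> (a $ i < y $ i \<and> y $ i < b $ i)"
    unfolding mem_box_cart by blast
  then have "y $ i - a $ i \<le> 0 \<or> b $ i - y $ i \<le> 0"
    by linarith
  then have "flat 0 (real (Suc k) * (y $ i - a $ i)) * flat 0 (real (Suc k) * (b $ i - y $ i)) = 0"
    by (auto simp: flat_0_bounds(3) mult_nonneg_nonpos)
  then show ?thesis
    unfolding box_bump_def by (metis (no_types, lifting) UNIV_I finite prod_zero_iff)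
qed

lemma box_bump_tendsto: "(\<lambda>k. box_bump a b k y) \<longlonglongrightarrow> indicator (box a b) y"
proof (cases "y \<in> box a b")
  case True
  have *: "(\<lambda>k. flat 0 (real (Suc k) * t)) \<longlonglongrightarrow> 1" if "t > 0" for t
  proof -
    have "(\<lambda>k. exp (- (1 / t) * (1 / real (Suc k)))) \<longlonglongrightarrow> exp (- (1 / t) * 0)"
      by (intro tendsto_intros LIMSEQ_Suc[OF lim_1_over_n])
    moreover have "flat 0 (real (Suc k) * t) = exp (- (1 / t) * (1 / real (Suc k)))" for k
    proof -
      have "real (Suc k) * t > 0" using that by simp
      then show ?thesis by (simp add: flat_def not_le mult.commute del: of_nat_Suc)
    qed
    ultimately show ?thesis by simp
  qed
  have "(\<lambda>k. box_bump a b k y) \<longlonglongrightarrow> (\<Prod>i\<in>(UNIV :: 'a set). 1 * 1)"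
    unfolding box_bump_def using True
    by (intro tendsto_prod tendsto_mult *) (auto simp: mem_box_cart)
  then show ?thesis using True by simp
qed (simp add: box_bump_eq_0)

lemma test_function_box_bump:
  assumes "cbox a b \<subseteq> W"
  shows "test_function_on W (box_bump a b k)"
proof -
  have "{y. box_bump a b k y \<noteq> 0} \<subseteq> cbox a b"
    using box_bump_eq_0[of _ a b k] box_subset_cbox by blast
  then have "closure {y. box_bump a b k y \<noteq> 0} \<subseteq> cbox a b"
    by (rule closure_minimal) (rule closed_cbox)
  moreover from this have "compact (closure {y. box_bump a b k y \<noteq> 0})"
    using compact_Int_closed[OF compact_cbox[of a b] closed_closure] by (metis Int_absorb1)
  ultimately show ?thesis
    using assms smooth_box_bump unfolding test_function_on_def by blast
qed

lemma box_bump_shift: "box_bump (a + c) (b + c) k y = box_bump a b k (y - c)"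
  by (simp add: box_bump_def algebra_simps)

section \<open>Continuity of translations in L^1\<close>

lemma nn_integral_lborel_shift:
  fixes f :: "'a::euclidean_space \<Rightarrow> ennreal"
  assumes [measurable]: "f \<in> borel_measurable borel"
  shows "(\<integral>\<^sup>+x. f (x + c) \<partial>lborel) = (\<integral>\<^sup>+x. f x \<partial>lborel)"
  by (subst (2) lborel_distr_plus[of c, symmetric], subst nn_integral_distr) (auto simp: add.commute)

lemma integral_lborel_shift:
  fixes f :: "'a::euclidean_space \<Rightarrow> real"
  assumes [measurable]: "f \<in> borel_measurable borel"
  shows "(LINT x|lborel. f (x + c)) = (LINT x|lborel. f x)"
  by (subst (2) lborel_distr_plus[of c, symmetric], subst integral_distr) (auto simp: add.commute)

lemma integrable_lborel_shift:
  fixes f :: "'a::euclidean_space \<Rightarrow> real"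
  assumes "integrable lborel f"
  shows "integrable lborel (\<lambda>x. f (x + c))"
proof -
  have [measurable]: "f \<in> borel_measurable borel"
    using assms by auto
  have "integrable (distr lborel borel ((+) c)) f"
    using assms by (simp add: lborel_distr_plus)
  then show ?thesis
    by (subst (asm) integrable_distr_eq) (auto simp: add.commute)
qed

text \<open>Both halves of \<open>\<bar>1\<^sub>U(x + h) - 1\<^sub>U(x)\<bar>\<close> have the same integral, and by lower semicontinuity
  dominated convergence applies to the one that is dominated by \<open>1\<^sub>U\<close>.\<close>

lemma indicator_shift_tendsto:
  fixes U :: "'a::euclidean_space set"
  assumes U: "open U" "emeasure lborel U < \<infinity>" and h: "h \<longlonglongrightarrow> 0"
  shows "(\<lambda>k. LINT x|lborel. \<bar>indicator U (x + h k) - indicator U x\<bar>) \<longlonglongrightarrow> (0::real)"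
proof -
  have [measurable]: "U \<in> sets borel" using U by simp
  have iU: "integrable lborel (indicator U :: 'a \<Rightarrow> real)"
    using U by (simp add: integrable_indicator_iff)
  note iUh = integrable_lborel_shift[OF iU]
  let ?g = "\<lambda>k x. max 0 (indicator U x - indicator U (x + h k)) :: real"
  have "(\<lambda>k. LINT x|lborel. ?g k x) \<longlonglongrightarrow> (LINT (x::'a)|lborel. 0)"
  proof (rule integral_dominated_convergence[where w = "indicator U"])
    show "AE x in lborel. (\<lambda>k. ?g k x) \<longlonglongrightarrow> 0"
    proof (rule AE_I2)
      fix x :: 'a
      show "(\<lambda>k. ?g k x) \<longlonglongrightarrow> 0"
      proof (cases "x \<in> U")
        case True
        have "(\<lambda>k. x + h k) \<longlonglongrightarrow> x + 0" by (intro tendsto_intros h)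
        then have "eventually (\<lambda>k. x + h k \<in> U) sequentially"
          using U True by (simp add: tendsto_def)
        then have "eventually (\<lambda>k. ?g k x = 0) sequentially"
          by eventually_elim (use True in auto)
        then show ?thesis by (simp add: tendsto_eventually)
      qed (auto simp: indicator_def)
    qed
  qed (use iU in \<open>auto simp: indicator_def\<close>)
  moreover have "(LINT x|lborel. \<bar>indicator U (x + h k) - indicator U x\<bar>) = 2 * (LINT x|lborel. ?g k x)" for k
  proof -
    have ig: "integrable lborel (?g k)"
      using iU iUh by (intro integrable_max) auto
    have "(LINT x|lborel. \<bar>indicator U (x + h k) - indicator U x\<bar>) =
        (LINT x|lborel. 2 * ?g k x + (indicator U (x + h k) - indicator U x))"
      by (intro Bochner_Integration.integral_cong) (auto simp: max_def abs_if)
    also have "\<dots> = 2 * (LINT x|lborel. ?g k x) +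
        ((LINT x|lborel. indicator U (x + h k)) - (LINT x|lborel. indicator U x))"
      using iU iUh ig by simp
    finally show ?thesis using integral_lborel_shift[of "indicator U" "h k"] by simp
  qed
  ultimately show ?thesis
    using tendsto_mult_left[of _ 0 _ 2] by simp
qed

lemma L1_dist_triangle:
  assumes "integrable M f" "integrable M g" "integrable M (h :: _ \<Rightarrow> real)"
  shows "(LINT x|M. \<bar>f x - h x\<bar>) \<le> (LINT x|M. \<bar>f x - g x\<bar>) + (LINT x|M. \<bar>g x - h x\<bar>)"
proof -
  have "(LINT x|M. \<bar>f x - h x\<bar>) \<le> (LINT x|M. \<bar>f x - g x\<bar> + \<bar>g x - h x\<bar>)"
    using assms by (intro integral_mono) auto
  then show ?thesis using assms by simp
qed

text \<open>Translation preserves the L^1 distance of \<open>F\<close> and \<open>G\<close>, so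
  replacing \<open>F\<close> by \<open>G\<close> costs this distance twice, uniformly in
  \<open>c\<close>. This carries continuity of translations from a dense class to its
  closure.\<close>

lemma L1_shift_approx:
  fixes F G :: "'a::euclidean_space \<Rightarrow> real"
  assumes F: "integrable lborel F" and G: "integrable lborel G"
  shows "(LINT x|lborel. \<bar>F (x + c) - F x\<bar>) \<le>
    (LINT x|lborel. \<bar>G (x + c) - G x\<bar>) + 2 * (LINT x|lborel. \<bar>F x - G x\<bar>)"
proof -
  have [measurable]: "F \<in> borel_measurable borel" "G \<in> borel_measurable borel"
    using F G by auto
  note i = F G integrable_lborel_shift[OF F, of c] integrable_lborel_shift[OF G, of c]
  have "(LINT x|lborel. \<bar>F (x + c) - G (x + c)\<bar>) = (LINT x|lborel. \<bar>F x - G x\<bar>)"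
    by (rule integral_lborel_shift[of "\<lambda>x. \<bar>F x - G x\<bar>"]) measurable
  moreover have "(LINT x|lborel. \<bar>G x - F x\<bar>) = (LINT x|lborel. \<bar>F x - G x\<bar>)"
    by (simp add: abs_minus_commute)
  ultimately show ?thesis
    using L1_dist_triangle[of lborel "\<lambda>x. F (x + c)" "\<lambda>x. G (x + c)" F]
      L1_dist_triangle[of lborel "\<lambda>x. G (x + c)" G F] i by simp
qed

lemma LIMSEQ_0_if_approx:
  fixes a :: "nat \<Rightarrow> real"
  assumes "\<And>k. 0 \<le> a k" "\<And>e. e > 0 \<Longrightarrow> \<exists>b. b \<longlonglongrightarrow> 0 \<and> (\<forall>k. a k \<le> b k + e)"
  shows "a \<longlonglongrightarrow> 0"
proof (rule LIMSEQ_I)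
  fix e :: real assume e: "0 < e"
  then obtain b where b: "b \<longlonglongrightarrow> 0" "\<And>k. a k \<le> b k + e/2"
    using assms(2)[of "e/2"] by auto
  then obtain N where "\<forall>k\<ge>N. norm (b k - 0) < e/2"
    using e by (meson LIMSEQ_D half_gt_zero)
  then have "\<forall>k\<ge>N. norm (a k - 0) < e"
    using b(2) assms(1) by (smt (verit) real_norm_def field_sum_of_halves)
  then show "\<exists>N. \<forall>k\<ge>N. norm (a k - 0) < e" by blast
qed

text \<open>Open sets of finite measure are settled by \<open>indicator_shift_tendsto\<close>; a
  measurable set of finite measure is approximated from outside by an open one, and sums and
  dominated limits follow by \<open>L1_shift_approx\<close>.\<close>

proposition L1_shift_tendsto:
  fixes F :: "'a::euclidean_space \<Rightarrow> real"
  assumes F: "integrable lborel F" and h: "h \<longlonglongrightarrow> 0"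
  shows "(\<lambda>k. LINT x|lborel. \<bar>F (x + h k) - F x\<bar>) \<longlonglongrightarrow> 0"
  using F
proof (induction F rule: integrable_induct)
  case (base A c)
  show ?case
  proof (rule LIMSEQ_0_if_approx)
    fix e :: real assume e: "e > 0"
    \<comment> \<open>Twice the error \<bar>c\<bar> * d is at most e; the summand 1 covers c =
      0.\<close>
    define d where "d = e / (2 * (\<bar>c\<bar> + 1))"
    have d: "d > 0" using e by (simp add: d_def)
    have "A \<in> sets lebesgue" using base by simp
    from sets_lebesgue_outer_open[OF this d] obtain T where
      T: "open T" "A \<subseteq> T" "T - A \<in> lmeasurable" "emeasure lebesgue (T - A) < ennreal d" by blast
    have [measurable]: "T \<in> sets borel" "A \<in> sets borel" using T base by auto
    have TA: "emeasure lborel (T - A) < ennreal d"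
      using T by simp
    have "emeasure lborel T \<le> emeasure lborel A + emeasure lborel (T - A)"
      by (subst plus_emeasure) (use T(2) in \<open>auto intro!: emeasure_mono\<close>)
    also have "\<dots> < \<infinity>"
      using base TA by (metis ennreal_add_less_top ennreal_less_top infinity_ennreal_def order_less_trans)
    finally have Tfin: "emeasure lborel T < \<infinity>" .
    let ?F = "\<lambda>x. indicat_real A x *\<^sub>R c" and ?G = "\<lambda>x. indicat_real T x *\<^sub>R c"
    have iF: "integrable lborel ?F" "integrable lborel ?G"
      using base Tfin by (auto simp: integrable_indicator_iff intro!: integrable_mult_left)
    have "(LINT x|lborel. \<bar>?F x - ?G x\<bar>) = (LINT x|lborel. \<bar>c\<bar> * indicator (T - A) x)"
      using T(2) by (intro Bochner_Integration.integral_cong) (auto simp: indicator_def)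
    also have "\<dots> = \<bar>c\<bar> * measure lborel (T - A)" by simp
    also have "\<dots> \<le> \<bar>c\<bar> * d"
      using TA d by (intro mult_left_mono) (auto simp: measure_def enn2real_leI)
    also have "\<dots> \<le> e / 2"
      using e by (simp add: d_def divide_simps)
    finally have 1: "(LINT x|lborel. \<bar>?F x - ?G x\<bar>) \<le> e / 2" .
    have "(LINT x|lborel. \<bar>?G (x + h k) - ?G x\<bar>) =
       \<bar>c\<bar> * (LINT x|lborel. \<bar>indicator T (x + h k) - indicator T x\<bar>)" for k
      by (subst integral_mult_right_zero[symmetric], intro Bochner_Integration.integral_cong)
        (auto simp: abs_mult[symmetric] algebra_simps)
    then have "(\<lambda>k. LINT x|lborel. \<bar>?G (x + h k) - ?G x\<bar>) \<longlonglongrightarrow> \<bar>c\<bar> * 0"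
      using tendsto_mult_left[OF indicator_shift_tendsto[OF T(1) Tfin h]] by presburger
    moreover have "(LINT x|lborel. \<bar>?F (x + h k) - ?F x\<bar>) \<le> (LINT x|lborel. \<bar>?G (x + h k) - ?G x\<bar>) + e" for k
      using L1_shift_approx[OF iF, of "h k"] 1 by simp
    ultimately show "\<exists>b. b \<longlonglongrightarrow> 0 \<and> (\<forall>k. (LINT x|lborel. \<bar>?F (x + h k) - ?F x\<bar>) \<le> b k + e)"
      by (intro exI[of _ "\<lambda>k. LINT x|lborel. \<bar>?G (x + h k) - ?G x\<bar>"]) simp
  qed simp
next
  case (add f g)
  note i = add(1,2) integrable_lborel_shift[OF add(1)] integrable_lborel_shift[OF add(2)]
  have le: "(LINT x|lborel. \<bar>(f (x + h k) + g (x + h k)) - (f x + g x)\<bar>) \<le>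
    (LINT x|lborel. \<bar>f (x + h k) - f x\<bar>) + (LINT x|lborel. \<bar>g (x + h k) - g x\<bar>)" for k
  proof -
    have "(LINT x|lborel. \<bar>(f (x + h k) + g (x + h k)) - (f x + g x)\<bar>) \<le>
        (LINT x|lborel. \<bar>f (x + h k) - f x\<bar> + \<bar>g (x + h k) - g x\<bar>)"
      using i by (intro integral_mono) auto
    then show ?thesis using i by simp
  qed
  have "(\<lambda>k. (LINT x|lborel. \<bar>f (x + h k) - f x\<bar>) + (LINT x|lborel. \<bar>g (x + h k) - g x\<bar>)) \<longlonglongrightarrow> 0"
    using tendsto_add[OF add(3,4)] by simp
  then show ?case
    by (rule tendsto_sandwich[OF _ _ tendsto_const, rotated 2]) (use le in auto)
next
  case (lim f s)
  show ?case
  proof (rule LIMSEQ_0_if_approx)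
    fix e :: real assume e: "e > 0"
    have "(\<lambda>i. LINT x|lborel. \<bar>f x - s i x\<bar>) \<longlonglongrightarrow> (LINT (x::'a)|lborel. 0)"
    proof (rule integral_dominated_convergence[where w = "\<lambda>x. 3 * \<bar>f x\<bar>"])
      show "AE x in lborel. (\<lambda>i. \<bar>f x - s i x\<bar>) \<longlonglongrightarrow> 0"
      proof (rule AE_I2)
        fix x :: 'a
        have "(\<lambda>i. \<bar>f x - s i x\<bar>) \<longlonglongrightarrow> \<bar>f x - f x\<bar>"
          by (intro tendsto_intros lim) simp
        then show "(\<lambda>i. \<bar>f x - s i x\<bar>) \<longlonglongrightarrow> 0" by simp
      qed
      show "AE x in lborel. norm \<bar>f x - s i x\<bar> \<le> 3 * \<bar>f x\<bar>" for i
      proof (rule AE_I2)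
        fix x :: 'a
        have "norm (s i x) \<le> 2 * norm (f x)" using lim.hyps(3)[of x i] by simp
        then show "norm \<bar>f x - s i x\<bar> \<le> 3 * \<bar>f x\<bar>" by simp
      qed
    qed (use lim in auto)
    then obtain i where "(LINT x|lborel. \<bar>f x - s i x\<bar>) < e/2"
      using e by (auto simp: LIMSEQ_def dist_real_def dest!: spec[of _ "e/2"])
    then have "(LINT x|lborel. \<bar>f (x + h k) - f x\<bar>) \<le> (LINT x|lborel. \<bar>s i (x + h k) - s i x\<bar>) + e" for k
      using L1_shift_approx[OF lim.hyps(4) lim.hyps(1)[of i], of "h k"] by simp
    then show "\<exists>b. b \<longlonglongrightarrow> 0 \<and> (\<forall>k. (LINT x|lborel. \<bar>f (x + h k) - f x\<bar>) \<le> b k + e)"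
      using lim.IH[of i] by blast
  qed simp
qed

section \<open>Weakly differentiable functions along segments\<close>

text \<open>Open boxes form an intersection-stable generator of the Borel sets. Hence inside a fixed
  box with closure in \<open>U\<close> all integrals of \<open>G\<close> over Borel sets vanish, and
  countably many closed boxes exhaust \<open>U\<close>, their boundaries being null.\<close>

lemma AE_zero_if_box_integrals_zero:
  fixes G :: "'a::euclidean_space \<Rightarrow> real"
  assumes G: "integrable lborel G"
    and zero: "\<And>a b. cbox a b \<subseteq> U \<Longrightarrow> (LINT x|lborel. indicator (box a b) x * G x) = 0"
    and U: "open U"
  shows "AE x in lborel. x \<in> U \<longrightarrow> G x = 0"
proof -
  have [measurable]: "G \<in> borel_measurable borel" using G by auto
  have box: "AE x in lborel. x \<in> box c d \<longrightarrow> G x = 0" if cd: "cbox c d \<subseteq> U" for c d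
  proof -
    let ?G = "\<lambda>x. indicator (box c d) x * G x"
    have iG: "integrable lborel ?G"
      using integrable_mult_indicator[OF _ G, of "box c d"] by simp
    have "set_lebesgue_integral lborel A ?G = 0" if "A \<in> sets lborel" for A
    proof -
      have *: "Int_stable (range (\<lambda>(a, b). box a b :: 'a set))"
          "range (\<lambda>(a, b). box a b :: 'a set) \<subseteq> Pow UNIV"
        by (auto simp: Int_stable_def box_Int_box)
      have "A \<in> sigma_sets UNIV (range (\<lambda>(a, b). box a b))"
        using that by (simp add: borel_eq_box)
      with * show ?thesis
      proof (induction rule: sigma_sets_induct_disjoint)
        case (basic A)
        then obtain a b where A: "A = box a b" by auto
        \<comment> \<open>The corners of the intersection of \<open>box a b\<close> and
          \<open>box c d\<close>. Its closed version lies in \<open>cbox c d\<close>, so the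
          hypothesis \<open>zero\<close> applies to it.\<close>
        define a' where "a' = (\<Sum>i\<in>Basis. max (a \<bullet> i) (c \<bullet> i) *\<^sub>R i)"
        define b' where "b' = (\<Sum>i\<in>Basis. min (b \<bullet> i) (d \<bullet> i) *\<^sub>R i)"
        have "cbox a' b' \<subseteq> U"
          using cd Int_interval[of a b c d] by (auto simp: a'_def b'_def)
        from zero[OF this] show ?case
          using box_Int_box[of a b c d]
          by (simp add: A a'_def b'_def set_lebesgue_integral_def mult.assoc[symmetric] indicator_inter_arith[symmetric])
      next
        case (compl A)
        have "A \<in> sets lborel" using compl by (simp add: borel_eq_box)
        then have "set_integrable lborel A ?G"
          using iG unfolding set_integrable_def by (rule integrable_mult_indicator)
        moreover have "(LINT x|lborel. ?G x) = 0" by (rule zero[OF cd])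
        ultimately show ?case
          using compl iG
          by (simp add: set_lebesgue_integral_def set_integrable_def Compl_eq_Diff_UNIV[symmetric] indicator_compl left_diff_distrib)
      next
        case (union A)
        have A: "A i \<in> sets lborel" for i using union by (auto simp: borel_eq_box)
        then have "set_integrable lborel (\<Union>i. A i) ?G"
          using iG unfolding set_integrable_def by (intro integrable_mult_indicator sets.countable_UN) auto
        then show ?case
          using union A by (subst lebesgue_integral_countable_add) (auto simp: disjoint_family_on_def)
      qed (simp add: set_lebesgue_integral_def)
    qed
    then have "AE x in lborel. ?G x = 0"
      by (intro sigma_finite_measure.density_zero[OF sigma_finite_lborel iG])
    then show ?thesis by eventually_elim (auto simp: indicator_def)
  qed
  obtain D where D: "countable D" "D \<subseteq> Pow U" "\<And>X. X \<in> D \<Longrightarrow> \<exists>a b. X = cbox a b" "\<Union>D = U"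
    using open_countable_Union_open_cbox[OF U] by metis
  have "\<forall>X\<in>D. AE x in lborel. x \<in> X \<longrightarrow> G x = 0"
  proof
    fix X assume X: "X \<in> D"
    then obtain a b where ab: "X = cbox a b" using D by blast
    have "AE x in lborel. x \<notin> cbox a b - box a b"
    proof (rule AE_not_in)
      show "cbox a b - box a b \<in> null_sets lborel"
        using negligible_frontier_interval[of a b]
        by (auto simp: negligible_iff_null_sets null_sets_def)
    qed
    moreover have "AE x in lborel. x \<in> box a b \<longrightarrow> G x = 0"
      using X D ab by (intro box) auto
    ultimately show "AE x in lborel. x \<in> X \<longrightarrow> G x = 0"
      by eventually_elim (auto simp: ab)
  qed
  then have "AE x in lborel. \<forall>X\<in>D. x \<in> X \<longrightarrow> G x = 0"
    using D(1) by (subst AE_ball_countable) auto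
  then show ?thesis
    by eventually_elim (use D(4) in auto)
qed

lemma differentiable_along_line:
  fixes g :: "'a::real_normed_vector \<Rightarrow> real"
  assumes "g differentiable at (y + s *\<^sub>R v)"
  shows "((\<lambda>s. g (y + s *\<^sub>R v)) has_real_derivative frechet_derivative g (at (y + s *\<^sub>R v)) v) (at s)"
proof -
  let ?D = "frechet_derivative g (at (y + s *\<^sub>R v))"
  have D: "(g has_derivative ?D) (at (y + s *\<^sub>R v))"
    using assms frechet_derivative_works by blast
  have "((\<lambda>s. y + s *\<^sub>R v) has_derivative (\<lambda>h. h *\<^sub>R v)) (at s)"
    by (auto intro!: derivative_eq_intros)
  from has_derivative_compose[OF this D]
  have "((\<lambda>s. g (y + s *\<^sub>R v)) has_derivative (\<lambda>h. ?D (h *\<^sub>R v))) (at s)" .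
  moreover have "(\<lambda>h. ?D (h *\<^sub>R v)) = (\<lambda>h. ?D v * h)"
    using linear_cmul[OF has_derivative_linear[OF D]] by (auto simp: mult.commute)
  ultimately show ?thesis by (simp add: has_field_derivative_def)
qed

lemma diff_along_line_le:
  fixes g :: "'a::real_normed_vector \<Rightarrow> real"
  assumes "0 \<le> t" "\<And>s. 0 \<le> s \<Longrightarrow> s \<le> t \<Longrightarrow> g differentiable at (y + s *\<^sub>R v)"
    and "\<And>s. 0 \<le> s \<Longrightarrow> s \<le> t \<Longrightarrow> \<bar>frechet_derivative g (at (y + s *\<^sub>R v)) v\<bar> \<le> C"
  shows "\<bar>g (y + t *\<^sub>R v) - g y\<bar> \<le> C * t"
proof -
  have "norm (g (y + t *\<^sub>R v) - g (y + 0 *\<^sub>R v)) \<le> C * norm (t - 0)"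
  proof (rule field_differentiable_bound[of "{0..t}" _ "\<lambda>s. frechet_derivative g (at (y + s *\<^sub>R v)) v"])
    show "((\<lambda>s. g (y + s *\<^sub>R v)) has_real_derivative frechet_derivative g (at (y + s *\<^sub>R v)) v)
        (at s within {0..t})" if "s \<in> {0..t}" for s
      by (rule has_field_derivative_at_within[OF differentiable_along_line[OF assms(2)]]) (use that in auto)
  qed (use assms in auto)
  then show ?thesis using assms(1) by simp
qed

lemma diff_quot_along_line_tendsto:
  fixes g :: "'a::real_normed_vector \<Rightarrow> real"
  assumes "g differentiable at y" "t \<longlonglongrightarrow> 0" "\<And>k. t k \<noteq> 0"
  shows "(\<lambda>k. (g (y + t k *\<^sub>R v) - g y) / t k) \<longlonglongrightarrow> frechet_derivative g (at y) v"
proof -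
  have "((\<lambda>s. g (y + s *\<^sub>R v)) has_real_derivative frechet_derivative g (at y) v) (at 0)"
    using differentiable_along_line[of g y 0 v] assms(1) by simp
  then have "((\<lambda>h. (g (y + h *\<^sub>R v) - g y) / h) \<longlongrightarrow> frechet_derivative g (at y) v) (at 0)"
    by (simp add: has_field_derivative_iff)
  moreover have "filterlim t (at 0) sequentially"
    using assms by (simp add: filterlim_at)
  ultimately show ?thesis
    by (rule filterlim_compose)
qed

lemma test_functionD:
  assumes "test_function_on W \<eta>"
  shows "\<eta> differentiable at y"
    and "continuous_on UNIV (\<lambda>y. frechet_derivative \<eta> (at y) v)"
    and "continuous_on UNIV \<eta>"
    and "y \<notin> closure {y. \<eta> y \<noteq> 0} \<Longrightarrow> \<eta> y = 0"
    and "y \<notin> closure {y. \<eta> y \<noteq> 0} \<Longrightarrow> frechet_derivative \<eta> (at y) v = 0"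
    and "compact (closure {y. \<eta> y \<noteq> 0})" and "closure {y. \<eta> y \<noteq> 0} \<subseteq> W"
proof -
  have "C_k_on (Suc 0) UNIV \<eta>" "C_k_on 0 UNIV \<eta>"
    using assms by (auto simp: test_function_on_def smooth_on_def simp del: C_k_on.simps)
  then show "\<eta> differentiable at y" "continuous_on UNIV (\<lambda>y. frechet_derivative \<eta> (at y) v)"
    "continuous_on UNIV \<eta>" by auto
  show *: "\<eta> y = 0" if "y \<notin> closure {y. \<eta> y \<noteq> 0}" for y
    using that closure_subset[of "{y. \<eta> y \<noteq> 0}"] by auto
  have D: "(\<eta> has_derivative (\<lambda>_. 0)) (at y)" if "y \<notin> closure {y. \<eta> y \<noteq> 0}"
  proof (rule has_derivative_transform_within_open)
    show "((\<lambda>_. 0) has_derivative (\<lambda>_. 0)) (at y)" by simp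
    show "open (- closure {y. \<eta> y \<noteq> 0})" by (simp only: open_Compl closed_closure)
    show "0 = \<eta> x" if "x \<in> - closure {y. \<eta> y \<noteq> 0}" for x
      using that by (intro *[of x, symmetric]) (simp only: Compl_iff not_False_eq_True)
  qed (use that in \<open>simp only: Compl_iff not_False_eq_True\<close>)
  show "frechet_derivative \<eta> (at y) v = 0" if "y \<notin> closure {y. \<eta> y \<noteq> 0}"
    using frechet_derivative_at[OF D[OF that], symmetric] by simp
qed (use assms in \<open>auto simp: test_function_on_def\<close>)

lemma compact_support_bounded:
  fixes g :: "'a::euclidean_space \<Rightarrow> real"
  assumes "compact K" "continuous_on K g" "\<And>y. y \<notin> K \<Longrightarrow> g y = 0"
  obtains C where "C \<ge> 0" "\<And>y. \<bar>g y\<bar> \<le> C"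
proof -
  have "bounded (g ` K)"
    using assms compact_continuous_image compact_imp_bounded by blast
  then obtain C where "\<forall>y\<in>K. \<bar>g y\<bar> \<le> C"
    by (auto simp: bounded_iff)
  then have "\<bar>g y\<bar> \<le> max C 0" for y
    using assms(3) by (cases "y \<in> K") force+
  then show ?thesis using that[of "max C 0"] by simp
qed

text \<open>The hypothesis of Fubini's theorem, for exchanging the averaging over the segment from y
  to y + w with the integration in y.\<close>

lemma integrable_segment_shift:
  fixes F :: "'a::euclidean_space \<Rightarrow> real"
  assumes F: "integrable lborel F"
  shows "integrable (lborel \<Otimes>\<^sub>M lborel) (\<lambda>(s, y). indicator {0..1::real} s * F (y + s *\<^sub>R w))"
proof (rule lborel_pair.Fubini_integrable)
  have [measurable]: "F \<in> borel_measurable borel" using F by auto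
  show "(\<lambda>(s, y). indicator {0..1::real} s * F (y + s *\<^sub>R w)) \<in> borel_measurable (lborel \<Otimes>\<^sub>M lborel)"
    by measurable
  have "(LINT y|lborel. norm (case (s, y) of (s, y) \<Rightarrow> indicator {0..1::real} s * F (y + s *\<^sub>R w))) =
      indicator {0..1} s * (LINT y|lborel. \<bar>F y\<bar>)" for s
    using integral_lborel_shift[of "\<lambda>y. \<bar>F y\<bar>" "s *\<^sub>R w"] by (simp add: abs_mult)
  then show "integrable lborel (\<lambda>s. LINT y|lborel. norm (case (s, y) of (s, y) \<Rightarrow> indicator {0..1::real} s * F (y + s *\<^sub>R w)))"
    by (simp add: integrable_indicator_iff)
  show "AE s in lborel. integrable lborel (\<lambda>y. case (s, y) of (s, y) \<Rightarrow> indicator {0..1::real} s * F (y + s *\<^sub>R w))"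
    using integrable_lborel_shift[OF F] by simp
qed

text \<open>The bump is smooth, so its increment from y to y - w is an integral of directional
  derivatives over s in [0,1]. For each s the bump translated by s w is a test function in
  \<open>U\<close>, and the weak derivative can be applied under the integral over s.\<close>

lemma weak_derivative_bump_shift:
  fixes f F :: "real ^ 'n::finite \<Rightarrow> real"
  assumes f: "integrable lborel f" and F: "integrable lborel F"
    and weak: "\<And>\<eta>. test_function_on U \<eta> \<Longrightarrow>
      (LINT y|lborel. f y * frechet_derivative \<eta> (at y) w) = - (LINT y|lborel. F y * \<eta> y)"
    and sub: "\<And>s. 0 \<le> s \<Longrightarrow> s \<le> 1 \<Longrightarrow> cbox (a + s *\<^sub>R w) (b + s *\<^sub>R w) \<subseteq> U"
  shows "(LINT y|lborel. f y * (box_bump a b k (y - w) - box_bump a b k y)) =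
    (LINT s|lborel. indicator {0..1} s * (LINT y|lborel. F y * box_bump a b k (y - s *\<^sub>R w)))"
proof -
  have [measurable]: "f \<in> borel_measurable borel" using f by auto
  let ?\<eta> = "box_bump a b k"
  have tU: "test_function_on UNIV ?\<eta>" by (rule test_function_box_bump) simp
  note dif = test_functionD(1)[OF tU]
  let ?D = "\<lambda>y. frechet_derivative ?\<eta> (at y) w"
  note Dc = test_functionD(2)[OF tU, of w]
  obtain C where C: "C \<ge> 0" "\<And>y. \<bar>?D y\<bar> \<le> C"
    by (rule compact_support_bounded[OF test_functionD(6)[OF tU], of ?D])
      (use continuous_on_subset[OF Dc] test_functionD(5)[OF tU] in auto)
  have [measurable]: "?D \<in> borel_measurable borel"
    using Dc by (rule borel_measurable_continuous_onI)
  have shift: "(LINT y|lborel. f y * ?D (y - s *\<^sub>R w)) = - (LINT y|lborel. F y * ?\<eta> (y - s *\<^sub>R w))"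
    if "0 \<le> s" "s \<le> 1" for s
  proof -
    have e: "box_bump (a + s *\<^sub>R w) (b + s *\<^sub>R w) k = (\<lambda>y. ?\<eta> (y - s *\<^sub>R w))"
      using box_bump_shift by blast
    have "((\<lambda>y. ?\<eta> (y - s *\<^sub>R w)) has_derivative frechet_derivative ?\<eta> (at (y - s *\<^sub>R w))) (at y)" for y
    proof -
      have 1: "((\<lambda>y. y - s *\<^sub>R w) has_derivative (\<lambda>h. h)) (at y)"
        by (auto intro!: derivative_eq_intros)
      have 2: "(?\<eta> has_derivative frechet_derivative ?\<eta> (at z)) (at z)" for z
        using dif frechet_derivative_works by blast
      show ?thesis
        by (rule has_derivative_compose[OF 1 2])
    qed
    note frechet_derivative_at[OF this, symmetric]
    with weak[OF test_function_box_bump[OF sub[OF that], of k]] show ?thesis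
      unfolding e by simp
  qed
  have FTC: "?\<eta> (y - w) - ?\<eta> y = - (LINT s|lborel. indicator {0..1} s * ?D (y - s *\<^sub>R w))" for y
  proof -
    have "(LINT s|lborel. ?D (y + s *\<^sub>R (- w)) * indicator {0..1} s) =
        - ?\<eta> (y + 1 *\<^sub>R (- w)) - (- ?\<eta> (y + 0 *\<^sub>R (- w)))"
    proof (rule integral_FTC_Icc_real)
      show "((\<lambda>s. - ?\<eta> (y + s *\<^sub>R (- w))) has_real_derivative ?D (y + s *\<^sub>R (- w))) (at s)" for s
        using DERIV_minus[OF differentiable_along_line[of ?\<eta> y s "- w", OF dif]]
          linear_neg[OF linear_frechet_derivative[of ?\<eta> "at (y + s *\<^sub>R (- w))", OF dif], of w] by simp
      show "isCont (\<lambda>s. ?D (y + s *\<^sub>R (- w))) s" for s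
        using Dc by (intro continuous_on_interior[of UNIV] continuous_on_compose2[OF Dc] continuous_intros) auto
    qed simp
    then show ?thesis by (simp add: mult.commute)
  qed
  have int: "integrable (lborel \<Otimes>\<^sub>M lborel) (\<lambda>(s, y). indicator {0..1::real} s * (f y * ?D (y - s *\<^sub>R w)))"
  proof (rule Bochner_Integration.integrable_bound)
    show "integrable (lborel \<Otimes>\<^sub>M lborel) (\<lambda>(s, y). C * (indicator {0..1::real} s * f (y + s *\<^sub>R 0)))"
      using integrable_mult_right[OF integrable_segment_shift[OF f, of 0], of C]
      by (simp add: case_prod_unfold)
    show "AE x in lborel \<Otimes>\<^sub>M lborel. norm (case x of (s, y) \<Rightarrow> indicator {0..1::real} s * (f y * ?D (y - s *\<^sub>R w)))
        \<le> norm (case x of (s, y) \<Rightarrow> C * (indicator {0..1::real} s * f (y + s *\<^sub>R 0)))"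
    proof (rule AE_I2)
      fix x :: "real \<times> (real ^ 'n)"
      obtain s y where x: "x = (s, y)" by force
      have "\<bar>f y\<bar> * \<bar>?D (y - s *\<^sub>R w)\<bar> \<le> \<bar>f y\<bar> * C"
        using C(2) by (intro mult_left_mono) auto
      then show "norm (case x of (s, y) \<Rightarrow> indicator {0..1::real} s * (f y * ?D (y - s *\<^sub>R w)))
        \<le> norm (case x of (s, y) \<Rightarrow> C * (indicator {0..1::real} s * f (y + s *\<^sub>R 0)))"
        using C(1) by (simp add: x abs_mult indicator_def mult.commute)
    qed
  qed measurable
  have "(LINT y|lborel. f y * (?\<eta> (y - w) - ?\<eta> y)) =
      - (LINT y|lborel. LINT s|lborel. indicator {0..1} s * (f y * ?D (y - s *\<^sub>R w)))"
    unfolding FTC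
    by (subst integral_minus[symmetric], intro Bochner_Integration.integral_cong refl,
        subst mult_minus_right, subst integral_mult_right_zero[symmetric]) (simp add: mult.left_commute)
  also have "\<dots> = - (LINT s|lborel. LINT y|lborel. indicator {0..1} s * (f y * ?D (y - s *\<^sub>R w)))"
    by (subst lborel_pair.Fubini_integral[OF int]) simp
  also have "\<dots> = (LINT s|lborel. indicator {0..1} s * (LINT y|lborel. F y * ?\<eta> (y - s *\<^sub>R w)))"
    unfolding integral_minus[symmetric]
    by (intro Bochner_Integration.integral_cong refl) (auto simp: shift indicator_def)
  finally show ?thesis .
qed

text \<open>The limit of \<open>weak_derivative_bump_shift\<close> as the bumps tend to the
  indicator of the box; translation invariance then moves the shift from the indicator to
  \<open>f\<close> and \<open>F\<close>.\<close>

lemma weak_derivative_box_shift: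
  fixes f F :: "real ^ 'n::finite \<Rightarrow> real"
  assumes f: "integrable lborel f" and F: "integrable lborel F"
    and weak: "\<And>\<eta>. test_function_on U \<eta> \<Longrightarrow>
      (LINT y|lborel. f y * frechet_derivative \<eta> (at y) w) = - (LINT y|lborel. F y * \<eta> y)"
    and sub: "\<And>s. 0 \<le> s \<Longrightarrow> s \<le> 1 \<Longrightarrow> cbox (a + s *\<^sub>R w) (b + s *\<^sub>R w) \<subseteq> U"
  shows "(LINT y|lborel. indicator (box a b) y *
    (f (y + w) - f y - (LINT s|lborel. indicator {0..1} s * F (y + s *\<^sub>R w)))) = 0"
proof -
  let ?B = "indicator (box a b) :: _ \<Rightarrow> real"
  let ?e = "box_bump a b"
  have [measurable]: "f \<in> borel_measurable borel" "F \<in> borel_measurable borel" using f F by auto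
  have [measurable]: "?e k \<in> borel_measurable borel" for k
    using test_functionD(3)[OF test_function_box_bump[of a b UNIV k]]
    by (auto intro: borel_measurable_continuous_onI)
  have bd: "\<bar>?e k y\<bar> \<le> 1" "\<bar>?e k y - ?e k z\<bar> \<le> 1" for k y z
    using box_bump_bounds[of a b k y] box_bump_bounds[of a b k z] by auto
  have "(\<lambda>k. LINT y|lborel. f y * (?e k (y - w) - ?e k y)) \<longlonglongrightarrow> (LINT y|lborel. f y * (?B (y - w) - ?B y))"
  proof (rule integral_dominated_convergence[where w = "\<lambda>y. \<bar>f y\<bar>"])
    show "AE y in lborel. norm (f y * (?e k (y - w) - ?e k y)) \<le> \<bar>f y\<bar>" for k
      using bd by (auto simp: abs_mult mult_left_le)
    show "AE y in lborel. (\<lambda>k. f y * (?e k (y - w) - ?e k y)) \<longlonglongrightarrow> f y * (?B (y - w) - ?B y)"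
      by (intro AE_I2 tendsto_intros box_bump_tendsto)
  qed (use f in auto)
  moreover have inner: "(\<lambda>k. LINT y|lborel. F y * ?e k (y - s *\<^sub>R w)) \<longlonglongrightarrow> (LINT y|lborel. F y * ?B (y - s *\<^sub>R w))" for s
  proof (rule integral_dominated_convergence[where w = "\<lambda>y. \<bar>F y\<bar>"])
    show "AE y in lborel. norm (F y * ?e k (y - s *\<^sub>R w)) \<le> \<bar>F y\<bar>" for k
      using bd by (auto simp: abs_mult mult_left_le)
    show "AE y in lborel. (\<lambda>k. F y * ?e k (y - s *\<^sub>R w)) \<longlonglongrightarrow> F y * ?B (y - s *\<^sub>R w)"
      by (intro AE_I2 tendsto_intros box_bump_tendsto)
  qed (use F in auto)
  have [measurable]: "(\<lambda>s. LINT y|lborel. F y * ?e k (y - s *\<^sub>R w)) \<in> borel_measurable lborel"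
    "(\<lambda>s. LINT y|lborel. F y * ?B (y - s *\<^sub>R w)) \<in> borel_measurable lborel" for k
    by (rule lborel.borel_measurable_lebesgue_integral, measurable)+
  have [measurable]: "{0..1::real} \<in> sets borel" by simp
  have "(\<lambda>k. LINT s|lborel. indicator {0..1::real} s * (LINT y|lborel. F y * ?e k (y - s *\<^sub>R w))) \<longlonglongrightarrow>
      (LINT s|lborel. indicator {0..1} s * (LINT y|lborel. F y * ?B (y - s *\<^sub>R w)))"
  proof (rule integral_dominated_convergence[where w = "\<lambda>s. indicator {0..1} s * (LINT y|lborel. \<bar>F y\<bar>)"])
    show "AE s in lborel. norm (indicator {0..1::real} s * (LINT y|lborel. F y * ?e k (y - s *\<^sub>R w)))
        \<le> indicator {0..1} s * (LINT y|lborel. \<bar>F y\<bar>)" for k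
    proof (rule AE_I2)
      fix s :: real
      have "\<bar>LINT y|lborel. F y * ?e k (y - s *\<^sub>R w)\<bar> \<le> (LINT y|lborel. \<bar>F y * ?e k (y - s *\<^sub>R w)\<bar>)"
        by (rule integral_abs_bound)
      also have "\<dots> \<le> (LINT y|lborel. \<bar>F y\<bar>)"
        using F bd by (intro integral_mono' ) (auto simp: abs_mult mult_left_le)
      finally show "norm (indicator {0..1::real} s * (LINT y|lborel. F y * ?e k (y - s *\<^sub>R w)))
        \<le> indicator {0..1} s * (LINT y|lborel. \<bar>F y\<bar>)" by (auto simp: indicator_def)
    qed
    show "AE s in lborel. (\<lambda>k. indicator {0..1::real} s * (LINT y|lborel. F y * ?e k (y - s *\<^sub>R w))) \<longlonglongrightarrow>
       indicator {0..1} s * (LINT y|lborel. F y * ?B (y - s *\<^sub>R w))"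
      by (intro AE_I2 tendsto_intros inner)
    show "integrable lborel (\<lambda>s. indicator {0..1::real} s * (LINT y|lborel. \<bar>F y\<bar>))"
      by (intro integrable_mult_left) (simp add: integrable_indicator_iff)
  qed measurable
  moreover have "(\<lambda>k. LINT y|lborel. f y * (?e k (y - w) - ?e k y)) =
      (\<lambda>k. LINT s|lborel. indicator {0..1::real} s * (LINT y|lborel. F y * ?e k (y - s *\<^sub>R w)))"
    by (intro ext weak_derivative_bump_shift[OF f F weak sub])
  ultimately have eq: "(LINT y|lborel. f y * (?B (y - w) - ?B y)) =
      (LINT s|lborel. indicator {0..1} s * (LINT y|lborel. F y * ?B (y - s *\<^sub>R w)))"
    by (intro LIMSEQ_unique) simp_all
  have sh: "(LINT y|lborel. g y * ?B (y - c)) = (LINT y|lborel. g (y + c) * ?B y)"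
    if [measurable]: "g \<in> borel_measurable borel" for g c
    using integral_lborel_shift[of "\<lambda>y. g y * ?B (y - c)" c] by simp
  have iB: "integrable lborel (\<lambda>y. g y * ?B y)" if "integrable lborel g" for g
    using integrable_mult_indicator[OF _ that, of "box a b"] by (simp add: mult.commute)
  have iB': "integrable lborel (\<lambda>y. g y * ?B (y - c))" if "integrable lborel g" for g c
    using integrable_lborel_shift[OF iB[OF integrable_lborel_shift[OF that, of c]], of "- c"] by simp
  have l: "(LINT y|lborel. f y * (?B (y - w) - ?B y)) = (LINT y|lborel. (f (y + w) - f y) * ?B y)"
    using f iB'[OF f, of w] iB[OF f] iB[OF integrable_lborel_shift[OF f, of w]] sh[of f w]
    by (simp add: right_diff_distrib left_diff_distrib)
  let ?P = "\<lambda>(s, y). ?B y * (indicator {0..1::real} s * F (y + s *\<^sub>R w))"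
  have iP: "integrable (lborel \<Otimes>\<^sub>M lborel) ?P"
    using integrable_segment_shift[OF F, of w]
    by (rule Bochner_Integration.integrable_bound) (auto simp: indicator_def)
  have "(LINT s|lborel. indicator {0..1::real} s * (LINT y|lborel. F y * ?B (y - s *\<^sub>R w))) =
     (LINT s|lborel. LINT y|lborel. ?B y * (indicator {0..1} s * F (y + s *\<^sub>R w)))"
    by (subst sh) (auto intro!: Bochner_Integration.integral_cong
        simp: integral_mult_right_zero[symmetric] mult_ac simp del: integral_mult_right_zero)
  also have "\<dots> = (LINT y|lborel. LINT s|lborel. ?B y * (indicator {0..1} s * F (y + s *\<^sub>R w)))"
    by (rule lborel_pair.Fubini_integral[OF iP, symmetric])
  finally have r: "(LINT s|lborel. indicator {0..1::real} s * (LINT y|lborel. F y * ?B (y - s *\<^sub>R w))) =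
    (LINT y|lborel. (LINT s|lborel. indicator {0..1} s * F (y + s *\<^sub>R w)) * ?B y)"
    by (simp add: mult.commute)
  have iA: "integrable lborel (\<lambda>y. (LINT s|lborel. indicator {0..1} s * F (y + s *\<^sub>R w)) * ?B y)"
    using lborel_pair.integrable_snd[OF iP] by (simp add: mult.commute)
  have "(LINT y|lborel. (f (y + w) - f y) * ?B y -
      (LINT s|lborel. indicator {0..1} s * F (y + s *\<^sub>R w)) * ?B y) = 0"
    using eq unfolding l r
    using iA iB[OF Bochner_Integration.integrable_diff[OF integrable_lborel_shift[OF f, of w] f]] by simp
  then show ?thesis
    by (simp add: algebra_simps)
qed

text \<open>The fundamental theorem of calculus for a weakly differentiable function along almost
  every segment of a fixed direction and length: its two sides have the same integral over every
  small box. \<open>U'\<close> holds the starting points whose whole segment stays in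
  \<open>U\<close>.\<close>

lemma weak_derivative_shift_AE:
  fixes f F :: "real ^ 'n::finite \<Rightarrow> real"
  assumes f: "integrable lborel f" and F: "integrable lborel F"
    and weak: "\<And>\<eta>. test_function_on U \<eta> \<Longrightarrow>
      (LINT y|lborel. f y * frechet_derivative \<eta> (at y) w) = - (LINT y|lborel. F y * \<eta> y)"
    and U': "open U'" "\<And>y s. y \<in> U' \<Longrightarrow> 0 \<le> s \<Longrightarrow> s \<le> 1 \<Longrightarrow> y + s *\<^sub>R w \<in> U"
  shows "AE y in lborel. y \<in> U' \<longrightarrow>
    f (y + w) - f y = (LINT s|lborel. indicator {0..1} s * F (y + s *\<^sub>R w))"
proof -
  have "integrable lborel (\<lambda>y. f (y + w) - f y - (LINT s|lborel. indicator {0..1} s * F (y + s *\<^sub>R w)))"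
    using lborel_pair.integrable_snd[OF integrable_segment_shift[OF F, of w]]
      integrable_lborel_shift[OF f, of w] f by simp
  moreover have "cbox (a + s *\<^sub>R w) (b + s *\<^sub>R w) \<subseteq> U" if "cbox a b \<subseteq> U'" "0 \<le> s" "s \<le> 1" for a b s
    using that U'(2) cbox_translation[of "s *\<^sub>R w" a b] by (force simp: add.commute)
  ultimately have "AE y in lborel. y \<in> U' \<longrightarrow>
      f (y + w) - f y - (LINT s|lborel. indicator {0..1} s * F (y + s *\<^sub>R w)) = 0"
    by (intro AE_zero_if_box_integrals_zero weak_derivative_box_shift[OF f F weak] U') auto
  then show ?thesis by simp
qed

text \<open>By \<open>weak_derivative_shift_AE\<close> the difference quotient minus
  \<open>F\<close> is the average over s in [0,1] of F(y + s t v) - F(y). Its L^1 norm is at most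
  the average of the L^1 moduli of continuity of translations, which tends to 0 by dominated
  convergence in s.\<close>

proposition L1_diff_quot_tendsto:
  fixes f F :: "real ^ 'n::finite \<Rightarrow> real"
  assumes f: "integrable lborel f" and F: "integrable lborel F"
    and weak: "\<And>\<eta>. test_function_on U \<eta> \<Longrightarrow>
      (LINT y|lborel. f y * frechet_derivative \<eta> (at y) v) = - (LINT y|lborel. F y * \<eta> y)"
    and t: "t \<longlonglongrightarrow> 0" "\<And>k. t k > 0"
    and U': "open U'" "\<And>y s k. y \<in> U' \<Longrightarrow> 0 \<le> s \<Longrightarrow> s \<le> 1 \<Longrightarrow> y + (s * t k) *\<^sub>R v \<in> U"
  shows "(\<lambda>k. LINT y|lborel. \<bar>indicator U' y * ((f (y + t k *\<^sub>R v) - f y) / t k - F y)\<bar>) \<longlonglongrightarrow> 0"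
proof -
  have [measurable]: "f \<in> borel_measurable borel" "F \<in> borel_measurable borel" "U' \<in> sets borel"
    using f F U' by auto
  let ?\<omega> = "\<lambda>k s. LINT y|lborel. \<bar>F (y + (s * t k) *\<^sub>R v) - F y\<bar>"
  have [measurable]: "?\<omega> k \<in> borel_measurable lborel" for k
    by (rule lborel.borel_measurable_lebesgue_integral) measurable
  have [measurable]: "{0..1::real} \<in> sets borel" by simp
  have "(\<lambda>k. LINT s|lborel. indicator {0..1::real} s * ?\<omega> k s) \<longlonglongrightarrow> (LINT (s::real)|lborel. 0)"
  proof (rule integral_dominated_convergence[where w = "\<lambda>s. indicator {0..1} s * (2 * (LINT y|lborel. \<bar>F y\<bar>))"])
    show "AE s in lborel. (\<lambda>k. indicator {0..1::real} s * ?\<omega> k s) \<longlonglongrightarrow> 0"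
    proof (rule AE_I2)
      fix s :: real
      have "(\<lambda>k. (s * t k) *\<^sub>R v) \<longlonglongrightarrow> (s * 0) *\<^sub>R v"
        by (intro tendsto_intros t)
      then have "(\<lambda>k. ?\<omega> k s) \<longlonglongrightarrow> 0"
        by (intro L1_shift_tendsto[OF F]) simp
      then show "(\<lambda>k. indicator {0..1::real} s * ?\<omega> k s) \<longlonglongrightarrow> 0"
        by (rule tendsto_mult_right_zero)
    qed
    show "AE s in lborel. norm (indicator {0..1::real} s * ?\<omega> k s) \<le> indicator {0..1} s * (2 * (LINT y|lborel. \<bar>F y\<bar>))" for k
    proof (rule AE_I2)
      fix s :: real
      have "?\<omega> k s \<le> 2 * (LINT y|lborel. \<bar>F y\<bar>)"
        by (rule order_trans[OF L1_shift_approx[OF F, where G = "\<lambda>_. 0"]]) simp_all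
      then show "norm (indicator {0..1::real} s * ?\<omega> k s) \<le> indicator {0..1} s * (2 * (LINT y|lborel. \<bar>F y\<bar>))"
        by (auto simp: indicator_def)
    qed
    show "(\<lambda>s. indicator {0..1::real} s * ?\<omega> k s) \<in> borel_measurable lborel" for k
      by measurable
    show "integrable lborel (\<lambda>s. indicator {0..1::real} s * (2 * (LINT y|lborel. \<bar>F y\<bar>)))"
      by (intro integrable_mult_left) (simp add: integrable_indicator_iff)
  qed simp
  then have lim: "(\<lambda>k. LINT s|lborel. indicator {0..1::real} s * ?\<omega> k s) \<longlonglongrightarrow> 0" by simp
  have "(LINT y|lborel. \<bar>indicator U' y * ((f (y + t k *\<^sub>R v) - f y) / t k - F y)\<bar>) \<le>
      (LINT s|lborel. indicator {0..1::real} s * ?\<omega> k s)" for k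
  proof -
    let ?w = "t k *\<^sub>R v"
    let ?I = "\<lambda>y. LINT s|lborel. indicator {0..1} s * F (y + s *\<^sub>R ?w)"
    have "(LINT y|lborel. f y * frechet_derivative \<eta> (at y) ?w) = - (LINT y|lborel. t k * F y * \<eta> y)"
      if \<eta>: "test_function_on U \<eta>" for \<eta>
    proof -
      have "frechet_derivative \<eta> (at y) ?w = t k * frechet_derivative \<eta> (at y) v" for y
        using linear_cmul[OF linear_frechet_derivative[OF test_functionD(1)[OF \<eta>]]] by simp
      then have "(\<lambda>y. f y * frechet_derivative \<eta> (at y) ?w) = (\<lambda>y. t k * (f y * frechet_derivative \<eta> (at y) v))"
        by (simp add: fun_eq_iff)
      then have "(LINT y|lborel. f y * frechet_derivative \<eta> (at y) ?w) =
         t k * (LINT y|lborel. f y * frechet_derivative \<eta> (at y) v)"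
        by (simp only: integral_mult_right_zero)
      also have "\<dots> = - (LINT y|lborel. t k * F y * \<eta> y)"
        by (simp add: weak[OF \<eta>] mult.assoc)
      finally show ?thesis .
    qed
    from weak_derivative_shift_AE[OF f _ this U'(1)]
    have "AE y in lborel. y \<in> U' \<longrightarrow>
        f (y + ?w) - f y = (LINT s|lborel. indicator {0..1} s * (t k * F (y + s *\<^sub>R ?w)))"
      using F U'(2) by simp
    moreover have "(LINT s|lborel. indicator {0..1} s * (t k * F (y + s *\<^sub>R ?w))) = t k * ?I y" for y
      by (simp add: mult.left_commute)
    ultimately have 1: "AE y in lborel. y \<in> U' \<longrightarrow> (f (y + ?w) - f y) / t k = ?I y"
      using t(2)[of k] by (simp add: field_simps)
    have int: "integrable (lborel \<Otimes>\<^sub>M lborel) (\<lambda>(s, y). indicator {0..1::real} s * F (y + s *\<^sub>R ?w))"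
      "integrable (lborel \<Otimes>\<^sub>M lborel) (\<lambda>(s, y). indicator {0..1::real} s * F (y + s *\<^sub>R 0))"
      by (rule integrable_segment_shift[OF F])+
    have int2: "integrable (lborel \<Otimes>\<^sub>M lborel) (\<lambda>(s, y). indicator {0..1::real} s * \<bar>F (y + s *\<^sub>R ?w) - F y\<bar>)"
      using integrable_abs[OF Bochner_Integration.integrable_diff[OF int]]
      by (rule Bochner_Integration.integrable_bound) (auto simp: indicator_def)
    have fin: "AE y in lborel. integrable lborel (\<lambda>s. indicator {0..1::real} s * F (y + s *\<^sub>R ?w))"
      "AE y in lborel. integrable lborel (\<lambda>s. indicator {0..1::real} s * \<bar>F (y + s *\<^sub>R ?w) - F y\<bar>)"
      using lborel_pair.AE_integrable_snd[OF int(1)] lborel_pair.AE_integrable_snd[OF int2] by simp_all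
    have "(LINT y|lborel. \<bar>indicator U' y * ((f (y + ?w) - f y) / t k - F y)\<bar>) \<le>
      (LINT y|lborel. LINT s|lborel. indicator {0..1::real} s * \<bar>F (y + s *\<^sub>R ?w) - F y\<bar>)"
    proof (rule integral_mono_AE)
      show "integrable lborel (\<lambda>y. \<bar>indicator U' y * ((f (y + ?w) - f y) / t k - F y)\<bar>)"
        using integrable_mult_indicator[of U' lborel "\<lambda>y. (f (y + ?w) - f y) / t k - F y"]
          integrable_lborel_shift[OF f, of ?w] f F by simp
      show "integrable lborel (\<lambda>y. LINT s|lborel. indicator {0..1::real} s * \<bar>F (y + s *\<^sub>R ?w) - F y\<bar>)"
        using lborel_pair.integrable_snd[OF int2] by simp
      show "AE y in lborel. \<bar>indicator U' y * ((f (y + ?w) - f y) / t k - F y)\<bar> \<le>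
         (LINT s|lborel. indicator {0..1::real} s * \<bar>F (y + s *\<^sub>R ?w) - F y\<bar>)"
        using 1 fin
      proof eventually_elim
        case (elim y)
        have i1: "integrable lborel (\<lambda>s. indicator {0..1::real} s * F y)"
          by (simp add: integrable_indicator_iff)
        have "?I y - F y = ?I y - (LINT s|lborel. indicator {0..1::real} s * F y)" by simp
        also have "\<dots> = (LINT s|lborel. indicator {0..1::real} s * (F (y + s *\<^sub>R ?w) - F y))"
          using elim(2) i1 by (simp add: right_diff_distrib)
        finally have "\<bar>?I y - F y\<bar> \<le> (LINT s|lborel. \<bar>indicator {0..1::real} s * (F (y + s *\<^sub>R ?w) - F y)\<bar>)"
          by (simp only: integral_abs_bound)
        also have "\<dots> = (LINT s|lborel. indicator {0..1::real} s * \<bar>F (y + s *\<^sub>R ?w) - F y\<bar>)"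
          by (simp add: abs_mult)
        finally have "\<bar>?I y - F y\<bar> \<le> (LINT s|lborel. indicator {0..1::real} s * \<bar>F (y + s *\<^sub>R ?w) - F y\<bar>)" .
        moreover have "0 \<le> (LINT s|lborel. indicator {0..1::real} s * \<bar>F (y + s *\<^sub>R ?w) - F y\<bar>)"
          by (intro integral_nonneg_AE) auto
        ultimately show ?case using elim(1) by (auto simp: indicator_def)
      qed
    qed
    also have "\<dots> = (LINT s|lborel. LINT y|lborel. indicator {0..1::real} s * \<bar>F (y + s *\<^sub>R ?w) - F y\<bar>)"
      by (rule lborel_pair.Fubini_integral[OF int2])
    finally show ?thesis by simp
  qed
  then show ?thesis
    by (intro tendsto_sandwich[OF _ _ tendsto_const lim]) (auto intro!: always_eventually integral_nonneg_AE)
qed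

section \<open>The weak chain and product rule\<close>

text \<open>The slope of \<open>h\<close>, filled in by the derivative on the diagonal: the
  factorization \<open>diff_ratio_eq\<close> then holds without a case distinction, and the slope is
  continuous in its second argument at the diagonal.\<close>

definition diff_ratio :: "(real \<Rightarrow> real) \<Rightarrow> (real \<Rightarrow> real) \<Rightarrow> real \<Rightarrow> real \<Rightarrow> real" where
  "diff_ratio h h' a b = (if a = b then h' a else (h b - h a) / (b - a))"

lemma diff_ratio_eq: "h b - h a = diff_ratio h h' a b * (b - a)"
  by (simp add: diff_ratio_def)

lemma lipschitz_if_deriv_bounded:
  fixes h :: "real \<Rightarrow> real"
  assumes h: "\<And>x. (h has_real_derivative h' x) (at x)" and B: "\<And>x. \<bar>h' x\<bar> \<le> B"
  shows "\<bar>h b - h a\<bar> \<le> B * \<bar>b - a\<bar>"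
  using field_differentiable_bound[of UNIV h h' B b a] h B by simp

lemma diff_ratio_bounded:
  assumes h: "\<And>x. (h has_real_derivative h' x) (at x)" and B: "\<And>x. \<bar>h' x\<bar> \<le> B"
  shows "\<bar>diff_ratio h h' a b\<bar> \<le> B"
  using B[of a] lipschitz_if_deriv_bounded[OF h B, of b a]
  by (auto simp: diff_ratio_def abs_divide divide_le_eq)

lemma diff_ratio_tendsto:
  assumes h: "\<And>x. (h has_real_derivative h' x) (at x)" and b: "b \<longlonglongrightarrow> a"
  shows "(\<lambda>k::nat. diff_ratio h h' a (b k)) \<longlonglongrightarrow> h' a"
proof -
  have "isCont (diff_ratio h h' a) a"
  proof -
    have "((\<lambda>x. (h x - h a) / (x - a)) \<longlongrightarrow> h' a) (at a)"
      using h[of a] by (simp add: has_field_derivative_iff)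
    then have "(diff_ratio h h' a \<longlongrightarrow> h' a) (at a)"
      by (rule Lim_transform_eventually) (auto simp: diff_ratio_def eventually_at_filter)
    then show ?thesis by (simp add: isCont_def diff_ratio_def)
  qed
  from isCont_tendsto_compose[OF this b] show ?thesis by (simp add: diff_ratio_def)
qed

lemma integrable_compact_bound:
  fixes g :: "'a::euclidean_space \<Rightarrow> real"
  assumes "integrable lborel (\<lambda>y. indicator K y * f y)" "compact K"
    and [measurable]: "g \<in> borel_measurable borel"
    and bd: "\<And>y. y \<in> K \<Longrightarrow> \<bar>g y\<bar> \<le> C * (1 + \<bar>f y\<bar>)" and z: "\<And>y. y \<notin> K \<Longrightarrow> g y = 0"
  shows "integrable lborel g"
proof (rule Bochner_Integration.integrable_bound)
  have K: "integrable lborel (indicator K :: 'a \<Rightarrow> real)"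
    using assms(2) emeasure_compact_finite[OF assms(2)] by (simp add: integrable_indicator_iff compact_imp_closed)
  show "integrable lborel (\<lambda>y. C * (indicator K y + \<bar>indicator K y * f y\<bar>))"
    using assms(1) K by auto
  show "AE y in lborel. norm (g y) \<le> norm (C * (indicator K y + \<bar>indicator K y * f y\<bar>))"
    using order_trans[OF bd abs_ge_self] z by (intro AE_I2) (auto simp: indicator_def)
qed simp

text \<open>The difference quotients of \<open>f\<close> converge in \<open>L\<^sup>1\<close> to \<open>F\<close>, and on a subsequence the translates
  of \<open>f\<close> converge almost everywhere; so those of \<open>h(f) \<kappa>\<close> converge as well.\<close>

theorem weak_chain_product_rule:
  fixes f F \<kappa> :: "real ^ 'n::finite \<Rightarrow> real"
  assumes W: "open W"
    and f_loc: "\<And>K. compact K \<Longrightarrow> K \<subseteq> W \<Longrightarrow> integrable lborel (\<lambda>y. indicator K y * f y)"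
    and F_loc: "\<And>K. compact K \<Longrightarrow> K \<subseteq> W \<Longrightarrow> integrable lborel (\<lambda>y. indicator K y * F y)"
    and weak: "\<And>\<eta>. test_function_on W \<eta> \<Longrightarrow>
      (LINT y|lborel. f y * frechet_derivative \<eta> (at y) v) = - (LINT y|lborel. F y * \<eta> y)"
    and h: "\<And>x. (h has_real_derivative h' x) (at x)" "continuous_on UNIV h'" "\<And>x. \<bar>h' x\<bar> \<le> B"
    and \<kappa>: "\<And>y. y \<in> W \<Longrightarrow> \<kappa> differentiable at y"
      "continuous_on W (\<lambda>y. frechet_derivative \<kappa> (at y) v)"
    and \<eta>: "test_function_on W \<eta>"
  shows "(LINT y|lborel. h (f y) * \<kappa> y * frechet_derivative \<eta> (at y) v) =
    - (LINT y|lborel. (h' (f y) * F y * \<kappa> y + h (f y) * frechet_derivative \<kappa> (at y) v) * \<eta> y)"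
proof -
  define K0 where "K0 = closure {y. \<eta> y \<noteq> 0}"
  note \<eta>D = test_functionD[OF \<eta>, folded K0_def]
  let ?D\<eta> = "\<lambda>y. frechet_derivative \<eta> (at y) v" and ?D\<kappa> = "\<lambda>y. frechet_derivative \<kappa> (at y) v"
  obtain e where e: "e > 0" "(\<Union>x\<in>K0. ball x e) \<subseteq> W"
    using compact_subset_open_imp_ball_epsilon_subset[OF \<eta>D(6) W \<eta>D(7)] by blast
  \<comment> \<open>Nested neighbourhoods K0 \<subseteq> U' \<subseteq> U \<subseteq> K1 \<subseteq>
    W of the support of \<eta>, of radii e/4 and e/2. All functions are cut off outside the compact
    set \<open>K1\<close>, where they are integrable or bounded, and steps shorter than e/4 lead
    from \<open>U'\<close> into \<open>U\<close>.\<close>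
  define K1 where "K1 = {x + y | x y. x \<in> K0 \<and> y \<in> cball 0 (e / 2)}"
  define U where "U = (\<Union>x\<in>K0. ball x (e / 2))"
  define U' where "U' = (\<Union>x\<in>K0. ball x (e / 4))"
  have K1: "compact K1" unfolding K1_def by (intro compact_sums \<eta>D(6) compact_cball)
  have K1W: "K1 \<subseteq> W"
  proof
    fix z assume "z \<in> K1"
    then obtain x y where "z = x + y" "x \<in> K0" "norm y \<le> e / 2" by (auto simp: K1_def)
    then have "z \<in> ball x e" "x \<in> K0" using e(1) by (auto simp: dist_norm)
    then show "z \<in> W" using e(2) by blast
  qed
  have UK1: "U \<subseteq> K1"
  proof
    fix z assume "z \<in> U"
    then obtain x where x: "x \<in> K0" "dist x z < e / 2" by (auto simp: U_def)
    then have "z = x + (z - x)" "z - x \<in> cball 0 (e / 2)"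
      by (auto simp: dist_norm norm_minus_commute)
    then show "z \<in> K1" using x(1) unfolding K1_def by blast
  qed
  have open_UU': "open U" "open U'" by (auto simp: U_def U'_def)
  have K0U': "K0 \<subseteq> U'" using e by (force simp: U'_def)
  have U'K1: "U' \<subseteq> K1" using UK1 e(1) by (force simp: U_def U'_def)
  \<comment> \<open>Step lengths tending to 0 with \<bar>t k v\<bar> < e/4; the summand 1 covers v =
    0.\<close>
  define t where "t k = e / (4 * (norm v + 1) * real (Suc k))" for k
  have t_pos: "t k > 0" for k using e(1) by (simp add: t_def add_nonneg_pos)
  have t_lim: "t \<longlonglongrightarrow> 0"
  proof -
    have "(\<lambda>k. e / (4 * (norm v + 1)) * (1 / real (Suc k))) \<longlonglongrightarrow> e / (4 * (norm v + 1)) * 0"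
      by (intro tendsto_intros LIMSEQ_Suc[OF lim_1_over_n])
    moreover have "t = (\<lambda>k. e / (4 * (norm v + 1)) * (1 / real (Suc k)))"
      unfolding t_def by (simp add: fun_eq_iff)
    ultimately show ?thesis by simp
  qed
  have t_small: "norm ((s * t k) *\<^sub>R v) < e / 4" if "0 \<le> s" "s \<le> 1" for s k
  proof -
    have "t k \<le> e / (4 * (norm v + 1))"
      unfolding t_def
    proof (rule divide_left_mono)
      have "4 * (norm v + 1) * 1 \<le> 4 * (norm v + 1) * real (Suc k)"
        by (intro mult_left_mono) auto
      then show "4 * (norm v + 1) \<le> 4 * (norm v + 1) * real (Suc k)" by simp
    qed (use e(1) in \<open>auto simp: add_nonneg_pos\<close>)
    then have "s * t k \<le> e / (4 * (norm v + 1))"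
      using that t_pos[of k] mult_left_le_one_le[of "t k" s] by linarith
    then have "s * t k * norm v \<le> e / (4 * (norm v + 1)) * norm v"
      by (intro mult_right_mono) auto
    also have "\<dots> < e / 4" using e(1) by (simp add: divide_simps add_nonneg_pos)
    finally show ?thesis using that t_pos[of k] by (simp add: abs_mult)
  qed
  have U'U: "y + (s * t k) *\<^sub>R v \<in> U" if "y \<in> U'" "0 \<le> s" "s \<le> 1" for y s k
  proof -
    have "\<exists>x\<in>K0. y \<in> ball x (e / 4)" using that(1) unfolding U'_def by blast
    then obtain x where x: "x \<in> K0" "dist x y < e / 4" by (meson mem_ball)
    have "dist x (y + (s * t k) *\<^sub>R v) \<le> dist x y + dist y (y + (s * t k) *\<^sub>R v)"
      by (rule dist_triangle)
    moreover have "dist y (y + (s * t k) *\<^sub>R v) = norm ((s * t k) *\<^sub>R v)"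
      by (simp add: dist_norm)
    ultimately have "y + (s * t k) *\<^sub>R v \<in> ball x (e / 2)"
      using x(2) t_small[OF that(2,3), of k] unfolding mem_ball by linarith
    then show ?thesis using x(1) unfolding U_def by blast
  qed
  have K0K1: "y + s *\<^sub>R v \<in> K1" if "y \<in> K0" "0 \<le> s" "s \<le> t k" for y s k
  proof -
    have "y + (s / t k * t k) *\<^sub>R v \<in> U"
      using that t_pos[of k] K0U' by (intro U'U) auto
    then show ?thesis using UK1 t_pos[of k] by auto
  qed
  define f1 where "f1 y = indicator K1 y * f y" for y
  define F1 where "F1 y = indicator K1 y * F y" for y
  define \<kappa>1 where "\<kappa>1 y = indicator K1 y *\<^sub>R \<kappa> y" for y
  define D1 where "D1 y = indicator K1 y *\<^sub>R ?D\<kappa> y" for y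
  have eq1 [simp]: "f1 y = f y" "F1 y = F y" "\<kappa>1 y = \<kappa> y" "D1 y = ?D\<kappa> y" if "y \<in> K1" for y
    using that by (simp_all add: f1_def F1_def \<kappa>1_def D1_def)
  have int: "integrable lborel f1" "integrable lborel F1"
    unfolding f1_def F1_def by (intro f_loc F_loc K1 K1W)+
  have cont\<kappa>: "continuous_on K1 \<kappa>"
    using \<kappa>(1) K1W by (intro continuous_at_imp_continuous_on ballI differentiable_imp_continuous_within) auto
  have contD: "continuous_on K1 ?D\<kappa>" by (rule continuous_on_subset[OF \<kappa>(2) K1W])
  have [measurable]: "f1 \<in> borel_measurable borel" "F1 \<in> borel_measurable borel" using int by auto
  have [measurable]: "\<kappa>1 \<in> borel_measurable borel" "D1 \<in> borel_measurable borel"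
    unfolding \<kappa>1_def D1_def
    by (rule borel_measurable_continuous_on_indicator[OF _ cont\<kappa>]
          borel_measurable_continuous_on_indicator[OF _ contD], simp add: K1 compact_imp_closed)+
  have [measurable]: "h \<in> borel_measurable borel" "h' \<in> borel_measurable borel"
    using h DERIV_continuous_on[of UNIV h h'] by (auto intro: borel_measurable_continuous_onI)
  have [measurable]: "\<eta> \<in> borel_measurable borel" "?D\<eta> \<in> borel_measurable borel"
    using \<eta>D(2,3) by (auto intro: borel_measurable_continuous_onI)
  have [measurable]: "U' \<in> sets borel" "K1 \<in> sets borel"
    using open_UU' K1 by (auto simp: compact_imp_closed)
  obtain C\<eta> where C\<eta>: "C\<eta> \<ge> 0" "\<And>y. \<bar>\<eta> y\<bar> \<le> C\<eta>"
    using compact_support_bounded[OF \<eta>D(6) continuous_on_subset[OF \<eta>D(3)] \<eta>D(4)] by auto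
  obtain CD where CD: "CD \<ge> 0" "\<And>y. \<bar>?D\<eta> y\<bar> \<le> CD"
    using compact_support_bounded[OF \<eta>D(6) continuous_on_subset[OF \<eta>D(2)] \<eta>D(5)] by (metis subset_UNIV)
  have "continuous_on K1 \<kappa>1" "continuous_on K1 D1"
    using cont\<kappa> contD by (auto cong: continuous_on_cong)
  then obtain C\<kappa> CD\<kappa> where C\<kappa>: "C\<kappa> \<ge> 0" "\<And>y. \<bar>\<kappa>1 y\<bar> \<le> C\<kappa>" and CD\<kappa>: "CD\<kappa> \<ge> 0" "\<And>y. \<bar>D1 y\<bar> \<le> CD\<kappa>"
    using compact_support_bounded[OF K1, of \<kappa>1] compact_support_bounded[OF K1, of D1]
    by (metis \<kappa>1_def D1_def indicator_simps(2) scaleR_zero_left)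
  have B0: "B \<ge> 0" using h(3)[of 0] by linarith
  have h_lin: "\<bar>h x\<bar> \<le> (\<bar>h 0\<bar> + B) * (1 + \<bar>x\<bar>)" for x
  proof -
    have "\<bar>h x\<bar> \<le> \<bar>h 0\<bar> + B * \<bar>x\<bar>"
      using lipschitz_if_deriv_bounded[OF h(1,3), of x 0] by simp
    also have "\<dots> \<le> (\<bar>h 0\<bar> + B) * (1 + \<bar>x\<bar>)"
      using B0 by (simp add: algebra_simps)
    finally show ?thesis .
  qed
  define Q where "Q k y = diff_ratio h h' (f1 y) (f1 (y + t k *\<^sub>R v))" for k y
  have [measurable]: "Q k \<in> borel_measurable borel" for k
    unfolding Q_def diff_ratio_def by measurable
  have Q_bd: "\<bar>Q k y\<bar> \<le> B" for k y unfolding Q_def by (rule diff_ratio_bounded[OF h(1,3)])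
  define H where "H y = h (f1 y) * \<kappa>1 y" for y
  have [measurable]: "H \<in> borel_measurable borel" unfolding H_def by measurable
  have intH: "integrable lborel H"
  proof (rule integrable_compact_bound[where K = K1 and f = f and C = "(\<bar>h 0\<bar> + B) * C\<kappa>"])
    show "\<bar>H y\<bar> \<le> (\<bar>h 0\<bar> + B) * C\<kappa> * (1 + \<bar>f y\<bar>)" if "y \<in> K1" for y
      using mult_mono[OF h_lin C\<kappa>(2)[of y], of "f y"] that B0
      by (simp add: H_def abs_mult mult_ac)
  qed (use K1 K1W f_loc in \<open>auto simp: H_def \<kappa>1_def\<close>)
  define E where "E k y = (f1 (y + t k *\<^sub>R v) - f1 y) / t k" for k y
  have [measurable]: "E k \<in> borel_measurable borel" for k unfolding E_def by measurable
  have intE: "integrable lborel (E k)" for k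
    unfolding E_def using int(1) integrable_lborel_shift[OF int(1)] by auto
  have "(LINT y|lborel. f1 y * frechet_derivative \<zeta> (at y) v) = - (LINT y|lborel. F1 y * \<zeta> y)"
    if \<zeta>: "test_function_on U \<zeta>" for \<zeta>
  proof -
    have "test_function_on W \<zeta>" using \<zeta> UK1 K1W unfolding test_function_on_def by blast
    note weak[OF this]
    moreover have "f1 y * frechet_derivative \<zeta> (at y) v = f y * frechet_derivative \<zeta> (at y) v"
      "F1 y * \<zeta> y = F y * \<zeta> y" for y
    proof -
      have "frechet_derivative \<zeta> (at y) v = 0 \<and> \<zeta> y = 0" if "y \<notin> K1"
        using test_functionD(7)[OF \<zeta>] UK1 that by (intro conjI test_functionD(4,5)[OF \<zeta>]) auto
      then show "f1 y * frechet_derivative \<zeta> (at y) v = f y * frechet_derivative \<zeta> (at y) v"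
        "F1 y * \<zeta> y = F y * \<zeta> y"
        by (cases "y \<in> K1"; simp)+
    qed
    ultimately show ?thesis by (simp only:)
  qed
  from L1_diff_quot_tendsto[OF int this t_lim t_pos open_UU'(2)] U'U
  have L1: "(\<lambda>k. LINT y|lborel. \<bar>indicator U' y * (E k y - F1 y)\<bar>) \<longlonglongrightarrow> 0"
    unfolding E_def by blast
  have intL1: "integrable lborel (\<lambda>y. indicator U' y * (E k y - F1 y))" for k
    using integrable_mult_indicator[of U' lborel "\<lambda>y. E k y - F1 y"] intE int(2) by simp
  \<comment> \<open>Almost everywhere convergence along \<open>r\<close> yields that of the
    translates of \<open>f1\<close>, since f1(y + t v) = f1 y + t E. This is what makes the slopes
    \<open>Q\<close> of h converge to h'(f).\<close>
  obtain r where
    r: "strict_mono r" "AE y in lborel. (\<lambda>k. indicator U' y * (E (r k) y - F1 y)) \<longlonglongrightarrow> 0"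
    using tendsto_L1_AE_subseq[of lborel "\<lambda>k y. indicator U' y * (E k y - F1 y)", OF intL1] L1
    unfolding real_norm_def by blast
  have tr: "(\<lambda>k. t (r k)) \<longlonglongrightarrow> 0" using t_lim r(1) LIMSEQ_subseq_LIMSEQ by (auto simp: o_def)
  have f1_lim: "AE y in lborel. y \<in> K0 \<longrightarrow> (\<lambda>k. f1 (y + t (r k) *\<^sub>R v)) \<longlonglongrightarrow> f1 y"
    using r(2)
  proof eventually_elim
    case (elim y)
    show ?case
    proof
      assume "y \<in> K0"
      then have "y \<in> U'" using K0U' by auto
      then have "(\<lambda>k. E (r k) y - F1 y) \<longlonglongrightarrow> 0" using elim by simp
      then have "(\<lambda>k. f1 y + t (r k) * ((E (r k) y - F1 y) + F1 y)) \<longlonglongrightarrow> f1 y + 0 * (0 + F1 y)"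
        by (intro tendsto_intros tr)
      moreover have "f1 y + t (r k) * ((E (r k) y - F1 y) + F1 y) = f1 (y + t (r k) *\<^sub>R v)" for k
        using t_pos[of "r k"] by (simp add: E_def)
      ultimately show "(\<lambda>k. f1 (y + t (r k) *\<^sub>R v)) \<longlonglongrightarrow> f1 y" by simp
    qed
  qed
  \<comment> \<open>The integral of H = h(f) \<kappa> against difference quotients of \<eta>. It
    tends to the left side of the claim; moving the shift to \<open>H\<close> gives -
    (\<open>T1\<close> + integral of \<open>G\<close>), whose limit along \<open>r\<close> is the
    right side.\<close>
  define S where "S k = (LINT y|lborel. H y * ((\<eta> y - \<eta> (y - t k *\<^sub>R v)) / t k))" for k
  have S_lim: "S \<longlonglongrightarrow> (LINT y|lborel. H y * ?D\<eta> y)"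
    unfolding S_def
  proof (rule integral_dominated_convergence[where w = "\<lambda>y. \<bar>H y\<bar> * CD"])
    show "AE y in lborel. (\<lambda>k. H y * ((\<eta> y - \<eta> (y - t k *\<^sub>R v)) / t k)) \<longlonglongrightarrow> H y * ?D\<eta> y"
    proof (intro AE_I2 tendsto_intros)
      fix y
      have "(\<lambda>k. (\<eta> (y + (- t k) *\<^sub>R v) - \<eta> y) / (- t k)) \<longlonglongrightarrow> ?D\<eta> y"
        using t_pos tendsto_minus[OF t_lim]
        by (intro diff_quot_along_line_tendsto \<eta>D(1)) (auto simp: less_imp_neq[symmetric])
      then show "(\<lambda>k. (\<eta> y - \<eta> (y - t k *\<^sub>R v)) / t k) \<longlonglongrightarrow> ?D\<eta> y"
        by (simp add: minus_divide_right[symmetric] minus_divide_left)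
    qed
    show "AE y in lborel. norm (H y * ((\<eta> y - \<eta> (y - t k *\<^sub>R v)) / t k)) \<le> \<bar>H y\<bar> * CD" for k
    proof (rule AE_I2)
      fix y
      have "\<bar>\<eta> ((y - t k *\<^sub>R v) + t k *\<^sub>R v) - \<eta> (y - t k *\<^sub>R v)\<bar> \<le> CD * t k"
        using t_pos[of k] by (intro diff_along_line_le \<eta>D(1) CD) auto
      then have "\<bar>(\<eta> y - \<eta> (y - t k *\<^sub>R v)) / t k\<bar> \<le> CD"
        using t_pos[of k] by (simp add: abs_divide divide_le_eq)
      then show "norm (H y * ((\<eta> y - \<eta> (y - t k *\<^sub>R v)) / t k)) \<le> \<bar>H y\<bar> * CD"
        unfolding real_norm_def abs_mult by (intro mult_left_mono) auto
    qed
  qed (use intH in auto)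
  \<comment> \<open>The difference quotient of h(f) \<kappa> is \<kappa>(y + t v) Q E + h(f) times
    the difference quotient of \<kappa>. With E = (E - F1) + F1, the part \<open>T1\<close> has
    bounded coefficients in front of something small in L^1, and the rest, \<open>G\<close>,
    converges almost everywhere under the dominating function \<open>w\<close>.\<close>
  define T1 where "T1 k = (LINT y|lborel. \<eta> y * \<kappa>1 (y + t k *\<^sub>R v) * Q k y * (indicator U' y * (E k y - F1 y)))" for k
  define G where "G k y = \<eta> y * \<kappa>1 (y + t k *\<^sub>R v) * Q k y * F1 y
      + \<eta> y * h (f1 y) * ((\<kappa>1 (y + t k *\<^sub>R v) - \<kappa>1 y) / t k)" for k y
  have [measurable]: "G k \<in> borel_measurable borel" for k unfolding G_def by measurable
  have int1: "integrable lborel (\<lambda>y. \<eta> y * \<kappa>1 (y + t k *\<^sub>R v) * Q k y * (indicator U' y * (E k y - F1 y)))"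
    and bd1: "\<bar>\<eta> y * \<kappa>1 (y + t k *\<^sub>R v) * Q k y * z\<bar> \<le> C\<eta> * C\<kappa> * B * \<bar>z\<bar>" for k y z
  proof -
    show bd: "\<bar>\<eta> y * \<kappa>1 (y + t k *\<^sub>R v) * Q k y * z\<bar> \<le> C\<eta> * C\<kappa> * B * \<bar>z\<bar>" for y z
      unfolding abs_mult using C\<eta> C\<kappa> Q_bd B0 by (intro mult_mono mult_nonneg_nonneg) auto
    show "integrable lborel (\<lambda>y. \<eta> y * \<kappa>1 (y + t k *\<^sub>R v) * Q k y * (indicator U' y * (E k y - F1 y)))"
    proof (rule Bochner_Integration.integrable_bound)
      show "integrable lborel (\<lambda>y. C\<eta> * C\<kappa> * B * \<bar>indicator U' y * (E k y - F1 y)\<bar>)"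
        by (intro integrable_mult_right integrable_abs intL1)
      show "AE y in lborel. norm (\<eta> y * \<kappa>1 (y + t k *\<^sub>R v) * Q k y * (indicator U' y * (E k y - F1 y)))
          \<le> norm (C\<eta> * C\<kappa> * B * \<bar>indicator U' y * (E k y - F1 y)\<bar>)"
        by (rule AE_I2, unfold real_norm_def, rule order_trans[OF bd abs_ge_self])
    qed measurable
  qed
  have T1_lim: "T1 \<longlonglongrightarrow> 0"
  proof (rule tendsto_rabs_zero_cancel, rule tendsto_sandwich[OF _ _ tendsto_const])
    show "(\<lambda>k. C\<eta> * C\<kappa> * B * (LINT y|lborel. \<bar>indicator U' y * (E k y - F1 y)\<bar>)) \<longlonglongrightarrow> 0"
      using tendsto_mult_right_zero[OF L1] by blast
    have "\<bar>T1 k\<bar> \<le> (LINT y|lborel. C\<eta> * C\<kappa> * B * \<bar>indicator U' y * (E k y - F1 y)\<bar>)" for k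
      unfolding T1_def
      by (rule order_trans[OF integral_abs_bound integral_mono])
        (use int1 intL1 bd1 in \<open>auto simp del: abs_mult\<close>)
    then show "\<forall>\<^sub>F k in sequentially. \<bar>T1 k\<bar> \<le> C\<eta> * C\<kappa> * B * (LINT y|lborel. \<bar>indicator U' y * (E k y - F1 y)\<bar>)"
      by simp
  qed simp
  have line: "\<bar>\<kappa>1 (y + t k *\<^sub>R v) - \<kappa>1 y\<bar> \<le> CD\<kappa> * t k" if "y \<in> K0" for y k
  proof -
    have "\<bar>\<kappa> (y + t k *\<^sub>R v) - \<kappa> y\<bar> \<le> CD\<kappa> * t k"
    proof (rule diff_along_line_le)
      fix s assume s: "0 \<le> s" "s \<le> t k"
      note in1 = K0K1[OF that s]
      show "\<kappa> differentiable at (y + s *\<^sub>R v)" using in1 K1W \<kappa>(1) by auto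
      show "\<bar>?D\<kappa> (y + s *\<^sub>R v)\<bar> \<le> CD\<kappa>" using CD\<kappa>(2)[of "y + s *\<^sub>R v"] in1 by simp
    qed (use t_pos[of k] in simp)
    then show ?thesis
      using K0K1[OF that, of 0 k] K0K1[OF that, of "t k" k] t_pos[of k] by simp
  qed
  define w where "w y = C\<eta> * C\<kappa> * B * \<bar>F1 y\<bar> + indicator K1 y * (C\<eta> * CD\<kappa> * \<bar>h (f1 y)\<bar>)" for y
  have int_w: "integrable lborel w"
  proof -
    have "integrable lborel (\<lambda>y. indicator K1 y * (C\<eta> * CD\<kappa> * \<bar>h (f1 y)\<bar>))"
    proof (rule integrable_compact_bound[where K = K1 and f = f and C = "C\<eta> * CD\<kappa> * (\<bar>h 0\<bar> + B)"])
      show "\<bar>indicator K1 y * (C\<eta> * CD\<kappa> * \<bar>h (f1 y)\<bar>)\<bar> \<le> C\<eta> * CD\<kappa> * (\<bar>h 0\<bar> + B) * (1 + \<bar>f y\<bar>)"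
        if "y \<in> K1" for y
        using mult_left_mono[OF h_lin[of "f y"], of "C\<eta> * CD\<kappa>"] that C\<eta>(1) CD\<kappa>(1)
        by (simp add: abs_mult mult.assoc)
    qed (use K1 K1W f_loc in simp_all)
    then show ?thesis unfolding w_def using int(2) by auto
  qed
  have G_bd: "\<bar>G k y\<bar> \<le> w y" for k y
  proof (cases "y \<in> K0")
    case True
    have "y \<in> K1" using True K0U' U'K1 by auto
    have "\<bar>(\<kappa>1 (y + t k *\<^sub>R v) - \<kappa>1 y) / t k\<bar> \<le> CD\<kappa>"
      using line[OF True, of k] t_pos[of k] by (simp add: abs_divide divide_le_eq)
    then have a2: "\<bar>\<eta> y * h (f1 y) * ((\<kappa>1 (y + t k *\<^sub>R v) - \<kappa>1 y) / t k)\<bar> \<le> C\<eta> * \<bar>h (f1 y)\<bar> * CD\<kappa>"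
      unfolding abs_mult using C\<eta> CD\<kappa> by (intro mult_mono) auto
    have "\<bar>G k y\<bar> \<le> C\<eta> * C\<kappa> * B * \<bar>F1 y\<bar> + C\<eta> * \<bar>h (f1 y)\<bar> * CD\<kappa>"
      unfolding G_def by (rule order_trans[OF abs_triangle_ineq add_mono[OF bd1 a2]])
    also have "\<dots> = w y" using \<open>y \<in> K1\<close> by (simp add: w_def mult_ac)
    finally show ?thesis .
  next
    case False
    then show ?thesis using C\<eta>(1) C\<kappa>(1) B0 CD\<kappa>(1) by (simp add: G_def w_def \<eta>D(4))
  qed
  have int_G: "integrable lborel (G k)" for k
    by (rule Bochner_Integration.integrable_bound[OF int_w]) (use order_trans[OF G_bd abs_ge_self] in auto)
  have S_eq: "S k = - (T1 k + (LINT y|lborel. G k y))" for k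
  proof -
    have i2: "integrable lborel (\<lambda>y. g y * \<eta> y)" if "integrable lborel g" for g
      by (rule Bochner_Integration.integrable_bound[OF integrable_mult_right[OF that, of C\<eta>]])
        (use that C\<eta> in \<open>auto simp: abs_mult mult.commute intro!: mult_right_mono\<close>)
    have sh: "(LINT y|lborel. H y * \<eta> (y - t k *\<^sub>R v)) = (LINT y|lborel. H (y + t k *\<^sub>R v) * \<eta> y)"
      using integral_lborel_shift[of "\<lambda>y. H y * \<eta> (y - t k *\<^sub>R v)" "t k *\<^sub>R v"] by simp
    have i3: "integrable lborel (\<lambda>y. H y * \<eta> (y - t k *\<^sub>R v))"
      using integrable_lborel_shift[OF i2[OF integrable_lborel_shift[OF intH, of "t k *\<^sub>R v"]], of "- (t k *\<^sub>R v)"]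
      by simp
    have "S k = ((LINT y|lborel. H y * \<eta> y) - (LINT y|lborel. H y * \<eta> (y - t k *\<^sub>R v))) / t k"
      unfolding S_def using i2[OF intH] i3 by (simp add: right_diff_distrib)
    also have "\<dots> = - (LINT y|lborel. (H (y + t k *\<^sub>R v) - H y) / t k * \<eta> y)"
      unfolding sh using i2[OF intH] i2[OF integrable_lborel_shift[OF intH, of "t k *\<^sub>R v"]]
      by (simp add: left_diff_distrib minus_divide_left)
    also have "(LINT y|lborel. (H (y + t k *\<^sub>R v) - H y) / t k * \<eta> y) =
        (LINT y|lborel. \<eta> y * \<kappa>1 (y + t k *\<^sub>R v) * Q k y * (indicator U' y * (E k y - F1 y)) + G k y)"
    proof (intro Bochner_Integration.integral_cong refl)
      fix y
      show "(H (y + t k *\<^sub>R v) - H y) / t k * \<eta> y =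
        \<eta> y * \<kappa>1 (y + t k *\<^sub>R v) * Q k y * (indicator U' y * (E k y - F1 y)) + G k y"
      proof (cases "y \<in> K0")
        case True
        have "h (f1 (y + t k *\<^sub>R v)) - h (f1 y) = Q k y * (t k * E k y)"
          using diff_ratio_eq[of h "f1 (y + t k *\<^sub>R v)" "f1 y" h'] t_pos[of k]
          by (simp add: Q_def E_def)
        then have "h (f1 (y + t k *\<^sub>R v)) = h (f1 y) + Q k y * (t k * E k y)" by simp
        then show ?thesis
          using True K0U' t_pos[of k] by (auto simp: H_def G_def field_simps)
      qed (simp add: G_def \<eta>D(4))
    qed
    also have "\<dots> = T1 k + (LINT y|lborel. G k y)"
      unfolding T1_def using int1 int_G by simp
    finally show ?thesis .
  qed
  have G_lim: "(\<lambda>k. LINT y|lborel. G (r k) y) \<longlonglongrightarrow>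
      (LINT y|lborel. (h' (f1 y) * F1 y * \<kappa>1 y + h (f1 y) * D1 y) * \<eta> y)"
  proof (rule integral_dominated_convergence[OF _ _ int_w])
    show "AE y in lborel. (\<lambda>k. G (r k) y) \<longlonglongrightarrow> (h' (f1 y) * F1 y * \<kappa>1 y + h (f1 y) * D1 y) * \<eta> y"
      using f1_lim
    proof eventually_elim
      case (elim y)
      show ?case
      proof (cases "y \<in> K0")
        case True
        have yK1: "y \<in> K1" using True K0U' U'K1 by auto
        then have yW: "y \<in> W" using K1W by auto
        have "(\<lambda>k. Q (r k) y) \<longlonglongrightarrow> h' (f1 y)"
          unfolding Q_def using elim True by (intro diff_ratio_tendsto[OF h(1)]) auto
        moreover have ink: "y + t k *\<^sub>R v \<in> K1" for k
          using K0K1[OF True, of "t k" k] t_pos[of k] by simp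
        have dq: "(\<lambda>k. (\<kappa> (y + t (r k) *\<^sub>R v) - \<kappa> y) / t (r k)) \<longlonglongrightarrow> ?D\<kappa> y"
          using t_pos by (intro diff_quot_along_line_tendsto \<kappa>(1) yW tr) (auto simp: less_imp_neq[symmetric])
        have "(\<lambda>k. y + t (r k) *\<^sub>R v) \<longlonglongrightarrow> y + 0 *\<^sub>R v"
          by (intro tendsto_intros tr)
        then have "(\<lambda>k. \<kappa> (y + t (r k) *\<^sub>R v)) \<longlonglongrightarrow> \<kappa> y"
          using differentiable_imp_continuous_within[OF \<kappa>(1)[OF yW]]
          by (intro isCont_tendsto_compose[of y \<kappa>]) auto
        ultimately have "(\<lambda>k. \<eta> y * \<kappa> (y + t (r k) *\<^sub>R v) * Q (r k) y * F1 y
            + \<eta> y * h (f1 y) * ((\<kappa> (y + t (r k) *\<^sub>R v) - \<kappa> y) / t (r k))) \<longlonglongrightarrow>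
          \<eta> y * \<kappa> y * h' (f1 y) * F1 y + \<eta> y * h (f1 y) * ?D\<kappa> y"
          by (intro tendsto_intros dq)
        then show ?thesis using yK1 ink unfolding G_def by (simp add: algebra_simps)
      qed (simp add: G_def \<eta>D(4))
    qed
    show "AE y in lborel. norm (G (r k) y) \<le> w y" for k using G_bd by simp
  qed measurable
  have "(\<lambda>k. S (r k)) \<longlonglongrightarrow> - (0 + (LINT y|lborel. (h' (f1 y) * F1 y * \<kappa>1 y + h (f1 y) * D1 y) * \<eta> y))"
    unfolding S_eq using LIMSEQ_subseq_LIMSEQ[OF T1_lim r(1)]
    by (intro tendsto_intros G_lim) (simp add: o_def)
  moreover have "(\<lambda>k. S (r k)) \<longlonglongrightarrow> (LINT y|lborel. H y * ?D\<eta> y)"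
    using LIMSEQ_subseq_LIMSEQ[OF S_lim r(1)] by (simp add: o_def)
  ultimately have "(LINT y|lborel. H y * ?D\<eta> y) =
      - (LINT y|lborel. (h' (f1 y) * F1 y * \<kappa>1 y + h (f1 y) * D1 y) * \<eta> y)"
    using LIMSEQ_unique by fastforce
  moreover have "H y * ?D\<eta> y = h (f y) * \<kappa> y * ?D\<eta> y" for y
  proof (cases "y \<in> K0")
    case True
    then have "y \<in> K1" using K0U' U'K1 by auto
    then show ?thesis by (simp add: H_def)
  qed (simp add: \<eta>D(5))
  moreover have "(h' (f1 y) * F1 y * \<kappa>1 y + h (f1 y) * D1 y) * \<eta> y =
      (h' (f y) * F y * \<kappa> y + h (f y) * ?D\<kappa> y) * \<eta> y" for y
  proof (cases "y \<in> K0")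
    case True
    then have "y \<in> K1" using K0U' U'K1 by auto
    then show ?thesis by simp
  qed (simp add: \<eta>D(4))
  ultimately show ?thesis by (simp only:)
qed

section \<open>The metric in charts and the change of charts\<close>

lemma has_derivative_vec_expand:
  fixes D :: "real ^ 'n::finite \<Rightarrow> real"
  assumes "linear D"
  shows "D v = (\<Sum>i\<in>UNIV. v $ i * D (axis i 1))"
proof -
  have "D v = D (\<Sum>i\<in>UNIV. v $ i *\<^sub>R axis i 1)"
    by (metis basis_expansion scalar_mult_eq_scaleR)
  also have "\<dots> = (\<Sum>i\<in>UNIV. v $ i * D (axis i 1))"
    using assms by (simp add: linear_sum linear_cmul)
  finally show ?thesis .
qed

lemma bilinear_vec_expand:
  fixes B :: "real ^ 'n::finite \<Rightarrow> real ^ 'n \<Rightarrow> real"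
  assumes "bilinear B"
  shows "B v w = (\<Sum>i\<in>UNIV. \<Sum>j\<in>UNIV. v $ i * w $ j * B (axis i 1) (axis j 1))"
proof -
  have l: "linear (\<lambda>v. B v w)" "linear (B v)" for v w
    using assms by (auto simp: bilinear_def)
  have "B v w = (\<Sum>i\<in>UNIV. v $ i * B (axis i 1) w)"
    by (rule has_derivative_vec_expand[OF l(1)])
  also have "\<dots> = (\<Sum>i\<in>UNIV. v $ i * (\<Sum>j\<in>UNIV. w $ j * B (axis i 1) (axis j 1)))"
    by (intro sum.cong refl arg_cong2[of _ _ _ _ "(*)"] has_derivative_vec_expand[OF l(2)])
  finally show ?thesis by (simp add: sum_distrib_left mult.assoc)
qed

lemma smooth_onD:
  assumes "smooth_on S f"
  shows "x \<in> S \<Longrightarrow> f differentiable at x"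
    and "continuous_on S (\<lambda>x. frechet_derivative f (at x) v)" and "continuous_on S f"
proof -
  have "C_k_on (Suc 0) S f" "C_k_on 0 S f"
    using assms unfolding smooth_on_def by blast+
  then show "x \<in> S \<Longrightarrow> f differentiable at x"
    "continuous_on S (\<lambda>x. frechet_derivative f (at x) v)" "continuous_on S f" by auto
qed

locale riem_manifold =
  fixes M :: "('a::{t2_space, second_countable_topology}, 'n::finite) riemannian"
  assumes manifold: "riemannian_manifold M"
begin

abbreviation "nrm c x v \<equiv> sqrt (metric M c x v v)"

lemma atlas_cover: "\<exists>c\<in>atlas M. x \<in> cdom c"
  using manifold unfolding riemannian_manifold_def smooth_atlas_def by blast

lemma chart_at: "chart_at M x \<in> atlas M" "x \<in> cdom (chart_at M x)"
proof -
  have "\<exists>c. c \<in> atlas M \<and> x \<in> cdom c" using atlas_cover[of x] by blast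
  from someI_ex[OF this] show "chart_at M x \<in> atlas M" "x \<in> cdom (chart_at M x)"
    by (simp_all only: chart_at_def)
qed

lemma chart_props:
  assumes "c \<in> atlas M"
  shows "open (cdom c)" "open (coord c ` cdom c)"
    and "homeomorphism (cdom c) (coord c ` cdom c) (coord c) (inv_coord c)"
  using manifold assms unfolding riemannian_manifold_def smooth_atlas_def by blast+

lemma inv_coord:
  assumes "c \<in> atlas M"
  shows "x \<in> cdom c \<Longrightarrow> inv_coord c (coord c x) = x"
    and "y \<in> coord c ` cdom c \<Longrightarrow> inv_coord c y \<in> cdom c"
    and "y \<in> coord c ` cdom c \<Longrightarrow> coord c (inv_coord c y) = y"
    and "continuous_on (cdom c) (coord c)" and "continuous_on (coord c ` cdom c) (inv_coord c)"
  using chart_props(3)[OF assms] by (auto simp: homeomorphism_def)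

lemma open_coord_image:
  assumes c: "c \<in> atlas M" and A: "open A"
  shows "open (coord c ` (A \<inter> cdom c))"
proof -
  have eq: "coord c ` (A \<inter> cdom c) = inv_coord c -` (A \<inter> cdom c) \<inter> coord c ` cdom c"
    using inv_coord[OF c] by (auto simp: image_iff)
  have "open (A \<inter> cdom c)" using A chart_props(1)[OF c] by (rule open_Int)
  then have "open (inv_coord c -` (A \<inter> cdom c) \<inter> coord c ` cdom c)"
    using continuous_on_open_vimage[OF chart_props(2)[OF c], of "inv_coord c"] inv_coord(5)[OF c] by blast
  then show ?thesis by (simp only: eq)
qed

lemma coord_mem_iff:
  assumes c: "c \<in> atlas M"
  shows "y \<in> coord c ` (A \<inter> cdom c) \<longleftrightarrow> y \<in> coord c ` cdom c \<and> inv_coord c y \<in> A"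
  using inv_coord[OF c] by (auto simp: image_iff)

lemma transition_smooth:
  assumes "c \<in> atlas M" "d \<in> atlas M"
  shows "smooth_on (coord c ` (cdom c \<inter> cdom d)) (transition c d)"
  using manifold assms unfolding riemannian_manifold_def smooth_atlas_def by blast

lemma transition_has_derivative:
  assumes "c \<in> atlas M" "d \<in> atlas M" "x \<in> cdom c" "x \<in> cdom d"
  shows "(transition c d has_derivative change_comp c d x) (at (coord c x))"
  using smooth_onD(1)[OF transition_smooth[OF assms(1,2)], of "coord c x"] assms
  unfolding change_comp_def by (metis IntI frechet_derivative_works imageI)

lemma metric_bilinear: "c \<in> atlas M \<Longrightarrow> x \<in> cdom c \<Longrightarrow> bilinear (metric M c x)"
  and metric_sym: "c \<in> atlas M \<Longrightarrow> x \<in> cdom c \<Longrightarrow> metric M c x v w = metric M c x w v"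
  and metric_pos: "c \<in> atlas M \<Longrightarrow> x \<in> cdom c \<Longrightarrow> v \<noteq> 0 \<Longrightarrow> metric M c x v v > 0"
  and metric_smooth: "c \<in> atlas M \<Longrightarrow>
    smooth_on (coord c ` cdom c) (\<lambda>y. metric M c (inv_coord c y) v w)"
  and metric_change: "c \<in> atlas M \<Longrightarrow> d \<in> atlas M \<Longrightarrow> x \<in> cdom c \<Longrightarrow> x \<in> cdom d \<Longrightarrow>
    metric M c x v w = metric M d x (change_comp c d x v) (change_comp c d x w)"
  using manifold unfolding riemannian_manifold_def by blast+

lemma metric_linear:
  assumes "c \<in> atlas M" "x \<in> cdom c"
  shows "linear (metric M c x v)" "linear (\<lambda>v. metric M c x v w)"
  using metric_bilinear[OF assms] by (auto simp: bilinear_def)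

lemmas metric_arith = linear_add[OF metric_linear(1)] linear_add[OF metric_linear(2)]
  linear_cmul[OF metric_linear(1)] linear_cmul[OF metric_linear(2)]
  linear_0[OF metric_linear(1)] linear_0[OF metric_linear(2)]
  linear_diff[OF metric_linear(1)] linear_diff[OF metric_linear(2)]

lemma metric_nonneg: "c \<in> atlas M \<Longrightarrow> x \<in> cdom c \<Longrightarrow> 0 \<le> metric M c x v v"
  by (cases "v = 0") (auto simp: metric_arith less_imp_le[OF metric_pos])

lemma nrm_scale:
  assumes "c \<in> atlas M" "x \<in> cdom c"
  shows "nrm c x (r *\<^sub>R v) = \<bar>r\<bar> * nrm c x v"
  using assms by (simp add: metric_arith real_sqrt_mult mult.assoc[symmetric])

lemma metric_Cauchy_Schwarz:
  assumes c: "c \<in> atlas M" "x \<in> cdom c"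
  shows "\<bar>metric M c x v w\<bar> \<le> nrm c x v * nrm c x w"
proof (cases "w = 0")
  case False
  let ?g = "metric M c x"
  have pos: "?g w w > 0" by (rule metric_pos[OF c False])
  define t where "t = ?g v w / ?g w w"
  have "0 \<le> ?g (v - t *\<^sub>R w) (v - t *\<^sub>R w)" by (rule metric_nonneg[OF c])
  also have "\<dots> = ?g v v - t * ?g v w"
    using pos metric_sym[OF c, of w v] by (simp add: metric_arith[OF c] t_def field_simps)
  finally have "(?g v w)\<^sup>2 \<le> ?g v v * ?g w w"
    using pos by (simp add: t_def field_simps power2_eq_square)
  then have "sqrt ((?g v w)\<^sup>2) \<le> sqrt (?g v v * ?g w w)"
    by (rule real_sqrt_le_mono)
  then show ?thesis by (simp add: real_sqrt_mult)
qed (simp add: metric_arith[OF c])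

lemma metric_expand:
  assumes "c \<in> atlas M" "x \<in> cdom c"
  shows "metric M c x v w =
    (\<Sum>i\<in>UNIV. \<Sum>j\<in>UNIV. v $ i * w $ j * metric M c x (axis i 1) (axis j 1))"
  by (rule bilinear_vec_expand[OF metric_bilinear[OF assms]])

lemma continuous_on_metric:
  assumes c: "c \<in> atlas M" and "continuous_on S f" "continuous_on S v" "continuous_on S w"
    and sub: "\<And>s. s \<in> S \<Longrightarrow> f s \<in> cdom c"
  shows "continuous_on S (\<lambda>s. metric M c (f s) (v s) (w s))"
proof -
  have "continuous_on S (\<lambda>s. metric M c (f s) (axis i 1) (axis j 1))" for i j
  proof -
    have "continuous_on S (\<lambda>s. metric M c (inv_coord c (coord c (f s))) (axis i 1) (axis j 1))"
    proof (rule continuous_on_compose2[OF smooth_onD(3)[OF metric_smooth[OF c]]])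
      show "continuous_on S (\<lambda>s. coord c (f s))"
        by (rule continuous_on_compose2[OF inv_coord(4)[OF c] assms(2)]) (use sub in auto)
    qed (use sub in auto)
    then show ?thesis
      by (subst continuous_on_cong[OF refl, of S _ "\<lambda>s. metric M c (inv_coord c (coord c (f s))) (axis i 1) (axis j 1)"])
        (use sub inv_coord(1)[OF c] in auto)
  qed
  then have "continuous_on S (\<lambda>s. \<Sum>i\<in>UNIV. \<Sum>j\<in>UNIV. v s $ i * w s $ j * metric M c (f s) (axis i 1) (axis j 1))"
    using assms by (intro continuous_intros) auto
  then show ?thesis
    by (subst continuous_on_cong[OF refl metric_expand[OF c sub]]) auto
qed

text \<open>The constant is the minimum of the continuous function (x, v) \<mapsto>
  \<open>nrm c x v\<close> over the compact product of \<open>K\<close> with the unit sphere;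
  homogeneity in v does the rest.\<close>

lemma nrm_lower_bound:
  assumes c: "c \<in> atlas M" and K: "compact K" "K \<subseteq> cdom c"
  obtains m where "m > 0" "\<And>x v. x \<in> K \<Longrightarrow> m * norm v \<le> nrm c x v"
proof (cases "K = {}")
  case False
  let ?S = "K \<times> sphere (0 :: real ^ 'n) 1"
  have "compact ?S" using K by (intro compact_Times) auto
  moreover have "axis undefined 1 \<in> sphere (0 :: real ^ 'n) 1" by simp
  then have "?S \<noteq> {}" using False by blast
  moreover have "continuous_on ?S (\<lambda>(x, v). nrm c x v)"
    unfolding case_prod_unfold
    by (intro continuous_intros continuous_on_metric c) (use K in auto)
  ultimately obtain z where z: "z \<in> ?S" "\<forall>p\<in>?S. (\<lambda>(x, v). nrm c x v) z \<le> (\<lambda>(x, v). nrm c x v) p"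
    using continuous_attains_inf[of ?S] by blast
  obtain x0 v0 where xv: "z = (x0, v0)" by force
  define m where "m = nrm c x0 v0"
  have "v0 \<noteq> 0" "x0 \<in> cdom c" using z(1) xv K by auto
  then have "m > 0" unfolding m_def using metric_pos[OF c] by simp
  moreover have "m * norm v \<le> nrm c x v" if x: "x \<in> K" for x v
  proof (cases "v = 0")
    case False
    have xc: "x \<in> cdom c" using x K by auto
    have "m \<le> nrm c x ((1 / norm v) *\<^sub>R v)"
      using z(2) x False by (auto simp: xv m_def)
    also have "\<dots> = nrm c x v / norm v"
      using nrm_scale[OF c xc] False by simp
    finally show ?thesis using False by (simp add: field_simps)
  qed (use x K c in \<open>auto simp: metric_arith\<close>)
  ultimately show ?thesis using that by blast
qed (use that[of 1] in auto)

lemma change_comp_linear: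
  assumes "c \<in> atlas M" "d \<in> atlas M" "x \<in> cdom c" "x \<in> cdom d"
  shows "linear (change_comp c d x)"
  using transition_has_derivative[OF assms] by (rule has_derivative_linear)

lemma change_comp_trans:
  assumes c: "c \<in> atlas M" "d \<in> atlas M" "e \<in> atlas M" "x \<in> cdom c" "x \<in> cdom d" "x \<in> cdom e"
  shows "change_comp d e x (change_comp c d x v) = change_comp c e x v"
proof -
  let ?U = "coord c ` (cdom d \<inter> cdom e \<inter> cdom c)"
  have U: "open ?U" "coord c x \<in> ?U"
    using c by (auto intro!: open_coord_image open_Int chart_props(1)[OF c(2)] chart_props(1)[OF c(3)])
  have tx: "transition c d (coord c x) = coord d x"
    using inv_coord(1)[OF c(1) c(4)] by (simp add: transition_def)
  have "((\<lambda>y. transition d e (transition c d y)) has_derivative (\<lambda>v. change_comp d e x (change_comp c d x v))) (at (coord c x))"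
    using has_derivative_compose[OF transition_has_derivative[OF c(1,2,4,5)], of "transition d e"]
      transition_has_derivative[OF c(2,3,5,6)] tx by simp
  then have "(transition c e has_derivative (\<lambda>v. change_comp d e x (change_comp c d x v))) (at (coord c x))"
  proof (rule has_derivative_transform_within_open[OF _ U])
    fix y assume "y \<in> ?U"
    then obtain z where "z \<in> cdom d" "z \<in> cdom e" "z \<in> cdom c" "y = coord c z" by auto
    then show "transition d e (transition c d y) = transition c e y"
      using inv_coord(1) c by (simp add: transition_def)
  qed
  then show ?thesis
    using transition_has_derivative[OF c(1,3,4,6)] has_derivative_unique by metis
qed

lemma change_comp_id:
  assumes c: "c \<in> atlas M" "x \<in> cdom c"
  shows "change_comp c c x v = v"
proof -
  have "(transition c c has_derivative (\<lambda>v. v)) (at (coord c x))"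
    by (rule has_derivative_transform_within_open[OF has_derivative_ident chart_props(2)[OF c(1)]])
      (use c inv_coord(3)[OF c(1)] in \<open>auto simp: transition_def\<close>)
  then show ?thesis
    using transition_has_derivative[OF c(1) c(1) c(2) c(2)] has_derivative_unique by metis
qed

lemma nrm_change:
  assumes "c \<in> atlas M" "d \<in> atlas M" "x \<in> cdom c" "x \<in> cdom d"
  shows "nrm d x (change_comp c d x v) = nrm c x v"
  using metric_change[OF assms, of v v] by simp

end

section \<open>Piecewise C^1 curves and their length\<close>

text \<open>Curves on arbitrary intervals, built by appending one C^1 piece at a time, so that
  concatenation, restriction, reversal and affine reparametrization go by induction. On [0,1] this
  agrees with the definition by partitions (\<open>piecewise_C1_curve_iff\<close>).\<close>

inductive pwC1 :: "('a::topological_space, 'n::finite) riemannian \<Rightarrow> (real \<Rightarrow> 'a) \<Rightarrow> real \<Rightarrow> real \<Rightarrow> bool"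
  for M \<gamma> where
  base: "a < b \<Longrightarrow> continuous_on {a..b} \<gamma> \<Longrightarrow> C1_curve_on M {a..b} \<gamma> \<Longrightarrow> pwC1 M \<gamma> a b"
| snoc: "pwC1 M \<gamma> a b \<Longrightarrow> b < c \<Longrightarrow> continuous_on {b..c} \<gamma> \<Longrightarrow> C1_curve_on M {b..c} \<gamma> \<Longrightarrow> pwC1 M \<gamma> a c"

lemma pwC1_less: "pwC1 M \<gamma> a b \<Longrightarrow> a < b"
  by (induction rule: pwC1.induct) auto

lemma continuous_on_Icc_Un:
  assumes "continuous_on {a..b} f" "continuous_on {b..c} f" "a \<le> b" "b \<le> (c::real)"
  shows "continuous_on {a..c} f"
  using continuous_on_closed_Un[of "{a..b}" "{b..c}" f] assms ivl_disj_un_two_touch(4)[of a b c] by simp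

lemma pwC1_continuous: "pwC1 M \<gamma> a b \<Longrightarrow> continuous_on {a..b} \<gamma>"
proof (induction rule: pwC1.induct)
  case (snoc a b c)
  then show ?case using pwC1_less[OF snoc.hyps(1)] continuous_on_Icc_Un[of a b \<gamma> c] by simp
qed

lemma pwC1_concat: "pwC1 M \<gamma> b c \<Longrightarrow> pwC1 M \<gamma> a b \<Longrightarrow> pwC1 M \<gamma> a c"
  by (induction rule: pwC1.induct) (auto intro: pwC1.snoc)

lemma C1_curve_on_subset:
  assumes "C1_curve_on M I \<gamma>" "J \<subseteq> I"
  shows "C1_curve_on M J \<gamma>"
  unfolding C1_curve_on_def
proof
  fix c assume "c \<in> atlas M"
  then obtain D where D: "continuous_on (I \<inter> \<gamma> -` cdom c) D"
    "\<And>t. t \<in> I \<inter> \<gamma> -` cdom c \<Longrightarrow> (coord c \<circ> \<gamma> has_vector_derivative D t) (at t within I)"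
    using assms(1) unfolding C1_curve_on_def by blast
  have "continuous_on (J \<inter> \<gamma> -` cdom c) D"
    by (rule continuous_on_subset[OF D(1)]) (use assms(2) in auto)
  moreover have "(coord c \<circ> \<gamma> has_vector_derivative D t) (at t within J)" if "t \<in> J \<inter> \<gamma> -` cdom c" for t
    by (rule has_vector_derivative_within_subset[OF D(2) assms(2)]) (use assms(2) that in auto)
  ultimately show "\<exists>D. continuous_on (J \<inter> \<gamma> -` cdom c) D \<and>
      (\<forall>t\<in>J \<inter> \<gamma> -` cdom c. (coord c \<circ> \<gamma> has_vector_derivative D t) (at t within J))"
    by blast
qed

lemma pwC1_single_subset:
  assumes "continuous_on {a..b} \<gamma>" "C1_curve_on M {a..b} \<gamma>" "a \<le> s" "s < t" "t \<le> b"
  shows "pwC1 M \<gamma> s t"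
  using assms by (intro pwC1.base continuous_on_subset[OF assms(1)] C1_curve_on_subset[OF assms(2)]) auto

lemma pwC1_restrict: "pwC1 M \<gamma> a b \<Longrightarrow> a \<le> s \<Longrightarrow> s < t \<Longrightarrow> t \<le> b \<Longrightarrow> pwC1 M \<gamma> s t"
proof (induction arbitrary: s t rule: pwC1.induct)
  case (base a b)
  then show ?case using pwC1_single_subset by blast
next
  case (snoc a b c)
  consider "t \<le> b" | "s < b" "b < t" | "b \<le> s" by linarith
  then show ?case
  proof cases
    case 1
    then show ?thesis using snoc by blast
  next
    case 2
    have "pwC1 M \<gamma> s b" using snoc 2 by auto
    moreover have "pwC1 M \<gamma> b t"
      using snoc 2 by (intro pwC1_single_subset[of b c]) auto
    ultimately show ?thesis by (rule pwC1_concat[rotated])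
  next
    case 3
    then show ?thesis using snoc pwC1_single_subset[of b c \<gamma> M s t] by auto
  qed
qed

lemma C1_curve_on_cong:
  assumes "\<And>t. t \<in> I \<Longrightarrow> \<gamma> t = \<delta> t" "C1_curve_on M I \<gamma>"
  shows "C1_curve_on M I \<delta>"
  unfolding C1_curve_on_def
proof
  fix c assume "c \<in> atlas M"
  then obtain D where D: "continuous_on (I \<inter> \<gamma> -` cdom c) D"
    "\<And>t. t \<in> I \<inter> \<gamma> -` cdom c \<Longrightarrow> (coord c \<circ> \<gamma> has_vector_derivative D t) (at t within I)"
    using assms(2) unfolding C1_curve_on_def by blast
  have eq: "I \<inter> \<gamma> -` cdom c = I \<inter> \<delta> -` cdom c" using assms(1) by auto
  have "(coord c \<circ> \<delta> has_vector_derivative D t) (at t within I)" if "t \<in> I \<inter> \<delta> -` cdom c" for t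
    by (rule has_vector_derivative_transform[OF _ _ D(2)]) (use that assms(1) eq in auto)
  then show "\<exists>D. continuous_on (I \<inter> \<delta> -` cdom c) D \<and>
      (\<forall>t\<in>I \<inter> \<delta> -` cdom c. (coord c \<circ> \<delta> has_vector_derivative D t) (at t within I))"
    using D(1) unfolding eq by blast
qed

lemma pwC1_cong:
  assumes "pwC1 M \<gamma> a b" "\<And>t. a \<le> t \<Longrightarrow> t \<le> b \<Longrightarrow> \<gamma> t = \<delta> t"
  shows "pwC1 M \<delta> a b"
  using assms
proof (induction rule: pwC1.induct)
  case (base a b)
  have "continuous_on {a..b} \<delta>" using base by (subst continuous_on_cong[OF refl, of _ _ \<gamma>]) auto
  moreover have "C1_curve_on M {a..b} \<delta>" by (rule C1_curve_on_cong[OF _ base(3)]) (use base in auto)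
  ultimately show ?case using base by (intro pwC1.base)
next
  case (snoc a b c)
  have "a < b" using snoc pwC1_less by blast
  have "continuous_on {b..c} \<delta>" using snoc \<open>a < b\<close> by (subst continuous_on_cong[OF refl, of _ _ \<gamma>]) auto
  moreover have "C1_curve_on M {b..c} \<delta>" by (rule C1_curve_on_cong[OF _ snoc(4)]) (use snoc \<open>a < b\<close> in auto)
  moreover have "pwC1 M \<delta> a b" using snoc by auto
  ultimately show ?case using snoc by (intro pwC1.snoc[of M \<delta> a b c])
qed

lemma C1_curve_on_affine:
  fixes m :: real
  assumes "C1_curve_on M I \<gamma>" and J: "\<And>t. t \<in> J \<Longrightarrow> m * t + k \<in> I"
  shows "C1_curve_on M J (\<lambda>t. \<gamma> (m * t + k))"
  unfolding C1_curve_on_def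
proof
  fix c assume "c \<in> atlas M"
  then obtain D where D: "continuous_on (I \<inter> \<gamma> -` cdom c) D"
    "\<And>t. t \<in> I \<inter> \<gamma> -` cdom c \<Longrightarrow> (coord c \<circ> \<gamma> has_vector_derivative D t) (at t within I)"
    using assms(1) unfolding C1_curve_on_def by blast
  let ?\<delta> = "\<lambda>t. \<gamma> (m * t + k)"
  have "continuous_on (J \<inter> ?\<delta> -` cdom c) (\<lambda>t. m *\<^sub>R D (m * t + k))"
    by (intro continuous_intros continuous_on_compose2[OF D(1)]) (use J in auto)
  moreover have "(coord c \<circ> ?\<delta> has_vector_derivative m *\<^sub>R D (m * t + k)) (at t within J)"
    if "t \<in> J \<inter> ?\<delta> -` cdom c" for t
  proof -
    have 1: "((\<lambda>t. m * t + k) has_vector_derivative m) (at t within J)"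
      by (auto intro!: derivative_eq_intros simp: has_real_derivative_iff_has_vector_derivative[symmetric])
    have 2: "(coord c \<circ> \<gamma> has_vector_derivative D (m * t + k)) (at (m * t + k) within (\<lambda>t. m * t + k) ` J)"
      by (rule has_vector_derivative_within_subset[OF D(2)]) (use J that in auto)
    show ?thesis using vector_diff_chain_within[OF 1 2] by (simp add: comp_def)
  qed
  ultimately show "\<exists>D. continuous_on (J \<inter> ?\<delta> -` cdom c) D \<and>
      (\<forall>t\<in>J \<inter> ?\<delta> -` cdom c. (coord c \<circ> ?\<delta> has_vector_derivative D t) (at t within J))"
    by blast
qed

lemma pwC1_affine:
  assumes "pwC1 M \<gamma> a b" "(m::real) > 0"
  shows "pwC1 M (\<lambda>t. \<gamma> (m * t + k)) ((a - k) / m) ((b - k) / m)"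
proof -
  have piece: "continuous_on {(a - k) / m..(b - k) / m} (\<lambda>t. \<gamma> (m * t + k))"
    "C1_curve_on M {(a - k) / m..(b - k) / m} (\<lambda>t. \<gamma> (m * t + k))"
    if "continuous_on {a..b} \<gamma>" "C1_curve_on M {a..b} \<gamma>" for a b
  proof -
    have *: "m * t + k \<in> {a..b}" if "t \<in> {(a - k) / m..(b - k) / m}" for t
      using that \<open>m > 0\<close> by (auto simp: field_simps)
    show "continuous_on {(a - k) / m..(b - k) / m} (\<lambda>t. \<gamma> (m * t + k))"
      by (rule continuous_on_compose2[OF that(1)]) (use * in \<open>auto intro!: continuous_intros\<close>)
    show "C1_curve_on M {(a - k) / m..(b - k) / m} (\<lambda>t. \<gamma> (m * t + k))"
      using C1_curve_on_affine[OF that(2) *] by blast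
  qed
  show ?thesis
    using assms(1)
  proof (induction rule: pwC1.induct)
    case (base a b)
    then show ?case using piece assms(2) by (intro pwC1.base) (auto simp: divide_strict_right_mono)
  next
    case (snoc a b c)
    then show ?case
      using piece assms(2) by (intro pwC1.snoc[OF snoc.IH]) (auto simp: divide_strict_right_mono)
  qed
qed

lemma pwC1_reverse: "pwC1 M \<gamma> a b \<Longrightarrow> pwC1 M (\<lambda>t. \<gamma> (- t)) (- b) (- a)"
proof -
  have piece: "pwC1 M (\<lambda>t. \<gamma> (- t)) (- b) (- a)"
    if "continuous_on {a..b} \<gamma>" "C1_curve_on M {a..b} \<gamma>" "a < b" for a b
  proof (rule pwC1.base)
    show "continuous_on {- b..- a} (\<lambda>t. \<gamma> (- t))"
      by (rule continuous_on_compose2[OF that(1)]) (auto intro!: continuous_intros)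
    have "C1_curve_on M {- b..- a} (\<lambda>t. \<gamma> ((-1) * t + 0))"
      by (rule C1_curve_on_affine[OF that(2)]) auto
    then show "C1_curve_on M {- b..- a} (\<lambda>t. \<gamma> (- t))" by simp
  qed (use that in simp)
  assume "pwC1 M \<gamma> a b"
  then show ?thesis
  proof (induction rule: pwC1.induct)
    case (base a b)
    then show ?case using piece by blast
  next
    case (snoc a b c)
    then show ?case using piece[of b c] pwC1_concat by blast
  qed
qed

lemma pwC1_imp_partition:
  assumes "pwC1 M \<gamma> a b"
  shows "\<exists>(n::nat) t. t 0 = a \<and> t n = b \<and> (\<forall>i<n. t i < t (Suc i) \<and> C1_curve_on M {t i..t (Suc i)} \<gamma>)"
  using assms
proof (induction rule: pwC1.induct)
  case (base a b)
  then show ?case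
    by (intro exI[of _ 1] exI[of _ "\<lambda>i. if i = 0 then a else b"]) auto
next
  case (snoc a b c)
  then obtain n :: nat and t where t: "t 0 = a" "t n = b"
    "\<And>i. i < n \<Longrightarrow> t i < t (Suc i) \<and> C1_curve_on M {t i..t (Suc i)} \<gamma>" by blast
  show ?case
    using snoc t
    by (intro exI[of _ "Suc n"] exI[of _ "t(Suc n := c)"]) (auto simp: less_Suc_eq)
qed

lemma partition_imp_pwC1:
  fixes t :: "nat \<Rightarrow> real"
  assumes "\<And>i. i \<le> n \<Longrightarrow> t i < t (Suc i) \<and> C1_curve_on M {t i..t (Suc i)} \<gamma>"
    and "continuous_on {t 0..t (Suc n)} \<gamma>"
  shows "pwC1 M \<gamma> (t 0) (t (Suc n))"
  using assms
proof (induction n)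
  case 0
  then show ?case by (auto intro: pwC1.base)
next
  case (Suc n)
  note step = Suc.prems(1)
  have mono: "i \<le> Suc n \<Longrightarrow> t 0 \<le> t i" for i
  proof (induction i)
    case (Suc j)
    then show ?case using step[of j] by simp
  qed simp
  have 1: "t (Suc n) < t (Suc (Suc n))" using Suc.prems(1)[of "Suc n"] by simp
  have "pwC1 M \<gamma> (t 0) (t (Suc n))"
    using Suc.prems(1) less_imp_le[OF 1] by (intro Suc.IH continuous_on_subset[OF Suc.prems(2)]) auto
  then show ?case
    using Suc.prems 1 mono[of "Suc n"]
    by (intro pwC1.snoc[OF _ 1] continuous_on_subset[OF Suc.prems(2)]) auto
qed

lemma piecewise_C1_curve_iff: "piecewise_C1_curve M \<gamma> \<longleftrightarrow> pwC1 M \<gamma> 0 1"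
proof
  assume "piecewise_C1_curve M \<gamma>"
  then obtain n :: nat and t where t: "continuous_on {0..1} \<gamma>" "t 0 = 0" "t n = 1"
    "\<And>i. i < n \<Longrightarrow> t i < t (Suc i) \<and> C1_curve_on M {t i..t (Suc i)} \<gamma>"
    unfolding piecewise_C1_curve_def path_def by blast
  then obtain k where "n = Suc k" by (cases n) auto
  then show "pwC1 M \<gamma> 0 1"
    using partition_imp_pwC1[of k t M \<gamma>] t by (simp add: less_Suc_eq_le)
next
  assume "pwC1 M \<gamma> 0 1"
  then show "piecewise_C1_curve M \<gamma>"
    unfolding piecewise_C1_curve_def path_def
    using pwC1_imp_partition pwC1_continuous by blast
qed

text \<open>\<open>speed\<close> differentiates within [0,1]; here the derivative is two-sided and
  thus independent of the parameter interval. On [0,1] the two differ at most at the end points,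
  which integrals ignore.\<close>

definition speed_at :: "('a, 'n::finite) riemannian \<Rightarrow> (real \<Rightarrow> 'a) \<Rightarrow> real \<Rightarrow> real" where
  "speed_at M \<gamma> t =
     (let c = chart_at M (\<gamma> t); v = vector_derivative (coord c \<circ> \<gamma>) (at t)
      in sqrt (metric M c (\<gamma> t) v v))"

definition clen :: "('a, 'n::finite) riemannian \<Rightarrow> (real \<Rightarrow> 'a) \<Rightarrow> real \<Rightarrow> real \<Rightarrow> real" where
  "clen M \<gamma> a b = integral {a..b} (speed_at M \<gamma>)"

context riem_manifold begin

lemma coord_curve_change:
  assumes c: "c \<in> atlas M" "d \<in> atlas M" and t: "\<gamma> t \<in> cdom c" "\<gamma> t \<in> cdom d"
    and \<gamma>: "continuous (at t within I) \<gamma>"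
    and v: "(coord c \<circ> \<gamma> has_vector_derivative v) (at t within I)"
  shows "(coord d \<circ> \<gamma> has_vector_derivative change_comp c d (\<gamma> t) v) (at t within I)"
proof -
  let ?T = "change_comp c d (\<gamma> t)"
  have "((\<lambda>s. transition c d ((coord c \<circ> \<gamma>) s)) has_derivative (\<lambda>h. ?T (h *\<^sub>R v))) (at t within I)"
    using has_derivative_compose[OF v[unfolded has_vector_derivative_def], of "transition c d"]
      transition_has_derivative[OF c t] by simp
  moreover have "(\<lambda>h. ?T (h *\<^sub>R v)) = (\<lambda>h. h *\<^sub>R ?T v)"
    using linear_cmul[OF change_comp_linear[OF c t]] by auto
  ultimately have 1: "((\<lambda>s. transition c d ((coord c \<circ> \<gamma>) s)) has_vector_derivative ?T v) (at t within I)"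
    by (simp add: has_vector_derivative_def)
  have "eventually (\<lambda>s. s \<in> I \<longrightarrow> \<gamma> s \<in> cdom c) (nhds t)"
  proof -
    have "eventually (\<lambda>s. \<gamma> s \<in> cdom c) (at t within I)"
      using \<gamma> t(1) chart_props(1)[OF c(1)] unfolding continuous_within tendsto_def by blast
    then show ?thesis
      unfolding eventually_at_filter by eventually_elim (use t(1) in auto)
  qed
  then have "eventually (\<lambda>s. s \<in> I \<longrightarrow> transition c d ((coord c \<circ> \<gamma>) s) = (coord d \<circ> \<gamma>) s) (nhds t)"
    by eventually_elim (simp add: transition_def inv_coord(1)[OF c(1)])
  moreover have "transition c d ((coord c \<circ> \<gamma>) t) = (coord d \<circ> \<gamma>) t"
    using t by (simp add: transition_def inv_coord(1)[OF c(1)])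
  ultimately show ?thesis
    using 1 has_vector_derivative_cong_ev[where f = "\<lambda>s. transition c d ((coord c \<circ> \<gamma>) s)" and g = "coord d \<circ> \<gamma>" and S = I and x = t]
    by simp
qed

end

context riem_manifold begin

text \<open>Along a piecewise C^1 curve this fails at finitely many parameters at most
  (\<open>pwC1_speed\<close>), so integrals of the speed may be computed at such \<open>t\<close>
  only, in any chart.\<close>

definition regular_at :: "(real \<Rightarrow> 'a) \<Rightarrow> real \<Rightarrow> bool" where
  "regular_at \<gamma> t \<longleftrightarrow> (\<forall>c\<in>atlas M. \<gamma> t \<in> cdom c \<longrightarrow>
     (\<exists>v. (coord c \<circ> \<gamma> has_vector_derivative v) (at t) \<and> speed_at M \<gamma> t = nrm c (\<gamma> t) v))"

lemma speed_at_eq: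
  assumes \<gamma>: "isCont \<gamma> t" and c: "c \<in> atlas M" "\<gamma> t \<in> cdom c"
    and v: "(coord c \<circ> \<gamma> has_vector_derivative v) (at t)"
  shows "speed_at M \<gamma> t = nrm c (\<gamma> t) v"
proof -
  let ?d = "chart_at M (\<gamma> t)"
  note d = chart_at[of "\<gamma> t"]
  have "(coord ?d \<circ> \<gamma> has_vector_derivative change_comp c ?d (\<gamma> t) v) (at t)"
    by (rule coord_curve_change[OF c(1) d(1) c(2) d(2) \<gamma> v])
  then have "vector_derivative (coord ?d \<circ> \<gamma>) (at t) = change_comp c ?d (\<gamma> t) v"
    by (rule vector_derivative_at)
  then show ?thesis
    unfolding speed_at_def Let_def using nrm_change[OF c(1) d(1) c(2) d(2)] by simp
qed

lemma speed_at_nonneg: "0 \<le> speed_at M \<gamma> t"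
  unfolding speed_at_def Let_def by (simp add: metric_nonneg chart_at)

lemma regular_atI:
  assumes \<gamma>: "isCont \<gamma> t" and c: "c \<in> atlas M" "\<gamma> t \<in> cdom c"
    and v: "(coord c \<circ> \<gamma> has_vector_derivative v) (at t)"
  shows "regular_at \<gamma> t"
  unfolding regular_at_def
proof (intro ballI impI)
  fix d assume d: "d \<in> atlas M" "\<gamma> t \<in> cdom d"
  have "(coord d \<circ> \<gamma> has_vector_derivative change_comp c d (\<gamma> t) v) (at t)"
    by (rule coord_curve_change[OF c(1) d(1) c(2) d(2) \<gamma> v])
  with speed_at_eq[OF \<gamma> d this]
  show "\<exists>v. (coord d \<circ> \<gamma> has_vector_derivative v) (at t) \<and> speed_at M \<gamma> t = nrm d (\<gamma> t) v"
    by blast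
qed

text \<open>The speed computed with derivatives within [a,b] is independent of the chart and
  therefore continuous on all of [a,b], even though one chart need not contain the piece. In the
  interior it equals \<open>speed_at\<close>.\<close>

lemma C1_piece_speed:
  assumes ab: "a < b" and \<gamma>: "continuous_on {a..b} \<gamma>" and C1: "C1_curve_on M {a..b} \<gamma>"
  shows "\<And>t. a < t \<Longrightarrow> t < b \<Longrightarrow> regular_at \<gamma> t" and "speed_at M \<gamma> integrable_on {a..b}"
proof -
  obtain D where D: "\<And>c. c \<in> atlas M \<Longrightarrow> continuous_on ({a..b} \<inter> \<gamma> -` cdom c) (D c)"
    "\<And>c t. c \<in> atlas M \<Longrightarrow> t \<in> {a..b} \<Longrightarrow> \<gamma> t \<in> cdom c \<Longrightarrow>
      (coord c \<circ> \<gamma> has_vector_derivative D c t) (at t within {a..b})"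
    using C1 unfolding C1_curve_on_def by (metis IntI vimageI)
  define \<sigma> where "\<sigma> t = nrm (chart_at M (\<gamma> t)) (\<gamma> t) (D (chart_at M (\<gamma> t)) t)" for t
  have \<sigma>: "\<sigma> t = nrm c (\<gamma> t) (D c t)" if t: "t \<in> {a..b}" and c: "c \<in> atlas M" "\<gamma> t \<in> cdom c" for c t
  proof -
    let ?d = "chart_at M (\<gamma> t)"
    note d = chart_at[of "\<gamma> t"]
    have "continuous (at t within {a..b}) \<gamma>"
      using \<gamma> t by (simp add: continuous_on_eq_continuous_within)
    from coord_curve_change[OF c(1) d(1) c(2) d(2) this D(2)[OF c(1) t c(2)]]
    have "D ?d t = change_comp c ?d (\<gamma> t) (D c t)"
      using vector_derivative_unique_within_closed_interval[of a b t "coord ?d \<circ> \<gamma>"] ab t D(2)[OF d(1) t d(2)]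
      by simp
    then show ?thesis unfolding \<sigma>_def using nrm_change[OF c(1) d(1) c(2) d(2)] by simp
  qed
  have "continuous (at t within {a..b}) \<sigma>" if t: "t \<in> {a..b}" for t
  proof -
    define c where "c = chart_at M (\<gamma> t)"
    have c: "c \<in> atlas M" "\<gamma> t \<in> cdom c" unfolding c_def by (rule chart_at)+
    let ?S = "{a..b} \<inter> \<gamma> -` cdom c"
    have "continuous_on ?S (\<lambda>t. nrm c (\<gamma> t) (D c t))"
      by (intro continuous_intros continuous_on_metric c D(1) continuous_on_subset[OF \<gamma>]) auto
    then have "continuous_on ?S \<sigma>"
      by (subst continuous_on_cong[OF refl, of _ _ "\<lambda>t. nrm c (\<gamma> t) (D c t)"]) (use \<sigma> c in auto)
    then have "continuous (at t within ?S) \<sigma>"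
      using t c by (simp add: continuous_on_eq_continuous_within)
    moreover obtain A where A: "open A" "A \<inter> {a..b} = \<gamma> -` cdom c \<inter> {a..b}"
      using continuous_on_open_invariant[THEN iffD1, OF \<gamma>, rule_format, OF chart_props(1)[OF c(1)]] by blast
    have "at t within ?S = at t within {a..b}"
    proof (rule at_within_nhd[OF _ A(1)])
      show "t \<in> A" using A(2) t c(2) by blast
      show "?S \<inter> A - {t} = {a..b} \<inter> A - {t}" using A(2) by blast
    qed
    ultimately show ?thesis by simp
  qed
  then have "continuous_on {a..b} \<sigma>" by (simp add: continuous_on_eq_continuous_within)
  then have int: "\<sigma> integrable_on {a..b}" by (rule integrable_continuous_interval)
  have reg: "regular_at \<gamma> t \<and> speed_at M \<gamma> t = \<sigma> t" if "a < t" "t < b" for t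
  proof -
    note c = chart_at[of "\<gamma> t"]
    have int: "at t within {a..b} = at t"
      using that by (intro at_within_interior) auto
    have v: "(coord (chart_at M (\<gamma> t)) \<circ> \<gamma> has_vector_derivative D (chart_at M (\<gamma> t)) t) (at t)"
      using D(2)[OF c(1) _ c(2)] that int by simp
    have cont: "isCont \<gamma> t"
      using \<gamma> that int unfolding continuous_on_eq_continuous_within by (metis atLeastAtMost_iff less_imp_le)
    show ?thesis
      using regular_atI[OF cont c v] speed_at_eq[OF cont c v] \<sigma>[OF _ c] that by simp
  qed
  then show "\<And>t. a < t \<Longrightarrow> t < b \<Longrightarrow> regular_at \<gamma> t" by blast
  show "speed_at M \<gamma> integrable_on {a..b}"
    by (rule integrable_spike_finite[of "{a, b}", OF _ _ int]) (use reg in auto)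
qed

lemma pwC1_speed:
  assumes "pwC1 M \<gamma> a b"
  shows "\<exists>S. finite S \<and> (\<forall>t. a \<le> t \<longrightarrow> t \<le> b \<longrightarrow> t \<notin> S \<longrightarrow> regular_at \<gamma> t)"
    and "speed_at M \<gamma> integrable_on {a..b}"
proof -
  have "(\<exists>S. finite S \<and> (\<forall>t. a \<le> t \<longrightarrow> t \<le> b \<longrightarrow> t \<notin> S \<longrightarrow> regular_at \<gamma> t)) \<and>
      speed_at M \<gamma> integrable_on {a..b}"
    using assms
  proof (induction rule: pwC1.induct)
    case (base a b)
    then show ?case using C1_piece_speed[of a b \<gamma>]
      by (intro conjI exI[of _ "{a, b}"]) (auto simp: less_le)
  next
    case (snoc a b c)
    note p = C1_piece_speed[OF snoc(2-4)]
    obtain S where S: "finite S" "\<And>t. a \<le> t \<Longrightarrow> t \<le> b \<Longrightarrow> t \<notin> S \<Longrightarrow> regular_at \<gamma> t"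
      using snoc.IH by blast
    have "finite (S \<union> {b, c})" using S by simp
    moreover have "regular_at \<gamma> t" if "a \<le> t" "t \<le> c" "t \<notin> S \<union> {b, c}" for t
      using S(2)[of t] p(1)[of t] that by (cases "t < b") auto
    moreover have "speed_at M \<gamma> integrable_on {a..c}"
      using snoc.IH p(2) pwC1_less[OF snoc(1)] snoc(2)
      by (intro Henstock_Kurzweil_Integration.integrable_combine[of a b c]) auto
    ultimately show ?case by blast
  qed
  then show "\<exists>S. finite S \<and> (\<forall>t. a \<le> t \<longrightarrow> t \<le> b \<longrightarrow> t \<notin> S \<longrightarrow> regular_at \<gamma> t)"
    "speed_at M \<gamma> integrable_on {a..b}" by blast+
qed

lemma clen_nonneg: "0 \<le> clen M \<gamma> a b"
  unfolding clen_def
  by (cases "speed_at M \<gamma> integrable_on {a..b}")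
    (auto intro!: Henstock_Kurzweil_Integration.integral_nonneg speed_at_nonneg simp: not_integrable_integral)

lemma clen_add:
  assumes "pwC1 M \<gamma> a b" "pwC1 M \<gamma> b c"
  shows "clen M \<gamma> a c = clen M \<gamma> a b + clen M \<gamma> b c"
  unfolding clen_def
  using Henstock_Kurzweil_Integration.integral_combine[of a b c "speed_at M \<gamma>"]
    pwC1_speed(2)[OF pwC1_concat[OF assms(2,1)]] pwC1_less[OF assms(1)] pwC1_less[OF assms(2)] by simp

lemma regular_at_affine:
  assumes m: "m \<noteq> (0::real)" and cont: "isCont \<gamma> (m * t + k)" and reg: "regular_at \<gamma> (m * t + k)"
  shows "speed_at M (\<lambda>t. \<gamma> (m * t + k)) t = \<bar>m\<bar> * speed_at M \<gamma> (m * t + k)"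
proof -
  let ?s = "m * t + k" let ?c = "chart_at M (\<gamma> ?s)"
  note c = chart_at[of "\<gamma> ?s"]
  obtain v where v: "(coord ?c \<circ> \<gamma> has_vector_derivative v) (at ?s)"
    using reg c unfolding regular_at_def by blast
  have 1: "((\<lambda>t. m * t + k) has_vector_derivative m) (at t)"
    by (auto intro!: derivative_eq_intros simp: has_real_derivative_iff_has_vector_derivative[symmetric])
  have 2: "(coord ?c \<circ> (\<lambda>t. \<gamma> (m * t + k)) has_vector_derivative m *\<^sub>R v) (at t)"
    using vector_diff_chain_at[OF 1 v] by (simp add: comp_def)
  have "isCont (\<lambda>t. \<gamma> (m * t + k)) t"
    by (rule isCont_o2[where f = "\<lambda>t. m * t + k", OF _ cont]) (intro continuous_intros)
  from speed_at_eq[OF this c 2] speed_at_eq[OF cont c v]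
  show ?thesis using nrm_scale[OF c] by simp
qed

lemma isCont_Icc_interior: "continuous_on {a..b} f \<Longrightarrow> a < t \<Longrightarrow> t < (b::real) \<Longrightarrow> isCont f t"
  using continuous_on_interior[of "{a..b}" f t] by auto

lemma clen_affine:
  assumes \<gamma>: "pwC1 M \<gamma> a b" and m: "m > (0::real)"
  shows "clen M (\<lambda>t. \<gamma> (m * t + k)) ((a - k) / m) ((b - k) / m) = clen M \<gamma> a b"
proof -
  obtain S where S: "finite S" "\<And>t. a \<le> t \<Longrightarrow> t \<le> b \<Longrightarrow> t \<notin> S \<Longrightarrow> regular_at \<gamma> t"
    using pwC1_speed(1)[OF \<gamma>] by blast
  have "(speed_at M \<gamma> has_integral clen M \<gamma> a b) {a..b}"
    unfolding clen_def using pwC1_speed(2)[OF \<gamma>] by (rule integrable_integral)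
  then have "((\<lambda>x. speed_at M \<gamma> (m * x + k)) has_integral clen M \<gamma> a b / m) {(a - k) / m..(b - k) / m}"
    using has_integral_affinity'[of "speed_at M \<gamma>" "clen M \<gamma> a b" a b m k] m
    by (simp add: divide_inverse mult.commute)
  from has_integral_mult_right[OF this, of m]
  have "((\<lambda>x. m * speed_at M \<gamma> (m * x + k)) has_integral clen M \<gamma> a b) {(a - k) / m..(b - k) / m}"
    using m by simp
  then have "(speed_at M (\<lambda>t. \<gamma> (m * t + k)) has_integral clen M \<gamma> a b) {(a - k) / m..(b - k) / m}"
  proof (rule has_integral_spike_finite[of "(\<lambda>s. (s - k) / m) ` (S \<union> {a, b})", rotated 2])
    fix t assume t: "t \<in> {(a - k) / m..(b - k) / m} - (\<lambda>s. (s - k) / m) ` (S \<union> {a, b})"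
    let ?s = "m * t + k"
    have "t = (?s - k) / m" using m by simp
    then have "?s \<notin> S \<union> {a, b}" using t by blast
    moreover have "a \<le> ?s" "?s \<le> b" using t m by (auto simp: field_simps)
    ultimately have "isCont \<gamma> ?s" "regular_at \<gamma> ?s"
      using S(2) isCont_Icc_interior[OF pwC1_continuous[OF \<gamma>], of ?s] by auto
    then show "speed_at M (\<lambda>t. \<gamma> (m * t + k)) t = m * speed_at M \<gamma> (m * t + k)"
      using regular_at_affine[where m = m and \<gamma> = \<gamma> and t = t and k = k] m by simp
  qed (use S in simp)
  then show ?thesis unfolding clen_def by (rule integral_unique)
qed

lemma clen_reverse:
  assumes \<gamma>: "pwC1 M \<gamma> a b"
  shows "clen M (\<lambda>t. \<gamma> (- t)) (- b) (- a) = clen M \<gamma> a b"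
proof -
  obtain S where S: "finite S" "\<And>t. a \<le> t \<Longrightarrow> t \<le> b \<Longrightarrow> t \<notin> S \<Longrightarrow> regular_at \<gamma> t"
    using pwC1_speed(1)[OF \<gamma>] by blast
  have "(speed_at M \<gamma> has_integral clen M \<gamma> a b) {a..b}"
    unfolding clen_def using pwC1_speed(2)[OF \<gamma>] by (rule integrable_integral)
  then have "((\<lambda>t. speed_at M \<gamma> (- t)) has_integral clen M \<gamma> a b) {- b..- a}"
    by (simp add: has_integral_reflect_real)
  then have "(speed_at M (\<lambda>t. \<gamma> (- t)) has_integral clen M \<gamma> a b) {- b..- a}"
  proof (rule has_integral_spike_finite[of "uminus ` (S \<union> {a, b})", rotated 2])
    fix t assume t: "t \<in> {- b..- a} - uminus ` (S \<union> {a, b})"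
    have "t = - (- t)" by simp
    then have "- t \<notin> S \<union> {a, b}" using t by blast
    moreover have "a \<le> - t" "- t \<le> b" using t by auto
    ultimately have "isCont \<gamma> (- t)" "regular_at \<gamma> (- t)"
      using S(2) isCont_Icc_interior[OF pwC1_continuous[OF \<gamma>], of "- t"] by auto
    then show "speed_at M (\<lambda>t. \<gamma> (- t)) t = speed_at M \<gamma> (- t)"
      using regular_at_affine[where m = "-1" and \<gamma> = \<gamma> and t = t and k = 0] by simp
  qed (use S in simp)
  then show ?thesis unfolding clen_def by (rule integral_unique)
qed

lemma clen_cong:
  assumes eq: "\<And>t. a \<le> t \<Longrightarrow> t \<le> b \<Longrightarrow> \<gamma> t = \<delta> t"
  shows "clen M \<gamma> a b = clen M \<delta> a b"
  unfolding clen_def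
proof (rule integral_spike[of "{a, b}"])
  fix t assume "t \<in> {a..b} - {a, b}"
  then have t: "a < t" "t < b" by auto
  have ev: "eventually (\<lambda>s. \<gamma> s = \<delta> s) (nhds t)"
  proof -
    have "eventually (\<lambda>s. s \<in> {a<..<b}) (nhds t)"
      using t by (intro eventually_nhds_in_open) auto
    then show ?thesis by eventually_elim (use eq in auto)
  qed
  have "vector_derivative (coord c \<circ> \<delta>) (at t) = vector_derivative (coord c \<circ> \<gamma>) (at t)" for c :: "('a, 'n) chart"
  proof (rule vector_derivative_cong_eq[OF _ refl refl])
    show "eventually (\<lambda>x. x \<in> UNIV \<longrightarrow> (coord c \<circ> \<delta>) x = (coord c \<circ> \<gamma>) x) (nhds t)"
      using ev by eventually_elim simp
  qed simp
  then show "speed_at M \<delta> t = speed_at M \<gamma> t"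
    unfolding speed_at_def Let_def using eq t by simp
qed (simp add: negligible_finite)

lemma curve_length_eq: "pwC1 M \<gamma> 0 1 \<Longrightarrow> curve_length M \<gamma> = clen M \<gamma> 0 1"
  unfolding curve_length_def clen_def
proof (rule integral_spike[of "{0, 1}"])
  fix t :: real assume "t \<in> {0..1} - {0, 1}"
  then have "at t within {0..1} = at t" by (intro at_within_interior) auto
  then show "speed_at M \<gamma> t = speed M \<gamma> t"
    unfolding speed_at_def speed_def by simp
qed (simp add: negligible_finite)

lemma riem_dist_eq:
  "riem_dist M x y = Inf {clen M \<gamma> 0 1 | \<gamma>. pwC1 M \<gamma> 0 1 \<and> \<gamma> 0 = x \<and> \<gamma> 1 = y}"
  unfolding riem_dist_def piecewise_C1_curve_iff pathstart_def pathfinish_def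
  by (intro arg_cong[of _ _ Inf] Collect_cong ex_cong1) (auto simp: curve_length_eq)

lemma bdd_below_clen: "bdd_below {clen M \<gamma> 0 1 | \<gamma>. pwC1 M \<gamma> 0 1 \<and> \<gamma> 0 = x \<and> \<gamma> 1 = y}"
  using clen_nonneg by (intro bdd_belowI[of _ 0]) auto

lemma riem_dist_le_clen:
  assumes \<gamma>: "pwC1 M \<gamma> a b"
  shows "riem_dist M (\<gamma> a) (\<gamma> b) \<le> clen M \<gamma> a b"
proof -
  have ab: "b - a > 0" using pwC1_less[OF \<gamma>] by simp
  let ?\<delta> = "\<lambda>t. \<gamma> ((b - a) * t + a)"
  have "pwC1 M ?\<delta> 0 1" "clen M ?\<delta> 0 1 = clen M \<gamma> a b"
    using pwC1_affine[OF \<gamma> ab, of a] clen_affine[OF \<gamma> ab, of a] ab by simp_all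
  moreover have "?\<delta> 0 = \<gamma> a" "?\<delta> 1 = \<gamma> b" by simp_all
  ultimately show ?thesis
    unfolding riem_dist_eq
    by (intro cInf_lower bdd_below_clen CollectI exI[of _ ?\<delta>]) simp
qed

text \<open>A straight segment in the chart has the constant coordinate velocity z - y, so its speed
  is the norm of this vector at the points passed. This is the source of all upper bounds on the
  distance.\<close>

lemma C1_segment:
  assumes c: "c \<in> atlas M" and seg: "closed_segment y z \<subseteq> coord c ` cdom c"
    and le: "\<And>w. w \<in> closed_segment y z \<Longrightarrow> nrm c (inv_coord c w) (z - y) \<le> A"
  obtains \<gamma> where "pwC1 M \<gamma> 0 1" "\<gamma> 0 = inv_coord c y" "\<gamma> 1 = inv_coord c z" "clen M \<gamma> 0 1 \<le> A"
proof -
  define p where "p t = y + t *\<^sub>R (z - y)" for t :: real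
  define \<gamma> where "\<gamma> t = inv_coord c (p t)" for t
  have p: "p t \<in> closed_segment y z" if "t \<in> {0..1}" for t
    using that unfolding in_segment p_def by (intro exI[of _ t]) (auto simp: algebra_simps)
  have pc: "p t \<in> coord c ` cdom c" if "t \<in> {0..1}" for t
    using p[OF that] seg by auto
  have cont_p: "continuous_on S p" for S unfolding p_def by (intro continuous_intros)
  have cont: "continuous_on {0..1} \<gamma>"
    unfolding \<gamma>_def by (rule continuous_on_compose2[OF inv_coord(5)[OF c] cont_p]) (use pc in auto)
  have in_c: "\<gamma> t \<in> cdom c" "coord c (\<gamma> t) = p t" if "t \<in> {0..1}" for t
    unfolding \<gamma>_def using inv_coord(2,3)[OF c pc[OF that]] .
  have der: "(coord c \<circ> \<gamma> has_vector_derivative z - y) (at t within {0..1})" if "t \<in> {0..1}" for t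
  proof (rule has_vector_derivative_transform[OF that])
    show "(p has_vector_derivative z - y) (at t within {0..1})"
      unfolding p_def has_vector_derivative_def by (auto intro!: derivative_eq_intros)
  qed (use in_c in auto)
  have "C1_curve_on M {0..1} \<gamma>"
    unfolding C1_curve_on_def
  proof
    fix d assume d: "d \<in> atlas M"
    let ?D = "\<lambda>t. change_comp c d (\<gamma> t) (z - y)"
    have "continuous_on ({0..1} \<inter> \<gamma> -` cdom d) (\<lambda>t. frechet_derivative (transition c d) (at (p t)) (z - y))"
    proof (rule continuous_on_compose2[OF smooth_onD(2)[OF transition_smooth[OF c d]] cont_p])
      show "p ` ({0..1} \<inter> \<gamma> -` cdom d) \<subseteq> coord c ` (cdom c \<inter> cdom d)"
        using in_c by (force simp: image_iff)
    qed
    then have "continuous_on ({0..1} \<inter> \<gamma> -` cdom d) ?D"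
      by (subst continuous_on_cong[OF refl]) (auto simp: change_comp_def in_c)
    moreover have "(coord d \<circ> \<gamma> has_vector_derivative ?D t) (at t within {0..1})"
      if "t \<in> {0..1} \<inter> \<gamma> -` cdom d" for t
      using that cont by (intro coord_curve_change[OF c d] der in_c)
        (auto simp: continuous_on_eq_continuous_within)
    ultimately show "\<exists>D. continuous_on ({0..1} \<inter> \<gamma> -` cdom d) D \<and>
        (\<forall>t\<in>{0..1} \<inter> \<gamma> -` cdom d. (coord d \<circ> \<gamma> has_vector_derivative D t) (at t within {0..1}))"
      by blast
  qed
  then have pw: "pwC1 M \<gamma> 0 1" using cont by (intro pwC1.base) auto
  have sp: "speed_at M \<gamma> t \<le> A" if t: "t \<in> {0<..<1}" for t
  proof -
    have "at t within {0..1} = at t" using t by (intro at_within_interior) auto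
    then have "(coord c \<circ> \<gamma> has_vector_derivative z - y) (at t)" using der[of t] t by simp
    then have "speed_at M \<gamma> t = nrm c (\<gamma> t) (z - y)"
      using t cont in_c[of t] by (intro speed_at_eq[OF _ c] isCont_Icc_interior[OF cont]) auto
    then show ?thesis using le[OF p[of t]] t by (simp add: \<gamma>_def)
  qed
  have "0 \<le> A" using sp[of "1/2"] speed_at_nonneg[of \<gamma> "1/2"] by simp
  \<comment> \<open>At the end points the two-sided derivative depends on the values of
    \<open>inv_coord\<close> off the segment, so \<open>speed_at\<close> is not controlled there and
    is replaced by 0.\<close>
  define g where "g t = (if t \<in> {0<..<1} then speed_at M \<gamma> t else 0)" for t
  have "g integrable_on {0..1}"
    by (rule integrable_spike_finite[of "{0, 1}", OF _ _ pwC1_speed(2)[OF pw]]) (auto simp: g_def)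
  then have "(g has_integral integral {0..1} g) {0..1}" by (rule integrable_integral)
  moreover have "((\<lambda>_. A) has_integral A) {0..1::real}" using has_integral_const_real[of A 0 1] by simp
  ultimately have "integral {0..1} g \<le> A"
    by (rule has_integral_le) (use sp \<open>0 \<le> A\<close> in \<open>auto simp: g_def\<close>)
  moreover have "clen M \<gamma> 0 1 = integral {0..1} g"
    unfolding clen_def by (rule integral_spike[of "{0, 1}"]) (auto simp: g_def)
  ultimately have "clen M \<gamma> 0 1 \<le> A" by linarith
  then show ?thesis using that[of \<gamma>] pw by (simp add: \<gamma>_def p_def)
qed

end

section \<open>C^1 functions on the manifold and their differentials\<close>

lemma has_derivative_cong_open:
  assumes "open S" "x \<in> S" "\<And>y. y \<in> S \<Longrightarrow> f y = g y"
  shows "(f has_derivative D) (at x) \<longleftrightarrow> (g has_derivative D) (at x)"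
  using has_derivative_transform_within_open[of f D x UNIV S g]
    has_derivative_transform_within_open[of g D x UNIV S f] assms by metis

lemma differentiable_cong_open:
  assumes "open S" "x \<in> S" "\<And>y. y \<in> S \<Longrightarrow> f y = g y"
  shows "f differentiable (at x) \<longleftrightarrow> g differentiable (at x)"
    and "frechet_derivative f (at x) = frechet_derivative g (at x)"
  using has_derivative_cong_open[OF assms] by (simp_all add: differentiable_def frechet_derivative_def)

lemma pos_part_square_deriv: "((\<lambda>t. (max 0 t)\<^sup>2) has_real_derivative 2 * max 0 t) (at (t::real))"
proof -
  consider "t < 0" | "t > 0" | "t = 0" by linarith
  then show ?thesis
  proof cases
    case 1
    have "((\<lambda>t. 0) has_real_derivative 2 * max 0 t) (at t)" using 1 by (auto intro!: derivative_eq_intros)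
    then show ?thesis
      by (rule DERIV_cong_ev[OF refl _ refl, THEN iffD1, rotated])
        (use 1 in \<open>auto simp: eventually_nhds intro!: exI[of _ "{..<0}"]\<close>)
  next
    case 2
    have "((\<lambda>t. t\<^sup>2) has_real_derivative 2 * max 0 t) (at t)" using 2 by (auto intro!: derivative_eq_intros)
    then show ?thesis
      by (rule DERIV_cong_ev[OF refl _ refl, THEN iffD1, rotated])
        (use 2 in \<open>auto simp: eventually_nhds intro!: exI[of _ "{0<..}"]\<close>)
  next
    case 3
    have "((\<lambda>h. (max 0 h)\<^sup>2 / h) \<longlongrightarrow> 0) (at (0::real))"
    proof (rule Lim_null_comparison)
      have "norm ((max 0 h)\<^sup>2 / h) \<le> \<bar>h\<bar>" for h :: real
        by (cases "h > 0") (auto simp: power2_eq_square max_def)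
      then show "\<forall>\<^sub>F h in at (0::real). norm ((max 0 h)\<^sup>2 / h) \<le> \<bar>h\<bar>" by simp
      show "((\<lambda>h. \<bar>h\<bar>) \<longlongrightarrow> 0) (at (0::real))" using tendsto_rabs[OF tendsto_ident_at, of 0] by simp
    qed
    then show ?thesis using 3 by (simp add: has_field_derivative_iff)
  qed
qed

context riem_manifold begin

lemma riem_dist_segment:
  assumes "c \<in> atlas M" "closed_segment y z \<subseteq> coord c ` cdom c"
    and "\<And>w. w \<in> closed_segment y z \<Longrightarrow> nrm c (inv_coord c w) (z - y) \<le> A"
  shows "riem_dist M (inv_coord c y) (inv_coord c z) \<le> A"
  using C1_segment[OF assms] riem_dist_le_clen by (metis order_trans)

definition C1_fun :: "('a \<Rightarrow> real) \<Rightarrow> bool" where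
  "C1_fun F \<longleftrightarrow> (\<forall>c\<in>atlas M. (\<forall>y\<in>coord c ` cdom c. (F \<circ> inv_coord c) differentiable (at y)) \<and>
     (\<forall>v. continuous_on (coord c ` cdom c) (\<lambda>y. frechet_derivative (F \<circ> inv_coord c) (at y) v)))"

definition cdiff :: "('a \<Rightarrow> real) \<Rightarrow> ('a, 'n) chart \<Rightarrow> 'a \<Rightarrow> real ^ 'n \<Rightarrow> real" where
  "cdiff F c x = frechet_derivative (F \<circ> inv_coord c) (at (coord c x))"

lemma C1_funD:
  assumes "C1_fun F" "c \<in> atlas M"
  shows "x \<in> cdom c \<Longrightarrow> (F \<circ> inv_coord c) differentiable (at (coord c x))"
    and "x \<in> cdom c \<Longrightarrow> ((F \<circ> inv_coord c) has_derivative cdiff F c x) (at (coord c x))"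
    and "x \<in> cdom c \<Longrightarrow> linear (cdiff F c x)"
    and "continuous_on (coord c ` cdom c) (\<lambda>y. cdiff F c (inv_coord c y) v)"
proof -
  show *: "x \<in> cdom c \<Longrightarrow> (F \<circ> inv_coord c) differentiable (at (coord c x))"
    using assms unfolding C1_fun_def by blast
  show D: "x \<in> cdom c \<Longrightarrow> ((F \<circ> inv_coord c) has_derivative cdiff F c x) (at (coord c x))"
    unfolding cdiff_def using * frechet_derivative_works by blast
  show "x \<in> cdom c \<Longrightarrow> linear (cdiff F c x)" using D has_derivative_linear by blast
  have "continuous_on (coord c ` cdom c) (\<lambda>y. frechet_derivative (F \<circ> inv_coord c) (at y) v)"
    using assms unfolding C1_fun_def by blast
  then show "continuous_on (coord c ` cdom c) (\<lambda>y. cdiff F c (inv_coord c y) v)"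
    by (rule continuous_on_eq) (simp add: cdiff_def inv_coord(3)[OF assms(2)])
qed

lemma chart_change_nbhd:
  assumes c: "c \<in> atlas M" "d \<in> atlas M" "x \<in> cdom c" "x \<in> cdom d" and U: "open U" "x \<in> U"
  shows "open (coord d ` (U \<inter> cdom c \<inter> cdom d))" "coord d x \<in> coord d ` (U \<inter> cdom c \<inter> cdom d)"
    and "\<And>y. y \<in> coord d ` (U \<inter> cdom c \<inter> cdom d) \<Longrightarrow> (F \<circ> inv_coord d) y = (F \<circ> inv_coord c) (transition d c y)"
    and "\<And>y. y \<in> coord d ` (U \<inter> cdom c \<inter> cdom d) \<Longrightarrow> transition d c y \<in> coord c ` (U \<inter> cdom c)"
proof -
  show "open (coord d ` (U \<inter> cdom c \<inter> cdom d))"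
    by (rule open_coord_image[OF c(2) open_Int[OF U(1) chart_props(1)[OF c(1)]]])
  show "coord d x \<in> coord d ` (U \<inter> cdom c \<inter> cdom d)" using c U by blast
  fix y assume "y \<in> coord d ` (U \<inter> cdom c \<inter> cdom d)"
  then obtain z where z: "z \<in> U" "z \<in> cdom c" "z \<in> cdom d" "y = coord d z" by blast
  then show "(F \<circ> inv_coord d) y = (F \<circ> inv_coord c) (transition d c y)"
    "transition d c y \<in> coord c ` (U \<inter> cdom c)"
    using inv_coord(1)[OF c(1)] inv_coord(1)[OF c(2)] by (auto simp: transition_def)
qed

lemma has_derivative_change_chart:
  assumes c: "c \<in> atlas M" "d \<in> atlas M" "x \<in> cdom c" "x \<in> cdom d"
    and D: "((F \<circ> inv_coord c) has_derivative D) (at (coord c x))"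
  shows "((F \<circ> inv_coord d) has_derivative (\<lambda>v. D (change_comp d c x v))) (at (coord d x))"
proof -
  note n = chart_change_nbhd[OF c open_UNIV UNIV_I]
  have "transition d c (coord d x) = coord c x"
    using inv_coord(1)[OF c(2,4)] by (simp add: transition_def)
  then have "((F \<circ> inv_coord c) has_derivative D) (at (transition d c (coord d x)))" using D by simp
  from has_derivative_compose[OF transition_has_derivative[OF c(2,1,4,3)] this]
  have "((\<lambda>y. (F \<circ> inv_coord c) (transition d c y)) has_derivative (\<lambda>v. D (change_comp d c x v))) (at (coord d x))" .
  moreover have "((F \<circ> inv_coord d) has_derivative D') (at (coord d x)) \<longleftrightarrow>
      ((\<lambda>y. (F \<circ> inv_coord c) (transition d c y)) has_derivative D') (at (coord d x))" for D'
    by (rule has_derivative_cong_open[OF n(1,2)]) (rule n(3))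
  ultimately show ?thesis by (simp only:)
qed

lemma cdiff_eqI: "((F \<circ> inv_coord c) has_derivative D) (at (coord c x)) \<Longrightarrow> cdiff F c x = D"
  unfolding cdiff_def by (rule frechet_derivative_at[symmetric])

lemma cdiff_change:
  assumes "C1_fun F" "c \<in> atlas M" "d \<in> atlas M" "x \<in> cdom c" "x \<in> cdom d"
  shows "cdiff F d x v = cdiff F c x (change_comp d c x v)"
  using cdiff_eqI[OF has_derivative_change_chart[OF assms(2-5) C1_funD(2)[OF assms(1,2,4)]]] by simp

text \<open>Transition maps are smooth, so by the chain rule a chart around each point decides for
  all charts. It serves functions given by a formula in one chart and by 0 elsewhere.\<close>

lemma C1_fun_local:
  assumes loc: "\<And>x. \<exists>c U. c \<in> atlas M \<and> open U \<and> x \<in> U \<and> U \<subseteq> cdom c \<and>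
    (\<forall>y\<in>coord c ` U. (F \<circ> inv_coord c) differentiable (at y)) \<and>
    (\<forall>v. continuous_on (coord c ` U) (\<lambda>y. frechet_derivative (F \<circ> inv_coord c) (at y) v))"
  shows "C1_fun F"
  unfolding C1_fun_def
proof (rule ballI)
  fix d assume d: "d \<in> atlas M"
  let ?W = "coord d ` cdom d"
  have main: "(F \<circ> inv_coord d) differentiable (at y) \<and>
      (\<forall>v. isCont (\<lambda>y. frechet_derivative (F \<circ> inv_coord d) (at y) v) y)" if y: "y \<in> ?W" for y
  proof -
    obtain x where x: "x \<in> cdom d" "y = coord d x" using y by blast
    obtain c U where c: "c \<in> atlas M" and U: "open U" "x \<in> U" "U \<subseteq> cdom c"
      and dif: "\<And>y. y \<in> coord c ` U \<Longrightarrow> (F \<circ> inv_coord c) differentiable (at y)"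
      and cont: "\<And>v. continuous_on (coord c ` U) (\<lambda>y. frechet_derivative (F \<circ> inv_coord c) (at y) v)"
      using loc[of x] by blast
    let ?N = "coord d ` (U \<inter> cdom c \<inter> cdom d)"
    have xc: "x \<in> cdom c" using U by blast
    note n = chart_change_nbhd[OF c d xc x(1) U(1,2)]
    have UI: "U \<inter> cdom c = U" using U by blast
    let ?D = "\<lambda>z. frechet_derivative (F \<circ> inv_coord c) (at z)"
    have der: "((F \<circ> inv_coord d) has_derivative (\<lambda>v. ?D (transition d c z) (frechet_derivative (transition d c) (at z) v))) (at z)"
      if z: "z \<in> ?N" for z
    proof -
      obtain x' where x': "x' \<in> U" "x' \<in> cdom c" "x' \<in> cdom d" "z = coord d x'" using z by blast
      have T: "transition d c z = coord c x'" using x' inv_coord(1)[OF d] by (simp add: transition_def)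
      have "((F \<circ> inv_coord c) has_derivative ?D (coord c x')) (at (coord c x'))"
        using dif x'(1) frechet_derivative_works by blast
      from has_derivative_change_chart[OF c d x'(2,3) this] show ?thesis
        by (simp only: T change_comp_def x'(4)[symmetric])
    qed
    have eq: "frechet_derivative (F \<circ> inv_coord d) (at z) v =
        (\<Sum>i\<in>UNIV. frechet_derivative (transition d c) (at z) v $ i * ?D (transition d c z) (axis i 1))"
      if z: "z \<in> ?N" for z v
    proof -
      have "linear (?D (transition d c z))"
        using dif n(4)[OF z] UI by (intro linear_frechet_derivative) simp
      from has_derivative_vec_expand[OF this] show ?thesis
        unfolding frechet_derivative_at[OF der[OF z], symmetric] .
    qed
    have NW: "?N \<subseteq> coord d ` (cdom d \<inter> cdom c)" by blast
    have contT: "continuous_on ?N (transition d c)"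
      by (rule continuous_on_subset[OF smooth_onD(3)[OF transition_smooth[OF d c]] NW])
    have "continuous_on ?N (\<lambda>z. \<Sum>i\<in>UNIV. frechet_derivative (transition d c) (at z) v $ i * ?D (transition d c z) (axis i 1))" for v
      using n(4) UI
      by (intro continuous_on_sum continuous_on_mult bounded_linear.continuous_on[OF bounded_linear_vec_nth]
          continuous_on_subset[OF smooth_onD(2)[OF transition_smooth[OF d c]] NW]
          continuous_on_compose2[OF cont contT]) auto
    then have "continuous_on ?N (\<lambda>z. frechet_derivative (F \<circ> inv_coord d) (at z) v)" for v
      by (rule continuous_on_eq) (simp add: eq)
    then have "isCont (\<lambda>z. frechet_derivative (F \<circ> inv_coord d) (at z) v) y" for v
      using n(1,2) x(2) by (auto simp: continuous_on_eq_continuous_at)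
    moreover have "(F \<circ> inv_coord d) differentiable (at y)"
      using der n(2) x(2) unfolding differentiable_def by blast
    ultimately show ?thesis by blast
  qed
  then show "(\<forall>y\<in>?W. (F \<circ> inv_coord d) differentiable (at y)) \<and>
     (\<forall>v. continuous_on ?W (\<lambda>y. frechet_derivative (F \<circ> inv_coord d) (at y) v))"
    by (auto intro: continuous_at_imp_continuous_on)
qed

text \<open>The support of \<phi> is compact in the chart, hence its image is closed in the
  Hausdorff space M. The extension by zero therefore vanishes near each point outside the chart, and
  both regions can be treated locally.\<close>

lemma C1_fun_extend:
  assumes c: "c \<in> atlas M"
    and \<phi>: "\<And>y. y \<in> coord c ` cdom c \<Longrightarrow> \<phi> differentiable (at y)"
      "\<And>v. continuous_on (coord c ` cdom c) (\<lambda>y. frechet_derivative \<phi> (at y) v)"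
    and K: "compact K" "K \<subseteq> coord c ` cdom c" "\<And>y. y \<in> coord c ` cdom c \<Longrightarrow> y \<notin> K \<Longrightarrow> \<phi> y = 0"
  defines "F \<equiv> \<lambda>x. if x \<in> cdom c then \<phi> (coord c x) else 0"
  shows "C1_fun F" and "\<And>x. x \<in> cdom c \<Longrightarrow> cdiff F c x = frechet_derivative \<phi> (at (coord c x))"
    and "\<And>x d v. d \<in> atlas M \<Longrightarrow> x \<in> cdom d \<Longrightarrow> x \<notin> cdom c \<Longrightarrow> cdiff F d x v = 0"
proof -
  let ?W = "coord c ` cdom c"
  have W: "open ?W" by (rule chart_props(2)[OF c])
  have eqc: "(F \<circ> inv_coord c) y = \<phi> y" if "y \<in> ?W" for y
    using inv_coord(2,3)[OF c that] by (simp add: F_def)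
  have cong: "(F \<circ> inv_coord c) differentiable (at y) \<longleftrightarrow> \<phi> differentiable (at y)"
    "frechet_derivative (F \<circ> inv_coord c) (at y) = frechet_derivative \<phi> (at y)" if "y \<in> ?W" for y
    using differentiable_cong_open[OF W that, of "F \<circ> inv_coord c" \<phi>] eqc by blast+
  have Kc: "closed (inv_coord c ` K)"
    by (intro compact_imp_closed compact_continuous_image K continuous_on_subset[OF inv_coord(5)[OF c]])
  have zero: "open (cdom d - inv_coord c ` K)" "x \<in> cdom d - inv_coord c ` K"
    "\<And>y. y \<in> coord d ` (cdom d - inv_coord c ` K) \<Longrightarrow> (F \<circ> inv_coord d) y = 0"
    "open (coord d ` (cdom d - inv_coord c ` K))"
    if d: "d \<in> atlas M" "x \<in> cdom d" "x \<notin> cdom c" for d x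
  proof -
    show op: "open (cdom d - inv_coord c ` K)" using chart_props(1)[OF d(1)] Kc by (rule open_Diff)
    show "x \<in> cdom d - inv_coord c ` K" using d K(2) inv_coord(2)[OF c] by blast
    show "open (coord d ` (cdom d - inv_coord c ` K))"
      using open_coord_image[OF d(1) op] by (simp add: Int_absorb2 Diff_subset)
    fix y assume "y \<in> coord d ` (cdom d - inv_coord c ` K)"
    then obtain z where z: "z \<in> cdom d" "z \<notin> inv_coord c ` K" "y = coord d z" by blast
    have "\<phi> (coord c z) = 0" if "z \<in> cdom c"
      using K(3) z(2) inv_coord(1)[OF c that] that by (metis imageI)
    then show "(F \<circ> inv_coord d) y = 0" using z inv_coord(1)[OF d(1)] by (simp add: F_def)
  qed
  show "C1_fun F"
  proof (rule C1_fun_local)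
    fix x
    show "\<exists>c U. c \<in> atlas M \<and> open U \<and> x \<in> U \<and> U \<subseteq> cdom c \<and>
      (\<forall>y\<in>coord c ` U. (F \<circ> inv_coord c) differentiable (at y)) \<and>
      (\<forall>v. continuous_on (coord c ` U) (\<lambda>y. frechet_derivative (F \<circ> inv_coord c) (at y) v))"
    proof (cases "x \<in> cdom c")
      case True
      have "continuous_on ?W (\<lambda>y. frechet_derivative (F \<circ> inv_coord c) (at y) v)" for v
        by (rule continuous_on_eq[OF \<phi>(2)]) (simp add: cong)
      moreover have "(F \<circ> inv_coord c) differentiable (at y)" if "y \<in> ?W" for y
        by (simp only: cong(1)[OF that] \<phi>(1)[OF that])
      ultimately show ?thesis
        using True c chart_props(1)[OF c] by (intro exI[of _ c] exI[of _ "cdom c"]) simp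
    next
      case False
      let ?d = "chart_at M x" let ?U = "cdom ?d - inv_coord c ` K"
      note z = zero[OF chart_at False]
      have D: "((F \<circ> inv_coord ?d) has_derivative (\<lambda>_. 0)) (at y)" if "y \<in> coord ?d ` ?U" for y
        using has_derivative_cong_open[OF z(4) that, of "F \<circ> inv_coord ?d" "\<lambda>_. 0"] z(3) by simp
      have dif: "(F \<circ> inv_coord ?d) differentiable (at y)" if "y \<in> coord ?d ` ?U" for y
        by (rule differentiableI[OF D[OF that]])
      have "continuous_on (coord ?d ` ?U) (\<lambda>y. frechet_derivative (F \<circ> inv_coord ?d) (at y) v)" for v
        by (rule continuous_on_eq[OF continuous_on_const[of _ 0]])
          (simp add: frechet_derivative_at[OF D, symmetric])
      then show ?thesis
        by (intro exI[of _ ?d] exI[of _ ?U] conjI ballI allI chart_at(1) z(1,2) dif Diff_subset)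
    qed
  qed
  show "cdiff F c x = frechet_derivative \<phi> (at (coord c x))" if "x \<in> cdom c" for x
    unfolding cdiff_def by (rule cong(2)) (rule imageI[OF that])
  show "cdiff F d x v = 0" if d: "d \<in> atlas M" "x \<in> cdom d" "x \<notin> cdom c" for d x v
  proof -
    note z = zero[OF d]
    have "((F \<circ> inv_coord d) has_derivative (\<lambda>_. 0)) (at (coord d x))"
      using has_derivative_cong_open[OF z(4) imageI[OF z(2)], of "F \<circ> inv_coord d" "\<lambda>_. 0"] z(3) by simp
    then show ?thesis by (simp add: cdiff_eqI)
  qed
qed

lemma C1_fun_continuous:
  assumes F: "C1_fun F"
  shows "continuous_on UNIV F"
proof (intro continuous_at_imp_continuous_on ballI)
  fix x :: 'a
  let ?c = "chart_at M x"
  note c = chart_at[of x]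
  have "isCont (F \<circ> inv_coord ?c) (coord ?c x)"
    using C1_funD(1)[OF F c] differentiable_imp_continuous_within by blast
  moreover have "isCont (coord ?c) x"
    using inv_coord(4)[OF c(1)] chart_props(1)[OF c(1)] c(2) by (simp add: continuous_on_eq_continuous_at)
  ultimately have "isCont (\<lambda>x. (F \<circ> inv_coord ?c) (coord ?c x)) x" by (rule isCont_o2[rotated])
  moreover have "eventually (\<lambda>y. (F \<circ> inv_coord ?c) (coord ?c y) = F y) (nhds x)"
    using eventually_nhds_in_open[OF chart_props(1)[OF c(1)] c(2)]
    by eventually_elim (simp add: inv_coord(1)[OF c(1)])
  ultimately show "isCont F x" using isCont_cong by fastforce
qed

lemma C1_fun_compose:
  assumes F: "C1_fun F" and k: "\<And>x. (k has_real_derivative k' (F x)) (at (F x))" "continuous_on (range F) k'"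
  shows "C1_fun (\<lambda>x. k (F x))"
    and "c \<in> atlas M \<Longrightarrow> x \<in> cdom c \<Longrightarrow> cdiff (\<lambda>x. k (F x)) c x v = k' (F x) * cdiff F c x v"
proof -
  have D: "(((\<lambda>x. k (F x)) \<circ> inv_coord c) has_derivative (\<lambda>v. k' (F x) * cdiff F c x v)) (at (coord c x))"
    if c: "c \<in> atlas M" "x \<in> cdom c" for c x
    using has_derivative_compose[OF C1_funD(2)[OF F c], of k "\<lambda>h. k' (F x) * h"] k(1)[of x] inv_coord(1)[OF c]
    by (simp add: has_field_derivative_def o_def)
  show "C1_fun (\<lambda>x. k (F x))"
    unfolding C1_fun_def
  proof (intro ballI conjI allI)
    fix c assume c: "c \<in> atlas M"
    let ?W = "coord c ` cdom c"
    show "((\<lambda>x. k (F x)) \<circ> inv_coord c) differentiable (at y)" if "y \<in> ?W" for y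
      using D[OF c] that unfolding differentiable_def by blast
    fix v
    have 1: "continuous_on ?W (\<lambda>y. k' (F (inv_coord c y)))"
      by (rule continuous_on_compose2[OF k(2)],
          rule continuous_on_compose2[OF C1_fun_continuous[OF F] inv_coord(5)[OF c]]) auto
    have "continuous_on ?W (\<lambda>y. k' (F (inv_coord c y)) * cdiff F c (inv_coord c y) v)"
      by (intro continuous_on_mult 1 C1_funD(4)[OF F c])
    then show "continuous_on ?W (\<lambda>y. frechet_derivative ((\<lambda>x. k (F x)) \<circ> inv_coord c) (at y) v)"
    proof (rule continuous_on_eq)
      fix y assume y: "y \<in> ?W"
      show "k' (F (inv_coord c y)) * cdiff F c (inv_coord c y) v =
        frechet_derivative ((\<lambda>x. k (F x)) \<circ> inv_coord c) (at y) v" 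
        by (rule fun_cong[OF frechet_derivative_at[OF D[OF c inv_coord(2)[OF c y]], unfolded inv_coord(3)[OF c y]]])
    qed
  qed
  show "c \<in> atlas M \<Longrightarrow> x \<in> cdom c \<Longrightarrow> cdiff (\<lambda>x. k (F x)) c x v = k' (F x) * cdiff F c x v"
    using cdiff_eqI[OF D] by simp
qed

lemma C1_fun_sum:
  assumes "finite I" and F: "\<And>i. i \<in> I \<Longrightarrow> C1_fun (F i)"
  shows "C1_fun (\<lambda>x. \<Sum>i\<in>I. a i * F i x)"
    and "c \<in> atlas M \<Longrightarrow> x \<in> cdom c \<Longrightarrow> cdiff (\<lambda>x. \<Sum>i\<in>I. a i * F i x) c x v = (\<Sum>i\<in>I. a i * cdiff (F i) c x v)"
proof -
  have D: "((\<lambda>x. \<Sum>i\<in>I. a i * F i x) \<circ> inv_coord c has_derivative (\<lambda>v. \<Sum>i\<in>I. a i * cdiff (F i) c x v)) (at (coord c x))"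
    if c: "c \<in> atlas M" "x \<in> cdom c" for c x
    using C1_funD(2)[OF F c] unfolding o_def
    by (intro has_derivative_sum has_derivative_mult_right) auto
  show "C1_fun (\<lambda>x. \<Sum>i\<in>I. a i * F i x)"
    unfolding C1_fun_def
  proof (intro ballI conjI allI)
    fix c assume c: "c \<in> atlas M"
    let ?W = "coord c ` cdom c"
    show "((\<lambda>x. \<Sum>i\<in>I. a i * F i x) \<circ> inv_coord c) differentiable (at y)" if "y \<in> ?W" for y
      using D[OF c] that unfolding differentiable_def by blast
    fix v
    have "continuous_on ?W (\<lambda>y. \<Sum>i\<in>I. a i * cdiff (F i) c (inv_coord c y) v)"
      by (intro continuous_on_sum continuous_on_mult continuous_on_const C1_funD(4)[OF F c])
    then show "continuous_on ?W (\<lambda>y. frechet_derivative ((\<lambda>x. \<Sum>i\<in>I. a i * F i x) \<circ> inv_coord c) (at y) v)"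
    proof (rule continuous_on_eq)
      fix y assume y: "y \<in> ?W"
      show "(\<Sum>i\<in>I. a i * cdiff (F i) c (inv_coord c y) v) =
        frechet_derivative ((\<lambda>x. \<Sum>i\<in>I. a i * F i x) \<circ> inv_coord c) (at y) v" 
        by (rule fun_cong[OF frechet_derivative_at[OF D[OF c inv_coord(2)[OF c y]], unfolded inv_coord(3)[OF c y]]])
    qed
  qed
  show "c \<in> atlas M \<Longrightarrow> x \<in> cdom c \<Longrightarrow> cdiff (\<lambda>x. \<Sum>i\<in>I. a i * F i x) c x v = (\<Sum>i\<in>I. a i * cdiff (F i) c x v)"
    using cdiff_eqI[OF D] by simp
qed

text \<open>Off a finite set F \<circ> \<gamma> is differentiable with derivative at most L times
  the speed; the strong form of the fundamental theorem of calculus tolerates the exceptional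
  set.\<close>

lemma C1_fun_along_curve:
  assumes F: "C1_fun F" and L: "L \<ge> 0"
    "\<And>c x v. c \<in> atlas M \<Longrightarrow> x \<in> cdom c \<Longrightarrow> \<bar>cdiff F c x v\<bar> \<le> L * nrm c x v"
    and \<gamma>: "pwC1 M \<gamma> a b"
  shows "\<bar>F (\<gamma> b) - F (\<gamma> a)\<bar> \<le> L * clen M \<gamma> a b"
proof -
  obtain S where S: "finite S" "\<And>t. a \<le> t \<Longrightarrow> t \<le> b \<Longrightarrow> t \<notin> S \<Longrightarrow> regular_at \<gamma> t"
    using pwC1_speed(1)[OF \<gamma>] by blast
  note ab = pwC1_less[OF \<gamma>] and cont = pwC1_continuous[OF \<gamma>]
  have ex: "\<exists>D. ((\<lambda>t. F (\<gamma> t)) has_vector_derivative D) (at t) \<and> \<bar>D\<bar> \<le> L * speed_at M \<gamma> t"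
    if t: "t \<in> {a<..<b} - S" for t
  proof -
    let ?c = "chart_at M (\<gamma> t)"
    note c = chart_at[of "\<gamma> t"]
    obtain v where v: "(coord ?c \<circ> \<gamma> has_vector_derivative v) (at t)" "speed_at M \<gamma> t = nrm ?c (\<gamma> t) v"
      using S(2)[of t] t c unfolding regular_at_def by force
    have "((\<lambda>s. (F \<circ> inv_coord ?c) ((coord ?c \<circ> \<gamma>) s)) has_derivative (\<lambda>h. cdiff F ?c (\<gamma> t) (h *\<^sub>R v))) (at t)"
      using has_derivative_compose[OF v(1)[unfolded has_vector_derivative_def], of "F \<circ> inv_coord ?c"] C1_funD(2)[OF F c]
      by simp
    moreover have "(\<lambda>h. cdiff F ?c (\<gamma> t) (h *\<^sub>R v)) = (\<lambda>h. h *\<^sub>R cdiff F ?c (\<gamma> t) v)"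
      using linear_cmul[OF C1_funD(3)[OF F c]] by simp
    ultimately have 1: "((\<lambda>s. (F \<circ> inv_coord ?c) ((coord ?c \<circ> \<gamma>) s)) has_vector_derivative cdiff F ?c (\<gamma> t) v) (at t)"
      by (simp add: has_vector_derivative_def)
    have "isCont \<gamma> t" using t by (intro isCont_Icc_interior[OF cont]) auto
    then have "eventually (\<lambda>s. \<gamma> s \<in> cdom ?c) (at t)"
      using topological_tendstoD[OF _ chart_props(1)[OF c(1)] c(2)] by (simp add: isCont_def)
    then have "eventually (\<lambda>s. \<gamma> s \<in> cdom ?c) (nhds t)"
      unfolding eventually_at_filter by eventually_elim (use c(2) in auto)
    then have "eventually (\<lambda>s. s \<in> UNIV \<longrightarrow> (F \<circ> inv_coord ?c) ((coord ?c \<circ> \<gamma>) s) = F (\<gamma> s)) (nhds t)"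
      by eventually_elim (simp add: inv_coord(1)[OF c(1)])
    from has_vector_derivative_cong_ev[OF this] 1
    have "((\<lambda>t. F (\<gamma> t)) has_vector_derivative cdiff F ?c (\<gamma> t) v) (at t)"
      using inv_coord(1)[OF c] by simp
    then show ?thesis using L(2)[OF c, of v] v(2) by auto
  qed
  then obtain f' where f': "\<And>t. t \<in> {a<..<b} - S \<Longrightarrow> ((\<lambda>t. F (\<gamma> t)) has_vector_derivative f' t) (at t)"
    "\<And>t. t \<in> {a<..<b} - S \<Longrightarrow> \<bar>f' t\<bar> \<le> L * speed_at M \<gamma> t" by metis
  define g where "g t = (if t \<in> {a<..<b} - S then f' t else 0)" for t
  have "(g has_integral F (\<gamma> b) - F (\<gamma> a)) {a..b}"
  proof (rule fundamental_theorem_of_calculus_interior_strong[OF S(1)])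
    show "continuous_on {a..b} (\<lambda>t. F (\<gamma> t))"
      by (rule continuous_on_compose2[OF C1_fun_continuous[OF F] cont]) auto
  qed (use ab f' in \<open>auto simp: g_def\<close>)
  moreover have "((\<lambda>t. L * speed_at M \<gamma> t) has_integral L * clen M \<gamma> a b) {a..b}"
    unfolding clen_def by (intro has_integral_mult_right integrable_integral pwC1_speed(2)[OF \<gamma>])
  moreover have g: "\<bar>g t\<bar> \<le> L * speed_at M \<gamma> t" for t
    using f'(2) L(1) speed_at_nonneg by (simp add: g_def)
  ultimately have "F (\<gamma> b) - F (\<gamma> a) \<le> L * clen M \<gamma> a b" "- (F (\<gamma> b) - F (\<gamma> a)) \<le> L * clen M \<gamma> a b"
    using has_integral_le[of g "F (\<gamma> b) - F (\<gamma> a)" "{a..b}" "\<lambda>t. L * speed_at M \<gamma> t"]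
      has_integral_le[of "\<lambda>t. - g t" "- (F (\<gamma> b) - F (\<gamma> a))" "{a..b}" "\<lambda>t. L * speed_at M \<gamma> t"]
      has_integral_neg[of g "F (\<gamma> b) - F (\<gamma> a)" "{a..b}"] abs_le_D1[OF g] abs_le_D2[OF g] by blast+
  then show ?thesis by linarith
qed

end

section \<open>Coordinate balls with almost constant metric\<close>

context riem_manifold begin

lemma nrm_triangle:
  assumes c: "c \<in> atlas M" "x \<in> cdom c"
  shows "nrm c x (v + w) \<le> nrm c x v + nrm c x w"
proof (rule real_le_lsqrt)
  have "metric M c x (v + w) (v + w) = metric M c x v v + 2 * metric M c x v w + metric M c x w w"
    using metric_sym[OF c, of w v] by (simp add: metric_arith[OF c])
  also have "\<dots> \<le> (nrm c x v)\<^sup>2 + 2 * (nrm c x v * nrm c x w) + (nrm c x w)\<^sup>2"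
    using metric_Cauchy_Schwarz[OF c, of v w] metric_nonneg[OF c] by simp
  finally show "metric M c x (v + w) (v + w) \<le> (nrm c x v + nrm c x w)\<^sup>2"
    by (simp add: power2_sum)
qed (simp add: metric_nonneg[OF c])

lemma nrm_convex:
  assumes c: "c \<in> atlas M" "x \<in> cdom c" and s: "nrm c x (y - a) \<le> s" "nrm c x (z - a) \<le> s"
    and w: "w \<in> closed_segment y z"
  shows "nrm c x (w - a) \<le> s"
proof -
  obtain u where u: "0 \<le> u" "u \<le> 1" "w = (1 - u) *\<^sub>R y + u *\<^sub>R z" using w by (auto simp: in_segment)
  have "w - a = (1 - u) *\<^sub>R (y - a) + u *\<^sub>R (z - a)"
    unfolding u(3) by (simp add: algebra_simps)
  then have "nrm c x (w - a) \<le> nrm c x ((1 - u) *\<^sub>R (y - a)) + nrm c x (u *\<^sub>R (z - a))"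
    using nrm_triangle[OF c] by metis
  also have "\<dots> = (1 - u) * nrm c x (y - a) + u * nrm c x (z - a)"
    using u by (simp add: nrm_scale[OF c])
  also have "\<dots> \<le> (1 - u) * s + u * s"
    using u s by (intro add_mono mult_left_mono) auto
  finally show ?thesis by (simp add: algebra_simps)
qed

definition good_radius :: "'a \<Rightarrow> real \<Rightarrow> real \<Rightarrow> bool" where
  "good_radius x e s \<longleftrightarrow> s > 0 \<and> (let c = chart_at M x in
     \<forall>y. nrm c x (y - coord c x) \<le> s \<longrightarrow> y \<in> coord c ` cdom c \<and>
       (\<forall>w. nrm c x w \<le> (1 + e) * nrm c (inv_coord c y) w \<and> nrm c (inv_coord c y) w \<le> (1 + e) * nrm c x w))"

abbreviation cnrm :: "'a \<Rightarrow> real ^ 'n \<Rightarrow> real" where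
  "cnrm x v \<equiv> nrm (chart_at M x) x v"

abbreviation crd :: "'a \<Rightarrow> 'a \<Rightarrow> real ^ 'n" where
  "crd x \<equiv> coord (chart_at M x)"

lemma good_radiusD:
  assumes "good_radius x e s"
  shows "s > 0" and "cnrm x (y - crd x x) \<le> s \<Longrightarrow> y \<in> crd x ` cdom (chart_at M x)"
    and "cnrm x (y - crd x x) \<le> s \<Longrightarrow> cnrm x w \<le> (1 + e) * nrm (chart_at M x) (inv_coord (chart_at M x) y) w"
    and "cnrm x (y - crd x x) \<le> s \<Longrightarrow> nrm (chart_at M x) (inv_coord (chart_at M x) y) w \<le> (1 + e) * cnrm x w"
  using assms unfolding good_radius_def Let_def by blast+

lemma ex_good_radius:
  assumes e: "e > 0" and U: "open U" "x \<in> U"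
  obtains s where "good_radius x e s"
    "\<And>y. cnrm x (y - crd x x) \<le> s \<Longrightarrow> inv_coord (chart_at M x) y \<in> U"
proof -
  define c where "c = chart_at M x"
  have c: "c \<in> atlas M" "x \<in> cdom c" unfolding c_def by (rule chart_at)+
  define y0 where "y0 = coord c x"
  define W where "W = coord c ` (U \<inter> cdom c)"
  have W: "open W" "y0 \<in> W" unfolding W_def y0_def using open_coord_image[OF c(1) U(1)] c U by auto
  obtain m where m: "m > 0" "\<And>v. m * norm v \<le> nrm c x v"
    using nrm_lower_bound[OF c(1), of "{x}"] c by (metis compact_sing empty_subsetI insert_subset singletonI)
  define g where "g y i j = metric M c (inv_coord c y) (axis i 1) (axis j 1)" for y i j
  define D where "D y = (\<Sum>i\<in>UNIV. \<Sum>j\<in>UNIV. \<bar>g y i j - g y0 i j\<bar>)" for y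
  have WW: "W \<subseteq> coord c ` cdom c" unfolding W_def by blast
  have "continuous_on W D"
    unfolding D_def g_def
    by (intro continuous_intros continuous_on_subset[OF smooth_onD(3)[OF metric_smooth[OF c(1)]] WW])
  then have D_cont: "isCont D y0" using W by (simp add: continuous_on_eq_continuous_at)
  have D0: "D y0 = 0" by (simp add: D_def)
  define a where "a = (1 + e)\<^sup>2"
  have a: "a > 1" using e by (simp add: a_def)
  define \<eta> where "\<eta> = 1 - 1 / a"
  have \<eta>: "\<eta> > 0" "1 - \<eta> = 1 / a" using a by (auto simp: \<eta>_def)
  have "2 \<le> a + 1 / a"
  proof -
    have "0 \<le> (a - 1)\<^sup>2" by simp
    then show ?thesis using a by (simp add: field_simps power2_eq_square)
  qed
  then have \<eta>2: "1 + \<eta> \<le> a" by (simp add: \<eta>_def)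
  have "eventually (\<lambda>y. D y < \<eta> * m\<^sup>2) (nhds y0)"
    using order_tendstoD(2)[OF D_cont[unfolded isCont_def tendsto_at_iff_tendsto_nhds], of "\<eta> * m\<^sup>2"]
      D0 \<eta> m by simp
  moreover have "eventually (\<lambda>y. y \<in> W) (nhds y0)" using W by (rule eventually_nhds_in_open)
  ultimately have "eventually (\<lambda>y. y \<in> W \<and> D y < \<eta> * m\<^sup>2) (nhds y0)" by eventually_elim blast
  then obtain r where r: "r > 0" "\<And>y. dist y y0 < r \<Longrightarrow> y \<in> W \<and> D y < \<eta> * m\<^sup>2"
    unfolding eventually_nhds_metric by blast
  define s where "s = m * r / 2"
  have s: "s > 0" using m r by (simp add: s_def)
  have near: "y \<in> W \<and> D y < \<eta> * m\<^sup>2" if "nrm c x (y - y0) \<le> s" for y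
  proof (rule r(2))
    have "m * norm (y - y0) \<le> m * (r / 2)" using m(2)[of "y - y0"] that by (simp add: s_def)
    then have "norm (y - y0) \<le> r / 2" using m(1) by simp
    then show "dist y y0 < r" using r(1) by (simp add: dist_norm)
  qed
  have compare: "nrm c x w \<le> (1 + e) * nrm c (inv_coord c y) w \<and> nrm c (inv_coord c y) w \<le> (1 + e) * nrm c x w"
    if "nrm c x (y - y0) \<le> s" for y w
  proof -
    have yc: "inv_coord c y \<in> cdom c" using near[OF that] WW inv_coord(2)[OF c(1)] by blast
    have x: "inv_coord c y0 = x" unfolding y0_def by (rule inv_coord(1)[OF c])
    let ?g = "metric M c (inv_coord c y) w w" let ?gx = "metric M c x w w"
    have nn: "0 \<le> ?g" "0 \<le> ?gx" using metric_nonneg c yc by auto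
    have e1: "?g = (\<Sum>i\<in>UNIV. \<Sum>j\<in>UNIV. w $ i * w $ j * g y i j)"
      unfolding g_def by (rule metric_expand[OF c(1) yc])
    have e2: "?gx = (\<Sum>i\<in>UNIV. \<Sum>j\<in>UNIV. w $ i * w $ j * g y0 i j)"
      unfolding g_def x by (rule metric_expand[OF c])
    have "?g - ?gx = (\<Sum>i\<in>UNIV. \<Sum>j\<in>UNIV. w $ i * w $ j * (g y i j - g y0 i j))"
      unfolding e1 e2 by (simp only: sum_subtractf right_diff_distrib)
    also have "\<bar>\<dots>\<bar> \<le> (\<Sum>i\<in>UNIV. \<bar>\<Sum>j\<in>UNIV. w $ i * w $ j * (g y i j - g y0 i j)\<bar>)"
      by (rule sum_abs)
    also have "\<dots> \<le> (\<Sum>i\<in>UNIV. \<Sum>j\<in>UNIV. \<bar>w $ i * w $ j * (g y i j - g y0 i j)\<bar>)"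
      by (intro sum_mono sum_abs)
    also have "\<dots> \<le> (\<Sum>i\<in>UNIV. \<Sum>j\<in>UNIV. (norm w)\<^sup>2 * \<bar>g y i j - g y0 i j\<bar>)"
      unfolding abs_mult power2_eq_square
      by (intro sum_mono mult_right_mono mult_mono component_le_norm_cart) auto
    also have "\<dots> = (norm w)\<^sup>2 * D y" by (simp add: D_def sum_distrib_left)
    also have "\<dots> \<le> (norm w)\<^sup>2 * (\<eta> * m\<^sup>2)"
      using near[OF that] by (intro mult_left_mono) auto
    also have "\<dots> = \<eta> * (m * norm w)\<^sup>2" by (simp add: power_mult_distrib)
    also have "\<dots> \<le> \<eta> * (nrm c x w)\<^sup>2"
      using \<eta> m by (intro mult_left_mono power_mono) auto
    finally have diff: "\<bar>?g - ?gx\<bar> \<le> \<eta> * ?gx" using nn by simp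
    have "?gx - ?g \<le> \<eta> * ?gx" using diff by linarith
    then have "(1 - \<eta>) * ?gx \<le> ?g" by (simp add: left_diff_distrib)
    then have "?gx / a \<le> ?g" unfolding \<eta>(2) by simp
    then have 1: "?gx \<le> a * ?g" using a by (simp add: field_simps)
    have "?g - ?gx \<le> \<eta> * ?gx" using diff by linarith
    then have "?g \<le> (1 + \<eta>) * ?gx" by (simp add: distrib_right)
    also have "\<dots> \<le> a * ?gx" using \<eta>2 nn by (intro mult_right_mono)
    finally have 2: "?g \<le> a * ?gx" .
    have "sqrt a = 1 + e" using e by (simp add: a_def)
    then show ?thesis
      using real_sqrt_le_mono[OF 1] real_sqrt_le_mono[OF 2] by (simp add: real_sqrt_mult)
  qed
  have "good_radius x e s"
    unfolding good_radius_def Let_def c_def[symmetric] y0_def[symmetric]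
    using s near WW compare by blast
  moreover have "inv_coord c y \<in> U" if "nrm c x (y - y0) \<le> s" for y
    using near[OF that] inv_coord(1)[OF c(1)] unfolding W_def by auto
  ultimately show ?thesis using that unfolding c_def y0_def by blast
qed

lemma coord_ball_compact:
  assumes "good_radius x e s"
  shows "compact {y. cnrm x (y - crd x x) \<le> s}"
proof -
  define c where "c = chart_at M x"
  have c: "c \<in> atlas M" "x \<in> cdom c" unfolding c_def by (rule chart_at)+
  obtain m where m: "m > 0" "\<And>v. m * norm v \<le> nrm c x v"
    using nrm_lower_bound[OF c(1), of "{x}"] c by (metis compact_sing empty_subsetI insert_subset singletonI)
  let ?K = "{y. nrm c x (y - coord c x) \<le> s}"
  have "continuous_on UNIV (\<lambda>y. nrm c x (y - coord c x))"
    by (intro continuous_intros continuous_on_metric c)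
  then have "closed ?K" by (intro closed_Collect_le continuous_on_const)
  moreover have "?K \<subseteq> cball (coord c x) (s / m)"
  proof
    fix y assume "y \<in> ?K"
    then have "m * norm (y - coord c x) \<le> s" using m(2) order_trans by blast
    then show "y \<in> cball (coord c x) (s / m)"
      using m(1) by (simp add: field_simps dist_norm norm_minus_commute)
  qed
  ultimately show ?thesis
    unfolding c_def[symmetric] using bounded_subset[OF bounded_cball] compact_eq_bounded_closed by blast
qed

abbreviation sqd :: "'a \<Rightarrow> real ^ 'n \<Rightarrow> 'a \<Rightarrow> real" where
  "sqd x a z \<equiv> metric M (chart_at M x) x (crd x z - a) (crd x z - a)"

text \<open>The profile \<theta> is a function of the squared frozen distance from the coordinate
  point \<open>a\<close>, so no singularity arises at the centre.\<close>

definition radial :: "'a \<Rightarrow> real ^ 'n \<Rightarrow> (real \<Rightarrow> real) \<Rightarrow> 'a \<Rightarrow> real" where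
  "radial x a \<theta> z = (if z \<in> cdom (chart_at M x) then \<theta> (sqd x a z) else 0)"

lemma C1_fun_radial:
  assumes good: "good_radius x e s'"
    and s: "s > 0" "\<And>y. cnrm x (y - y0) \<le> s \<Longrightarrow> cnrm x (y - crd x x) \<le> s'"
    and \<theta>: "\<And>r. r \<ge> 0 \<Longrightarrow> (\<theta> has_real_derivative \<theta>' r) (at r)" "continuous_on {0..} \<theta>'"
    and zero: "\<And>r. r \<ge> s\<^sup>2 \<Longrightarrow> \<theta> r = 0" "\<And>r. r \<ge> s\<^sup>2 \<Longrightarrow> \<theta>' r = 0" and e: "e \<ge> 0"
  shows "C1_fun (radial x y0 \<theta>)"
    and "\<And>z d v. d \<in> atlas M \<Longrightarrow> z \<in> cdom d \<Longrightarrow> \<bar>cdiff (radial x y0 \<theta>) d z v\<bar> \<le>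
      (if z \<in> cdom (chart_at M x) then 2 * \<bar>\<theta>' (sqd x y0 z)\<bar> * sqrt (sqd x y0 z) * (1 + e) else 0) * nrm d z v"
proof -
  define c where "c = chart_at M x"
  have c: "c \<in> atlas M" "x \<in> cdom c" unfolding c_def by (rule chart_at)+
  define Q where "Q y = metric M c x (y - y0) (y - y0)" for y
  define \<phi> where "\<phi> y = \<theta> (Q y)" for y
  note gr = good_radiusD[OF good, folded c_def]
  define K where "K = {y. nrm c x (y - y0) \<le> s}"
  have K: "compact K" "K \<subseteq> coord c ` cdom c"
  proof -
    have "closed K"
      unfolding K_def by (intro closed_Collect_le continuous_intros continuous_on_metric c)
    moreover have "{y. nrm c x (y - coord c x) \<le> s'} \<inter> K = K"
      using s(2) unfolding K_def c_def by blast
    ultimately show "compact K"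
      using compact_Int_closed[OF coord_ball_compact[OF good, folded c_def], of K] by simp
    show "K \<subseteq> coord c ` cdom c" using gr(2) s(2) unfolding K_def c_def by blast
  qed
  have Q_nonneg: "0 \<le> Q y" for y unfolding Q_def by (rule metric_nonneg[OF c])
  have Q_ge: "Q y \<ge> s\<^sup>2" if "y \<notin> K" for y
  proof -
    have "s \<le> sqrt (Q y)" using that by (simp add: K_def Q_def)
    then show ?thesis using s(1) by (metis Q_def c less_eq_real_def metric_nonneg power_mono real_sqrt_pow2)
  qed
  have bb: "bounded_bilinear (metric M c x)"
    using metric_bilinear[OF c] by (simp add: bilinear_conv_bounded_bilinear)
  have dQ: "(Q has_derivative (\<lambda>w. 2 * metric M c x (y - y0) w)) (at y)" for y
  proof -
    have 1: "((\<lambda>y. y - y0) has_derivative (\<lambda>w. w)) (at y)" by (auto intro!: derivative_eq_intros)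
    have "(Q has_derivative (\<lambda>w. metric M c x (y - y0) w + metric M c x w (y - y0))) (at y)"
      unfolding Q_def by (rule bounded_bilinear.FDERIV[OF bb 1 1])
    then show ?thesis using metric_sym[OF c, of _ "y - y0"] by simp
  qed
  have d\<phi>: "(\<phi> has_derivative (\<lambda>w. \<theta>' (Q y) * (2 * metric M c x (y - y0) w))) (at y)" for y
    unfolding \<phi>_def
    using has_derivative_compose[OF dQ \<theta>(1)[OF Q_nonneg, unfolded has_field_derivative_def]] by simp
  note f\<phi> = frechet_derivative_at[OF d\<phi>, symmetric]
  have cQ: "continuous_on UNIV Q"
    unfolding Q_def by (intro continuous_intros continuous_on_metric c)
  have ext1: "\<phi> differentiable (at y)" for y by (rule differentiableI[OF d\<phi>])
  have ext2: "continuous_on (coord c ` cdom c) (\<lambda>y. frechet_derivative \<phi> (at y) v)" for v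
    unfolding f\<phi>
    by (intro continuous_intros continuous_on_metric c continuous_on_compose2[OF \<theta>(2)]
        continuous_on_subset[OF cQ]) (auto simp: Q_nonneg)
  have ext3: "\<phi> y = 0" if "y \<notin> K" for y using zero(1)[OF Q_ge[OF that]] by (simp add: \<phi>_def)
  have F: "radial x y0 \<theta> = (\<lambda>z. if z \<in> cdom c then \<phi> (coord c z) else 0)"
    by (auto simp: radial_def c_def \<phi>_def Q_def)
  note ext' = C1_fun_extend[OF c(1) ext1 ext2 K, folded F]
  show C1: "C1_fun (radial x y0 \<theta>)" by (rule ext'(1)[OF ext3])
  have ext2: "cdiff (radial x y0 \<theta>) c z = frechet_derivative \<phi> (at (coord c z))" if "z \<in> cdom c" for z
    by (rule ext'(2)[OF ext3 that])
  have ext3: "cdiff (radial x y0 \<theta>) d z v = 0" if "d \<in> atlas M" "z \<in> cdom d" "z \<notin> cdom c" for d z v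
    by (rule ext'(3)[OF ext3 that])
  fix z d v assume d: "d \<in> atlas M" "z \<in> cdom d"
  show "\<bar>cdiff (radial x y0 \<theta>) d z v\<bar> \<le>
      (if z \<in> cdom (chart_at M x) then 2 * \<bar>\<theta>' (sqd x y0 z)\<bar> * sqrt (sqd x y0 z) * (1 + e) else 0) * nrm d z v"
  proof (cases "z \<in> cdom c")
    case True
    let ?y = "coord c z" and ?w = "change_comp d c z v"
    have eq: "cdiff (radial x y0 \<theta>) d z v = \<theta>' (Q ?y) * (2 * metric M c x (?y - y0) ?w)"
      using cdiff_change[OF C1 c(1) d(1) True d(2)] ext2[OF True] by (simp add: f\<phi>)
    have "\<bar>\<theta>' (Q ?y) * (2 * metric M c x (?y - y0) ?w)\<bar> \<le> 2 * \<bar>\<theta>' (Q ?y)\<bar> * sqrt (Q ?y) * ((1 + e) * nrm d z v)"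
    proof (cases "?y \<in> K")
      case True2: True
      have "nrm c x ?w \<le> (1 + e) * nrm c z ?w"
        using gr(3)[OF s(2)[of ?y, folded c_def], of ?w] True2 inv_coord(1)[OF c(1) True] by (simp add: K_def)
      also have "nrm c z ?w = nrm d z v" by (rule nrm_change[OF d(1) c(1) d(2) True])
      finally have "nrm c x (?y - y0) * nrm c x ?w \<le> sqrt (Q ?y) * ((1 + e) * nrm d z v)"
        unfolding Q_def by (intro mult_left_mono) (auto simp: metric_nonneg[OF c])
      then have "\<bar>metric M c x (?y - y0) ?w\<bar> \<le> sqrt (Q ?y) * ((1 + e) * nrm d z v)"
        using metric_Cauchy_Schwarz[OF c, of "?y - y0" ?w] by linarith
      then have "(2 * \<bar>\<theta>' (Q ?y)\<bar>) * \<bar>metric M c x (?y - y0) ?w\<bar> \<le> (2 * \<bar>\<theta>' (Q ?y)\<bar>) * (sqrt (Q ?y) * ((1 + e) * nrm d z v))"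
        by (intro mult_left_mono) auto
      then show ?thesis by (simp add: abs_mult mult_ac)
    qed (simp add: zero(2)[OF Q_ge])
    then show ?thesis
      unfolding eq using True unfolding Q_def c_def by (simp add: mult.assoc)
  next
    case False
    then show ?thesis using ext3[OF d] unfolding c_def by simp
  qed
qed

text \<open>Needed for the comparison of the distance with the topology: a function that drops from
  1 at \<open>x\<close> to 0 off \<open>U\<close> with bounded slope forces curves that leave
  \<open>U\<close> to have a minimal length.\<close>

lemma ex_C1_bump:
  assumes U: "open U" "x \<in> U"
  obtains F L where "C1_fun F" "L > 0" "F x = 1" "\<And>z. z \<notin> U \<Longrightarrow> F z = 0"
    "\<And>c z v. c \<in> atlas M \<Longrightarrow> z \<in> cdom c \<Longrightarrow> \<bar>cdiff F c z v\<bar> \<le> L * nrm c z v"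
proof -
  obtain s where s: "good_radius x 1 s"
    "\<And>y. cnrm x (y - crd x x) \<le> s \<Longrightarrow> inv_coord (chart_at M x) y \<in> U"
    using ex_good_radius[OF zero_less_one U] by blast
  have s0: "s > 0" by (rule good_radiusD[OF s(1)])
  note c = chart_at[of x]
  define y0 where "y0 = crd x x"
  define \<theta> where "\<theta> r = (max 0 (1 - r / s\<^sup>2))\<^sup>2" for r
  define \<theta>' where "\<theta>' r = 2 * max 0 (1 - r / s\<^sup>2) * (- 1 / s\<^sup>2)" for r
  have \<theta>: "(\<theta> has_real_derivative \<theta>' r) (at r)" for r
  proof -
    have "((\<lambda>r. 1 - r / s\<^sup>2) has_real_derivative (- 1 / s\<^sup>2)) (at r)"
      using DERIV_diff[OF DERIV_const DERIV_cdivide[OF DERIV_ident, of "s\<^sup>2"], of 1] by simp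
    from DERIV_chain2[OF pos_part_square_deriv this] show ?thesis
      unfolding \<theta>_def \<theta>'_def .
  qed
  have \<theta>'c: "continuous_on {0..} \<theta>'" unfolding \<theta>'_def using s0 by (intro continuous_intros) auto
  have z: "\<theta> r = 0" "\<theta>' r = 0" if "r \<ge> s\<^sup>2" for r using that s0 by (auto simp: \<theta>_def \<theta>'_def max_def)
  have "C1_fun (radial x y0 \<theta>)" and R: "d \<in> atlas M \<Longrightarrow> z \<in> cdom d \<Longrightarrow> \<bar>cdiff (radial x y0 \<theta>) d z v\<bar> \<le>
      (if z \<in> cdom (chart_at M x) then 2 * \<bar>\<theta>' (sqd x y0 z)\<bar> * sqrt (sqd x y0 z) * (1 + 1) else 0) * nrm d z v" for d z v
    by (rule C1_fun_radial[OF s(1) s0 _ \<theta> \<theta>'c z]; simp add: y0_def)+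
  have "radial x y0 \<theta> x = 1" using c by (simp add: radial_def \<theta>_def metric_arith y0_def)
  moreover have "radial x y0 \<theta> z = 0" if zU: "z \<notin> U" for z
  proof (cases "z \<in> cdom (chart_at M x)")
    case True
    then have "\<not> cnrm x (crd x z - crd x x) \<le> s"
      using s(2)[of "crd x z"] zU inv_coord(1)[OF c(1)] by auto
    then have "sqd x y0 z \<ge> s\<^sup>2"
      unfolding y0_def using s0 metric_nonneg[OF c] by (metis less_eq_real_def linorder_not_le power_mono real_sqrt_pow2)
    then show ?thesis using z by (simp add: radial_def)
  qed (simp add: radial_def)
  \<comment> \<open>Here \<bar>\<theta>'\<bar> \<le> 2/s^2 and the root is at most s; with the
    factor 2 of the chain rule and the factor 1 + 1 of the good radius this makes 8/s.\<close>
  moreover have "\<bar>cdiff (radial x y0 \<theta>) d z v\<bar> \<le> 8 / s * nrm d z v" if d: "d \<in> atlas M" "z \<in> cdom d" for d z v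
  proof -
    have "(if z \<in> cdom (chart_at M x) then 2 * \<bar>\<theta>' (sqd x y0 z)\<bar> * sqrt (sqd x y0 z) * (1 + 1) else 0) \<le> 8 / s"
    proof (cases "z \<in> cdom (chart_at M x) \<and> sqd x y0 z < s\<^sup>2")
      case True
      have nn: "0 \<le> sqd x y0 z" by (rule metric_nonneg[OF c])
      have "sqrt (sqd x y0 z) \<le> s" using True s0 by (intro real_le_lsqrt) auto
      moreover have "\<bar>\<theta>' (sqd x y0 z)\<bar> \<le> 2 * 1 * (1 / s\<^sup>2)"
        using nn s0 unfolding \<theta>'_def abs_mult by (intro mult_mono) auto
      ultimately have "\<bar>\<theta>' (sqd x y0 z)\<bar> * sqrt (sqd x y0 z) \<le> (2 * 1 * (1 / s\<^sup>2)) * s"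
        using s0 nn by (intro mult_mono) auto
      also have "\<dots> = 2 / s" using s0 by (simp add: power2_eq_square)
      finally show ?thesis using True by simp
    qed (use z s0 in auto)
    then have "(if z \<in> cdom (chart_at M x) then 2 * \<bar>\<theta>' (sqd x y0 z)\<bar> * sqrt (sqd x y0 z) * (1 + 1) else 0) * nrm d z v \<le> 8 / s * nrm d z v"
      using metric_nonneg[OF d] by (intro mult_right_mono) auto
    then show ?thesis using R[OF d, of v] by linarith
  qed
  ultimately show ?thesis using that[of "radial x y0 \<theta>" "8 / s"] \<open>C1_fun (radial x y0 \<theta>)\<close> s0 by simp
qed

end

section \<open>The Riemannian distance as a metric\<close>

locale conn_riem_manifold = riem_manifold +
  assumes conn: "connected (UNIV :: 'a set)"
begin

lemma pwC1_join:
  assumes "pwC1 M \<gamma> 0 1" "pwC1 M \<delta> 0 1" "\<gamma> 1 = \<delta> 0"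
  obtains \<epsilon> where "pwC1 M \<epsilon> 0 2" "\<epsilon> 0 = \<gamma> 0" "\<epsilon> 2 = \<delta> 1" "clen M \<epsilon> 0 2 = clen M \<gamma> 0 1 + clen M \<delta> 0 1"
proof -
  define \<epsilon> where "\<epsilon> t = (if t \<le> 1 then \<gamma> t else \<delta> (t - 1))" for t
  let ?\<delta> = "\<lambda>t. \<delta> (1 * t + (- 1))"
  have d: "pwC1 M ?\<delta> 1 2" "clen M ?\<delta> 1 2 = clen M \<delta> 0 1"
    using pwC1_affine[OF assms(2), of 1 "-1"] clen_affine[OF assms(2), of 1 "-1"] by simp_all
  have eq: "?\<delta> t = \<epsilon> t" if "1 \<le> t" "t \<le> 2" for t
    using that assms(3) by (cases "t = 1") (auto simp: \<epsilon>_def)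
  have 1: "pwC1 M \<epsilon> 0 1" by (rule pwC1_cong[OF assms(1)]) (simp add: \<epsilon>_def)
  have 2: "pwC1 M \<epsilon> 1 2" by (rule pwC1_cong[OF d(1) eq])
  have "clen M \<epsilon> 0 1 = clen M \<gamma> 0 1" by (rule clen_cong) (simp add: \<epsilon>_def)
  moreover have "clen M \<epsilon> 1 2 = clen M ?\<delta> 1 2" by (rule clen_cong[OF eq[symmetric]])
  ultimately have "clen M \<epsilon> 0 2 = clen M \<gamma> 0 1 + clen M \<delta> 0 1"
    using clen_add[OF 1 2] d(2) by simp
  then show ?thesis
    using that[of \<epsilon>] pwC1_concat[OF 2 1] by (simp add: \<epsilon>_def)
qed

lemma pwC1_normalize:
  assumes "pwC1 M \<gamma> a b"
  obtains \<delta> where "pwC1 M \<delta> 0 1" "\<delta> 0 = \<gamma> a" "\<delta> 1 = \<gamma> b" "clen M \<delta> 0 1 = clen M \<gamma> a b"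
proof -
  have ab: "b - a > 0" using pwC1_less[OF assms] by simp
  show ?thesis
    using that[of "\<lambda>t. \<gamma> ((b - a) * t + a)"] pwC1_affine[OF assms ab, of a] clen_affine[OF assms ab, of a] ab
    by simp
qed

lemma near_connected:
  assumes "good_radius x e s" "cnrm x (y - crd x x) \<le> s" "cnrm x (z - crd x x) \<le> s"
  shows "closed_segment y z \<subseteq> crd x ` cdom (chart_at M x)"
    and "\<And>w. w \<in> closed_segment y z \<Longrightarrow>
      nrm (chart_at M x) (inv_coord (chart_at M x) w) (z - y) \<le> (1 + e) * cnrm x (z - y)"
  using nrm_convex[OF chart_at assms(2,3)] good_radiusD[OF assms(1)] by blast+

lemma near_riem_dist:
  assumes "good_radius x e s" "cnrm x (y - crd x x) \<le> s" "cnrm x (z - crd x x) \<le> s"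
  shows "riem_dist M (inv_coord (chart_at M x) y) (inv_coord (chart_at M x) z) \<le> (1 + e) * cnrm x (z - y)"
  by (rule riem_dist_segment[OF chart_at(1) near_connected[OF assms]])

lemma open_coord_ball: "open {z \<in> cdom (chart_at M x). cnrm x (crd x z - a) < r}"
proof -
  note c = chart_at[of x]
  have "continuous_on (cdom (chart_at M x)) (\<lambda>z. cnrm x (crd x z - a))"
    by (intro continuous_intros continuous_on_metric inv_coord c)
  from continuous_on_open_vimage[THEN iffD1, OF chart_props(1)[OF c(1)] this, rule_format, of "{..<r}"]
  have "open ((\<lambda>z. cnrm x (crd x z - a)) -` {..<r} \<inter> cdom (chart_at M x))" by simp
  moreover have "(\<lambda>z. cnrm x (crd x z - a)) -` {..<r} \<inter> cdom (chart_at M x) =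
     {z \<in> cdom (chart_at M x). cnrm x (crd x z - a) < r}" by auto
  ultimately show ?thesis by simp
qed

text \<open>Every point has a neighbourhood all of whose points it reaches by coordinate segments.
  Hence the set reachable from \<open>x\<close> and its complement are both open, and M is
  connected.\<close>

lemma ex_curve: "\<exists>\<gamma>. pwC1 M \<gamma> 0 1 \<and> \<gamma> 0 = x \<and> \<gamma> 1 = y"
proof -
  define R where "R = {y. \<exists>\<gamma>. pwC1 M \<gamma> 0 1 \<and> \<gamma> 0 = x \<and> \<gamma> 1 = y}"
  have near: "\<exists>V. open V \<and> z \<in> V \<and> (\<forall>w\<in>V. \<exists>\<gamma>. pwC1 M \<gamma> 0 1 \<and> \<gamma> 0 = z \<and> \<gamma> 1 = w)" for z
  proof -
    obtain s where s: "good_radius z 1 s" using ex_good_radius[OF zero_less_one open_UNIV UNIV_I] by metis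
    have s0: "s > 0" by (rule good_radiusD[OF s])
    note c = chart_at[of z]
    let ?V = "{w \<in> cdom (chart_at M z). cnrm z (crd z w - crd z z) < s}"
    have z0: "cnrm z (crd z z - crd z z) \<le> s" using s0 by (simp add: metric_arith c)
    have "\<exists>\<gamma>. pwC1 M \<gamma> 0 1 \<and> \<gamma> 0 = z \<and> \<gamma> 1 = w" if w: "w \<in> ?V" for w
    proof -
      have w': "cnrm z (crd z w - crd z z) \<le> s" using w by simp
      obtain \<gamma> where "pwC1 M \<gamma> 0 1" "\<gamma> 0 = inv_coord (chart_at M z) (crd z z)" "\<gamma> 1 = inv_coord (chart_at M z) (crd z w)"
        by (rule C1_segment[OF c(1) near_connected[OF s z0 w']])
      then show ?thesis using inv_coord(1)[OF c(1)] c w by auto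
    qed
    moreover have "z \<in> ?V" using s0 by (simp add: metric_arith c)
    ultimately show ?thesis using open_coord_ball[of z "crd z z" s] by blast
  qed
  have trans: "w \<in> R" if asm: "z \<in> R" "pwC1 M \<gamma> 0 1" "\<gamma> 0 = z" "\<gamma> 1 = w" for z w \<gamma>
  proof -
    obtain \<delta> where \<delta>: "pwC1 M \<delta> 0 1" "\<delta> 0 = x" "\<delta> 1 = z" using \<open>z \<in> R\<close> by (auto simp: R_def)
    have "\<delta> 1 = \<gamma> 0" using \<delta>(3) asm(3) by simp
    then obtain \<epsilon> where \<epsilon>: "pwC1 M \<epsilon> 0 2" "\<epsilon> 0 = \<delta> 0" "\<epsilon> 2 = \<gamma> 1"
      by (rule pwC1_join[OF \<delta>(1) asm(2)])
    obtain \<zeta> where "pwC1 M \<zeta> 0 1" "\<zeta> 0 = \<epsilon> 0" "\<zeta> 1 = \<epsilon> 2" by (rule pwC1_normalize[OF \<epsilon>(1)])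
    then show ?thesis unfolding R_def using \<epsilon>(2,3) \<delta>(2) asm(4) by auto
  qed
  have "open R"
    unfolding open_subopen[of R]
  proof
    fix z assume z: "z \<in> R"
    obtain V where V: "open V" "z \<in> V" "\<And>w. w \<in> V \<Longrightarrow> \<exists>\<gamma>. pwC1 M \<gamma> 0 1 \<and> \<gamma> 0 = z \<and> \<gamma> 1 = w"
      using near[of z] by blast
    have "V \<subseteq> R" using V(3) trans[OF z] by blast
    then show "\<exists>T. open T \<and> z \<in> T \<and> T \<subseteq> R" using V by blast
  qed
  moreover have "open (- R)"
    unfolding open_subopen[of "- R"]
  proof
    fix z assume z: "z \<in> - R"
    obtain V where V: "open V" "z \<in> V" "\<And>w. w \<in> V \<Longrightarrow> \<exists>\<gamma>. pwC1 M \<gamma> 0 1 \<and> \<gamma> 0 = z \<and> \<gamma> 1 = w"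
      using near[of z] by blast
    have "w \<notin> R" if w: "w \<in> V" for w
    proof
      assume wR: "w \<in> R"
      obtain \<gamma> where \<gamma>: "pwC1 M \<gamma> 0 1" "\<gamma> 0 = z" "\<gamma> 1 = w" using V(3)[OF w] by blast
      obtain \<delta> where "pwC1 M \<delta> 0 1" "\<delta> 0 = w" "\<delta> 1 = z"
        using pwC1_normalize[OF pwC1_reverse[OF \<gamma>(1)]] \<gamma>(2,3) by (metis minus_minus neg_0_equal_iff_equal)
      then have "z \<in> R" using trans[OF wR] by blast
      then show False using z by simp
    qed
    then show "\<exists>T. open T \<and> z \<in> T \<and> T \<subseteq> - R" using V by blast
  qed
  ultimately have "R = {} \<or> R = UNIV"
    using connectedD[OF conn, of R "- R"] by auto
  moreover have "x \<in> R"
  proof -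
    obtain V where "x \<in> V" "\<And>w. w \<in> V \<Longrightarrow> \<exists>\<gamma>. pwC1 M \<gamma> 0 1 \<and> \<gamma> 0 = x \<and> \<gamma> 1 = w"
      using near[of x] by blast
    then show ?thesis by (auto simp: R_def)
  qed
  ultimately have "y \<in> R" by blast
  then show ?thesis by (simp add: R_def)
qed

lemma riem_dist_nonneg: "0 \<le> riem_dist M x y"
  unfolding riem_dist_eq using ex_curve[of x y] clen_nonneg by (intro cInf_greatest) auto

lemma riem_dist_approx:
  assumes "riem_dist M x y < r"
  obtains \<gamma> where "pwC1 M \<gamma> 0 1" "\<gamma> 0 = x" "\<gamma> 1 = y" "clen M \<gamma> 0 1 < r"
proof -
  have "\<exists>l\<in>{clen M \<gamma> 0 1 | \<gamma>. pwC1 M \<gamma> 0 1 \<and> \<gamma> 0 = x \<and> \<gamma> 1 = y}. l < r"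
    using assms ex_curve[of x y] unfolding riem_dist_eq by (intro cInf_lessD) auto
  then show ?thesis using that by blast
qed

lemma riem_dist_refl: "riem_dist M x x = 0"
proof -
  note c = chart_at[of x]
  have "riem_dist M (inv_coord (chart_at M x) (crd x x)) (inv_coord (chart_at M x) (crd x x)) \<le> 0"
    by (rule riem_dist_segment[OF c(1)]) (use c inv_coord(1)[OF c(1)] in \<open>auto simp: metric_arith\<close>)
  then show ?thesis using inv_coord(1)[OF c] riem_dist_nonneg[of x x] by simp
qed

lemma riem_dist_sym_le: "riem_dist M y x \<le> riem_dist M x y"
proof (rule field_le_epsilon)
  fix e :: real assume "e > 0"
  then obtain \<gamma> where \<gamma>: "pwC1 M \<gamma> 0 1" "\<gamma> 0 = x" "\<gamma> 1 = y" "clen M \<gamma> 0 1 < riem_dist M x y + e"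
    using riem_dist_approx[of x y "riem_dist M x y + e"] by auto
  have "riem_dist M (\<gamma> (- (- 1))) (\<gamma> (- (- 0))) \<le> clen M (\<lambda>t. \<gamma> (- t)) (- 1) (- 0)"
    by (rule riem_dist_le_clen[OF pwC1_reverse[OF \<gamma>(1)]])
  then show "riem_dist M y x \<le> riem_dist M x y + e" using clen_reverse[OF \<gamma>(1)] \<gamma> by simp
qed

lemma riem_dist_sym: "riem_dist M x y = riem_dist M y x"
  using riem_dist_sym_le[of x y] riem_dist_sym_le[of y x] by simp

lemma riem_dist_triangle: "riem_dist M x z \<le> riem_dist M x y + riem_dist M y z"
proof (rule field_le_epsilon)
  fix e :: real assume e: "e > 0"
  obtain \<gamma> where \<gamma>: "pwC1 M \<gamma> 0 1" "\<gamma> 0 = x" "\<gamma> 1 = y" "clen M \<gamma> 0 1 < riem_dist M x y + e / 2"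
    using riem_dist_approx[of x y "riem_dist M x y + e / 2"] e by auto
  obtain \<delta> where \<delta>: "pwC1 M \<delta> 0 1" "\<delta> 0 = y" "\<delta> 1 = z" "clen M \<delta> 0 1 < riem_dist M y z + e / 2"
    using riem_dist_approx[of y z "riem_dist M y z + e / 2"] e by auto
  have "\<gamma> 1 = \<delta> 0" using \<gamma>(3) \<delta>(2) by simp
  then obtain \<epsilon> where \<epsilon>: "pwC1 M \<epsilon> 0 2" "\<epsilon> 0 = \<gamma> 0" "\<epsilon> 2 = \<delta> 1" "clen M \<epsilon> 0 2 = clen M \<gamma> 0 1 + clen M \<delta> 0 1"
    by (rule pwC1_join[OF \<gamma>(1) \<delta>(1)])
  have "riem_dist M (\<epsilon> 0) (\<epsilon> 2) \<le> clen M \<epsilon> 0 2" by (rule riem_dist_le_clen[OF \<epsilon>(1)])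
  then show "riem_dist M x z \<le> riem_dist M x y + riem_dist M y z + e"
    using \<epsilon> \<gamma> \<delta> by simp
qed

text \<open>\<open>C1_fun_along_curve\<close> applied to almost shortest curves. It is the source of
  lower bounds on the distance.\<close>

lemma C1_fun_lipschitz:
  assumes F: "C1_fun F" and L: "L \<ge> 0"
    "\<And>c x v. c \<in> atlas M \<Longrightarrow> x \<in> cdom c \<Longrightarrow> \<bar>cdiff F c x v\<bar> \<le> L * nrm c x v"
  shows "\<bar>F x - F y\<bar> \<le> L * riem_dist M x y"
proof (rule field_le_epsilon)
  fix e :: real assume e: "e > 0"
  then have "riem_dist M x y < riem_dist M x y + e / (L + 1)" using L(1) by simp
  then obtain \<gamma> where \<gamma>: "pwC1 M \<gamma> 0 1" "\<gamma> 0 = x" "\<gamma> 1 = y" "clen M \<gamma> 0 1 < riem_dist M x y + e / (L + 1)"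
    by (rule riem_dist_approx)
  have "\<bar>F (\<gamma> 1) - F (\<gamma> 0)\<bar> \<le> L * clen M \<gamma> 0 1" by (rule C1_fun_along_curve[OF F L \<gamma>(1)])
  also have "\<dots> \<le> L * (riem_dist M x y + e / (L + 1))" using \<gamma>(4) L(1) by (intro mult_left_mono) auto
  also have "\<dots> \<le> L * riem_dist M x y + e"
    using L(1) e by (simp add: distrib_left mult.commute pos_divide_le_eq)
  finally show "\<bar>F x - F y\<bar> \<le> L * riem_dist M x y + e" using \<gamma> by (simp add: abs_minus_commute)
qed

text \<open>By \<open>C1_fun_lipschitz\<close> the bump of \<open>ex_C1_bump\<close>, whose slope is
  at most L, cannot fall from 1 to 0 within distance less than 1/L.\<close>

lemma ball_in_open:
  assumes "open U" "x \<in> U"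
  obtains r where "r > 0" "\<And>y. riem_dist M x y < r \<Longrightarrow> y \<in> U"
proof -
  obtain F L where F: "C1_fun F" "L > 0" "F x = 1" "\<And>z. z \<notin> U \<Longrightarrow> F z = 0"
    "\<And>c z v. c \<in> atlas M \<Longrightarrow> z \<in> cdom c \<Longrightarrow> \<bar>cdiff F c z v\<bar> \<le> L * nrm c z v"
    by (rule ex_C1_bump[OF assms]) blast
  have "y \<in> U" if "riem_dist M x y < 1 / L" for y
  proof (rule ccontr)
    assume "y \<notin> U"
    then have "1 \<le> L * riem_dist M x y"
      using C1_fun_lipschitz[OF F(1) less_imp_le[OF F(2)] F(5), of x y] F(3,4) by simp
    then show False using that F(2) by (simp add: field_simps)
  qed
  then show ?thesis using that[of "1 / L"] F(2) by simp
qed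

lemma open_in_ball:
  assumes "r > 0"
  obtains V where "open V" "x \<in> V" "\<And>y. y \<in> V \<Longrightarrow> riem_dist M x y < r"
proof -
  obtain s where s: "good_radius x 1 s" using ex_good_radius[OF zero_less_one open_UNIV UNIV_I] by metis
  have s0: "s > 0" by (rule good_radiusD[OF s])
  note c = chart_at[of x]
  have z0: "cnrm x (crd x x - crd x x) \<le> s" using s0 by (simp add: metric_arith c)
  \<comment> \<open>The bound r/2 compensates the factor 1 + 1 lost in
    \<open>near_riem_dist\<close>.\<close>
  let ?V = "{w \<in> cdom (chart_at M x). cnrm x (crd x w - crd x x) < min s (r / 2)}"
  have "riem_dist M x y < r" if y: "y \<in> ?V" for y
    using near_riem_dist[OF s z0, of "crd x y"] y c by (simp add: inv_coord(1)[OF c(1)])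
  moreover have "x \<in> ?V" using s0 assms by (simp add: metric_arith c)
  ultimately show ?thesis using that open_coord_ball by blast
qed

lemma riem_dist_eq_0: "riem_dist M x y = 0 \<longleftrightarrow> x = y"
proof
  assume 0: "riem_dist M x y = 0"
  show "x = y"
  proof (rule ccontr)
    assume "x \<noteq> y"
    then have "open (- {y})" "x \<in> - {y}" by auto
    then obtain r where "r > 0" "\<And>z. riem_dist M x z < r \<Longrightarrow> z \<in> - {y}" by (rule ball_in_open) blast
    then show False using 0 by force
  qed
qed (simp add: riem_dist_refl)

sublocale D: Metric_space UNIV "riem_dist M"
  by unfold_locales (rule riem_dist_nonneg riem_dist_sym riem_dist_eq_0 riem_dist_triangle)+

text \<open>Balls and open sets of M are nested in each other by \<open>open_in_ball\<close> and
  \<open>ball_in_open\<close>. The identification makes the compactness criterion for complete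
  metric spaces available for the topology of M.\<close>

lemma mtopology_eq: "D.mtopology = euclidean"
proof (rule topology_eq[THEN iffD2], rule allI)
  fix U :: "'a set"
  have "(\<forall>x\<in>U. \<exists>r>0. D.mball x r \<subseteq> U) \<longleftrightarrow> open U"
  proof
    assume L: "\<forall>x\<in>U. \<exists>r>0. D.mball x r \<subseteq> U"
    show "open U"
      unfolding open_subopen[of U]
    proof
      fix x assume "x \<in> U"
      then obtain r where r: "r > 0" "D.mball x r \<subseteq> U" using L by blast
      obtain V where "open V" "x \<in> V" "\<And>y. y \<in> V \<Longrightarrow> riem_dist M x y < r"
        using open_in_ball[OF r(1)] by metis
      then show "\<exists>T. open T \<and> x \<in> T \<and> T \<subseteq> U" using r(2) by (intro exI[of _ V]) (auto simp: D.mball_def)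
    qed
  next
    assume U: "open U"
    show "\<forall>x\<in>U. \<exists>r>0. D.mball x r \<subseteq> U"
    proof
      fix x assume "x \<in> U"
      with U obtain r where "r > 0" "\<And>y. riem_dist M x y < r \<Longrightarrow> y \<in> U" by (rule ball_in_open) blast
      then show "\<exists>r>0. D.mball x r \<subseteq> U" by (intro exI[of _ r]) auto
    qed
  qed
  then show "openin D.mtopology U = openin euclidean U" by (auto simp: D.openin_mtopology)
qed

lemma continuous_riem_dist: "continuous_on UNIV (\<lambda>y. riem_dist M x y)"
proof (rule continuous_at_imp_continuous_on, rule ballI, unfold isCont_def, rule tendstoI)
  fix y and e :: real assume "e > 0"
  then obtain V where V: "open V" "y \<in> V" "\<And>z. z \<in> V \<Longrightarrow> riem_dist M y z < e"
    using open_in_ball by metis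
  have "eventually (\<lambda>z. z \<in> V) (at y)" using V by (meson eventually_at_topological)
  then show "\<forall>\<^sub>F z in at y. dist (riem_dist M x z) (riem_dist M x y) < e"
  proof eventually_elim
    case (elim z)
    then show ?case
      using V(3)[OF elim] riem_dist_triangle[of x y z] riem_dist_triangle[of x z y] riem_dist_sym[of y z]
      by (simp add: dist_real_def abs_less_iff)
  qed
qed

lemma open_riem_ball: "open (riem_ball M x r)"
  unfolding riem_ball_def by (intro open_Collect_less continuous_riem_dist continuous_on_const)

lemma closed_riem_cball: "closed {y. riem_dist M x y \<le> r}"
  by (intro closed_Collect_le continuous_riem_dist continuous_on_const)

lemma ex_compact_cball: "\<exists>r>0. compact {y. riem_dist M x y \<le> r}"
proof -
  obtain s where s: "good_radius x 1 s" using ex_good_radius[OF zero_less_one open_UNIV UNIV_I] by metis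
  have s0: "s > 0" by (rule good_radiusD[OF s])
  note c = chart_at[of x]
  let ?c = "chart_at M x"
  let ?K = "inv_coord ?c ` {y. cnrm x (y - crd x x) \<le> s}"
  have K: "compact ?K"
    by (intro compact_continuous_image coord_ball_compact[OF s] continuous_on_subset[OF inv_coord(5)[OF c(1)]])
      (use good_radiusD(2)[OF s] in auto)
  let ?V = "{w \<in> cdom ?c. cnrm x (crd x w - crd x x) < s}"
  have "x \<in> ?V" using s0 by (simp add: metric_arith c)
  with open_coord_ball obtain r where r: "r > 0" "\<And>y. riem_dist M x y < r \<Longrightarrow> y \<in> ?V"
    by (rule ball_in_open) blast
  have "{y. riem_dist M x y \<le> r / 2} \<subseteq> ?K"
  proof
    fix y assume "y \<in> {y. riem_dist M x y \<le> r / 2}"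
    then have "y \<in> ?V" using r by (intro r(2)) simp
    then show "y \<in> ?K" using inv_coord(1)[OF c(1)] by (intro image_eqI[of _ _ "crd x y"]) auto
  qed
  then have "?K \<inter> {y. riem_dist M x y \<le> r / 2} = {y. riem_dist M x y \<le> r / 2}" by blast
  then have "compact {y. riem_dist M x y \<le> r / 2}"
    using compact_Int_closed[OF K closed_riem_cball[of x "r / 2"]] by simp
  then show ?thesis using r(1) by (intro exI[of _ "r / 2"]) simp
qed

text \<open>The distance is an infimum of lengths: an almost shortest curve is cut where its length
  reaches \<open>R\<close>, which the intermediate value theorem permits.\<close>

lemma ex_intermediate:
  assumes "0 < R" "0 < \<delta>" "riem_dist M x y < R + \<delta>"
  shows "\<exists>z. riem_dist M x z \<le> R \<and> riem_dist M z y < \<delta>"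
proof -
  obtain \<gamma> where \<gamma>: "pwC1 M \<gamma> 0 1" "\<gamma> 0 = x" "\<gamma> 1 = y" "clen M \<gamma> 0 1 < R + \<delta>"
    using riem_dist_approx[OF assms(3)] by metis
  show ?thesis
  proof (cases "clen M \<gamma> 0 1 \<le> R")
    case True
    then have "riem_dist M x y \<le> R" using riem_dist_le_clen[OF \<gamma>(1)] \<gamma> by simp
    then show ?thesis using assms(2) riem_dist_refl by metis
  next
    case False
    have "continuous_on {0..1} (\<lambda>t. clen M \<gamma> 0 t)"
      unfolding clen_def by (rule indefinite_integral_continuous_1[OF pwC1_speed(2)[OF \<gamma>(1)]])
    moreover have "clen M \<gamma> 0 0 \<le> R" using assms(1) by (simp add: clen_def)
    ultimately obtain t where t: "0 \<le> t" "t \<le> 1" "clen M \<gamma> 0 t = R"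
      using IVT'[of "\<lambda>t. clen M \<gamma> 0 t" 0 R 1] False by auto
    have "t \<noteq> 0" "t \<noteq> 1" using t False assms(1) by (auto simp: clen_def)
    then have p: "pwC1 M \<gamma> 0 t" "pwC1 M \<gamma> t 1" using t by (auto intro!: pwC1_restrict[OF \<gamma>(1)])
    have "riem_dist M (\<gamma> t) y < \<delta>"
      using riem_dist_le_clen[OF p(2)] clen_add[OF p] t \<gamma> by simp
    moreover have "riem_dist M x (\<gamma> t) \<le> R" using riem_dist_le_clen[OF p(1)] t \<gamma> by simp
    ultimately show ?thesis by blast
  qed
qed

end

section \<open>Compactness of closed balls\<close>

locale complete_riem_manifold = conn_riem_manifold +
  assumes complete: "riem_complete M"
begin

lemma mcomplete: "D.mcomplete"
  unfolding D.mcomplete_def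
proof (intro allI impI)
  fix s :: "nat \<Rightarrow> 'a" assume "D.MCauchy s"
  then have C: "\<forall>e>0. \<exists>N. \<forall>m\<ge>N. \<forall>n\<ge>N. riem_dist M (s m) (s n) < e"
    by (simp add: D.MCauchy_def)
  obtain l where "(\<lambda>n. riem_dist M (s n) l) \<longlonglongrightarrow> 0"
    by (rule exE[OF complete[unfolded riem_complete_def, THEN spec, THEN mp, OF C]])
  then show "\<exists>x. limitin D.mtopology s x sequentially"
    by (intro exI[of _ l]) (simp add: D.limitin_metric_dist_null)
qed

text \<open>Hopf and Rinow: the radii of compact closed balls form an open and closed set.\<close>

theorem compact_riem_cball: "compact {y. riem_dist M x y \<le> R}"
proof -
  let ?B = "\<lambda>R. {y. riem_dist M x y \<le> R}"
  have mono: "compact (?B r)" if "compact (?B R)" "r \<le> R" for r R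
  proof -
    have "?B R \<inter> ?B r = ?B r" using that(2) by auto
    then show ?thesis using compact_Int_closed[OF that(1) closed_riem_cball[of x r]] by simp
  qed
  \<comment> \<open>Openness: finitely many compact balls, already with half their radii, cover the
    ball of radius R. A point slightly further out is, by \<open>ex_intermediate\<close>, close to a
    point of that ball and hence within one of the full compact balls.\<close>
  have up: "\<exists>\<delta>>0. compact (?B (R + \<delta>))" if R: "R > 0" "compact (?B R)" for R
  proof -
    obtain r where r: "\<And>z. r z > 0" "\<And>z. compact {y. riem_dist M z y \<le> r z}"
      using ex_compact_cball by metis
    have "?B R \<subseteq> (\<Union>z\<in>UNIV. riem_ball M z (r z / 2))"
    proof
      fix y assume "y \<in> ?B R"
      have "y \<in> riem_ball M y (r y / 2)" using r(1)[of y] by (simp add: riem_ball_def riem_dist_refl)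
      then show "y \<in> (\<Union>z\<in>UNIV. riem_ball M z (r z / 2))" by blast
    qed
    then obtain I where I: "finite I" "?B R \<subseteq> (\<Union>z\<in>I. riem_ball M z (r z / 2))"
      by (rule compactE_image[OF R(2) open_riem_ball]) blast
    define \<delta> where "\<delta> = Min (insert 1 ((\<lambda>z. r z / 2) ` I))"
    have \<delta>: "\<delta> > 0" "\<And>z. z \<in> I \<Longrightarrow> \<delta> \<le> r z / 2"
      using I(1) r(1) unfolding \<delta>_def by (simp, intro Min_le) auto
    let ?K = "\<Union>z\<in>I. {y. riem_dist M z y \<le> r z}"
    have "?B (R + \<delta> / 2) \<subseteq> ?K"
    proof
      fix y assume "y \<in> ?B (R + \<delta> / 2)"
      then have "riem_dist M x y < R + \<delta>" using \<delta>(1) by simp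
      then obtain z where z: "riem_dist M x z \<le> R" "riem_dist M z y < \<delta>"
        using ex_intermediate[OF R(1) \<delta>(1)] by blast
      then obtain i where i: "i \<in> I" "riem_dist M i z < r i / 2" using I(2) by (auto simp: riem_ball_def)
      have "riem_dist M i y \<le> r i"
        using riem_dist_triangle[of i y z] i(2) z(2) \<delta>(2)[OF i(1)] by linarith
      then show "y \<in> ?K" using i(1) by blast
    qed
    then have eq: "?K \<inter> ?B (R + \<delta> / 2) = ?B (R + \<delta> / 2)" by blast
    have "compact ?K" using I(1) r(2) by (intro compact_UN) auto
    from compact_Int_closed[OF this closed_riem_cball[of x "R + \<delta> / 2"]]
    have "compact (?B (R + \<delta> / 2))" by (simp only: eq)
    then show ?thesis using \<delta>(1) by (intro exI[of _ "\<delta> / 2"]) simp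
  qed
  \<comment> \<open>Closedness: a finite net of a slightly smaller compact ball is, by
    \<open>ex_intermediate\<close>, a coarser net of the ball of radius R. So the latter is totally
    bounded, and completeness makes it compact.\<close>
  have lim: "compact (?B R)" if R: "R > 0" "\<And>r. r < R \<Longrightarrow> compact (?B r)" for R
  proof -
    have "D.mtotally_bounded (?B R)"
      unfolding D.mtotally_bounded_def
    proof (intro allI impI)
      fix e :: real assume e: "e > 0"
      define r where "r = max (R / 2) (R - e / 4)"
      have r: "0 < r" "r < R" "R < r + e / 2" using R(1) e by (auto simp: r_def)
      have "?B r \<subseteq> (\<Union>z\<in>?B r. riem_ball M z (e / 2))"
      proof
        fix y assume y: "y \<in> ?B r"
        have "y \<in> riem_ball M y (e / 2)" using e by (simp add: riem_ball_def riem_dist_refl)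
        then show "y \<in> (\<Union>z\<in>?B r. riem_ball M z (e / 2))" using y by blast
      qed
      then obtain K where K: "K \<subseteq> ?B r" "finite K" "?B r \<subseteq> (\<Union>z\<in>K. riem_ball M z (e / 2))"
        by (rule compactE_image[OF R(2)[OF r(2)] open_riem_ball]) blast
      have "?B R \<subseteq> (\<Union>z\<in>K. D.mball z e)"
      proof
        fix y assume "y \<in> ?B R"
        then have "riem_dist M x y < r + e / 2" using r(3) by simp
        then obtain z where z: "riem_dist M x z \<le> r" "riem_dist M z y < e / 2"
          using ex_intermediate[OF r(1), of "e / 2"] e by auto
        then obtain k where k: "k \<in> K" "riem_dist M k z < e / 2" using K(3) by (auto simp: riem_ball_def)
        have "riem_dist M k y < e" using riem_dist_triangle[of k y z] k z by linarith
        then show "y \<in> (\<Union>z\<in>K. D.mball z e)" using k(1) by auto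
      qed
      moreover have "K \<subseteq> ?B R" using K(1) r(2) by auto
      ultimately show "\<exists>K. finite K \<and> K \<subseteq> ?B R \<and> ?B R \<subseteq> (\<Union>z\<in>K. D.mball z e)" using K(2) by blast
    qed
    then have "compactin D.mtopology (D.mtopology closure_of (?B R))"
      using D.mtotally_bounded_eq_compact_closure_of[OF mcomplete] by blast
    then show ?thesis
      using closed_riem_cball[of x R] by (simp add: mtopology_eq closure_of_closedin compactin_euclidean_iff)
  qed
  show ?thesis
  proof (rule ccontr)
    assume R: "\<not> compact (?B R)"
    define S where "S = {r. \<not> compact (?B r)}"
    obtain r0 where r0: "r0 > 0" "compact (?B r0)" using ex_compact_cball by blast
    have S_gt: "r0 < r" if "r \<in> S" for r
    proof (rule ccontr)
      assume "\<not> r0 < r"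
      then have "compact (?B r)" by (intro mono[OF r0(2)]) simp
      then show False using that by (simp add: S_def)
    qed
    define s where "s = Inf S"
    have "S \<noteq> {}" using R by (auto simp: S_def)
    then have s: "r0 \<le> s" unfolding s_def using S_gt by (intro cInf_greatest) (auto intro: less_imp_le)
    have "bdd_below S" using S_gt by (intro bdd_belowI[of _ r0]) (auto intro: less_imp_le)
    have below: "compact (?B r)" if "r < s" for r
    proof (rule ccontr)
      assume "\<not> compact (?B r)"
      then have "s \<le> r" unfolding s_def using \<open>bdd_below S\<close> by (intro cInf_lower) (simp_all add: S_def)
      then show False using that by simp
    qed
    have "compact (?B s)" by (rule lim[OF _ below]) (use s r0(1) in simp_all)
    moreover have "s > 0" using s r0(1) by simp
    ultimately obtain \<delta> where \<delta>: "\<delta> > 0" "compact (?B (s + \<delta>))" using up[of s] by blast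
    have "\<exists>r\<in>S. r < s + \<delta>"
      by (rule cInf_lessD[OF \<open>S \<noteq> {}\<close>]) (use \<delta>(1) in \<open>simp add: s_def\<close>)
    then obtain r where r: "r \<in> S" "r < s + \<delta>" by blast
    have "compact (?B r)" using r(2) by (intro mono[OF \<delta>(2)]) simp
    then show False using r(1) by (simp add: S_def)
  qed
qed

end

section \<open>A C^1 substitute for the distance function\<close>

context complete_riem_manifold begin

lemma ex_uniform_charts:
  assumes K: "compact K" and e: "e > 0"
  obtains \<sigma> where "0 < \<sigma>" "\<sigma> \<le> 1"
    "\<And>p. p \<in> K \<Longrightarrow> \<exists>z s. good_radius z e s \<and> p \<in> cdom (chart_at M z) \<and>
       cnrm z (crd z p - crd z z) \<le> s / 2 \<and> 2 * \<sigma> \<le> s"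
proof -
  have "\<forall>z. \<exists>s. good_radius z e s" using ex_good_radius[OF e open_UNIV UNIV_I] by metis
  then obtain s where s: "\<And>z. good_radius z e (s z)" by metis
  have s0: "s z > 0" for z by (rule good_radiusD[OF s])
  let ?V = "\<lambda>z. {w \<in> cdom (chart_at M z). cnrm z (crd z w - crd z z) < s z / 2}"
  have "K \<subseteq> (\<Union>z\<in>UNIV. ?V z)"
  proof
    fix z assume "z \<in> K"
    have "z \<in> ?V z" using s0[of z] by (simp add: metric_arith chart_at)
    then show "z \<in> (\<Union>z\<in>UNIV. ?V z)" by blast
  qed
  then obtain J where J: "finite J" "K \<subseteq> (\<Union>z\<in>J. ?V z)"
    by (rule compactE_image[OF K open_coord_ball]) blast
  define \<sigma> where "\<sigma> = Min (insert 1 ((\<lambda>z. s z / 2) ` J))"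
  have "\<sigma> > 0" "\<sigma> \<le> 1" using J(1) s0 by (auto simp: \<sigma>_def)
  moreover have \<sigma>: "\<sigma> \<le> s z / 2" if "z \<in> J" for z
    unfolding \<sigma>_def using J(1) that by (intro Min_le) auto
  moreover have "\<exists>z s. good_radius z e s \<and> p \<in> cdom (chart_at M z) \<and>
       cnrm z (crd z p - crd z z) \<le> s / 2 \<and> 2 * \<sigma> \<le> s" if "p \<in> K" for p
  proof -
    obtain z where z: "z \<in> J" "p \<in> ?V z" using J(2) \<open>p \<in> K\<close> by blast
    then show ?thesis using s[of z] \<sigma>[OF z(1)] by (intro exI[of _ z] exI[of _ "s z"]) auto
  qed
  ultimately show ?thesis using that by blast
qed

end

lemma exp_divide_mono: "a \<le> b \<Longrightarrow> t > 0 \<Longrightarrow> exp (a / t) \<le> exp (b / t :: real)"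
  by (simp add: divide_right_mono)

text \<open>The profile of one cone of the soft minimum below: a smoothed \<open>exp (- b d)\<close> as a function of
  \<open>r = d\<^sup>2\<close>, cut off at \<open>d = \<sigma>\<close>.\<close>

definition cone_profile :: "real \<Rightarrow> real \<Rightarrow> real \<Rightarrow> real \<Rightarrow> real" where
  "cone_profile b \<delta> \<sigma> r = exp (- b * sqrt (\<delta>\<^sup>2 + r)) * (max 0 (1 - r / \<sigma>\<^sup>2))\<^sup>2"

definition cone_deriv_fun :: "real \<Rightarrow> real \<Rightarrow> real \<Rightarrow> real \<Rightarrow> real" where
  "cone_deriv_fun b \<delta> \<sigma> r = exp (- b * sqrt (\<delta>\<^sup>2 + r)) *
     (- (b * (max 0 (1 - r / \<sigma>\<^sup>2))\<^sup>2 / (2 * sqrt (\<delta>\<^sup>2 + r))) - 2 * max 0 (1 - r / \<sigma>\<^sup>2) / \<sigma>\<^sup>2)"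

lemma cone_deriv:
  assumes "\<delta> > 0" "\<sigma> > 0" "r \<ge> 0"
  shows "(cone_profile b \<delta> \<sigma> has_real_derivative cone_deriv_fun b \<delta> \<sigma> r) (at r)"
proof -
  have pos: "\<delta>\<^sup>2 + r > 0" using assms by (simp add: add_pos_nonneg)
  have "((\<lambda>r. sqrt (\<delta>\<^sup>2 + r)) has_real_derivative (1 / (2 * sqrt (\<delta>\<^sup>2 + r)))) (at r)"
    using pos by (auto intro!: derivative_eq_intros simp: field_simps)
  then have 1: "((\<lambda>r. exp (- b * sqrt (\<delta>\<^sup>2 + r))) has_real_derivative
      exp (- b * sqrt (\<delta>\<^sup>2 + r)) * (- b * (1 / (2 * sqrt (\<delta>\<^sup>2 + r))))) (at r)"
    by (intro DERIV_fun_exp DERIV_cmult)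
  have "((\<lambda>r. 1 - r / \<sigma>\<^sup>2) has_real_derivative (- 1 / \<sigma>\<^sup>2)) (at r)"
    using DERIV_diff[OF DERIV_const DERIV_cdivide[OF DERIV_ident, of "\<sigma>\<^sup>2"], of 1] by simp
  from DERIV_mult[OF 1 DERIV_chain2[OF pos_part_square_deriv this]]
  show ?thesis unfolding cone_profile_def cone_deriv_fun_def
    by (rule DERIV_cong) (simp add: algebra_simps)
qed

lemma cone_deriv_fun_continuous: "\<delta> > 0 \<Longrightarrow> \<sigma> > 0 \<Longrightarrow> continuous_on {0..} (cone_deriv_fun b \<delta> \<sigma>)"
  unfolding cone_deriv_fun_def by (intro continuous_intros) (auto simp: add_pos_nonneg pos_add_strict dest: add_nonneg_eq_0_iff[THEN iffD1, rotated 2])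

lemma cone_zero:
  assumes "\<sigma> > 0" "r \<ge> \<sigma>\<^sup>2"
  shows "cone_profile b \<delta> \<sigma> r = 0" "cone_deriv_fun b \<delta> \<sigma> r = 0"
proof -
  have "1 - r / \<sigma>\<^sup>2 \<le> 0" using assms by (simp add: field_simps)
  then have "max 0 (1 - r / \<sigma>\<^sup>2) = 0" by simp
  then show "cone_profile b \<delta> \<sigma> r = 0" "cone_deriv_fun b \<delta> \<sigma> r = 0" unfolding cone_profile_def cone_deriv_fun_def by simp_all
qed

lemma cone_nonneg: "0 \<le> cone_profile b \<delta> \<sigma> r"
  by (simp add: cone_profile_def)

lemma cone_le:
  assumes "r \<ge> 0" "b \<ge> 0"
  shows "cone_profile b \<delta> \<sigma> r \<le> exp (- (b * sqrt r))"
proof -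
  have t: "(max 0 (1 - r / \<sigma>\<^sup>2))\<^sup>2 \<le> 1" using assms by (intro power_le_one) auto
  have "sqrt r \<le> sqrt (\<delta>\<^sup>2 + r)" by simp
  then have "exp (- b * sqrt (\<delta>\<^sup>2 + r)) \<le> exp (- (b * sqrt r))"
    using assms(2) by (simp add: mult_left_mono)
  with t show ?thesis
    unfolding cone_profile_def using mult_mono[of "exp (- b * sqrt (\<delta>\<^sup>2 + r))" "exp (- (b * sqrt r))" "(max 0 (1 - r / \<sigma>\<^sup>2))\<^sup>2" 1] by simp
qed

text \<open>Let t = 1 - r/\<sigma>^2, so that the cut-off factor is t^2. The exponential contributes
  at most b times the profile, and the cut-off at most 4t/\<sigma> times the exponential. If t \<ge>
  4/(\<sigma> \<kappa>), the latter is at most \<kappa> times the profile. Otherwise t < 1/2 because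
  8 \<le> \<sigma> \<kappa>, so sqrt r \<ge> \<sigma>/2 and the contribution goes into the
  exceptional term, where the exponential is small.\<close>

lemma cone_deriv_fun_bound:
  assumes r: "r \<ge> 0" and \<delta>: "\<delta> > 0" and \<sigma>: "\<sigma> > 0" and b: "b \<ge> 0" and \<kappa>: "8 \<le> \<sigma> * \<kappa>"
  shows "2 * \<bar>cone_deriv_fun b \<delta> \<sigma> r\<bar> * sqrt r \<le> (b + \<kappa>) * cone_profile b \<delta> \<sigma> r +
    (if \<sigma> / 2 \<le> sqrt r \<and> r < \<sigma>\<^sup>2 then 4 / \<sigma> * exp (- (b * sqrt r)) else 0)"
proof (cases "r < \<sigma>\<^sup>2")
  case True
  define t where "t = 1 - r / \<sigma>\<^sup>2"
  have t: "0 < t" "t \<le> 1" using True r \<sigma> by (auto simp: t_def)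
  have mt: "max 0 (1 - r / \<sigma>\<^sup>2) = t" using t by (simp add: t_def)
  define E where "E = exp (- b * sqrt (\<delta>\<^sup>2 + r))"
  define q where "q = sqrt (\<delta>\<^sup>2 + r)"
  have q: "q > 0" "sqrt r \<le> q" using r \<delta> by (auto simp: q_def add_pos_nonneg)
  have sr: "sqrt r < \<sigma>" "0 \<le> sqrt r" using True \<sigma> r by (auto intro: real_less_lsqrt)
  have E: "E > 0" "E \<le> exp (- (b * sqrt r))"
    using b q(2) unfolding E_def q_def[symmetric] by (auto simp: mult_left_mono)
  have ab: "\<bar>cone_deriv_fun b \<delta> \<sigma> r\<bar> = E * (b * t\<^sup>2 / (2 * q) + 2 * t / \<sigma>\<^sup>2)"
  proof -
    have nn: "0 \<le> b * t\<^sup>2 / (2 * q)" "0 \<le> 2 * t / \<sigma>\<^sup>2" using b q t by auto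
    have "cone_deriv_fun b \<delta> \<sigma> r = - (E * (b * t\<^sup>2 / (2 * q) + 2 * t / \<sigma>\<^sup>2))"
      unfolding cone_deriv_fun_def mt E_def q_def by (simp add: algebra_simps)
    then show ?thesis using E(1) nn by simp
  qed
  have "2 * \<bar>cone_deriv_fun b \<delta> \<sigma> r\<bar> * sqrt r = E * (b * t\<^sup>2 * (sqrt r / q)) + E * (4 / \<sigma> * t) * (sqrt r / \<sigma>)"
    unfolding ab using q \<sigma> by (simp add: field_simps power2_eq_square)
  also have "\<dots> \<le> E * (b * t\<^sup>2 * 1) + E * (4 / \<sigma> * t) * 1"
    using E q sr \<sigma> b t by (intro add_mono mult_left_mono) auto
  finally have 1: "2 * \<bar>cone_deriv_fun b \<delta> \<sigma> r\<bar> * sqrt r \<le> b * (E * t\<^sup>2) + E * (4 / \<sigma> * t)" by (simp add: mult_ac)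
  have ct: "cone_profile b \<delta> \<sigma> r = E * t\<^sup>2" unfolding cone_profile_def mt E_def ..
  show ?thesis
  proof (cases "4 / \<sigma> \<le> \<kappa> * t")
    case True
    then have "E * (4 / \<sigma> * t) \<le> E * (\<kappa> * t * t)" using E t by (intro mult_left_mono mult_right_mono) auto
    also have "\<dots> = \<kappa> * cone_profile b \<delta> \<sigma> r" by (simp add: ct power2_eq_square mult_ac)
    finally have "2 * \<bar>cone_deriv_fun b \<delta> \<sigma> r\<bar> * sqrt r \<le> (b + \<kappa>) * cone_profile b \<delta> \<sigma> r"
      using 1 by (simp add: ct distrib_right)
    moreover have "0 \<le> 4 / \<sigma> * exp (- (b * sqrt r))" using \<sigma> by simp
    ultimately show ?thesis by simp
  next
    case False
    have "\<sigma> * \<kappa> * t < 4" using False \<sigma> by (simp add: field_simps)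
    moreover have "8 * t \<le> \<sigma> * \<kappa> * t" using \<kappa> t by (intro mult_right_mono) auto
    ultimately have "t < 1 / 2" by simp
    then have "(\<sigma> / 2)\<^sup>2 \<le> r" using \<sigma> r by (simp add: t_def field_simps power2_eq_square)
    then have far: "\<sigma> / 2 \<le> sqrt r" by (rule real_le_rsqrt)
    have "E * (4 / \<sigma> * t) \<le> exp (- (b * sqrt r)) * (4 / \<sigma> * 1)"
      using E t \<sigma> by (intro mult_mono mult_left_mono) auto
    moreover have "0 \<le> \<kappa> * cone_profile b \<delta> \<sigma> r"
    proof -
      have "\<kappa> > 0" using \<kappa> \<sigma> zero_less_mult_pos[of \<sigma> \<kappa>] by linarith
      then show ?thesis using cone_nonneg by simp
    qed
    ultimately show ?thesis using 1 far \<open>r < \<sigma>\<^sup>2\<close> by (simp add: ct distrib_right mult.commute)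
  qed
next
  case False
  then have "cone_profile b \<delta> \<sigma> r = 0" "cone_deriv_fun b \<delta> \<sigma> r = 0" using cone_zero[OF \<sigma>, of r] by simp_all
  then show ?thesis using False by simp
qed

context complete_riem_manifold begin

text \<open>The soft minimum \<open>- \<tau> log (\<Sum>\<^sub>p exp (- (dist x0 p + d\<^sub>p) / \<tau>))\<close> of cones \<open>d\<^sub>p\<close> with slope slightly
  larger than 1 over a fine finite net of points \<open>p\<close>: as the slope is larger than 1, the cut-offs of
  the cones are negligible against the sum when \<open>\<tau>\<close> is small.\<close>

theorem ex_C1_distance:
  assumes \<epsilon>: "0 < \<epsilon>" "\<epsilon> \<le> 1"
  obtains \<rho> where "C1_fun \<rho>"
    "\<And>c w v. c \<in> atlas M \<Longrightarrow> w \<in> cdom c \<Longrightarrow> \<bar>cdiff \<rho> c w v\<bar> \<le> (1 + \<epsilon>) * nrm c w v"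
    "\<And>w. \<rho> w \<le> riem_dist M x0 w + 1" "\<And>w. min (riem_dist M x0 w) (R + 1) - 1 / 2 \<le> \<rho> w"
proof -
  let ?r = "riem_dist M x0"
  \<comment> \<open>The slope obtained in the end is (1 + 4e)(1 + e), which is at most 1 +
    10e.\<close>
  define e where "e = \<epsilon> / 10"
  have e: "e > 0" "e \<le> 1 / 10" using \<epsilon> by (auto simp: e_def)
  define K where "K = {w. ?r w \<le> R + 1}"
  have K: "compact K" unfolding K_def by (rule compact_riem_cball)
  obtain \<sigma> where \<sigma>: "0 < \<sigma>" "\<sigma> \<le> 1"
    "\<And>p. p \<in> K \<Longrightarrow> \<exists>z s. good_radius z e s \<and> p \<in> cdom (chart_at M z) \<and>
       cnrm z (crd z p - crd z z) \<le> s / 2 \<and> 2 * \<sigma> \<le> s"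
    by (rule ex_uniform_charts[OF K e(1)]) blast
  obtain zz ss where zs: "\<And>p. p \<in> K \<Longrightarrow> good_radius (zz p) e (ss p)"
    "\<And>p. p \<in> K \<Longrightarrow> p \<in> cdom (chart_at M (zz p))"
    "\<And>p. p \<in> K \<Longrightarrow> cnrm (zz p) (crd (zz p) p - crd (zz p) (zz p)) \<le> ss p / 2"
    "\<And>p. p \<in> K \<Longrightarrow> 2 * \<sigma> \<le> ss p"
    using \<sigma>(3) by metis
  \<comment> \<open>Both the mesh of the net and the smoothing of the cones. Together they cost 2
    \<delta> + 4 \<delta> = e \<sigma> / 4 in the estimate \<open>lower\<close>.\<close>
  define \<delta> where "\<delta> = e * \<sigma> / 24"
  have \<delta>: "\<delta> > 0" "\<delta> \<le> \<sigma> / 2" using e \<sigma> by (auto simp: \<delta>_def mult_left_le_one_le)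
  let ?a = "\<lambda>p. crd (zz p) p"
  let ?V = "\<lambda>p. {w \<in> cdom (chart_at M (zz p)). cnrm (zz p) (crd (zz p) w - ?a p) < \<delta>}"
  have "K \<subseteq> (\<Union>p\<in>K. ?V p)"
  proof
    fix p assume p: "p \<in> K"
    have "p \<in> ?V p" using \<delta> zs(2)[OF p] by (simp add: metric_arith chart_at)
    then show "p \<in> (\<Union>p\<in>K. ?V p)" using p by blast
  qed
  then obtain P where P: "P \<subseteq> K" "finite P" "K \<subseteq> (\<Union>p\<in>P. ?V p)"
    by (rule compactE_image[OF K open_coord_ball]) blast
  \<comment> \<open>Counts the cones and, as one further summand, the constant
    \<open>c0\<close>.\<close>
  define N where "N = real (card P) + 1"
  have N: "N \<ge> 1" by (simp add: N_def)
  \<comment> \<open>The first bound makes 16 N \<tau> \<le> e \<sigma>, which controls the cut-offs;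
    the second makes the error \<tau> ln N of the soft minimum at most 1/4.\<close>
  define \<tau> where "\<tau> = min (e * \<sigma> / (16 * N)) (1 / (4 * N))"
  have \<tau>: "\<tau> > 0" "\<tau> \<le> e * \<sigma> / (16 * N)" "\<tau> \<le> 1 / (4 * N)" using e \<sigma> N by (auto simp: \<tau>_def)
  have \<tau>N: "16 * N * \<tau> \<le> e * \<sigma>" "4 * N * \<tau> \<le> 1" using \<tau>(2,3) N by (simp_all add: field_simps)
  have \<tau>1: "16 * \<tau> \<le> e * \<sigma>" "4 * \<tau> \<le> 1"
    using \<tau>N mult_right_mono[OF N less_imp_le[OF \<tau>(1)]] by linarith+
  \<comment> \<open>The cones have slope 1 + 2e, while distances in the charts are distorted by 1 +
    e at most. The surplus is at least e \<sigma> / 2 where the cut-offs act, more than the loss e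
    \<sigma> / 4 in \<open>lower\<close>.\<close>
  define b where "b = (1 + 2 * e) / \<tau>"
  have b: "b \<ge> 0" using e \<tau> by (simp add: b_def)
  define D where "D p w = sqrt (sqd (zz p) (?a p) w)" for p w
  have sq_nn: "0 \<le> sqd z a w" for z a w by (rule metric_nonneg[OF chart_at])
  have D_nn: "0 \<le> D p w" for p w by (simp add: D_def sq_nn)
  define \<Theta> where "\<Theta> p = radial (zz p) (?a p) (cone_profile b \<delta> \<sigma>)" for p
  have \<Theta>_nn: "0 \<le> \<Theta> p w" for p w by (simp add: \<Theta>_def radial_def cone_nonneg)
  \<comment> \<open>The exceptional term of \<open>cone_deriv_fun_bound\<close>, living in the outer
    half of the cone.\<close>
  define bad where "bad p w = (if w \<in> cdom (chart_at M (zz p)) \<and> \<sigma> / 2 \<le> D p w \<and> sqd (zz p) (?a p) w < \<sigma>\<^sup>2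
      then 4 / \<sigma> * exp (- (b * D p w)) else 0)" for p w
  have near: "cnrm (zz p) (y - crd (zz p) (zz p)) \<le> ss p"
    if p: "p \<in> K" and y: "cnrm (zz p) (y - ?a p) \<le> \<sigma>" for p y
  proof -
    have "cnrm (zz p) ((y - ?a p) + (?a p - crd (zz p) (zz p))) \<le> \<sigma> + ss p / 2"
      using nrm_triangle[OF chart_at, of "zz p" "y - ?a p" "?a p - crd (zz p) (zz p)"] y zs(3)[OF p] by linarith
    then show ?thesis using zs(4)[OF p] by simp
  qed
  have \<kappa>: "8 \<le> \<sigma> * (e / \<tau>)" using \<tau>1(1) \<tau>(1) by (simp add: field_simps)
  have \<Theta>: "C1_fun (\<Theta> p)" "\<And>c w v. c \<in> atlas M \<Longrightarrow> w \<in> cdom c \<Longrightarrow>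
      \<bar>cdiff (\<Theta> p) c w v\<bar> \<le> ((b + e / \<tau>) * \<Theta> p w + bad p w) * (1 + e) * nrm c w v" if p: "p \<in> K" for p
  proof -
    show "C1_fun (\<Theta> p)"
      unfolding \<Theta>_def
      by (rule C1_fun_radial(1), rule zs(1)[OF p], rule \<sigma>(1), erule near[OF p],
          erule cone_deriv[OF \<delta>(1) \<sigma>(1)], rule cone_deriv_fun_continuous[OF \<delta>(1) \<sigma>(1)],
          erule cone_zero(1)[OF \<sigma>(1)], erule cone_zero(2)[OF \<sigma>(1)], rule less_imp_le[OF e(1)])
    fix c w v assume c: "c \<in> atlas M" "w \<in> cdom c"
    let ?Q = "sqd (zz p) (?a p) w"
    have R: "\<bar>cdiff (\<Theta> p) c w v\<bar> \<le> (if w \<in> cdom (chart_at M (zz p))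
        then 2 * \<bar>cone_deriv_fun b \<delta> \<sigma> ?Q\<bar> * sqrt ?Q * (1 + e) else 0) * nrm c w v"
      unfolding \<Theta>_def
      by (rule C1_fun_radial(2), rule zs(1)[OF p], rule \<sigma>(1), erule near[OF p],
          erule cone_deriv[OF \<delta>(1) \<sigma>(1)], rule cone_deriv_fun_continuous[OF \<delta>(1) \<sigma>(1)],
          erule cone_zero(1)[OF \<sigma>(1)], erule cone_zero(2)[OF \<sigma>(1)], rule less_imp_le[OF e(1)],
          rule c(1), rule c(2))
    have "(if w \<in> cdom (chart_at M (zz p)) then 2 * \<bar>cone_deriv_fun b \<delta> \<sigma> ?Q\<bar> * sqrt ?Q * (1 + e) else 0)
        \<le> ((b + e / \<tau>) * \<Theta> p w + bad p w) * (1 + e)"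
    proof (cases "w \<in> cdom (chart_at M (zz p))")
      case True
      have Q_nn: "0 \<le> ?Q" by (rule sq_nn)
      have "2 * \<bar>cone_deriv_fun b \<delta> \<sigma> ?Q\<bar> * sqrt ?Q \<le> (b + e / \<tau>) * \<Theta> p w + bad p w"
      proof -
        have 1: "\<Theta> p w = cone_profile b \<delta> \<sigma> ?Q" using True by (simp add: \<Theta>_def radial_def)
        have 2: "bad p w = (if \<sigma> / 2 \<le> sqrt ?Q \<and> ?Q < \<sigma>\<^sup>2 then 4 / \<sigma> * exp (- (b * sqrt ?Q)) else 0)"
          unfolding bad_def D_def using True by (simp only: simp_thms)
        show ?thesis unfolding 1 2 by (rule cone_deriv_fun_bound[OF Q_nn \<delta>(1) \<sigma>(1) b \<kappa>])
      qed
      then show ?thesis using True e by (simp add: mult_right_mono)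
    next
      case False
      then show ?thesis using e \<tau> b \<sigma> by (simp add: \<Theta>_def radial_def bad_def)
    qed
    then show "\<bar>cdiff (\<Theta> p) c w v\<bar> \<le> ((b + e / \<tau>) * \<Theta> p w + bad p w) * (1 + e) * nrm c w v"
      by (rule order_trans[OF R mult_right_mono]) (simp add: metric_nonneg[OF c])
  qed
  have lip: "?r w \<le> ?r p + (1 + e) * D p w"
    if p: "p \<in> K" and w: "w \<in> cdom (chart_at M (zz p))" "sqd (zz p) (?a p) w < \<sigma>\<^sup>2" for p w
  proof -
    have "D p w \<le> \<sigma>" unfolding D_def using w(2) \<sigma>(1) by (intro real_le_lsqrt) auto
    then have 1: "cnrm (zz p) (crd (zz p) w - crd (zz p) (zz p)) \<le> ss p"
      unfolding D_def by (rule near[OF p])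
    have 2: "cnrm (zz p) (?a p - crd (zz p) (zz p)) \<le> ss p"
      using zs(3,4)[OF p] \<sigma>(1) by linarith
    have "riem_dist M p w \<le> (1 + e) * D p w"
      using near_riem_dist[OF zs(1)[OF p] 2 1] inv_coord(1)[OF chart_at(1)] w(1) zs(2)[OF p]
      by (simp add: D_def)
    then show ?thesis using riem_dist_triangle[of x0 w p] by linarith
  qed
  have exp_split: "exp (- ?r p / \<tau>) * exp (- (b * D p w)) \<le> exp (- (?r w + e * D p w) / \<tau>)"
    if p: "p \<in> K" and w: "w \<in> cdom (chart_at M (zz p))" "sqd (zz p) (?a p) w < \<sigma>\<^sup>2" for p w
  proof -
    have "- ?r p - (1 + 2 * e) * D p w \<le> - (?r w + e * D p w)"
      using lip[OF that] by (simp add: algebra_simps)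
    then have "(- ?r p - (1 + 2 * e) * D p w) / \<tau> \<le> - (?r w + e * D p w) / \<tau>"
      using \<tau>(1) by (intro divide_right_mono) auto
    then show ?thesis by (simp add: exp_add[symmetric] b_def diff_divide_distrib)
  qed
  \<comment> \<open>This constant keeps the argument of the logarithm positive where no cone
    reaches, and caps the soft minimum at the level R + 1.\<close>
  define c0 where "c0 = exp (- (R + 1) / \<tau>)"
  define S where "S w = (\<Sum>p\<in>P. exp (- ?r p / \<tau>) * \<Theta> p w)" for w
  have S_nn: "0 \<le> S w" for w unfolding S_def by (intro sum_nonneg mult_nonneg_nonneg \<Theta>_nn) auto
  have T: "c0 + S w > 0" for w using S_nn[of w] by (simp add: c0_def add_pos_nonneg)
  have upper: "c0 + S w \<le> N * exp (- min (?r w) (R + 1) / \<tau>)" for w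
  proof -
    have "exp (- ?r p / \<tau>) * \<Theta> p w \<le> exp (- min (?r w) (R + 1) / \<tau>)" if p: "p \<in> P" for p
    proof (cases "w \<in> cdom (chart_at M (zz p)) \<and> sqd (zz p) (?a p) w < \<sigma>\<^sup>2")
      case True
      have pK: "p \<in> K" using p P by blast
      have "exp (- ?r p / \<tau>) * \<Theta> p w \<le> exp (- ?r p / \<tau>) * exp (- (b * D p w))"
        using True cone_le[OF sq_nn b] by (intro mult_left_mono) (auto simp: \<Theta>_def radial_def D_def)
      also have "\<dots> \<le> exp (- (?r w + e * D p w) / \<tau>)" using True by (intro exp_split pK) auto
      also have "\<dots> \<le> exp (- min (?r w) (R + 1) / \<tau>)"
        using mult_nonneg_nonneg[of e "D p w"] e(1) D_nn[of p w] by (intro exp_divide_mono \<tau>(1)) linarith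
      finally show ?thesis .
    next
      case False
      then have "\<Theta> p w = 0" using cone_zero(1)[OF \<sigma>(1)] by (auto simp: \<Theta>_def radial_def)
      then show ?thesis by simp
    qed
    then have "S w \<le> (\<Sum>p\<in>P. exp (- min (?r w) (R + 1) / \<tau>))" unfolding S_def by (rule sum_mono)
    moreover have "c0 \<le> exp (- min (?r w) (R + 1) / \<tau>)"
      unfolding c0_def by (intro exp_divide_mono \<tau>(1)) linarith
    ultimately show ?thesis by (simp add: N_def distrib_right)
  qed
  \<comment> \<open>Inside \<open>K\<close> a single nearby net point gives the bound: the cut-off
    there is at least 1/2, whence the factor 1/4 after squaring. Outside \<open>K\<close> the
    constant \<open>c0\<close> suffices. After the logarithm this is the upper bound for \<rho>, and
    \<open>upper\<close> is the lower one.\<close>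
  have lower: "exp (- (?r w + e * \<sigma> / 4) / \<tau>) / 4 \<le> c0 + S w" for w
  proof (cases "w \<in> K")
    case True
    then obtain p where p: "p \<in> P" "w \<in> cdom (chart_at M (zz p))" "D p w < \<delta>"
      using P(3) by (auto simp: D_def)
    have pK: "p \<in> K" using p P by blast
    let ?Q = "sqd (zz p) (?a p) w"
    have Q: "?Q \<le> \<delta>\<^sup>2" 
    proof -
      have "?Q = (D p w)\<^sup>2" unfolding D_def by (rule real_sqrt_pow2[symmetric]) (rule sq_nn)
      also have "\<dots> \<le> \<delta>\<^sup>2" using p(3) D_nn[of p w] by (intro power_mono) auto
      finally show ?thesis .
    qed
    have \<delta>\<sigma>: "\<delta>\<^sup>2 \<le> (\<sigma> / 2)\<^sup>2" using \<delta> by (intro power_mono) auto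
    then have Q4: "?Q \<le> \<sigma>\<^sup>2 / 4" using Q by (simp add: power_divide)
    then have Q\<sigma>: "?Q < \<sigma>\<^sup>2" using zero_less_power[OF \<sigma>(1), of 2] by linarith
    have "riem_dist M w p \<le> (1 + e) * D p w"
    proof -
      have "D p w \<le> \<sigma>" unfolding D_def using Q\<sigma> \<sigma>(1) by (intro real_le_lsqrt) auto
      then have 1: "cnrm (zz p) (crd (zz p) w - crd (zz p) (zz p)) \<le> ss p"
        unfolding D_def by (rule near[OF pK])
      have 2: "cnrm (zz p) (?a p - crd (zz p) (zz p)) \<le> ss p"
        using zs(3,4)[OF pK] \<sigma>(1) by linarith
      show ?thesis
        using near_riem_dist[OF zs(1)[OF pK] 2 1] inv_coord(1)[OF chart_at(1)] p(2) zs(2)[OF pK]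
        by (simp add: D_def riem_dist_sym)
    qed
    also have "\<dots> \<le> 2 * \<delta>" using e p(3) D_nn[of p w] by (intro mult_mono) auto
    finally have rp: "?r p \<le> ?r w + 2 * \<delta>" using riem_dist_triangle[of x0 p w] by linarith
    have "sqrt (\<delta>\<^sup>2 + ?Q) \<le> 2 * \<delta>"
    proof (rule real_le_lsqrt)
      have "(2 * \<delta>)\<^sup>2 = 4 * \<delta>\<^sup>2" by (simp add: power_mult_distrib)
      then show "\<delta>\<^sup>2 + ?Q \<le> (2 * \<delta>)\<^sup>2" using Q zero_le_power2[of \<delta>] by linarith
    qed (use \<delta>(1) in simp)
    then have "b * sqrt (\<delta>\<^sup>2 + ?Q) \<le> (2 / \<tau>) * (2 * \<delta>)"
      using e \<tau>(1) \<delta>(1) sq_nn by (intro mult_mono) (auto simp: b_def divide_right_mono)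
    then have 1: "exp (- (4 * \<delta> / \<tau>)) \<le> exp (- b * sqrt (\<delta>\<^sup>2 + ?Q))" by simp
    have "?Q / \<sigma>\<^sup>2 \<le> (\<sigma>\<^sup>2 / 4) / \<sigma>\<^sup>2" by (rule divide_right_mono[OF Q4]) simp
    also have "\<dots> = 1 / 4" using \<sigma>(1) by simp
    finally have "1 / 2 \<le> max 0 (1 - ?Q / \<sigma>\<^sup>2)" by linarith
    then have 2: "(1 / 2)\<^sup>2 \<le> (max 0 (1 - ?Q / \<sigma>\<^sup>2))\<^sup>2" by (rule power_mono) simp
    have 3: "exp (- (4 * \<delta> / \<tau>)) * (1 / 2)\<^sup>2 \<le> \<Theta> p w"
      using mult_mono[OF 1 2] p(2) by (simp add: \<Theta>_def radial_def cone_profile_def)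
    have 4: "exp (- (?r w + 2 * \<delta>) / \<tau>) \<le> exp (- ?r p / \<tau>)"
      using rp by (intro exp_divide_mono \<tau>(1)) linarith
    have "exp (- (?r w + e * \<sigma> / 4) / \<tau>) = exp (- (?r w + 2 * \<delta>) / \<tau>) * exp (- (4 * \<delta> / \<tau>))"
    proof -
      have "- (?r w + e * \<sigma> / 4) / \<tau> = - (?r w + 2 * \<delta>) / \<tau> + - (4 * \<delta> / \<tau>)"
        using \<tau>(1) by (simp add: \<delta>_def field_simps)
      then show ?thesis by (simp only: exp_add)
    qed
    then have "exp (- (?r w + e * \<sigma> / 4) / \<tau>) / 4 \<le> exp (- ?r p / \<tau>) * \<Theta> p w"
      using mult_mono[OF 4 3] by (simp add: power2_eq_square)
    also have "\<dots> \<le> S w"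
      unfolding S_def using p(1) P(2) \<Theta>_nn by (intro member_le_sum) auto
    finally show ?thesis by (simp add: c0_def add_increasing)
  next
    case False
    have "exp (- (?r w + e * \<sigma> / 4) / \<tau>) \<le> c0"
      unfolding c0_def using False mult_pos_pos[OF e(1) \<sigma>(1)]
      by (intro exp_divide_mono \<tau>(1)) (simp add: K_def)
    moreover have "0 < exp (- (?r w + e * \<sigma> / 4) / \<tau>)" by simp
    ultimately show ?thesis using S_nn[of w] by linarith
  qed
  have grad: "\<bar>cdiff S c w v\<bar> \<le> (1 + \<epsilon>) / \<tau> * (c0 + S w) * nrm c w v" if c: "c \<in> atlas M" "w \<in> cdom c" for c w v
  proof -
    \<comment> \<open>By the surplus slope all cut-off terms are bounded by the exponential
      occurring in \<open>lower\<close>, hence by 16 N / \<sigma> times c0 + S, and 16 N / \<sigma>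
      \<le> e / \<tau>.\<close>
    have bad_le: "exp (- ?r p / \<tau>) * bad p w \<le> 4 / \<sigma> * exp (- (?r w + e * \<sigma> / 2) / \<tau>)" if p: "p \<in> P" for p
    proof (cases "w \<in> cdom (chart_at M (zz p)) \<and> \<sigma> / 2 \<le> D p w \<and> sqd (zz p) (?a p) w < \<sigma>\<^sup>2")
      case True
      have pK: "p \<in> K" using p P by blast
      have "exp (- ?r p / \<tau>) * exp (- (b * D p w)) \<le> exp (- (?r w + e * D p w) / \<tau>)"
        using True by (intro exp_split pK) auto
      also have "\<dots> \<le> exp (- (?r w + e * \<sigma> / 2) / \<tau>)"
        using True e(1) mult_left_mono[of "\<sigma> / 2" "D p w" e] by (intro exp_divide_mono \<tau>(1)) simp
      finally have "4 / \<sigma> * (exp (- ?r p / \<tau>) * exp (- (b * D p w))) \<le> 4 / \<sigma> * exp (- (?r w + e * \<sigma> / 2) / \<tau>)"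
        using \<sigma>(1) by (intro mult_left_mono) auto
      then show ?thesis using True by (simp add: bad_def mult.left_commute)
    next
      case False
      then show ?thesis using \<sigma>(1) by (auto simp: bad_def)
    qed
    have "(\<Sum>p\<in>P. exp (- ?r p / \<tau>) * bad p w) \<le> (\<Sum>p\<in>P. 4 / \<sigma> * exp (- (?r w + e * \<sigma> / 2) / \<tau>))"
      by (rule sum_mono[OF bad_le])
    also have "\<dots> = real (card P) * (4 / \<sigma> * exp (- (?r w + e * \<sigma> / 2) / \<tau>))" by simp
    also have "\<dots> \<le> N * (4 / \<sigma> * exp (- (?r w + e * \<sigma> / 2) / \<tau>))"
      using \<sigma>(1) by (intro mult_right_mono) (auto simp: N_def)
    also have "\<dots> = N * (4 / \<sigma>) * exp (- (?r w + e * \<sigma> / 2) / \<tau>)" by simp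
    also have "\<dots> \<le> N * (4 / \<sigma>) * exp (- (?r w + e * \<sigma> / 4) / \<tau>)"
      using \<sigma>(1) N e(1) mult_pos_pos[OF e(1) \<sigma>(1)]
      by (intro mult_left_mono exp_divide_mono \<tau>(1)) (auto simp: field_simps)
    also have "\<dots> \<le> N * (4 / \<sigma>) * (4 * (c0 + S w))"
      using lower[of w] N \<sigma>(1) by (intro mult_left_mono) auto
    also have "\<dots> = (16 * N / \<sigma>) * (c0 + S w)" by simp
    also have "\<dots> \<le> (e / \<tau>) * (c0 + S w)"
      using \<tau>N(1) \<tau>(1) \<sigma>(1) less_imp_le[OF T[of w]] by (intro mult_right_mono) (simp_all add: field_simps)
    finally have bads: "(\<Sum>p\<in>P. exp (- ?r p / \<tau>) * bad p w) \<le> (e / \<tau>) * (c0 + S w)" .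
    have "cdiff S c w v = (\<Sum>p\<in>P. exp (- ?r p / \<tau>) * cdiff (\<Theta> p) c w v)"
      unfolding S_def by (rule C1_fun_sum(2)[OF P(2) _ c]) (use \<Theta>(1) P(1) in blast)
    also have "\<bar>\<dots>\<bar> \<le> (\<Sum>p\<in>P. \<bar>exp (- ?r p / \<tau>) * cdiff (\<Theta> p) c w v\<bar>)" by (rule sum_abs)
    also have "\<dots> \<le> (\<Sum>p\<in>P. exp (- ?r p / \<tau>) * (((b + e / \<tau>) * \<Theta> p w + bad p w) * (1 + e) * nrm c w v))"
      unfolding abs_mult using \<Theta>(2)[OF _ c] P(1) by (intro sum_mono mult_mono) auto
    also have "\<dots> = ((b + e / \<tau>) * S w + (\<Sum>p\<in>P. exp (- ?r p / \<tau>) * bad p w)) * ((1 + e) * nrm c w v)"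
      unfolding S_def sum_distrib_left sum_distrib_right sum.distrib[symmetric]
      by (intro sum.cong refl) (simp add: algebra_simps add_divide_distrib)
    also have "\<dots> \<le> ((b + e / \<tau>) * (c0 + S w) + (e / \<tau>) * (c0 + S w)) * ((1 + e) * nrm c w v)"
      using bads b e \<tau>(1) metric_nonneg[OF c, of v]
      by (intro mult_right_mono add_mono mult_left_mono) (auto simp: c0_def)
    \<comment> \<open>The slope 1 + 2e of the cones plus e each for the inner and the outer part of
      the cut-offs, multiplied by the chart distortion 1 + e.\<close>
    also have "\<dots> = ((1 + 4 * e) * (1 + e)) / \<tau> * (c0 + S w) * nrm c w v"
      using \<tau>(1) by (simp add: b_def field_simps)
    also have "\<dots> \<le> (1 + \<epsilon>) / \<tau> * (c0 + S w) * nrm c w v"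
    proof -
      have "e * e \<le> 1 / 10 * e" using e by (intro mult_right_mono) auto
      moreover have "(1 + 4 * e) * (1 + e) = 1 + 5 * e + 4 * (e * e)" by (simp add: algebra_simps)
      moreover have "\<epsilon> = 10 * e" by (simp add: e_def)
      ultimately have "(1 + 4 * e) * (1 + e) \<le> 1 + \<epsilon>" using e by linarith
      then show ?thesis
        using \<tau>(1) less_imp_le[OF T[of w]] metric_nonneg[OF c, of v]
        by (intro mult_right_mono divide_right_mono) auto
    qed
    finally show ?thesis .
  qed
  define \<rho> where "\<rho> w = - \<tau> * ln (c0 + S w)" for w
  have C1S: "C1_fun S" unfolding S_def by (rule C1_fun_sum(1)[OF P(2)]) (use \<Theta>(1) P(1) in blast)
  have k: "((\<lambda>t. - \<tau> * ln (c0 + t)) has_real_derivative - \<tau> / (c0 + S w)) (at (S w))" for w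
    using T[of w] by (auto intro!: derivative_eq_intros)
  have k': "continuous_on (range S) (\<lambda>t. - \<tau> / (c0 + t))"
    using T by (intro continuous_intros) (auto simp: less_imp_neq[symmetric])
  note C\<rho> = C1_fun_compose[OF C1S, of "\<lambda>t. - \<tau> * ln (c0 + t)" "\<lambda>t. - \<tau> / (c0 + t)", OF k k', folded \<rho>_def]
  show ?thesis
  proof (rule that)
    show "C1_fun \<rho>" using C\<rho>(1) by (simp add: \<rho>_def[abs_def])
    fix c w v assume c: "c \<in> atlas M" "w \<in> cdom c"
    have "cdiff \<rho> c w v = - \<tau> / (c0 + S w) * cdiff S c w v"
      using C\<rho>(2)[OF c] by (simp add: \<rho>_def[abs_def])
    then have "\<bar>cdiff \<rho> c w v\<bar> = \<tau> / (c0 + S w) * \<bar>cdiff S c w v\<bar>"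
      using \<tau>(1) T[of w] by (simp add: abs_mult)
    also have "\<dots> \<le> \<tau> / (c0 + S w) * ((1 + \<epsilon>) / \<tau> * (c0 + S w) * nrm c w v)"
      using \<tau>(1) less_imp_le[OF T[of w]] by (intro mult_left_mono grad[OF c]) auto
    also have "\<dots> = (1 + \<epsilon>) * nrm c w v"
    proof -
      have "s / t * (a / s * t * n) = a * n" if "s > 0" "t > 0" for s t a n :: real
        using that by simp
      then show ?thesis using \<tau>(1) T[of w] by blast
    qed
    finally show "\<bar>cdiff \<rho> c w v\<bar> \<le> (1 + \<epsilon>) * nrm c w v" .
  next
    fix w
    have "ln (exp (- (?r w + e * \<sigma> / 4) / \<tau>) / 4) \<le> ln (c0 + S w)"
      using lower[of w] T[of w] by (intro ln_mono) auto
    then have "- (?r w + e * \<sigma> / 4) / \<tau> - ln 4 \<le> ln (c0 + S w)" by (simp add: ln_div)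
    then have "\<tau> * (- (?r w + e * \<sigma> / 4) / \<tau> - ln 4) \<le> \<tau> * ln (c0 + S w)"
      using \<tau>(1) by (intro mult_left_mono) auto
    moreover have "\<tau> * (a / \<tau> - c) = a - \<tau> * c" for a c
      using \<tau>(1) by (simp add: field_simps)
    ultimately have 1: "\<rho> w \<le> ?r w + e * \<sigma> / 4 + \<tau> * ln 4"
      by (simp add: \<rho>_def)
    have "ln (4 :: real) \<le> 4 - 1" by (rule ln_le_minus_one) simp
    then have "\<tau> * ln 4 \<le> (1 / 4) * 3" using \<tau>1(2) \<tau>(1) by (intro mult_mono) auto
    moreover have "e * \<sigma> \<le> 1 / 10 * 1" using e \<sigma> by (intro mult_mono) auto
    ultimately show "\<rho> w \<le> ?r w + 1" using 1 by simp
    have "ln (c0 + S w) \<le> ln (N * exp (- min (?r w) (R + 1) / \<tau>))"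
      using upper[of w] T[of w] N by (intro ln_mono) auto
    also have "\<dots> = ln N - min (?r w) (R + 1) / \<tau>" using N by (simp add: ln_mult)
    finally have "\<tau> * ln (c0 + S w) \<le> \<tau> * (ln N - min (?r w) (R + 1) / \<tau>)"
      using \<tau>(1) by (intro mult_left_mono) auto
    moreover have "\<tau> * (c - a / \<tau>) = \<tau> * c - a" for a c
      using \<tau>(1) by (simp add: field_simps)
    ultimately have 2: "min (?r w) (R + 1) - \<tau> * ln N \<le> \<rho> w"
      by (simp add: \<rho>_def)
    have "ln N \<le> N" using N ln_le_minus_one[of N] by linarith
    then have "\<tau> * ln N \<le> \<tau> * N" using \<tau>(1) by (intro mult_left_mono) auto
    moreover have "4 * (\<tau> * N) \<le> 1" using \<tau>N(2) by (simp add: mult_ac)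
    ultimately show "min (?r w) (R + 1) - 1 / 2 \<le> \<rho> w" using 2 by linarith
  qed
qed

end

section \<open>Gradients and measurability of vector fields\<close>

lemma continuous_on_det:
  fixes A :: "'s::topological_space \<Rightarrow> real ^ 'n::finite ^ 'n"
  assumes "\<And>i j. continuous_on S (\<lambda>s. A s $ i $ j)"
  shows "continuous_on S (\<lambda>s. det (A s))"
  unfolding det_def by (intro continuous_intros assms)

context riem_manifold begin

definition gram :: "('a, 'n) chart \<Rightarrow> 'a \<Rightarrow> real ^ 'n ^ 'n" where
  "gram c x = (\<chi> i j. metric M c x (axis i 1) (axis j 1))"

lemma gram_mult:
  assumes c: "c \<in> atlas M" "x \<in> cdom c"
  shows "(gram c x *v X) \<bullet> v = metric M c x X v"
proof -
  have "(gram c x *v X) \<bullet> v = (\<Sum>i\<in>UNIV. (\<Sum>j\<in>UNIV. metric M c x (axis i 1) (axis j 1) * X $ j) * v $ i)"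
    by (simp add: gram_def matrix_vector_mult_def inner_vec_def)
  also have "\<dots> = metric M c x v X"
    unfolding metric_expand[OF c, of v X] by (simp add: sum_distrib_left sum_distrib_right mult_ac)
  finally show ?thesis using metric_sym[OF c] by simp
qed

text \<open>On the segment from the identity to the Gram matrix all matrices are positive definite,
  hence injective; the determinant starts at 1 and never vanishes.\<close>

lemma det_gram_pos:
  assumes c: "c \<in> atlas M" "x \<in> cdom c"
  shows "det (gram c x) > 0"
proof -
  define A :: "real \<Rightarrow> real ^ 'n ^ 'n" where "A t = (1 - t) *\<^sub>R mat 1 + t *\<^sub>R gram c x" for t
  have nz: "det (A t) \<noteq> 0" if t: "0 \<le> t" "t \<le> 1" for t
  proof -
    have "v = 0" if "A t *v v = 0" for v
    proof (rule ccontr)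
      assume v: "v \<noteq> 0"
      have "(A t *v v) \<bullet> v = (1 - t) * (v \<bullet> v) + t * metric M c x v v"
        unfolding A_def by (simp add: matrix_vector_mult_add_rdistrib scaleR_matrix_vector_assoc[symmetric]
            inner_add_left gram_mult[OF c])
      moreover have "(1 - t) * (v \<bullet> v) + t * metric M c x v v > 0"
      proof (cases "t = 0")
        case False
        then show ?thesis using t v metric_pos[OF c v] by (intro add_nonneg_pos) auto
      qed (use v in simp)
      ultimately show False using that by simp
    qed
    then have "inj ((*v) (A t))"
      by (auto simp: inj_on_def) (metis eq_iff_diff_eq_0 matrix_vector_mult_diff_distrib)
    then show ?thesis
      using matrix_left_invertible_injective invertible_left_inverse invertible_det_nz by metis
  qed
  show ?thesis
  proof (rule ccontr)
    assume "\<not> det (gram c x) > 0"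
    then have "det (A 1) \<le> 0" "0 \<le> det (A 0)" by (simp_all add: A_def det_I)
    moreover have "continuous_on {0..1} (\<lambda>t. det (A t))"
      unfolding A_def by (intro continuous_on_det) (auto intro!: continuous_intros)
    ultimately obtain t where "0 \<le> t" "t \<le> 1" "det (A t) = 0"
      using IVT2'[of "\<lambda>t. det (A t)" 1 0 0] by auto
    then show False using nz by blast
  qed
qed

lemma vol_density_eq: "vol_density M c x = sqrt (det (gram c x))"
  by (simp add: vol_density_def gram_def)

lemma continuous_on_gram:
  assumes c: "c \<in> atlas M"
  shows "continuous_on (coord c ` cdom c) (\<lambda>y. gram c (inv_coord c y) $ i $ j)"
  unfolding gram_def by (simp add: smooth_onD(3)[OF metric_smooth[OF c]])

lemma continuous_on_density:
  assumes c: "c \<in> atlas M"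
  shows "continuous_on (coord c ` cdom c) (\<lambda>y. vol_density M c (inv_coord c y))"
  unfolding vol_density_eq by (intro continuous_intros continuous_on_det continuous_on_gram c)

text \<open>The vector that represents the differential with respect to the metric, written by
  Cramer's rule. This makes its continuity in the point evident.\<close>

definition gradv :: "('a \<Rightarrow> real) \<Rightarrow> ('a, 'n) vfield" where
  "gradv F c x = (\<chi> k. det (\<chi> i j. if j = k then cdiff F c x (axis i 1) else gram c x $ i $ j) / det (gram c x))"

lemma metric_gradv:
  assumes F: "C1_fun F" and c: "c \<in> atlas M" "x \<in> cdom c"
  shows "metric M c x (gradv F c x) v = cdiff F c x v"
proof -
  let ?b = "(\<chi> i. cdiff F c x (axis i 1)) :: real ^ 'n"
  have g: "gradv F c x = (\<chi> k. det (\<chi> i j. if j = k then ?b $ i else gram c x $ i $ j) / det (gram c x))"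
    by (simp only: gradv_def vec_lambda_beta)
  have "gram c x *v gradv F c x = ?b"
    by (rule cramer[THEN iffD2, OF _ g]) (use det_gram_pos[OF c] in simp)
  then have "metric M c x (gradv F c x) v = ?b \<bullet> v" using gram_mult[OF c] by metis
  also have "\<dots> = cdiff F c x v"
    unfolding has_derivative_vec_expand[OF C1_funD(3)[OF F c], of v] by (simp add: inner_vec_def mult.commute)
  finally show ?thesis .
qed

lemma change_comp_inverse:
  assumes "c \<in> atlas M" "d \<in> atlas M" "x \<in> cdom c" "x \<in> cdom d"
  shows "change_comp c d x (change_comp d c x v) = v"
  using change_comp_trans[OF assms(2,1,2,4,3,4)] change_comp_id[OF assms(2,4)] by simp

lemma metric_eqI:
  assumes c: "c \<in> atlas M" "x \<in> cdom c" and eq: "\<And>v. metric M c x X v = metric M c x Y v"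
  shows "X = Y"
proof (rule ccontr)
  assume "X \<noteq> Y"
  then have "metric M c x (X - Y) (X - Y) > 0" using metric_pos[OF c] by simp
  then show False using eq[of "X - Y"] by (simp add: metric_arith[OF c])
qed

lemma gradv_change:
  assumes F: "C1_fun F" and c: "c \<in> atlas M" "d \<in> atlas M" "x \<in> cdom c" "x \<in> cdom d"
  shows "gradv F d x = change_comp c d x (gradv F c x)"
proof (rule metric_eqI[OF c(2,4)])
  fix w
  have "metric M d x (change_comp c d x (gradv F c x)) w =
      metric M d x (change_comp c d x (gradv F c x)) (change_comp c d x (change_comp d c x w))"
    by (simp add: change_comp_inverse[OF c])
  also have "\<dots> = metric M c x (gradv F c x) (change_comp d c x w)"
    by (rule metric_change[OF c, symmetric])
  also have "\<dots> = cdiff F d x w"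
    by (simp add: metric_gradv[OF F c(1,3)] cdiff_change[OF F c])
  finally show "metric M d x (gradv F d x) w = metric M d x (change_comp c d x (gradv F c x)) w"
    by (simp add: metric_gradv[OF F c(2,4)])
qed

lemma continuous_on_gradv:
  assumes F: "C1_fun F" and c: "c \<in> atlas M"
  shows "continuous_on (cdom c) (gradv F c)"
proof -
  have 1: "continuous_on (coord c ` cdom c) (\<lambda>y. (if j = k then cdiff F c (inv_coord c y) (axis i 1) else gram c (inv_coord c y) $ i $ j))" for i j k
    by (cases "j = k") (simp_all add: C1_funD(4)[OF F c] continuous_on_gram[OF c])
  have nz: "det (gram c (inv_coord c y)) \<noteq> 0" if "y \<in> coord c ` cdom c" for y
    using det_gram_pos[OF c inv_coord(2)[OF c that]] by simp
  have "continuous_on (coord c ` cdom c) (\<lambda>y. gradv F c (inv_coord c y))"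
    unfolding gradv_def
    by (intro continuous_on_vec_lambda continuous_on_divide continuous_on_det continuous_on_gram c)
      (use 1 nz in auto)
  then have "continuous_on (cdom c) (\<lambda>x. gradv F c (inv_coord c (coord c x)))"
    by (rule continuous_on_compose2[OF _ inv_coord(4)[OF c]]) simp
  then show ?thesis by (rule continuous_on_eq) (simp add: inv_coord(1)[OF c])
qed

text \<open>By the Lindelof property countably many chart domains cover M, so measurability can be
  tested on each of them.\<close>

lemma measurable_on_charts:
  fixes f :: "'a \<Rightarrow> 'b::topological_space"
  assumes \<Omega>: "open \<Omega>"
    and f: "\<And>c. c \<in> atlas M \<Longrightarrow> f \<in> borel_measurable (restrict_space borel (\<Omega> \<inter> cdom c))"
  shows "f \<in> borel_measurable (restrict_space borel \<Omega>)"
proof -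
  obtain C where C: "C \<subseteq> cdom ` atlas M" "countable C" "\<Union>C = \<Union>(cdom ` atlas M)"
    using Lindelof[of "cdom ` atlas M"] chart_props(1) by (metis (no_types, lifting) imageE)
  show ?thesis
  proof (rule measurable_piecewise_restrict[OF C(2)])
    show "S \<inter> space (restrict_space borel \<Omega>) \<in> sets (restrict_space borel \<Omega>)" if "S \<in> C" for S
    proof -
      have "open S" using that C(1) chart_props(1) by blast
      then show ?thesis using \<Omega> by (auto simp: space_restrict_space sets_restrict_space intro!: image_eqI[of _ _ S])
    qed
    show "space (restrict_space borel \<Omega>) \<subseteq> \<Union>C" using C(3) atlas_cover by auto
    show "f \<in> borel_measurable (restrict_space (restrict_space borel \<Omega>) S)" if SC: "S \<in> C" for S
    proof -
      obtain c where c: "c \<in> atlas M" "S = cdom c" using SC C(1) by blast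
      have "restrict_space (restrict_space borel \<Omega>) S = restrict_space borel (\<Omega> \<inter> S)"
        using \<Omega> chart_props(1)[OF c(1)] c(2) by (intro restrict_restrict_space) auto
      then show ?thesis using f[OF c(1)] c(2) by simp
    qed
  qed
qed

lemma riem_inner_eq:
  assumes X: "measurable_vfield_on M \<Omega> X" and Y: "measurable_vfield_on M \<Omega> Y"
    and c: "c \<in> atlas M" "x \<in> \<Omega>" "x \<in> cdom c"
  shows "riem_inner M X Y x = metric M c x (X c x) (Y c x)"
proof -
  let ?d = "chart_at M x"
  note d = chart_at[of x]
  have "X ?d x = change_comp c ?d x (X c x)" "Y ?d x = change_comp c ?d x (Y c x)"
    using X Y c d unfolding measurable_vfield_on_def by blast+
  then show ?thesis
    unfolding riem_inner_def Let_def using metric_change[OF c(1) d(1) c(3) d(2)] by simp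
qed

lemma measurable_metric:
  assumes c: "c \<in> atlas M" and \<Omega>: "\<Omega> \<subseteq> cdom c"
    and [measurable]: "v \<in> borel_measurable (restrict_space borel \<Omega>)" "w \<in> borel_measurable (restrict_space borel \<Omega>)"
  shows "(\<lambda>x. metric M c x (v x) (w x)) \<in> borel_measurable (restrict_space borel \<Omega>)"
proof -
  have [measurable]: "(\<lambda>x. metric M c x (axis i 1) (axis j 1)) \<in> borel_measurable (restrict_space borel \<Omega>)" for i j
    using continuous_on_metric[OF c continuous_on_id continuous_on_const continuous_on_const, of \<Omega>] \<Omega>
    by (intro borel_measurable_continuous_on_restrict) auto
  have vn: "(\<lambda>v :: real ^ 'n. v $ i) \<in> borel_measurable borel" for i
    by (intro borel_measurable_continuous_onI continuous_intros)
  have [measurable]: "(\<lambda>x. v x $ i) \<in> borel_measurable (restrict_space borel \<Omega>)"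
    "(\<lambda>x. w x $ i) \<in> borel_measurable (restrict_space borel \<Omega>)" for i
    by (rule measurable_compose[OF _ vn], measurable)+
  have "(\<lambda>x. \<Sum>i\<in>UNIV. \<Sum>j\<in>UNIV. v x $ i * w x $ j * metric M c x (axis i 1) (axis j 1))
      \<in> borel_measurable (restrict_space borel \<Omega>)"
    by measurable
  moreover have "metric M c x (v x) (w x) =
      (\<Sum>i\<in>UNIV. \<Sum>j\<in>UNIV. v x $ i * w x $ j * metric M c x (axis i 1) (axis j 1))"
    if "x \<in> space (restrict_space borel \<Omega>)" for x
    using that \<Omega> by (intro metric_expand c) (auto simp: space_restrict_space)
  ultimately show ?thesis by (subst measurable_cong) auto
qed

lemma measurable_riem_inner:
  assumes \<Omega>: "open \<Omega>" and X: "measurable_vfield_on M \<Omega> X" and Y: "measurable_vfield_on M \<Omega> Y"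
  shows "riem_inner M X Y \<in> borel_measurable (restrict_space borel \<Omega>)"
proof (rule measurable_on_charts[OF \<Omega>])
  fix c assume c: "c \<in> atlas M"
  have "(\<lambda>x. metric M c x (X c x) (Y c x)) \<in> borel_measurable (restrict_space borel (\<Omega> \<inter> cdom c))"
    using X Y c unfolding measurable_vfield_on_def by (intro measurable_metric) auto
  then show "riem_inner M X Y \<in> borel_measurable (restrict_space borel (\<Omega> \<inter> cdom c))"
    by (rule measurable_cong[THEN iffD1, rotated])
      (auto simp: space_restrict_space riem_inner_eq[OF X Y c])
qed

lemma measurable_gradv:
  assumes F: "C1_fun F"
  shows "measurable_vfield_on M \<Omega> (gradv F)"
  unfolding measurable_vfield_on_def
proof (intro conjI ballI)
  fix c d x assume c: "c \<in> atlas M" "d \<in> atlas M" and x: "x \<in> \<Omega> \<inter> cdom c \<inter> cdom d"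
  show "gradv F d x = change_comp c d x (gradv F c x)"
    by (rule gradv_change[OF F c]) (use x in simp_all)
next
  fix c assume c: "c \<in> atlas M"
  show "gradv F c \<in> borel_measurable (restrict_space borel (\<Omega> \<inter> cdom c))"
    by (rule borel_measurable_continuous_on_restrict[OF continuous_on_subset[OF continuous_on_gradv[OF F c]]]) simp
qed

lemma riem_norm_nonneg: "0 \<le> riem_norm M X x"
  unfolding riem_norm_def riem_inner_def Let_def by (simp add: metric_nonneg chart_at)

end

section \<open>The volume measure and integration in charts\<close>

locale riem_volume = complete_riem_manifold M
  for M :: "('a::{t2_space, second_countable_topology}, 'n::finite) riemannian" +
  fixes vol :: "'a measure"
  assumes volume: "riemannian_volume M vol"
begin

lemma sets_vol [measurable_cong]: "sets vol = sets borel"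
  using volume unfolding riemannian_volume_def by blast

lemma space_vol [simp]: "space vol = UNIV"
  using sets_eq_imp_space_eq[OF sets_vol] by simp

text \<open>Off the image of the chart the values of \<open>inv_coord\<close> are arbitrary; a
  constant there makes the map Borel on the whole space.\<close>

definition inv_ext :: "('a, 'n) chart \<Rightarrow> real ^ 'n \<Rightarrow> 'a" where
  "inv_ext c y = (if y \<in> coord c ` cdom c then inv_coord c y else undefined)"

lemma measurable_inv_ext: "c \<in> atlas M \<Longrightarrow> inv_ext c \<in> borel_measurable borel"
  unfolding inv_ext_def[abs_def]
  by (intro borel_measurable_continuous_on_if inv_coord(5) continuous_on_const) (simp add: chart_props(2))

lemma measurable_density:
  "c \<in> atlas M \<Longrightarrow> (\<lambda>y. indicator (coord c ` cdom c) y * vol_density M c (inv_coord c y)) \<in> borel_measurable borel"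
  using borel_measurable_continuous_on_indicator[OF _ continuous_on_density, of c] chart_props(2)[of c] by simp

text \<open>The volume restricted to a chart and the image of Lebesgue measure with density under
  the inverse coordinates agree on Borel sets by the defining property of the volume, so they
  integrate alike.\<close>

lemma nn_integral_chart:
  assumes c: "c \<in> atlas M" and G: "G \<in> borel_measurable borel"
  shows "(\<integral>\<^sup>+x. G x * indicator (cdom c) x \<partial>vol) =
    (\<integral>\<^sup>+y. G (inv_ext c y) * ennreal (indicator (coord c ` cdom c) y * vol_density M c (inv_coord c y)) \<partial>lborel)"
proof -
  let ?W = "coord c ` cdom c"
  let ?d = "\<lambda>y. ennreal (indicator ?W y * vol_density M c (inv_coord c y))"
  have [measurable]: "?d \<in> borel_measurable borel" using measurable_density[OF c] by measurable
  have [measurable]: "inv_ext c \<in> borel_measurable borel" by (rule measurable_inv_ext[OF c])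
  have [measurable]: "cdom c \<in> sets borel" using chart_props(1)[OF c] by simp
  note [measurable] = G
  have "density vol (indicator (cdom c)) = distr (density lborel ?d) borel (inv_ext c)"
  proof (rule measure_eqI)
    fix A assume "A \<in> sets (density vol (indicator (cdom c)))"
    then have [measurable]: "A \<in> sets borel" by (simp add: sets_vol)
    have [measurable]: "inv_ext c -` A \<in> sets borel"
      using measurable_sets[OF measurable_inv_ext[OF c], of A] by simp
    have "emeasure (density vol (indicator (cdom c))) A = emeasure vol (A \<inter> cdom c)"
      by (subst emeasure_density) (auto simp: sets_vol nn_integral_indicator[symmetric] indicator_inter_arith mult.commute simp del: nn_integral_indicator)
    also have "\<dots> = (\<integral>\<^sup>+y\<in>coord c ` (A \<inter> cdom c). ennreal (vol_density M c (inv_coord c y)) \<partial>lborel)"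
      by (rule volume[unfolded riemannian_volume_def, THEN conjunct2, rule_format, OF c]) auto
    also have "\<dots> = (\<integral>\<^sup>+y. ?d y * indicator (inv_ext c -` A) y \<partial>lborel)"
    proof (rule nn_integral_cong)
      fix y
      show "ennreal (vol_density M c (inv_coord c y)) * indicator (coord c ` (A \<inter> cdom c)) y = ?d y * indicator (inv_ext c -` A) y"
        using coord_mem_iff[OF c, of y A] by (auto simp: indicator_def inv_ext_def)
    qed
    also have "\<dots> = emeasure (distr (density lborel ?d) borel (inv_ext c)) A"
      by (subst emeasure_distr, simp, simp, subst emeasure_density) simp_all
    finally show "emeasure (density vol (indicator (cdom c))) A = emeasure (distr (density lborel ?d) borel (inv_ext c)) A" .
  qed (simp add: sets_vol)
  then have "(\<integral>\<^sup>+x. G x \<partial>density vol (indicator (cdom c))) = (\<integral>\<^sup>+x. G x \<partial>distr (density lborel ?d) borel (inv_ext c))" by simp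
  moreover have "(\<integral>\<^sup>+x. G x \<partial>density vol (indicator (cdom c))) = (\<integral>\<^sup>+x. indicator (cdom c) x * G x \<partial>vol)"
    by (rule nn_integral_density) measurable
  moreover have "(\<integral>\<^sup>+x. G x \<partial>distr (density lborel ?d) borel (inv_ext c)) = (\<integral>\<^sup>+y. ?d y * G (inv_ext c y) \<partial>lborel)"
    by (subst nn_integral_distr, simp, simp add: G, subst nn_integral_density) simp_all
  ultimately show ?thesis by (simp add: mult.commute)
qed

text \<open>On the compact set \<open>K\<close> the volume density is bounded below, so an L^p bound
  for the volume is one for Lebesgue measure; as \<open>K\<close> has finite measure, \<bar>t\<bar>
  \<le> 1 + \<bar>t\<bar>^p turns it into integrability.\<close>

lemma chart_locally_integrable:
  assumes c: "c \<in> atlas M" and K: "compact K" "K \<subseteq> coord c ` cdom c"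
    and g: "g \<in> borel_measurable borel" and p: "1 \<le> p"
    and int: "(\<integral>\<^sup>+x. ennreal (\<bar>g x\<bar> powr p) * indicator (inv_coord c ` K) x \<partial>vol) < \<infinity>"
  shows "integrable lborel (\<lambda>y. indicator K y * g (inv_ext c y))"
proof -
  let ?W = "coord c ` cdom c"
  let ?d = "\<lambda>y. vol_density M c (inv_coord c y)"
  have [measurable]: "K \<in> sets borel" using K by (simp add: compact_imp_closed)
  have [measurable]: "inv_ext c \<in> borel_measurable borel" by (rule measurable_inv_ext[OF c])
  note [measurable] = g
  have pos: "?d y > 0" if "y \<in> K" for y
    using det_gram_pos[OF c inv_coord(2)[OF c]] that K(2) unfolding vol_density_eq by auto
  obtain m where m: "m > 0" "\<And>y. y \<in> K \<Longrightarrow> m \<le> ?d y"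
  proof (cases "K = {}")
    case False
    obtain z where "z \<in> K" "\<forall>y\<in>K. ?d z \<le> ?d y"
      using continuous_attains_inf[OF K(1) False continuous_on_subset[OF continuous_on_density[OF c] K(2)]] by blast
    then show ?thesis using that[of "?d z"] pos by blast
  qed (use that[of 1] in auto)
  have iK: "inv_coord c ` K \<subseteq> cdom c" using inv_coord(2)[OF c] K(2) by blast
  have "compact (inv_coord c ` K)"
    by (rule compact_continuous_image[OF continuous_on_subset[OF inv_coord(5)[OF c] K(2)] K(1)])
  then have [measurable]: "inv_coord c ` K \<in> sets borel" by (simp add: compact_imp_closed)
  have "(\<integral>\<^sup>+x. (ennreal (\<bar>g x\<bar> powr p) * indicator (inv_coord c ` K) x) * indicator (cdom c) x \<partial>vol) =
    (\<integral>\<^sup>+y. (ennreal (\<bar>g (inv_ext c y)\<bar> powr p) * indicator (inv_coord c ` K) (inv_ext c y)) * ennreal (indicator ?W y * ?d y) \<partial>lborel)"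
    by (rule nn_integral_chart[OF c]) measurable
  moreover have "(ennreal (\<bar>g x\<bar> powr p) * indicator (inv_coord c ` K) x) * indicator (cdom c) x =
     ennreal (\<bar>g x\<bar> powr p) * indicator (inv_coord c ` K) x" for x
    using iK by (auto simp: indicator_def)
  ultimately have fin: "(\<integral>\<^sup>+y. (ennreal (\<bar>g (inv_ext c y)\<bar> powr p) * indicator (inv_coord c ` K) (inv_ext c y)) * ennreal (indicator ?W y * ?d y) \<partial>lborel) < \<infinity>"
    using int by simp
  have le: "ennreal m * (ennreal (\<bar>g (inv_ext c y)\<bar> powr p) * indicator K y) \<le>
      (ennreal (\<bar>g (inv_ext c y)\<bar> powr p) * indicator (inv_coord c ` K) (inv_ext c y)) * ennreal (indicator ?W y * ?d y)" for y
  proof (cases "y \<in> K")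
    case True
    then have "y \<in> ?W" "inv_ext c y \<in> inv_coord c ` K" using K(2) by (auto simp: inv_ext_def)
    moreover have "ennreal m * ennreal (\<bar>g (inv_ext c y)\<bar> powr p) \<le> ennreal (?d y) * ennreal (\<bar>g (inv_ext c y)\<bar> powr p)"
      by (intro mult_right_mono ennreal_leI m(2) True) simp
    ultimately show ?thesis using True by (simp add: mult.commute)
  qed simp
  have "ennreal m * (\<integral>\<^sup>+y. ennreal (\<bar>g (inv_ext c y)\<bar> powr p) * indicator K y \<partial>lborel) < \<infinity>"
    by (subst nn_integral_cmult[symmetric], measurable, rule le_less_trans[OF nn_integral_mono[OF le] fin])
  then have fin2: "(\<integral>\<^sup>+y. ennreal (\<bar>g (inv_ext c y)\<bar> powr p) * indicator K y \<partial>lborel) < \<infinity>"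
    using m(1) by (auto simp: ennreal_mult_less_top)
  have fin3: "(\<integral>\<^sup>+y. indicator K y \<partial>lborel) < \<infinity>"
    using emeasure_compact_finite[OF K(1)] by simp
  show ?thesis
  proof (rule integrableI_bounded)
    have le2: "\<bar>t\<bar> \<le> 1 + \<bar>t\<bar> powr p" for t :: real
    proof (cases "\<bar>t\<bar> \<le> 1")
      case False
      then have "\<bar>t\<bar> powr 1 \<le> \<bar>t\<bar> powr p" using p by (intro powr_mono) auto
      then show ?thesis using False by simp
    qed (simp add: add_increasing2)
    have "(\<integral>\<^sup>+y. ennreal (norm (indicator K y * g (inv_ext c y))) \<partial>lborel) \<le>
       (\<integral>\<^sup>+y. indicator K y + ennreal (\<bar>g (inv_ext c y)\<bar> powr p) * indicator K y \<partial>lborel)"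
    proof (rule nn_integral_mono)
      fix y
      show "ennreal (norm (indicator K y * g (inv_ext c y))) \<le> indicator K y + ennreal (\<bar>g (inv_ext c y)\<bar> powr p) * indicator K y"
        using ennreal_leI[OF le2[of "g (inv_ext c y)"]] by (auto simp: indicator_def ennreal_plus)
    qed
    also have "\<dots> = (\<integral>\<^sup>+y. indicator K y \<partial>lborel) + (\<integral>\<^sup>+y. ennreal (\<bar>g (inv_ext c y)\<bar> powr p) * indicator K y \<partial>lborel)"
      by (rule nn_integral_add) measurable
    also have "\<dots> < \<infinity>" using fin2 fin3 by simp
    finally show "(\<integral>\<^sup>+y. ennreal (norm (indicator K y * g (inv_ext c y))) \<partial>lborel) < \<infinity>" .
  qed measurable
qed

end

section \<open>Admissible test functions composed of u and a C^1 function\<close>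

lemma powr_add_le:
  fixes a b p :: real
  assumes "0 \<le> a" "0 \<le> b" "0 \<le> p"
  shows "(a + b) powr p \<le> 2 powr p * (a powr p + b powr p)"
proof -
  have "(a + b) powr p \<le> (2 * max a b) powr p"
    using assms by (intro powr_mono2) auto
  also have "\<dots> = 2 powr p * max a b powr p" by (rule powr_mult)
  also have "\<dots> \<le> 2 powr p * (a powr p + b powr p)"
    by (intro mult_left_mono) (auto simp: max_def)
  finally show ?thesis .
qed

context riem_volume begin

lemma measurable_on_open:
  fixes f :: "'a \<Rightarrow> real"
  assumes "open \<Omega>" "f \<in> borel_measurable (restrict_space borel \<Omega>)"
  shows "(\<lambda>x. indicator \<Omega> x * f x) \<in> borel_measurable borel"
  using assms by (subst (asm) borel_measurable_restrict_space_iff) auto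

lemma set_integrable_bound_on:
  fixes f G :: "'a \<Rightarrow> real"
  assumes \<Omega>: "open \<Omega>" and G: "set_integrable vol \<Omega> G"
    and f: "f \<in> borel_measurable (restrict_space borel \<Omega>)" and le: "\<And>x. x \<in> \<Omega> \<Longrightarrow> \<bar>f x\<bar> \<le> G x"
  shows "set_integrable vol \<Omega> f"
  unfolding set_integrable_def
proof (rule Bochner_Integration.integrable_bound)
  show "integrable vol (\<lambda>x. indicator \<Omega> x *\<^sub>R G x)" using G by (simp add: set_integrable_def)
  show "(\<lambda>x. indicator \<Omega> x *\<^sub>R f x) \<in> borel_measurable vol"
    using measurable_on_open[OF \<Omega> f] by (simp add: measurable_cong_sets[OF sets_vol refl])
  show "AE x in vol. norm (indicator \<Omega> x *\<^sub>R f x) \<le> norm (indicator \<Omega> x *\<^sub>R G x)"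
    using le by (intro AE_I2) (auto simp: indicator_def intro: order_trans[OF _ abs_ge_self])
qed

text \<open>Supplies the local integrability in coordinates that
  \<open>weak_chain_product_rule\<close> asks for. The components of the gradient are controlled by
  its norm through Cauchy-Schwarz.\<close>

lemma W1p_chart_integrable:
  assumes p: "1 < p" and \<Omega>: "open \<Omega>" and u: "in_W1p M vol p \<Omega> u X"
    and c: "c \<in> atlas M" and K: "compact K" "K \<subseteq> coord c ` (\<Omega> \<inter> cdom c)"
  shows "integrable lborel (\<lambda>y. indicator K y * u (inv_coord c y))"
    and "integrable lborel (\<lambda>y. indicator K y * metric M c (inv_coord c y) (X c (inv_coord c y)) v)"
proof -
  have um: "u \<in> borel_measurable (restrict_space borel \<Omega>)" and X: "measurable_vfield_on M \<Omega> X"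
    and iu: "set_integrable vol \<Omega> (\<lambda>x. \<bar>u x\<bar> powr p)" and iX: "set_integrable vol \<Omega> (\<lambda>x. riem_norm M X x powr p)"
    using u unfolding in_W1p_def by blast+
  have KW: "K \<subseteq> coord c ` cdom c" using K(2) by blast
  have in\<Omega>: "inv_coord c y \<in> \<Omega>" "inv_coord c y \<in> cdom c" "inv_ext c y = inv_coord c y" if "y \<in> K" for y
    using that K(2) coord_mem_iff[OF c, of y \<Omega>] inv_coord(2)[OF c] KW by (auto simp: inv_ext_def)
  have iK: "compact (inv_coord c ` K)"
    by (rule compact_continuous_image[OF continuous_on_subset[OF inv_coord(5)[OF c] KW] K(1)])
  then have [measurable]: "inv_coord c ` K \<in> sets borel" by (simp add: compact_imp_closed)
  have fin: "(\<integral>\<^sup>+x. ennreal (\<bar>g x\<bar> powr p) * indicator (inv_coord c ` K) x \<partial>vol) < \<infinity>"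
    if G: "set_integrable vol \<Omega> G" and le: "\<And>x. x \<in> inv_coord c ` K \<Longrightarrow> \<bar>g x\<bar> powr p \<le> C * G x"
      and G0: "\<And>x. 0 \<le> G x" and C0: "C \<ge> 0" for g G :: "'a \<Rightarrow> real" and C :: real
  proof -
    have "(\<integral>\<^sup>+x. ennreal (\<bar>g x\<bar> powr p) * indicator (inv_coord c ` K) x \<partial>vol) \<le>
        (\<integral>\<^sup>+x. ennreal (C * (indicator \<Omega> x *\<^sub>R G x)) \<partial>vol)"
      using in\<Omega>(1) le by (intro nn_integral_mono) (auto simp: indicator_def intro!: ennreal_leI)
    also have "\<dots> < \<infinity>"
      using integrableD(2)[OF integrable_mult_right[OF G[unfolded set_integrable_def], of C]] G0 C0
      by (simp add: less_top abs_mult)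
    finally show ?thesis .
  qed
  have "integrable lborel (\<lambda>y. indicator K y * (indicator \<Omega> (inv_ext c y) * u (inv_ext c y)))"
    by (rule chart_locally_integrable[OF c K(1) KW measurable_on_open[OF \<Omega> um] less_imp_le[OF p] fin[OF iu, of _ 1]])
      (use in\<Omega>(1) in auto)
  moreover have "indicator K y * (indicator \<Omega> (inv_ext c y) * u (inv_ext c y)) = indicator K y * u (inv_coord c y)" for y
    using in\<Omega> by (auto simp: indicator_def)
  ultimately show "integrable lborel (\<lambda>y. indicator K y * u (inv_coord c y))" by simp
  let ?g = "\<lambda>x. indicator (\<Omega> \<inter> cdom c) x * metric M c x (X c x) v"
  have op: "open (\<Omega> \<inter> cdom c)" using \<Omega> chart_props(1)[OF c] by (rule open_Int)
  have gm: "?g \<in> borel_measurable borel"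
    using X c unfolding measurable_vfield_on_def by (intro measurable_on_open op measurable_metric) auto
  have "continuous_on (inv_coord c ` K) (\<lambda>x. nrm c x v)"
    using in\<Omega>(2) by (intro continuous_intros continuous_on_metric c) auto
  from compact_imp_bounded[OF compact_continuous_image[OF this iK]]
  obtain N where N0: "N > 0" "\<forall>z\<in>(\<lambda>x. nrm c x v) ` inv_coord c ` K. norm z \<le> N"
    unfolding bounded_pos by blast
  have N: "\<And>x. x \<in> inv_coord c ` K \<Longrightarrow> nrm c x v \<le> N" "N \<ge> 0"
  proof -
    fix x assume "x \<in> inv_coord c ` K"
    then have "norm (nrm c x v) \<le> N" using N0(2) by blast
    then show "nrm c x v \<le> N" by simp
  qed (use N0(1) in simp)
  have gle: "\<bar>?g x\<bar> powr p \<le> N powr p * riem_norm M X x powr p" if x: "x \<in> inv_coord c ` K" for x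
  proof -
    have xc: "x \<in> \<Omega>" "x \<in> cdom c" using x in\<Omega> by auto
    have "\<bar>?g x\<bar> \<le> nrm c x (X c x) * nrm c x v"
      using metric_Cauchy_Schwarz[OF c xc(2), of "X c x" v] xc by simp
    also have "nrm c x (X c x) = riem_norm M X x"
      using riem_inner_eq[OF X X c xc] by (simp add: riem_norm_def)
    also have "riem_norm M X x * nrm c x v \<le> riem_norm M X x * N"
      using N(1)[OF x] by (intro mult_left_mono riem_norm_nonneg)
    finally have "\<bar>?g x\<bar> powr p \<le> (riem_norm M X x * N) powr p" using p by (intro powr_mono2) auto
    then show ?thesis using N(2) by (simp add: powr_mult riem_norm_nonneg mult.commute)
  qed
  have "integrable lborel (\<lambda>y. indicator K y * ?g (inv_ext c y))"
    by (rule chart_locally_integrable[OF c K(1) KW gm less_imp_le[OF p] fin[OF iX gle]]) auto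
  moreover have "indicator K y * ?g (inv_ext c y) = indicator K y * metric M c (inv_coord c y) (X c (inv_coord c y)) v" for y
    using in\<Omega> by (auto simp: indicator_def)
  ultimately show "integrable lborel (\<lambda>y. indicator K y * metric M c (inv_coord c y) (X c (inv_coord c y)) v)" by simp
qed

lemma gradv_norm_le:
  assumes F: "C1_fun F" and c: "c \<in> atlas M" "x \<in> cdom c" and le: "\<And>v. \<bar>cdiff F c x v\<bar> \<le> L * nrm c x v" and L: "L \<ge> 0"
  shows "nrm c x (gradv F c x) \<le> L"
proof -
  let ?n = "nrm c x (gradv F c x)"
  have "?n * ?n = metric M c x (gradv F c x) (gradv F c x)" using metric_nonneg[OF c] by simp
  also have "\<dots> = cdiff F c x (gradv F c x)" by (rule metric_gradv[OF F c])
  also have "\<dots> \<le> L * ?n" using le[of "gradv F c x"] by linarith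
  finally have le2: "?n * ?n \<le> L * ?n" .
  have "n \<le> L" if "n * n \<le> L * n" "0 \<le> n" for n
    using that L by (cases "n = 0") (auto simp: mult_le_cancel_right)
  from this[OF le2] show ?thesis using metric_nonneg[OF c] by simp
qed

text \<open>What the chain and product rule predict as the gradient of h(u) \<kappa>, with
  \<open>h'\<close> standing for the derivative of h and \<open>X\<close> for the weak gradient of
  u.\<close>

definition test_field :: "(real \<Rightarrow> real) \<Rightarrow> (real \<Rightarrow> real) \<Rightarrow> ('a \<Rightarrow> real) \<Rightarrow> ('a, 'n) vfield \<Rightarrow> ('a \<Rightarrow> real) \<Rightarrow> ('a, 'n) vfield" where
  "test_field h h' u X \<kappa> c x = h (u x) *\<^sub>R gradv \<kappa> c x + (\<kappa> x * h' (u x)) *\<^sub>R X c x"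

lemma metric_test_field:
  assumes "C1_fun \<kappa>" "c \<in> atlas M" "x \<in> cdom c"
  shows "metric M c x (test_field h h' u X \<kappa> c x) v =
    h (u x) * cdiff \<kappa> c x v + \<kappa> x * h' (u x) * metric M c x (X c x) v"
  by (simp add: test_field_def metric_arith[OF assms(2,3)] metric_gradv[OF assms])

text \<open>\<open>weak_chain_product_rule\<close> in every chart identifies the gradient. The bound
  on \<open>h'\<close> and h(0) = 0 give \<bar>h(t)\<bar> \<le> B \<bar>t\<bar>, which keeps the
  function and its gradient in L^p; the vanishing of both h and h' on t \<le> 0 gives the condition
  off the positivity set of u.\<close>

proposition test_function_in_D_plus:
  assumes p: "1 < p" and u: "in_W1p_loc M vol p u X"
    and \<kappa>: "C1_fun \<kappa>" "\<And>x. 0 \<le> \<kappa> x" "compact C" "\<And>x. x \<notin> C \<Longrightarrow> \<kappa> x = 0"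
    and L: "L \<ge> 0" "\<And>c x v. c \<in> atlas M \<Longrightarrow> x \<in> cdom c \<Longrightarrow> \<bar>cdiff \<kappa> c x v\<bar> \<le> L * nrm c x v"
    and h: "\<And>t. (h has_real_derivative h' t) (at t)" "continuous_on UNIV h'" "\<And>t. \<bar>h' t\<bar> \<le> B"
    and h0: "\<And>t. 0 \<le> h t" "\<And>t. t \<le> 0 \<Longrightarrow> h t = 0" "\<And>t. t \<le> 0 \<Longrightarrow> h' t = 0"
  shows "(\<lambda>x. h (u x) * \<kappa> x, test_field h h' u X \<kappa>) \<in> D_plus M vol p {x. u x > 0}"
proof -
  let ?\<phi> = "\<lambda>x. h (u x) * \<kappa> x" and ?Y = "test_field h h' u X \<kappa>"
  have [measurable]: "h \<in> borel_measurable borel" "h' \<in> borel_measurable borel"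
    using h DERIV_continuous_on[of UNIV h h'] by (auto intro: borel_measurable_continuous_onI)
  have \<kappa>c: "continuous_on UNIV \<kappa>" by (rule C1_fun_continuous[OF \<kappa>(1)])
  have B0: "B \<ge> 0" using h(3)[of 0] by linarith
  have h_le: "\<bar>h t\<bar> \<le> B * \<bar>t\<bar>" for t
    using lipschitz_if_deriv_bounded[OF h(1,3), of t 0] h0(2)[of 0] by simp
  obtain N where N: "N \<ge> 0" "\<And>x. \<bar>\<kappa> x\<bar> \<le> N"
  proof -
    have "bounded (\<kappa> ` C)"
      by (rule compact_imp_bounded[OF compact_continuous_image[OF continuous_on_subset[OF \<kappa>c] \<kappa>(3)]]) simp
    then obtain b where b: "b > 0" "\<And>y. y \<in> \<kappa> ` C \<Longrightarrow> norm y \<le> b" unfolding bounded_pos by blast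
    have "\<bar>\<kappa> x\<bar> \<le> b" for x using b \<kappa>(4)[of x] by (cases "x \<in> C") auto
    then show ?thesis using that[of b] b(1) by simp
  qed
  have W: "in_W1p M vol p \<Omega> ?\<phi> ?Y" if \<Omega>: "open \<Omega>" "compact (closure \<Omega>)" for \<Omega>
  proof -
    have u\<Omega>: "in_W1p M vol p \<Omega> u X" using u \<Omega> unfolding in_W1p_loc_def by blast
    have um [measurable]: "u \<in> borel_measurable (restrict_space borel \<Omega>)" and X: "measurable_vfield_on M \<Omega> X"
      and iu: "set_integrable vol \<Omega> (\<lambda>x. \<bar>u x\<bar> powr p)" and iX: "set_integrable vol \<Omega> (\<lambda>x. riem_norm M X x powr p)"
      and wk: "\<And>c \<eta> v. c \<in> atlas M \<Longrightarrow> test_function_on (coord c ` (\<Omega> \<inter> cdom c)) \<eta> \<Longrightarrow>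
        (LINT y|lborel. u (inv_coord c y) * frechet_derivative \<eta> (at y) v) =
        - (LINT y|lborel. metric M c (inv_coord c y) (X c (inv_coord c y)) v * \<eta> y)"
      using u\<Omega> unfolding in_W1p_def by blast+
    have [measurable]: "\<kappa> \<in> borel_measurable (restrict_space borel A)" for A
      by (rule borel_measurable_continuous_on_restrict[OF continuous_on_subset[OF \<kappa>c]]) simp
    have \<phi>m: "?\<phi> \<in> borel_measurable (restrict_space borel \<Omega>)" by measurable
    have Ym: "measurable_vfield_on M \<Omega> ?Y"
      unfolding measurable_vfield_on_def
    proof (intro conjI ballI)
      fix c d x assume c: "c \<in> atlas M" "d \<in> atlas M" and x: "x \<in> \<Omega> \<inter> cdom c \<inter> cdom d"
      have xc: "x \<in> cdom c" "x \<in> cdom d" using x by auto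
      have "X d x = change_comp c d x (X c x)" using X c x unfolding measurable_vfield_on_def by blast
      then show "?Y d x = change_comp c d x (?Y c x)"
        using change_comp_linear[OF c xc] gradv_change[OF \<kappa>(1) c xc]
        by (simp add: test_field_def linear_add linear_cmul)
    next
      fix c assume c: "c \<in> atlas M"
      let ?R = "restrict_space borel (\<Omega> \<inter> cdom c)"
      have [measurable]: "X c \<in> borel_measurable ?R" using X c unfolding measurable_vfield_on_def by blast
      have [measurable]: "gradv \<kappa> c \<in> borel_measurable ?R"
        using measurable_gradv[OF \<kappa>(1)] c unfolding measurable_vfield_on_def by blast
      have "?R = restrict_space (restrict_space borel \<Omega>) (cdom c)"
        using \<Omega>(1) chart_props(1)[OF c] by (intro restrict_restrict_space[symmetric]) auto
      then have [measurable]: "u \<in> borel_measurable ?R" using um by (simp add: measurable_restrict_space1)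
      have "(\<lambda>x. h (u x) *\<^sub>R gradv \<kappa> c x + (\<kappa> x * h' (u x)) *\<^sub>R X c x) \<in> borel_measurable ?R" by measurable
      then show "?Y c \<in> borel_measurable ?R" unfolding test_field_def[abs_def] .
    qed
    have i1: "set_integrable vol \<Omega> (\<lambda>x. \<bar>?\<phi> x\<bar> powr p)"
    proof (rule set_integrable_bound_on[OF \<Omega>(1)])
      show "set_integrable vol \<Omega> (\<lambda>x. (B * N) powr p * \<bar>u x\<bar> powr p)"
        using iu by (rule set_integrable_mult_right)
      show "(\<lambda>x. \<bar>?\<phi> x\<bar> powr p) \<in> borel_measurable (restrict_space borel \<Omega>)" by measurable
      fix x
      have "\<bar>?\<phi> x\<bar> \<le> (B * \<bar>u x\<bar>) * N"
        unfolding abs_mult using h_le N B0 by (intro mult_mono) auto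
      then have "\<bar>?\<phi> x\<bar> powr p \<le> ((B * N) * \<bar>u x\<bar>) powr p" using p by (intro powr_mono2) (auto simp: mult_ac)
      then show "\<bar>\<bar>?\<phi> x\<bar> powr p\<bar> \<le> (B * N) powr p * \<bar>u x\<bar> powr p" using B0 N by (simp add: powr_mult)
    qed
    have Yle: "riem_norm M ?Y x \<le> (B * L) * \<bar>u x\<bar> + (N * B) * riem_norm M X x" for x
    proof -
      let ?c = "chart_at M x"
      note c = chart_at[of x]
      have rn: "riem_norm M Z x = nrm ?c x (Z ?c x)" for Z :: "('a, 'n) vfield"
        by (simp add: riem_norm_def riem_inner_def Let_def)
      have "riem_norm M ?Y x \<le> nrm ?c x (h (u x) *\<^sub>R gradv \<kappa> ?c x) + nrm ?c x ((\<kappa> x * h' (u x)) *\<^sub>R X ?c x)"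
        unfolding rn test_field_def by (rule nrm_triangle[OF c])
      also have "\<dots> = \<bar>h (u x)\<bar> * nrm ?c x (gradv \<kappa> ?c x) + (\<bar>\<kappa> x\<bar> * \<bar>h' (u x)\<bar>) * riem_norm M X x"
        unfolding nrm_scale[OF c] rn by (simp add: abs_mult)
      also have "\<dots> \<le> (B * \<bar>u x\<bar>) * L + (N * B) * riem_norm M X x"
        using h_le N h(3) B0 L gradv_norm_le[OF \<kappa>(1) c L(2)[OF c] L(1)] riem_norm_nonneg metric_nonneg[OF c]
        by (intro add_mono mult_mono) auto
      finally show ?thesis by (simp add: mult_ac)
    qed
    have i2: "set_integrable vol \<Omega> (\<lambda>x. riem_norm M ?Y x powr p)"
    proof (rule set_integrable_bound_on[OF \<Omega>(1)])
      show "set_integrable vol \<Omega> (\<lambda>x. 2 powr p * ((B * L) powr p * \<bar>u x\<bar> powr p + (N * B) powr p * riem_norm M X x powr p))"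
        using iu iX by (intro set_integrable_mult_right set_integral_add(1))
      have [measurable]: "riem_inner M ?Y ?Y \<in> borel_measurable (restrict_space borel \<Omega>)"
        by (rule measurable_riem_inner[OF \<Omega>(1) Ym Ym])
      show "(\<lambda>x. riem_norm M ?Y x powr p) \<in> borel_measurable (restrict_space borel \<Omega>)"
        unfolding riem_norm_def by measurable
      fix x
      have "riem_norm M ?Y x powr p \<le> ((B * L) * \<bar>u x\<bar> + (N * B) * riem_norm M X x) powr p"
        using p Yle riem_norm_nonneg by (intro powr_mono2) auto
      also have "\<dots> \<le> 2 powr p * (((B * L) * \<bar>u x\<bar>) powr p + ((N * B) * riem_norm M X x) powr p)"
        using B0 L N p riem_norm_nonneg by (intro powr_add_le) auto
      finally show "\<bar>riem_norm M ?Y x powr p\<bar> \<le> 2 powr p * ((B * L) powr p * \<bar>u x\<bar> powr p + (N * B) powr p * riem_norm M X x powr p)"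
        using B0 L N riem_norm_nonneg by (simp add: powr_mult)
    qed
    have wk': "(LINT y|lborel. ?\<phi> (inv_coord c y) * frechet_derivative \<eta> (at y) v) =
        - (LINT y|lborel. metric M c (inv_coord c y) (?Y c (inv_coord c y)) v * \<eta> y)"
      if c: "c \<in> atlas M" and \<eta>: "test_function_on (coord c ` (\<Omega> \<inter> cdom c)) \<eta>" for c \<eta> v
    proof -
      let ?W = "coord c ` (\<Omega> \<inter> cdom c)"
      have Wc: "?W \<subseteq> coord c ` cdom c" by blast
      have dk: "(\<kappa> \<circ> inv_coord c) differentiable at y" if "y \<in> ?W" for y
        using C1_funD(1)[OF \<kappa>(1) c] that by blast
      have ck: "continuous_on ?W (\<lambda>y. frechet_derivative (\<kappa> \<circ> inv_coord c) (at y) v)"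
        using \<kappa>(1) c unfolding C1_fun_def by (blast intro: continuous_on_subset[OF _ Wc])
      have "(LINT y|lborel. h (u (inv_coord c y)) * (\<kappa> \<circ> inv_coord c) y * frechet_derivative \<eta> (at y) v) =
        - (LINT y|lborel. (h' (u (inv_coord c y)) * metric M c (inv_coord c y) (X c (inv_coord c y)) v * (\<kappa> \<circ> inv_coord c) y
          + h (u (inv_coord c y)) * frechet_derivative (\<kappa> \<circ> inv_coord c) (at y) v) * \<eta> y)"
        by (rule weak_chain_product_rule[OF open_coord_image[OF c \<Omega>(1)] W1p_chart_integrable(1)[OF p \<Omega>(1) u\<Omega> c]
              W1p_chart_integrable(2)[OF p \<Omega>(1) u\<Omega> c] wk[OF c] h dk ck \<eta>])
      also have "(\<lambda>y. (h' (u (inv_coord c y)) * metric M c (inv_coord c y) (X c (inv_coord c y)) v * (\<kappa> \<circ> inv_coord c) y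
          + h (u (inv_coord c y)) * frechet_derivative (\<kappa> \<circ> inv_coord c) (at y) v) * \<eta> y) =
          (\<lambda>y. metric M c (inv_coord c y) (?Y c (inv_coord c y)) v * \<eta> y)" (is "?l = ?r")
      proof
        fix y
        show "?l y = ?r y"
        proof (cases "y \<in> ?W")
          case True
          then have y: "y \<in> coord c ` cdom c" by blast
          have "cdiff \<kappa> c (inv_coord c y) v = frechet_derivative (\<kappa> \<circ> inv_coord c) (at y) v"
            by (simp add: cdiff_def inv_coord(3)[OF c y])
          then show ?thesis
            by (simp add: metric_test_field[OF \<kappa>(1) c inv_coord(2)[OF c y]])
        next
          case False
          then have "\<eta> y = 0" using test_functionD(4,7)[OF \<eta>] by blast
          then show ?thesis by simp
        qed
      qed
      finally show ?thesis by (simp only: o_apply)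
    qed
    show ?thesis
      unfolding in_W1p_def by (intro conjI ballI allI impI \<phi>m Ym i1 i2 wk')
  qed
  have "closure {x. ?\<phi> x \<noteq> 0} \<subseteq> C"
    using \<kappa>(4) compact_imp_closed[OF \<kappa>(3)] by (intro closure_minimal) force+
  then have cpt: "compact (closure {x. ?\<phi> x \<noteq> 0})"
    using compact_Int_closed[OF \<kappa>(3) closed_closure] by (metis Int_absorb1)
  have zero: "riem_norm M ?Y x = 0" if "u x \<le> 0" for x
    using h0(2,3)[OF that] chart_at[of x]
    by (simp add: riem_norm_def riem_inner_def Let_def test_field_def metric_arith)
  show ?thesis
    unfolding D_plus_def in_W1p_loc_def
    using W cpt zero h0(1,2) \<kappa>(2) by (auto simp: not_less intro!: AE_I2)
qed

end

section \<open>Young's inequality and truncated powers\<close>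

text \<open>For positive w the right side is the maximum of the left side over z, attained at z =
  (p-1) w / d. This sharpness produces the constant in \<open>const_C0\<close>.\<close>

lemma Youngs_inequality_scaled:
  fixes z w d p :: real
  assumes "0 \<le> z" "0 \<le> w" "0 < d" "1 < p"
  shows "p * z powr (p - 1) * w - d * z powr p \<le> (p - 1) powr (p - 1) * w powr p / d powr (p - 1)"
proof (cases "z = 0 \<or> w = 0")
  case True
  then show ?thesis using assms by auto
next
  case False
  then have zw: "z > 0" "w > 0" using assms by auto
  \<comment> \<open>The two quantities whose weighted geometric mean is the mixed term, while their
    weighted arithmetic mean is the sum of the other two terms.\<close>
  define a where "a = p / (p - 1) * d * z powr p"
  define b where "b = p * (p - 1) powr (p - 1) * w powr p / d powr (p - 1)"
  have ab: "a > 0" "b > 0" using assms zw by (auto simp: a_def b_def)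
  have "a powr ((p - 1) / p) * b powr (1 / p) \<le> (p - 1) / p * a + 1 / p * b"
    using assms ab by (intro Youngs_inequality_0) (auto simp: field_simps)
  also have "\<dots> = d * z powr p + (p - 1) powr (p - 1) * w powr p / d powr (p - 1)"
    using assms by (simp add: a_def b_def field_simps)
  also have "a powr ((p - 1) / p) * b powr (1 / p) = p * z powr (p - 1) * w"
  proof -
    have "ln (a powr ((p - 1) / p) * b powr (1 / p)) = (p - 1) / p * ln a + 1 / p * ln b"
      using ab by (simp add: ln_mult ln_powr)
    also have "\<dots> = ln (p * z powr (p - 1) * w)"
      using assms zw by (simp add: a_def b_def ln_mult ln_div ln_powr) (simp add: field_simps)
    finally show ?thesis using assms zw ab by (subst (asm) ln_inj_iff) auto
  qed
  finally show ?thesis by simp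
qed

text \<open>Tends to t_+^s as e tends to 0. The factor t/(t + e) makes it of order s + 1 at 0, so it
  is C^1 there also for s < 1. The last factor reduces the growth at infinity to order s - s^2/(1+s)
  = s/(1+s) < 1, so the derivative is bounded.\<close>

definition truncated_power :: "real \<Rightarrow> real \<Rightarrow> real \<Rightarrow> real" where
  "truncated_power s e t = max 0 t powr (s + 1) / (max 0 t + e) * (1 + e * max 0 t) powr (- (s\<^sup>2 / (1 + s)))"

text \<open>The logarithmic slope t h'/h of the truncated power h for t > 0. The Caccioppoli
  argument depends on the shape of h only through it; it tends to s.\<close>

definition log_slope :: "real \<Rightarrow> real \<Rightarrow> real \<Rightarrow> real" where
  "log_slope s e t = (s + 1) - max 0 t / (max 0 t + e) - s\<^sup>2 / (1 + s) * e * max 0 t / (1 + e * max 0 t)"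

definition truncated_power_deriv :: "real \<Rightarrow> real \<Rightarrow> real \<Rightarrow> real" where
  "truncated_power_deriv s e t =
    max 0 t powr s / (max 0 t + e) * (1 + e * max 0 t) powr (- (s\<^sup>2 / (1 + s))) * log_slope s e t"

context
  fixes s e :: real
  assumes s: "s > 0" and e: "0 < e"
begin

lemma truncated_power_nonneg: "0 \<le> truncated_power s e t"
  unfolding truncated_power_def using e by simp

lemma truncated_power_eq_0: "t \<le> 0 \<Longrightarrow> truncated_power s e t = 0" "t \<le> 0 \<Longrightarrow> truncated_power_deriv s e t = 0"
  by (simp_all add: truncated_power_def truncated_power_deriv_def max_def)

text \<open>Each of the two subtracted fractions is a number in [0,1] times 1 or s^2/(1+s), and s -
  s^2/(1+s) = s/(1+s). The bounds are independent of \<open>e\<close>, which provides a dominating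
  function in \<open>caccioppoli\<close>.\<close>

lemma log_slope_bounds: "s / (1 + s) \<le> log_slope s e t" "log_slope s e t \<le> s + 1"
proof -
  have 1: "0 \<le> max 0 t / (max 0 t + e)" "max 0 t / (max 0 t + e) \<le> 1" using e by (auto simp: field_simps)
  have 2: "0 \<le> e * max 0 t / (1 + e * max 0 t)" "e * max 0 t / (1 + e * max 0 t) \<le> 1"
  proof -
    have "0 \<le> z / (1 + z)" "z / (1 + z) \<le> 1" if "0 \<le> z" for z :: real
      using that by (auto simp: field_simps)
    from this[of "e * max 0 t"] show "0 \<le> e * max 0 t / (1 + e * max 0 t)" "e * max 0 t / (1 + e * max 0 t) \<le> 1"
      using e by (metis max.cobounded1 less_imp_le mult_nonneg_nonneg)+
  qed
  have k: "s\<^sup>2 / (1 + s) \<ge> 0" using s by simp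
  have 3: "0 \<le> s\<^sup>2 / (1 + s) * (e * max 0 t / (1 + e * max 0 t))" using k 2(1) by (rule mult_nonneg_nonneg)
  have 4: "s\<^sup>2 / (1 + s) * (e * max 0 t / (1 + e * max 0 t)) \<le> s\<^sup>2 / (1 + s)"
    using mult_left_mono[OF 2(2) k] by simp
  have eq: "s\<^sup>2 / (1 + s) * e * max 0 t / (1 + e * max 0 t) = s\<^sup>2 / (1 + s) * (e * max 0 t / (1 + e * max 0 t))"
    by simp
  have 5: "s - s\<^sup>2 / (1 + s) = s / (1 + s)" using s by (simp add: field_simps power2_eq_square)
  show "s / (1 + s) \<le> log_slope s e t" "log_slope s e t \<le> s + 1"
    unfolding log_slope_def eq using 1 3 4 5 by linarith+
qed

lemma truncated_power_slope: "t * truncated_power_deriv s e t = truncated_power s e t * log_slope s e t"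
proof (cases "t > 0")
  case True
  then show ?thesis
    by (simp add: truncated_power_def truncated_power_deriv_def powr_add max_def)
qed (simp add: truncated_power_eq_0)

lemma continuous_truncated_power_deriv: "continuous_on UNIV (truncated_power_deriv s e)"
proof -
  have 1: "1 + e * max 0 t > 0" "max 0 t + e > 0" for t :: real using e
    by (auto intro: add_pos_nonneg add_nonneg_pos)
  then have 2: "1 + e * max 0 t \<noteq> 0" "max 0 t + e \<noteq> 0" for t :: real by (metis less_irrefl)+
  have 3: "continuous_on UNIV (\<lambda>t::real. max 0 t powr s)"
    using s by (intro continuous_on_powr' continuous_intros) auto
  have 4: "continuous_on UNIV (\<lambda>t::real. (1 + e * max 0 t) powr (- (s\<^sup>2 / (1 + s))))"
    using 2 by (intro continuous_on_powr continuous_intros) auto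
  show ?thesis
    unfolding truncated_power_deriv_def[abs_def] log_slope_def
    using 2 by (intro continuous_intros 3 4) auto
qed

lemma truncated_power_has_derivative:
  "(truncated_power s e has_real_derivative truncated_power_deriv s e t) (at t)"
proof -
  consider "t < 0" | "t = 0" | "t > 0" by linarith
  then show ?thesis
  proof cases
    case 1
    have "((\<lambda>_. 0) has_real_derivative 0) (at t)" by simp
    then have "(truncated_power s e has_real_derivative 0) (at t)"
      by (rule has_field_derivative_transform_within_open[of _ _ _ "{..<0}"])
        (use 1 in \<open>auto simp: truncated_power_eq_0\<close>)
    then show ?thesis using 1 by (simp add: truncated_power_eq_0)
  next
    case 2
    \<comment> \<open>Caratheodory's form of differentiability at 0: the truncated power is t times
      the continuous function \<open>m\<close> with m(0) = 0.\<close>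
    define m where "m t = max 0 t powr s / (max 0 t + e) * (1 + e * max 0 t) powr (- (s\<^sup>2 / (1 + s)))" for t :: real
    have pos: "1 + e * max 0 t > 0" "max 0 t + e > 0" for t :: real using e
      by (auto intro: add_pos_nonneg add_nonneg_pos)
    then have nz: "1 + e * max 0 t \<noteq> 0" "max 0 t + e \<noteq> 0" for t :: real by (metis less_irrefl)+
    have 3: "continuous_on UNIV (\<lambda>t::real. max 0 t powr s)"
      using s by (intro continuous_on_powr' continuous_intros) auto
    have 4: "continuous_on UNIV (\<lambda>t::real. (1 + e * max 0 t) powr (- (s\<^sup>2 / (1 + s))))"
      using nz by (intro continuous_on_powr continuous_intros) auto
    have "continuous_on UNIV m"
      unfolding m_def using nz by (intro continuous_intros 3 4) auto
    then have "isCont m 0" by (simp add: continuous_on_eq_continuous_at)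
    moreover have "truncated_power s e z - truncated_power s e 0 = m z * (z - 0)" for z
      by (cases "z > 0") (simp_all add: truncated_power_def m_def powr_add max_def)
    moreover have "m 0 = truncated_power_deriv s e 0" by (simp add: m_def truncated_power_deriv_def)
    ultimately show ?thesis unfolding 2 CARAT_DERIV by blast
  next
    case 3
    have pos: "t + e > 0" "1 + e * t > 0" using 3 e by (auto intro: add_pos_pos)
    define k where "k = s\<^sup>2 / (1 + s)"
    have d1: "((\<lambda>t. t powr (s + 1)) has_real_derivative (s + 1) * t powr s) (at t)"
      using 3 by (auto intro!: derivative_eq_intros)
    have d2: "((\<lambda>t. inverse (t + e)) has_real_derivative - (1 / (t + e)\<^sup>2)) (at t)"
      using pos by (auto intro!: derivative_eq_intros simp: field_simps power2_eq_square)
    have d3: "((\<lambda>t. (1 + e * t) powr (- k)) has_real_derivative (- k * e / (1 + e * t)) * (1 + e * t) powr (- k)) (at t)"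
      using pos by (auto intro!: derivative_eq_intros simp: powr_diff)
    have "((\<lambda>t. t powr (s + 1) * inverse (t + e) * (1 + e * t) powr (- k)) has_real_derivative
        ((s + 1) * t powr s * inverse (t + e) + - (1 / (t + e)\<^sup>2) * t powr (s + 1)) * (1 + e * t) powr (- k) +
        (- k * e / (1 + e * t)) * (1 + e * t) powr (- k) * (t powr (s + 1) * inverse (t + e))) (at t)"
      by (rule DERIV_mult[OF DERIV_mult[OF d1 d2] d3])
    also have "((s + 1) * t powr s * inverse (t + e) + - (1 / (t + e)\<^sup>2) * t powr (s + 1)) * (1 + e * t) powr (- k) +
        (- k * e / (1 + e * t)) * (1 + e * t) powr (- k) * (t powr (s + 1) * inverse (t + e)) =
        t powr s / (t + e) * (1 + e * t) powr (- k) * ((s + 1) - t / (t + e) - k * e * t / (1 + e * t))"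
    proof -
      have *: "((s + 1) * T * inverse a + - (1 / a\<^sup>2) * (T * t)) * P + (- k * e / b) * P * ((T * t) * inverse a) =
        T / a * P * ((s + 1) - t / a - k * e * t / b)" if "a > 0" "b > 0" for T P a b :: real
        using that by (simp add: field_simps power2_eq_square)
      show ?thesis using *[OF pos, of "t powr s" "(1 + e * t) powr (- k)"] 3 by (simp add: powr_add)
    qed
    also have "\<dots> = truncated_power_deriv s e t"
      using 3 by (simp add: truncated_power_deriv_def log_slope_def k_def max_def)
    finally have "((\<lambda>t. t powr (s + 1) * inverse (t + e) * (1 + e * t) powr (- k)) has_real_derivative truncated_power_deriv s e t) (at t)" .
    then show ?thesis
      by (rule has_field_derivative_transform_within_open[of _ _ _ "{0<..}"])
        (use 3 in \<open>auto simp: truncated_power_def k_def divide_inverse\<close>)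
  qed
qed

lemma truncated_power_le: "truncated_power s e t \<le> max 0 t powr s"
proof (cases "t > 0")
  case True
  have "(1 + e * t) powr (- (s\<^sup>2 / (1 + s))) \<le> (1 + e * t) powr 0"
    using True e s by (intro powr_mono) auto
  then have le1: "(1 + e * t) powr (- (s\<^sup>2 / (1 + s))) \<le> 1" using True e by (simp split: if_splits)
  have "t powr (s + 1) / (t + e) = t powr s * (t / (t + e))" using True by (simp add: powr_add)
  also have "\<dots> \<le> t powr s * 1" using True e by (intro mult_left_mono) auto
  finally have "t powr (s + 1) / (t + e) * (1 + e * t) powr (- (s\<^sup>2 / (1 + s))) \<le> (t powr s * 1) * 1"
    using True e by (intro mult_mono le1) auto
  then show ?thesis using True by (simp add: truncated_power_def)
qed (simp add: truncated_power_eq_0)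

lemma truncated_power_deriv_bounded:
  "\<bar>truncated_power_deriv s e t\<bar> \<le> (1 / e + e powr (- (s\<^sup>2 / (1 + s)))) * (s + 1)"
proof (cases "t > 0")
  case True
  define k where "k = s\<^sup>2 / (1 + s)"
  \<comment> \<open>The inequality \<open>sk\<close> says that the growth exponent s - k is at most
    1; it bounds the derivative for t > 1, while for t \<le> 1 the denominator t + e \<ge> e
    does.\<close>
  have k: "k \<ge> 0" and sk: "s - 1 - k \<le> 0" using s by (auto simp: k_def field_simps power2_eq_square)
  have E: "0 \<le> log_slope s e t" using log_slope_bounds(1)[of t] s by (smt (verit) divide_nonneg_nonneg)
  have "t powr s / (t + e) * (1 + e * t) powr (- k) \<le> 1 / e + e powr (- k)"
  proof (cases "t \<le> 1")
    case t1: True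
    have "(1 + e * t) powr (- k) \<le> (1 + e * t) powr 0"
      using True e k by (intro powr_mono) auto
    then have le1: "(1 + e * t) powr (- k) \<le> 1" using True e by (simp split: if_splits)
    have "t powr s \<le> 1" using t1 True s by (intro powr_le1) auto
    then have "t powr s / (t + e) \<le> 1 / e" using True e by (intro frac_le) auto
    then have "t powr s / (t + e) * (1 + e * t) powr (- k) \<le> 1 / e * 1"
      using le1 True e by (intro mult_mono) auto
    then show ?thesis using powr_ge_zero[of e "-k"] by linarith
  next
    case t1: False
    have "t powr s / (t + e) \<le> t powr s / t" using True e by (intro divide_left_mono) auto
    moreover have "(1 + e * t) powr (- k) \<le> (e * t) powr (- k)" using True e k by (intro powr_mono2') auto
    ultimately have "t powr s / (t + e) * (1 + e * t) powr (- k) \<le> (t powr s / t) * (e * t) powr (- k)"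
      using True e by (intro mult_mono) auto
    also have "\<dots> = t powr (s - 1 - k) * e powr (- k)"
      using True e by (simp add: powr_mult powr_diff powr_minus powr_add field_simps)
    also have "\<dots> \<le> t powr 0 * e powr (- k)"
      using t1 sk by (intro mult_right_mono powr_mono) auto
    also have "\<dots> = e powr (- k)" using True by simp
    finally show ?thesis using e by (smt (verit) divide_pos_pos)
  qed
  then have "t powr s / (t + e) * (1 + e * t) powr (- k) * log_slope s e t \<le> (1 / e + e powr (- k)) * (s + 1)"
    using E log_slope_bounds(2)[of t] e s by (intro mult_mono) (auto simp: add_nonneg_nonneg)
  moreover have "truncated_power_deriv s e t \<ge> 0"
    unfolding truncated_power_deriv_def using True E e by simp
  moreover have "truncated_power_deriv s e t = t powr s / (t + e) * (1 + e * t) powr (- k) * log_slope s e t"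
    using True by (simp add: truncated_power_deriv_def k_def)
  ultimately show ?thesis unfolding k_def by linarith
qed (use e s in \<open>simp add: truncated_power_eq_0 add_nonneg_nonneg\<close>)

end

lemma truncated_power_tendsto:
  assumes s: "s > 0" and e: "e \<longlonglongrightarrow> 0" "\<And>n::nat. e n > 0" and t: "t > 0"
  shows "(\<lambda>n. truncated_power s (e n) t) \<longlonglongrightarrow> t powr s" "(\<lambda>n. log_slope s (e n) t) \<longlonglongrightarrow> s"
proof -
  have "(\<lambda>n. t powr (s + 1) / (t + e n) * (1 + e n * t) powr (- (s\<^sup>2 / (1 + s)))) \<longlonglongrightarrow>
      t powr (s + 1) / (t + 0) * (1 + 0 * t) powr (- (s\<^sup>2 / (1 + s)))"
    using t by (intro tendsto_intros e(1)) auto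
  then show "(\<lambda>n. truncated_power s (e n) t) \<longlonglongrightarrow> t powr s"
    using t by (simp add: truncated_power_def powr_add max_def)
  have "(\<lambda>n. (s + 1) - t / (t + e n) - s\<^sup>2 / (1 + s) * e n * t / (1 + e n * t)) \<longlonglongrightarrow>
      (s + 1) - t / (t + 0) - s\<^sup>2 / (1 + s) * 0 * t / (1 + 0 * t)"
    using t by (intro tendsto_intros e(1)) auto
  then show "(\<lambda>n. log_slope s (e n) t) \<longlonglongrightarrow> s"
    using t by (simp add: log_slope_def max_def)
qed

section \<open>The Caccioppoli inequality\<close>

context riem_volume begin

lemma relatively_compact_riem_ball: "compact (closure (riem_ball M x r))"
proof -
  have "closure (riem_ball M x r) \<subseteq> {y. riem_dist M x y \<le> r}"
    by (rule closure_minimal[OF _ closed_riem_cball]) (auto simp: riem_ball_def)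
  then show ?thesis using compact_Int_closed[OF compact_riem_cball closed_closure] by (metis Int_absorb1)
qed

lemma W1p_loc_measurable:
  assumes u: "in_W1p_loc M vol p u X"
  shows "u \<in> borel_measurable borel"
proof (rule measurable_piecewise_restrict)
  \<comment> \<open>Here and below \<open>undefined\<close> is an arbitrary centre; the balls about
    it exhaust M.\<close>
  let ?S = "range (\<lambda>n::nat. riem_ball M undefined (real n))"
  show "countable ?S" by simp
  show "space borel \<subseteq> \<Union>?S"
    using reals_Archimedean2 by (auto simp: riem_ball_def)
  fix S assume "S \<in> ?S"
  then obtain r where S: "S = riem_ball M undefined r" by blast
  then show "S \<inter> space borel \<in> sets borel" using open_riem_ball by simp
  show "u \<in> borel_measurable (restrict_space borel S)"
    using u relatively_compact_riem_ball open_riem_ball unfolding S in_W1p_loc_def in_W1p_def by blast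
qed

text \<open>The negative part only lowers the left side, and for a non-integrable \<open>f\<close>
  the left side is 0 by convention. So the gradient term of the weak inequality can be estimated
  pointwise by a nonnegative function.\<close>

lemma ennreal_integral_le_nn_integral:
  fixes f :: "'b \<Rightarrow> real"
  shows "ennreal (\<integral>x. f x \<partial>N) \<le> (\<integral>\<^sup>+x. ennreal (f x) \<partial>N)"
proof (cases "integrable N f")
  case True
  have "(\<integral>x. f x \<partial>N) \<le> enn2real (\<integral>\<^sup>+x. ennreal (f x) \<partial>N)"
    using real_lebesgue_integral_def[OF True] enn2real_nonneg by (simp add: less_eq_real_def)
  then have "ennreal (\<integral>x. f x \<partial>N) \<le> ennreal (enn2real (\<integral>\<^sup>+x. ennreal (f x) \<partial>N))" by (rule ennreal_leI)
  also have "\<dots> \<le> (\<integral>\<^sup>+x. ennreal (f x) \<partial>N)"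
    by (cases "(\<integral>\<^sup>+x. ennreal (f x) \<partial>N)") auto
  finally show ?thesis .
qed (simp add: not_integrable_integral_eq)

text \<open>The test function is h(u) \<psi>^p. With n the norm of the gradient of u, the gradient
  term is at most h(u) times p (\<psi> n)^(p-1) \<Lambda> - (E/u) (\<psi> n)^p, and
  \<open>Youngs_inequality_scaled\<close> with d = E/u eliminates n. \<open>\<Lambda>\<close> stands
  for the norm of the gradient of \<psi>; it is introduced through \<psi>^p because that power is
  C^1 while \<psi> itself, later a positive part, need not be.\<close>

lemma caccioppoli_truncated:
  assumes p: "1 < p" and u: "in_W1p_loc M vol p u X"
    and V: "continuous_on UNIV V" "\<And>x. 0 < V x"
    and weak: "p_laplacian_ge_weakly_on M vol p V u {x. u x > 0}"
    and \<psi>: "C1_fun (\<lambda>x. \<psi> x powr p)" "\<And>x. 0 \<le> \<psi> x" "\<And>x. \<psi> x \<le> N0" "compact C" "\<And>x. x \<notin> C \<Longrightarrow> \<psi> x = 0"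
    and \<Lambda>: "\<And>x. 0 \<le> \<Lambda> x" "\<And>x. \<Lambda> x \<le> L0"
      "\<And>c x v. c \<in> atlas M \<Longrightarrow> x \<in> cdom c \<Longrightarrow> \<bar>cdiff (\<lambda>x. \<psi> x powr p) c x v\<bar> \<le> p * \<psi> x powr (p - 1) * \<Lambda> x * nrm c x v"
    and h: "\<And>t. (h has_real_derivative h' t) (at t)" "continuous_on UNIV h'" "\<And>t. \<bar>h' t\<bar> \<le> B"
    and h0: "\<And>t. 0 \<le> h t" "\<And>t. t \<le> 0 \<Longrightarrow> h t = 0" "\<And>t. t \<le> 0 \<Longrightarrow> h' t = 0"
    and E: "\<And>t. 0 < E t" "\<And>t. t * h' t = h t * E t"
  shows "(\<integral>\<^sup>+x. ennreal (V x * max 0 (u x) powr (p - 1) * (h (u x) * \<psi> x powr p)) \<partial>vol) \<le>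
    (\<integral>\<^sup>+x. ennreal ((p - 1) powr (p - 1) * h (u x) * max 0 (u x) powr (p - 1) * \<Lambda> x powr p / E (u x) powr (p - 1)) \<partial>vol)"
proof -
  let ?\<kappa> = "\<lambda>x. \<psi> x powr p"
  let ?\<phi> = "\<lambda>x. h (u x) * ?\<kappa> x" and ?Y = "test_field h h' u X ?\<kappa>"
  let ?A = "\<lambda>x. riem_norm M X x powr (p - 2) * riem_inner M X ?Y x"
  let ?f = "\<lambda>x. V x * u x powr (p - 1) * ?\<phi> x"
  have N0: "N0 \<ge> 0" using \<psi>(2,3) order_trans by blast
  have L0: "L0 \<ge> 0" using \<Lambda>(1,2) order_trans by blast
  have B0: "B \<ge> 0" using h(3)[of 0] by linarith
  have h_le: "\<bar>h t\<bar> \<le> B * \<bar>t\<bar>" for t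
    using lipschitz_if_deriv_bounded[OF h(1,3), of t 0] h0(2)[of 0] by simp
  have L: "\<bar>cdiff ?\<kappa> c x v\<bar> \<le> (p * N0 powr (p - 1) * L0) * nrm c x v" if "c \<in> atlas M" "x \<in> cdom c" for c x v
  proof (rule order_trans[OF \<Lambda>(3)[OF that]])
    have "\<psi> x powr (p - 1) \<le> N0 powr (p - 1)" using p \<psi> by (intro powr_mono2) auto
    then show "p * \<psi> x powr (p - 1) * \<Lambda> x * nrm c x v \<le> p * N0 powr (p - 1) * L0 * nrm c x v"
      using p \<Lambda>(1,2)[of x] L0 metric_nonneg[OF that] by (intro mult_mono mult_right_mono mult_left_mono) auto
  qed
  have D: "(?\<phi>, ?Y) \<in> D_plus M vol p {x. u x > 0}"
    by (rule test_function_in_D_plus[OF p u \<psi>(1) _ \<psi>(4) _ _ L h h0]) (use \<psi>(5) p N0 L0 in auto)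
  have ineq: "(LINT x|vol. ?f x) \<le> (LINT x|vol. - ?A x)"
    using weak u D unfolding p_laplacian_ge_weakly_on_def by fastforce
  have um [measurable]: "u \<in> borel_measurable borel" by (rule W1p_loc_measurable[OF u])
  have [measurable]: "h \<in> borel_measurable borel" "V \<in> borel_measurable borel" "?\<kappa> \<in> borel_measurable borel"
    using h DERIV_continuous_on[of UNIV h h'] V(1) C1_fun_continuous[OF \<psi>(1)]
    by (auto intro: borel_measurable_continuous_onI)
  \<comment> \<open>Integrability is required for reading the Bochner integral on the left as a
    nonnegative integral. It holds since the integrand is at most a constant times \<bar>u\<bar>^p
    on the compact support of \<psi>.\<close>
  have fi: "integrable vol ?f"
  proof -
    obtain r where r: "C \<subseteq> riem_ball M undefined r"
    proof -
      have "bounded ((\<lambda>y. riem_dist M undefined y) ` C)"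
        by (rule compact_imp_bounded, rule compact_continuous_image[OF continuous_on_subset[OF continuous_riem_dist] \<psi>(4)]) simp
      then obtain b where "\<forall>y\<in>(\<lambda>y. riem_dist M undefined y) ` C. norm y \<le> b"
        unfolding bounded_iff by blast
      then have b: "\<bar>riem_dist M undefined x\<bar> \<le> b" if "x \<in> C" for x using that by simp
      have "C \<subseteq> riem_ball M undefined (b + 1)"
      proof
        fix x assume "x \<in> C"
        from b[OF this] show "x \<in> riem_ball M undefined (b + 1)" by (simp add: riem_ball_def)
      qed
      then show thesis by (rule that)
    qed
    let ?\<Omega> = "riem_ball M undefined r"
    have Wu: "in_W1p M vol p ?\<Omega> u X"
      using u open_riem_ball relatively_compact_riem_ball unfolding in_W1p_loc_def by blast
    obtain V0 where V0: "V0 \<ge> 0" "\<And>x. x \<in> C \<Longrightarrow> V x \<le> V0"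
    proof -
      have "bounded (V ` C)" by (rule compact_imp_bounded, rule compact_continuous_image[OF continuous_on_subset[OF V(1)] \<psi>(4)]) simp
      then obtain b where b: "\<forall>y\<in>V ` C. norm y \<le> b" unfolding bounded_iff by blast
      have "V x \<le> max 0 b" if "x \<in> C" for x using bspec[OF b imageI[OF that]] by simp
      then show thesis using that[of "max 0 b"] by simp
    qed
    have bd: "\<bar>?f x\<bar> \<le> (V0 * B * N0 powr p) * \<bar>u x\<bar> powr p" for x
    proof (cases "x \<in> C \<and> u x > 0")
      case True
      have k: "\<bar>?\<kappa> x\<bar> \<le> N0 powr p" using \<psi>(2,3)[of x] p by (simp add: powr_mono2)
      have "\<bar>?f x\<bar> = V x * u x powr (p - 1) * (\<bar>h (u x)\<bar> * \<bar>?\<kappa> x\<bar>)"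
        using less_imp_le[OF V(2)[of x]] by (simp add: abs_mult)
      also have "\<dots> \<le> V0 * u x powr (p - 1) * ((B * \<bar>u x\<bar>) * N0 powr p)"
        using V0 V(2)[of x] True k B0 by (intro mult_mono h_le k) auto
      also have "\<dots> = (V0 * B * N0 powr p) * (u x powr (p - 1) * u x)" using True by simp
      also have "u x powr (p - 1) * u x = \<bar>u x\<bar> powr p" using True by (simp add: powr_diff)
      finally show ?thesis .
    next
      case False
      then have "\<bar>?f x\<bar> = 0" using h0(2)[of "u x"] \<psi>(5)[of x] by (cases "x \<in> C") auto
      moreover have "0 \<le> (V0 * B * N0 powr p) * \<bar>u x\<bar> powr p" using V0(1) B0 by simp
      ultimately show ?thesis by (simp only:)
    qed
    have "set_integrable vol ?\<Omega> ?f"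
    proof (rule set_integrable_bound_on[OF open_riem_ball _ _ bd])
      show "set_integrable vol ?\<Omega> (\<lambda>x. (V0 * B * N0 powr p) * \<bar>u x\<bar> powr p)"
        using Wu unfolding in_W1p_def by (intro set_integrable_mult_right) auto
      show "?f \<in> borel_measurable (restrict_space borel ?\<Omega>)" by (rule measurable_restrict_space1) measurable
    qed
    moreover have "(\<lambda>x. indicator ?\<Omega> x *\<^sub>R ?f x) = ?f"
      using r \<psi>(5) by (fastforce simp: indicator_def)
    ultimately show ?thesis unfolding set_integrable_def by simp
  qed
  have f0: "0 \<le> ?f x" for x using V(2)[of x] h0(1)[of "u x"] by simp
  have fe: "V x * max 0 (u x) powr (p - 1) * ?\<phi> x = ?f x" for x
    by (cases "u x > 0") (simp_all add: h0(2))
  have key: "- ?A x \<le> (p - 1) powr (p - 1) * h (u x) * max 0 (u x) powr (p - 1) * \<Lambda> x powr p / E (u x) powr (p - 1)" for x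
  proof -
    let ?c = "chart_at M x"
    note c = chart_at[of x]
    define n where "n = nrm ?c x (X ?c x)"
    have n0: "n \<ge> 0" unfolding n_def using metric_nonneg[OF c] by simp
    have nn: "metric M ?c x (X ?c x) (X ?c x) = n * n" unfolding n_def using metric_nonneg[OF c] by simp
    have rn: "riem_norm M X x = n" by (simp add: n_def riem_norm_def riem_inner_def Let_def)
    have inn: "riem_inner M X ?Y x = h (u x) * cdiff ?\<kappa> ?c x (X ?c x) + ?\<kappa> x * h' (u x) * (n * n)"
    proof -
      have "riem_inner M X ?Y x = metric M ?c x (?Y ?c x) (X ?c x)"
        unfolding riem_inner_def Let_def by (rule metric_sym[OF c])
      then show ?thesis unfolding metric_test_field[OF \<psi>(1) c] nn .
    qed
    have rhs0: "0 \<le> (p - 1) powr (p - 1) * h (u x) * max 0 (u x) powr (p - 1) * \<Lambda> x powr p / E (u x) powr (p - 1)"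
      using h0(1) by simp
    show ?thesis
    proof (cases "u x > 0 \<and> n > 0")
      case False
      then have "- ?A x = 0" unfolding inn rn using h0(2,3)[of "u x"] n0 by auto
      then show ?thesis using rhs0 by (simp only:)
    next
      case True
      then have ux: "u x > 0" and n: "n > 0" by auto
      have d: "\<bar>cdiff ?\<kappa> ?c x (X ?c x)\<bar> \<le> p * \<psi> x powr (p - 1) * \<Lambda> x * n"
        unfolding n_def by (rule \<Lambda>(3)[OF c])
      have h'e: "h' (u x) = h (u x) * (E (u x) / u x)" using E(2)[of "u x"] ux by (simp add: field_simps)
      have n1: "n powr (p - 2) * n = n powr (p - 1)" using n by (simp add: powr_diff powr_numeral field_simps power2_eq_square)
      have n2: "n powr (p - 2) * (n * n) = n powr p" using n by (simp add: powr_diff powr_numeral field_simps power2_eq_square)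
      have "- ?A x = h (u x) * (n powr (p - 2) * - cdiff ?\<kappa> ?c x (X ?c x)) -
          h (u x) * (E (u x) / u x * (?\<kappa> x * (n powr (p - 2) * (n * n))))"
        unfolding inn rn h'e by (simp add: algebra_simps)
      also have "\<dots> \<le> h (u x) * (n powr (p - 2) * (p * \<psi> x powr (p - 1) * \<Lambda> x * n)) -
          h (u x) * (E (u x) / u x * (?\<kappa> x * (n powr (p - 2) * (n * n))))"
        using d h0(1) by (intro diff_right_mono mult_left_mono) auto
      also have "\<dots> = h (u x) * (p * (\<psi> x * n) powr (p - 1) * \<Lambda> x - E (u x) / u x * (\<psi> x * n) powr p)"
        unfolding n2 n1[symmetric] powr_mult by (simp add: algebra_simps)
      also have "\<dots> \<le> h (u x) * ((p - 1) powr (p - 1) * \<Lambda> x powr p / (E (u x) / u x) powr (p - 1))"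
        using \<psi>(2) n0 \<Lambda>(1) E(1) ux p by (intro mult_left_mono Youngs_inequality_scaled h0(1)) auto
      also have "\<dots> = (p - 1) powr (p - 1) * h (u x) * max 0 (u x) powr (p - 1) * \<Lambda> x powr p / E (u x) powr (p - 1)"
        using ux by (simp add: powr_divide less_imp_le[OF E(1)])
      finally show ?thesis .
    qed
  qed
  have "(\<integral>\<^sup>+x. ennreal (V x * max 0 (u x) powr (p - 1) * ?\<phi> x) \<partial>vol) = ennreal (LINT x|vol. ?f x)"
    unfolding fe by (rule nn_integral_eq_integral[OF fi]) (use f0 in simp)
  also have "\<dots> \<le> ennreal (LINT x|vol. - ?A x)" by (rule ennreal_leI[OF ineq])
  also have "\<dots> \<le> (\<integral>\<^sup>+x. ennreal (- ?A x) \<partial>vol)" by (rule ennreal_integral_le_nn_integral)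
  also have "\<dots> \<le> (\<integral>\<^sup>+x. ennreal ((p - 1) powr (p - 1) * h (u x) * max 0 (u x) powr (p - 1) * \<Lambda> x powr p / E (u x) powr (p - 1)) \<partial>vol)"
    by (intro nn_integral_mono ennreal_leI key)
  finally show ?thesis .
qed

text \<open>\<open>caccioppoli_truncated\<close> for truncated powers with parameters tending to 0:
  Fatou's lemma on the left, dominated convergence on the right. If the integral on the right is
  infinite, the claim is trivial as the constant is positive.\<close>

proposition caccioppoli:
  assumes p: "1 < p" and q: "p - 1 < q" and u: "in_W1p_loc M vol p u X"
    and V: "continuous_on UNIV V" "\<And>x. 0 < V x"
    and weak: "p_laplacian_ge_weakly_on M vol p V u {x. u x > 0}"
    and \<psi>: "C1_fun (\<lambda>x. \<psi> x powr p)" "\<And>x. 0 \<le> \<psi> x" "\<And>x. \<psi> x \<le> N0" "compact C" "\<And>x. x \<notin> C \<Longrightarrow> \<psi> x = 0"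
    and \<Lambda>: "\<And>x. 0 \<le> \<Lambda> x" "\<And>x. \<Lambda> x \<le> L0"
      "\<And>c x v. c \<in> atlas M \<Longrightarrow> x \<in> cdom c \<Longrightarrow> \<bar>cdiff (\<lambda>x. \<psi> x powr p) c x v\<bar> \<le> p * \<psi> x powr (p - 1) * \<Lambda> x * nrm c x v"
    and \<Lambda>m [measurable]: "\<Lambda> \<in> borel_measurable borel"
  shows "(\<integral>\<^sup>+x. ennreal (V x * max (u x) 0 powr q * \<psi> x powr p) \<partial>vol) \<le>
    ennreal (((p - 1) / (q - p + 1)) powr (p - 1)) * (\<integral>\<^sup>+x. ennreal (max (u x) 0 powr q * \<Lambda> x powr p) \<partial>vol)"
proof (cases "(\<integral>\<^sup>+x. ennreal (max (u x) 0 powr q * \<Lambda> x powr p) \<partial>vol) = \<infinity>")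
  case True
  then show ?thesis using p q by (simp add: ennreal_mult_top)
next
  case False
  define s where "s = q - p + 1"
  define e where "e n = 1 / (real n + 1)" for n :: nat
  have s: "s > 0" using q by (simp add: s_def)
  have e: "e n > 0" for n by (simp add: e_def)
  have e0: "e \<longlonglongrightarrow> 0" unfolding e_def by real_asymp
  have um [measurable]: "u \<in> borel_measurable borel" by (rule W1p_loc_measurable[OF u])
  have [measurable]: "V \<in> borel_measurable borel" "(\<lambda>x. \<psi> x powr p) \<in> borel_measurable borel"
    using V(1) C1_fun_continuous[OF \<psi>(1)] by (auto intro: borel_measurable_continuous_onI)
  have [measurable]: "(\<lambda>t. truncated_power s (e n) t) \<in> borel_measurable borel" "(\<lambda>t. log_slope s (e n) t) \<in> borel_measurable borel" for n
    unfolding truncated_power_def log_slope_def by measurable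
  define f where "f n x = V x * max 0 (u x) powr (p - 1) * (truncated_power s (e n) (u x) * \<psi> x powr p)" for n x
  define g where "g n x = (p - 1) powr (p - 1) * truncated_power s (e n) (u x) * max 0 (u x) powr (p - 1) * \<Lambda> x powr p / log_slope s (e n) (u x) powr (p - 1)" for n x
  have step: "(\<integral>\<^sup>+x. ennreal (f n x) \<partial>vol) \<le> (\<integral>\<^sup>+x. ennreal (g n x) \<partial>vol)" for n
    unfolding f_def g_def
  proof (rule caccioppoli_truncated[OF p u V weak \<psi> \<Lambda> truncated_power_has_derivative[OF s e]
        continuous_truncated_power_deriv[OF s e] truncated_power_deriv_bounded[OF s e]
        truncated_power_nonneg[OF s e] truncated_power_eq_0[OF s e] _ truncated_power_slope[OF s e]])
    show "0 < log_slope s (e n) t" for t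
      using log_slope_bounds(1)[OF s e, of n t] s by (smt (verit) divide_pos_pos)
  qed
  have pw: "max 0 t powr (p - 1) * t powr s = max t 0 powr q" if "t > 0" for t
    using that by (simp add: powr_add[symmetric] s_def)
  have fl: "(\<lambda>n. f n x) \<longlonglongrightarrow> V x * max (u x) 0 powr q * \<psi> x powr p" for x
  proof (cases "u x > 0")
    case True
    have "(\<lambda>n. f n x) \<longlonglongrightarrow> V x * max 0 (u x) powr (p - 1) * (u x powr s * \<psi> x powr p)"
      unfolding f_def by (intro tendsto_intros truncated_power_tendsto[OF s e0 e True])
    also have "V x * max 0 (u x) powr (p - 1) * (u x powr s * \<psi> x powr p) = V x * max (u x) 0 powr q * \<psi> x powr p"
      unfolding pw[OF True, symmetric] by (simp only: mult_ac)
    finally show ?thesis .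
  qed (simp add: f_def)
  let ?K = "((p - 1) / s) powr (p - 1)"
  have gl: "(\<lambda>n. g n x) \<longlonglongrightarrow> ?K * (max (u x) 0 powr q * \<Lambda> x powr p)" for x
  proof (cases "u x > 0")
    case True
    have "(\<lambda>n. g n x) \<longlonglongrightarrow> (p - 1) powr (p - 1) * u x powr s * max 0 (u x) powr (p - 1) * \<Lambda> x powr p / s powr (p - 1)"
      unfolding g_def using s by (intro tendsto_intros truncated_power_tendsto[OF s e0 e True]) auto
    also have "(p - 1) powr (p - 1) * u x powr s * max 0 (u x) powr (p - 1) * \<Lambda> x powr p / s powr (p - 1) = ?K * (max (u x) 0 powr q * \<Lambda> x powr p)"
      unfolding pw[OF True, symmetric] using p s by (simp add: powr_divide)
    finally show ?thesis .
  qed (simp add: g_def)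
  \<comment> \<open>The limit integrand with the limit slope s replaced by the uniform lower bound
    s/(1+s) of the slopes.\<close>
  define w where "w x = (p - 1) powr (p - 1) / (s / (1 + s)) powr (p - 1) * (max (u x) 0 powr q * \<Lambda> x powr p)" for x
  have gw: "g n x \<le> w x" for n x
  proof (cases "u x > 0")
    case True
    have "truncated_power s (e n) (u x) \<le> u x powr s" using truncated_power_le[OF s e, of n "u x"] True by simp
    moreover have "(s / (1 + s)) powr (p - 1) \<le> log_slope s (e n) (u x) powr (p - 1)"
      using log_slope_bounds(1)[OF s e] s p by (intro powr_mono2) auto
    ultimately have "g n x \<le> (p - 1) powr (p - 1) * u x powr s * max 0 (u x) powr (p - 1) * \<Lambda> x powr p / (s / (1 + s)) powr (p - 1)"
      unfolding g_def using s by (intro frac_le mult_right_mono mult_left_mono) auto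
    also have "\<dots> = w x" unfolding w_def pw[OF True, symmetric] by simp
    finally show ?thesis .
  qed (simp add: g_def w_def)
  have g0: "0 \<le> g n x" for n x unfolding g_def using truncated_power_nonneg[OF s e] by simp
  have "(\<integral>\<^sup>+x. ennreal (V x * max (u x) 0 powr q * \<psi> x powr p) \<partial>vol) = (\<integral>\<^sup>+x. liminf (\<lambda>n. ennreal (f n x)) \<partial>vol)"
    by (intro nn_integral_cong lim_imp_Liminf[symmetric] tendsto_ennrealI fl) simp
  also have "\<dots> \<le> liminf (\<lambda>n. \<integral>\<^sup>+x. ennreal (f n x) \<partial>vol)"
    unfolding f_def by (rule nn_integral_liminf) measurable
  also have "\<dots> \<le> liminf (\<lambda>n. \<integral>\<^sup>+x. ennreal (g n x) \<partial>vol)"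
    by (intro Liminf_mono eventuallyI step)
  also have "\<dots> = (\<integral>\<^sup>+x. ennreal (?K * (max (u x) 0 powr q * \<Lambda> x powr p)) \<partial>vol)"
  proof (rule lim_imp_Liminf)
    show "(\<lambda>n. \<integral>\<^sup>+x. ennreal (g n x) \<partial>vol) \<longlonglongrightarrow> (\<integral>\<^sup>+x. ennreal (?K * (max (u x) 0 powr q * \<Lambda> x powr p)) \<partial>vol)"
    proof (rule nn_integral_dominated_convergence[where w = "\<lambda>x. ennreal (w x)"])
      show "(\<lambda>x. ennreal (g n x)) \<in> borel_measurable vol" for n unfolding g_def by measurable
      show "(\<lambda>x. ennreal (w x)) \<in> borel_measurable vol" unfolding w_def by measurable
      have "(\<integral>\<^sup>+x. ennreal (w x) \<partial>vol) = (\<integral>\<^sup>+x. ennreal ((p - 1) powr (p - 1) / (s / (1 + s)) powr (p - 1)) * ennreal (max (u x) 0 powr q * \<Lambda> x powr p) \<partial>vol)"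
        unfolding w_def by (intro nn_integral_cong ennreal_mult') simp
      also have "\<dots> = ennreal ((p - 1) powr (p - 1) / (s / (1 + s)) powr (p - 1)) * (\<integral>\<^sup>+x. ennreal (max (u x) 0 powr q * \<Lambda> x powr p) \<partial>vol)"
        by (rule nn_integral_cmult) measurable
      finally show "(\<integral>\<^sup>+x. ennreal (w x) \<partial>vol) < \<infinity>"
        using False by (simp add: ennreal_mult_less_top less_top)
    qed (use gl gw in \<open>auto intro!: AE_I2 ennreal_leI tendsto_ennrealI\<close>)
  qed simp
  also have "\<dots> = (\<integral>\<^sup>+x. ennreal ?K * ennreal (max (u x) 0 powr q * \<Lambda> x powr p) \<partial>vol)"
    by (intro nn_integral_cong ennreal_mult') simp
  also have "\<dots> = ennreal ?K * (\<integral>\<^sup>+x. ennreal (max (u x) 0 powr q * \<Lambda> x powr p) \<partial>vol)"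
    by (rule nn_integral_cmult) measurable
  finally show ?thesis unfolding s_def .
qed

end

section \<open>The growth estimate for a general weight\<close>

lemma pos_part_powr_deriv:
  assumes p: "1 < (p::real)"
  shows "((\<lambda>y. max 0 y powr p) has_real_derivative p * max 0 y powr (p - 1)) (at y)"
proof -
  consider "y < 0" | "y = 0" | "y > 0" by linarith
  then show ?thesis
  proof cases
    case 1
    have "((\<lambda>_. 0) has_real_derivative 0) (at y)" by simp
    then have "((\<lambda>y. max 0 y powr p) has_real_derivative 0) (at y)"
      by (rule has_field_derivative_transform_within_open[of _ _ _ "{..<0}"]) (use 1 in auto)
    then show ?thesis using 1 by simp
  next
    case 2
    have "continuous_on UNIV (\<lambda>y::real. max 0 y powr (p - 1))"
      using p by (intro continuous_on_powr' continuous_intros) auto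
    then have "isCont (\<lambda>y::real. max 0 y powr (p - 1)) 0" by (simp add: continuous_on_eq_continuous_at)
    moreover have "max 0 z powr p - max 0 0 powr p = max 0 z powr (p - 1) * (z - 0)" for z
      using p by (cases "z > 0") (simp_all add: powr_diff max_def)
    moreover have "max 0 (0::real) powr (p - 1) = p * max 0 0 powr (p - 1)" by simp
    ultimately show ?thesis unfolding 2 CARAT_DERIV
      by (intro exI[of _ "\<lambda>y. max 0 y powr (p - 1)"] conjI allI)
  next
    case 3
    have "((\<lambda>y. y powr p) has_real_derivative p * y powr (p - 1)) (at y)"
      using 3 by (auto intro!: derivative_eq_intros)
    then have "((\<lambda>y. max 0 y powr p) has_real_derivative p * y powr (p - 1)) (at y)"
      by (rule has_field_derivative_transform_within_open[of _ _ _ "{0<..}"]) (use 3 in auto)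
    then show ?thesis using 3 by simp
  qed
qed

lemma eventually_at_infty: "eventually P (at_infty :: 'a::t2_space filter) \<longleftrightarrow> (\<exists>K. compact K \<and> (\<forall>x. x \<notin> K \<longrightarrow> P x))"
proof -
  have "eventually P (at_infty :: 'a filter) \<longleftrightarrow> (\<exists>K\<in>{K. compact K}. eventually P (principal (- K)))"
    unfolding at_infty_def
  proof (rule eventually_INF_base)
    show "{K. compact (K :: 'a set)} \<noteq> {}" using compact_empty by blast
    fix A B :: "'a set" assume "A \<in> {K. compact K}" "B \<in> {K. compact K}"
    then show "\<exists>x\<in>{K. compact K}. principal (- x) \<le> inf (principal (- A)) (principal (- B))"
      by (intro bexI[of _ "A \<union> B"]) (auto intro: compact_Un)
  qed
  then show ?thesis by (auto simp: eventually_principal)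
qed

context riem_volume begin

text \<open>The lower limit gives the bound off a compact set, with \<lambda> lowered to
  \<open>l\<close>. Adding \<open>b\<close> to the distance absorbs both the compact set, where V
  has a positive minimum, and the change of the base point from o' to x0.\<close>

lemma potential_lower_bound:
  assumes V: "continuous_on UNIV V" "\<And>x. 0 < V x" and \<mu>: "0 \<le> \<mu>" and l: "0 < l" "l < lam"
    and V0: "\<And>x. \<mu> = 0 \<Longrightarrow> lam \<le> V x"
    and V1: "\<mu> > 0 \<Longrightarrow> \<exists>o'. Liminf at_infty (\<lambda>x. ereal (riem_dist M x o' powr \<mu> * V x)) \<ge> ereal lam"
  obtains b where "b \<ge> 1" "\<And>x. l * (riem_dist M x0 x + b) powr (- \<mu>) \<le> V x"
proof (cases "\<mu> = 0")
  case True
  have "l * (riem_dist M x0 x + 1) powr (- \<mu>) \<le> V x" for x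
    using V0[OF True, of x] l True riem_dist_nonneg[of x0 x] by simp
  then show ?thesis using that[of 1] by simp
next
  case False
  then have \<mu>: "\<mu> > 0" using \<mu> by simp
  obtain o' where o': "ereal lam \<le> Liminf at_infty (\<lambda>x. ereal (riem_dist M x o' powr \<mu> * V x))" using V1[OF \<mu>] by blast
  have "ereal l < ereal lam" using l by simp
  then have "ereal l < Liminf at_infty (\<lambda>x. ereal (riem_dist M x o' powr \<mu> * V x))"
    using o' by (rule less_le_trans)
  from less_LiminfD[OF this] obtain K where K: "compact K" "\<And>x. x \<notin> K \<Longrightarrow> l < riem_dist M x o' powr \<mu> * V x"
    unfolding eventually_at_infty less_ereal.simps by blast
  obtain m where m: "m > 0" "\<And>x. x \<in> K \<Longrightarrow> m \<le> V x"
  proof (cases "K = {}")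
    case False
    obtain z where "z \<in> K" "\<forall>y\<in>K. V z \<le> V y"
      using continuous_attains_inf[OF K(1) False continuous_on_subset[OF V(1)]] by blast
    then show ?thesis using that[of "V z"] V(2) by blast
  qed (use that[of 1] in auto)
  \<comment> \<open>The second entry serves the change of base point, the third the compact set,
    where V \<ge> m.\<close>
  define b where "b = max 1 (max (riem_dist M x0 o') ((l / m) powr (1 / \<mu>)))"
  have b: "b \<ge> 1" "riem_dist M x0 o' \<le> b" "(l / m) powr (1 / \<mu>) \<le> b" by (auto simp: b_def)
  have lV: "l \<le> V x * (riem_dist M x0 x + b) powr \<mu>" for x
  proof (cases "x \<in> K")
    case True
    have lm: "(l / m) powr (1 / \<mu>) \<le> riem_dist M x0 x + b" using b(3) riem_dist_nonneg[of x0 x] by linarith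
    have "l = m * ((l / m) powr (1 / \<mu>)) powr \<mu>" using m(1) l \<mu> by (simp add: powr_powr)
    also have "\<dots> \<le> V x * (riem_dist M x0 x + b) powr \<mu>"
      using \<mu> less_imp_le[OF V(2)[of x]] by (intro mult_mono powr_mono2 lm m(2) True) auto
    finally show ?thesis .
  next
    case False
    have "l \<le> V x * riem_dist M x o' powr \<mu>" using K(2)[OF False] by (simp add: mult.commute)
    also have "\<dots> \<le> V x * (riem_dist M x0 x + b) powr \<mu>"
      using riem_dist_triangle[of x o' x0] riem_dist_sym[of x x0] b(2) \<mu> V(2)[of x] riem_dist_nonneg
      by (intro mult_left_mono powr_mono2) auto
    finally show ?thesis .
  qed
  have "l * (riem_dist M x0 x + b) powr (- \<mu>) \<le> V x" for x
  proof -
    have "0 < (riem_dist M x0 x + b) powr \<mu>" using riem_dist_nonneg[of x0 x] b(1) by (simp add: add_nonneg_eq_0_iff)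
    then show ?thesis using lV[of x] by (simp add: powr_minus_divide pos_divide_le_eq del: powr_gt_zero)
  qed
  then show ?thesis using that b(1) by blast
qed

text \<open>The balls about \<open>x0\<close> exhaust M, so if all these integrals vanished, u would
  be nonpositive almost everywhere.\<close>

lemma ex_positive_on_ball:
  assumes um [measurable]: "u \<in> borel_measurable borel" and V: "continuous_on UNIV V" "\<And>x. 0 < V x"
    and pos: "emeasure vol {x. u x > 0} > 0"
  obtains r c where "0 < c" "0 < r"
    "ennreal c \<le> (\<integral>\<^sup>+x. ennreal (V x * max (u x) 0 powr q) * indicator (riem_ball M x0 r) x \<partial>vol)"
proof -
  have [measurable]: "V \<in> borel_measurable borel" using V(1) by (rule borel_measurable_continuous_onI)
  have [measurable]: "riem_ball M x0 r \<in> sets borel" for r using open_riem_ball by simp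
  let ?I = "\<lambda>n::nat. \<integral>\<^sup>+x. ennreal (V x * max (u x) 0 powr q) * indicator (riem_ball M x0 (real n + 1)) x \<partial>vol"
  have "\<exists>n. ?I n \<noteq> 0"
  proof (rule ccontr)
    assume "\<not> ?thesis"
    then have I0: "?I n = 0" for n by blast
    have Gm [measurable]: "(\<lambda>x. ennreal (V x * max (u x) 0 powr q)) \<in> borel_measurable borel" by measurable
    have "(\<lambda>x. ennreal (V x * max (u x) 0 powr q) * indicator (riem_ball M x0 (real n + 1)) x) \<in> borel_measurable vol" for n
      by measurable
    from nn_integral_0_iff_AE[OF this, THEN iffD1, OF I0]
    have "AE x in vol. ennreal (V x * max (u x) 0 powr q) * indicator (riem_ball M x0 (real n + 1)) x = 0" for n .
    then have "AE x in vol. \<forall>n. ennreal (V x * max (u x) 0 powr q) * indicator (riem_ball M x0 (real n + 1)) x = 0"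
      unfolding AE_all_countable by blast
    then have "AE x in vol. \<not> (u x > 0)"
    proof (rule AE_mp, intro AE_I2 impI notI)
      fix x assume *: "\<forall>n. ennreal (V x * max (u x) 0 powr q) * indicator (riem_ball M x0 (real n + 1)) x = 0" "0 < u x"
      obtain n :: nat where "riem_dist M x0 x < real n" using reals_Archimedean2 by blast
      then have "x \<in> riem_ball M x0 (real n + 1)" by (simp add: riem_ball_def)
      then have "ennreal (V x * max (u x) 0 powr q) = 0" using *(1) by (metis indicator_simps(1) mult.right_neutral)
      moreover have "V x * max (u x) 0 powr q > 0" using *(2) V(2)[of x] by simp
      ultimately show False by (metis ennreal_eq_0_iff not_le)
    qed
    then have "emeasure vol {x. u x > 0} = 0"
      by (subst (asm) AE_iff_measurable[OF _ refl]) (auto simp: sets_vol)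
    then show False using pos by simp
  qed
  then obtain n where n: "?I n \<noteq> 0" by blast
  \<comment> \<open>The integral may be infinite; any positive number then serves as
    \<open>c\<close>.\<close>
  define c where "c = (if ?I n = \<infinity> then 1 else enn2real (?I n))"
  have "0 < c" unfolding c_def using n by (auto simp: enn2real_positive_iff less_top zero_less_iff_neq_zero)
  moreover have "ennreal c \<le> ?I n" unfolding c_def by (auto simp: less_top)
  ultimately show ?thesis using that[of c "real n + 1"] by simp
qed

text \<open>\<open>caccioppoli\<close> with \<psi> = (g(\<rho>) - g(R))_+ for the C^1 distance
  \<rho>. By the differential equation for \<open>g\<close> the right integrand is a constant times
  (\<rho> + b + 1/2)^(-\<mu>) g(\<rho>)^p u_+^q. Where g(\<rho>) \<ge> m g(R), the hypothesis
  \<open>small\<close> makes it a fraction a < 1 of the left integrand; elsewhere it is at most a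
  constant times g(R)^p W u_+^q. The left side exceeds a positive constant independent of R.\<close>

proposition growth_estimate:
  fixes g g' :: "real \<Rightarrow> real"
  assumes p: "1 < p" and q: "p - 1 < q" and u: "in_W1p_loc M vol p u X"
    and V: "continuous_on UNIV V" "\<And>x. 0 < V x"
    and weak: "p_laplacian_ge_weakly_on M vol p V u {x. u x > 0}"
    and pos: "emeasure vol {x. u x > 0} > 0"
    and \<mu>: "0 \<le> \<mu>" and l: "0 < l" and b: "b \<ge> 1" "\<And>x. l * (riem_dist M x0 x + b) powr (- \<mu>) \<le> V x"
    and \<beta>: "0 < \<beta>" and g: "\<And>t. -1/2 \<le> t \<Longrightarrow> 0 < g t" "\<And>t. -1/2 \<le> t \<Longrightarrow> (g has_real_derivative g' t) (at t)"
      "\<And>t. -1/2 \<le> t \<Longrightarrow> g' t = - \<beta> * (t + (b + 1/2)) powr (- \<mu> / p) * g t"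
    and \<epsilon>: "0 < \<epsilon>" "\<epsilon> \<le> 1" and m: "1 < m"
    and small: "((p - 1) / (q - p + 1)) powr (p - 1) * ((1 + \<epsilon>) * \<beta>) powr p * (1 - 1 / m) powr (- p) < l"
  obtains c R0 where "0 < c"
    "\<And>R W. R0 \<le> R \<Longrightarrow> 0 < W \<Longrightarrow> (\<And>t. -1/2 \<le> t \<Longrightarrow> t < R \<Longrightarrow> g t < m * g R \<Longrightarrow> (t + (b + 1/2)) powr (- \<mu>) \<le> W) \<Longrightarrow>
      ennreal c \<le> ennreal (g R powr p * W) * growth_integral M vol q u x0 (R + 1)"
proof -
  let ?r = "riem_dist M x0"
  define K where "K = ((p - 1) / (q - p + 1)) powr (p - 1)"
  define A where "A = K * ((1 + \<epsilon>) * \<beta>) powr p"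
  \<comment> \<open>The fraction of the left side that reappears on the right; the assumption
    \<open>small\<close> says a < 1.\<close>
  define a where "a = A * (1 - 1 / m) powr (- p) / l"
  have K: "K > 0" using p q by (simp add: K_def)
  then have A: "A > 0" using \<epsilon> \<beta> by (simp add: A_def)
  have a: "0 \<le> a" "a < 1" using small A l unfolding a_def A_def K_def by (auto simp: divide_less_eq)
  have um [measurable]: "u \<in> borel_measurable borel" by (rule W1p_loc_measurable[OF u])
  have Vm [measurable]: "V \<in> borel_measurable borel" using V(1) by (rule borel_measurable_continuous_onI)
  obtain r1 c1 where c1: "0 < c1" "0 < r1"
    "ennreal c1 \<le> (\<integral>\<^sup>+x. ennreal (V x * max (u x) 0 powr q) * indicator (riem_ball M x0 r1) x \<partial>vol)"
    using ex_positive_on_ball[OF um V pos] by blast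
  have g'neg: "g' t < 0" if "-1/2 \<le> t" for t
    using g(1)[OF that] \<beta> b(1) that unfolding g(3)[OF that] by (simp add: mult_neg_pos)
  have dec: "g t < g s" if "-1/2 \<le> s" "s < t" for s t
  proof (rule DERIV_neg_imp_decreasing[OF that(2)])
    fix x assume "s \<le> x" "x \<le> t"
    then have "-1/2 \<le> x" using that by simp
    then show "\<exists>y. (g has_real_derivative y) (at x) \<and> y < 0" using g(2) g'neg by blast
  qed
  have dec': "g t \<le> g s" if "-1/2 \<le> s" "s \<le> t" for s t
    using dec[of s t] that by (cases "s = t") auto
  have contg: "continuous_on {-1/2..} g"
    by (intro continuous_at_imp_continuous_on ballI DERIV_isCont[OF g(2)]) simp
  have contg': "continuous_on {-1/2..} g'"
  proof -
    have "continuous_on {-1/2..} (\<lambda>t. - \<beta> * (t + (b + 1/2)) powr (- \<mu> / p) * g t)"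
      using b(1) by (intro continuous_intros contg) auto
    then show ?thesis by (rule continuous_on_eq) (simp add: g(3))
  qed
  \<comment> \<open>The lower bound for the left side: on the ball of radius r1, \<rho> \<le> r1 +
    1, and for R \<ge> r1 + 2 this makes \<psi> at least g(r1 + 1) - g(r1 + 2), independently of
    R.\<close>
  define c3 where "c3 = (g (r1 + 1) - g (r1 + 2)) powr p * c1"
  have c3: "c3 > 0" using dec[of "r1 + 1" "r1 + 2"] c1 by (simp add: c3_def)
  define c where "c = (1 - a) * c3 / (A * m powr p)"
  have "c > 0" using c3 a A m by (simp add: c_def)
  moreover have "ennreal c \<le> ennreal (g R powr p * W) * growth_integral M vol q u x0 (R + 1)"
    if R: "r1 + 2 \<le> R" and W: "0 < W" and w: "\<And>t. -1/2 \<le> t \<Longrightarrow> t < R \<Longrightarrow> g t < m * g R \<Longrightarrow> (t + (b + 1/2)) powr (- \<mu>) \<le> W" for R W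
  proof -
    let ?F = "growth_integral M vol q u x0 (R + 1)"
    have gR: "g R > 0" using R c1(2) by (intro g(1)) simp
    obtain \<rho> where \<rho>: "C1_fun \<rho>"
      "\<And>c w v. c \<in> atlas M \<Longrightarrow> w \<in> cdom c \<Longrightarrow> \<bar>cdiff \<rho> c w v\<bar> \<le> (1 + \<epsilon>) * nrm c w v"
      "\<And>w. \<rho> w \<le> ?r w + 1" "\<And>w. min (?r w) (R + 1) - 1 / 2 \<le> \<rho> w"
      using ex_C1_distance[OF \<epsilon>, of x0 R] by blast
    have \<rho>0: "-1/2 \<le> \<rho> x" for x
    proof -
      have "0 \<le> min (?r x) (R + 1)" using riem_dist_nonneg[of x0 x] R c1(2) by simp
      then show ?thesis using \<rho>(4)[of x] by linarith
    qed
    have \<rho>r: "?r x - 1 / 2 \<le> \<rho> x" if "\<rho> x < R" for x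
      using \<rho>(4)[of x] that by (simp add: min_def split: if_splits)
    \<comment> \<open>Supported where \<rho> \<le> R, hence in the closed ball of radius R + 1,
      because \<rho> is within 1/2 below the distance there; \<psi>^p is C^1 since p > 1.\<close>
    define \<psi> where "\<psi> x = max 0 (g (\<rho> x) - g R)" for x
    define \<Lambda> where "\<Lambda> x = (if \<rho> x < R then (1 + \<epsilon>) * \<bar>g' (\<rho> x)\<bar> else 0)" for x
    let ?k' = "\<lambda>t. p * max 0 (g t - g R) powr (p - 1) * g' t"
    have kd: "((\<lambda>t. max 0 (g t - g R) powr p) has_real_derivative ?k' (\<rho> x)) (at (\<rho> x))" for x
    proof -
      have "((\<lambda>t. g t - g R) has_real_derivative g' (\<rho> x)) (at (\<rho> x))"
        using g(2)[OF \<rho>0[of x]] by (auto intro!: derivative_eq_intros)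
      from DERIV_chain2[OF pos_part_powr_deriv[OF p] this] show ?thesis .
    qed
    have rng: "range \<rho> \<subseteq> {-1/2..}" using \<rho>0 by auto
    have kc: "continuous_on (range \<rho>) ?k'"
    proof -
      have "continuous_on {-1/2..} ?k'"
        using p by (intro continuous_intros continuous_on_powr' contg contg') auto
      then show ?thesis by (rule continuous_on_subset[OF _ rng])
    qed
    have \<psi>C: "C1_fun (\<lambda>x. \<psi> x powr p)" unfolding \<psi>_def by (rule C1_fun_compose(1)[OF \<rho>(1) kd kc])
    have \<psi>d: "cdiff (\<lambda>x. \<psi> x powr p) c x v = ?k' (\<rho> x) * cdiff \<rho> c x v" if "c \<in> atlas M" "x \<in> cdom c" for c x v
      unfolding \<psi>_def by (rule C1_fun_compose(2)[OF \<rho>(1) kd kc that])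
    have \<psi>0: "0 \<le> \<psi> x" for x by (simp add: \<psi>_def)
    have \<psi>g: "\<psi> x \<le> g (-1/2)" for x
      using dec'[OF order_refl \<rho>0[of x]] gR g(1)[of "-1/2"] unfolding \<psi>_def by auto
    have \<psi>R: "\<psi> x = 0" if "R \<le> \<rho> x" for x
      using dec'[OF _ that] R c1(2) by (simp add: \<psi>_def)
    have \<psi>C0: "\<psi> x = 0" if "x \<notin> {y. ?r y \<le> R + 1}" for x
    proof (rule \<psi>R)
      have "R + 1 < ?r x" using that by simp
      then show "R \<le> \<rho> x" using \<rho>(4)[of x] by (simp add: min_def)
    qed
    have \<Lambda>0: "0 \<le> \<Lambda> x" for x using \<epsilon> by (simp add: \<Lambda>_def)
    have g'abs: "\<bar>g' (\<rho> x)\<bar> = \<beta> * (\<rho> x + (b + 1/2)) powr (- \<mu> / p) * g (\<rho> x)" for x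
      using g(3)[OF \<rho>0[of x]] \<beta> g(1)[OF \<rho>0[of x]] by (simp add: abs_mult)
    have one: "1 \<le> \<rho> x + (b + 1/2)" for x using \<rho>0[of x] b(1) by linarith
    have \<Lambda>L: "\<Lambda> x \<le> (1 + \<epsilon>) * (\<beta> * 1 * g (-1/2))" for x
    proof -
      have "(\<rho> x + (b + 1/2)) powr (- \<mu> / p) \<le> (\<rho> x + (b + 1/2)) powr 0"
        using one[of x] \<mu> p by (intro powr_mono) auto
      then have "(\<rho> x + (b + 1/2)) powr (- \<mu> / p) \<le> 1" using one[of x] by (simp split: if_splits)
      then have "\<bar>g' (\<rho> x)\<bar> \<le> \<beta> * 1 * g (-1/2)"
        unfolding g'abs using dec'[OF order_refl \<rho>0[of x]] \<beta> g(1)[OF \<rho>0[of x]] by (intro mult_mono) auto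
      then show ?thesis unfolding \<Lambda>_def using \<epsilon> \<beta> g(1)[of "-1/2"] by auto
    qed
    have \<Lambda>d: "\<bar>cdiff (\<lambda>x. \<psi> x powr p) c x v\<bar> \<le> p * \<psi> x powr (p - 1) * \<Lambda> x * nrm c x v"
      if c: "c \<in> atlas M" "x \<in> cdom c" for c x v
    proof (cases "\<rho> x < R")
      case True
      have "\<bar>cdiff (\<lambda>x. \<psi> x powr p) c x v\<bar> = p * \<psi> x powr (p - 1) * \<bar>g' (\<rho> x)\<bar> * \<bar>cdiff \<rho> c x v\<bar>"
        unfolding \<psi>d[OF c] using p by (simp add: abs_mult \<psi>_def)
      also have "\<dots> \<le> p * \<psi> x powr (p - 1) * \<bar>g' (\<rho> x)\<bar> * ((1 + \<epsilon>) * nrm c x v)"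
        using p by (intro mult_left_mono \<rho>(2)[OF c]) auto
      finally show ?thesis using True by (simp add: \<Lambda>_def mult_ac)
    next
      case False
      then have "\<psi> x = 0" using \<psi>R by simp
      then have "max 0 (g (\<rho> x) - g R) = 0" by (simp add: \<psi>_def)
      then show ?thesis unfolding \<psi>d[OF c] using \<open>\<psi> x = 0\<close> by simp
    qed
    have \<rho>m [measurable]: "\<rho> \<in> borel_measurable borel"
      by (rule borel_measurable_continuous_onI[OF C1_fun_continuous[OF \<rho>(1)]])
    have "continuous_on UNIV (\<lambda>x. \<bar>g' (\<rho> x)\<bar>)"
      by (intro continuous_intros continuous_on_compose2[OF contg' C1_fun_continuous[OF \<rho>(1)]] rng)
    then have [measurable]: "(\<lambda>x. \<bar>g' (\<rho> x)\<bar>) \<in> borel_measurable borel" by (rule borel_measurable_continuous_onI)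
    have \<Lambda>m [measurable]: "\<Lambda> \<in> borel_measurable borel" unfolding \<Lambda>_def by measurable
    have [measurable]: "(\<lambda>x. \<psi> x powr p) \<in> borel_measurable borel"
      by (rule borel_measurable_continuous_onI[OF C1_fun_continuous[OF \<psi>C]])
    have [measurable]: "riem_ball M x0 s \<in> sets borel" for s using open_riem_ball by simp
    define T where "T x = max (u x) 0 powr q" for x
    have [measurable]: "T \<in> borel_measurable borel" unfolding T_def by measurable
    have T0: "0 \<le> T x" for x by (simp add: T_def)
    define I where "I = (\<integral>\<^sup>+x. ennreal (V x * T x * \<psi> x powr p) \<partial>vol)"
    have F: "?F = (\<integral>\<^sup>+x. ennreal (T x) * indicator (riem_ball M x0 (R + 1)) x \<partial>vol)"
      by (simp add: growth_integral_def T_def)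
    have cac: "I \<le> ennreal K * (\<integral>\<^sup>+x. ennreal (T x * \<Lambda> x powr p) \<partial>vol)"
      unfolding I_def T_def K_def
      by (rule caccioppoli[OF p q u V weak \<psi>C \<psi>0 \<psi>g compact_riem_cball \<psi>C0 \<Lambda>0 \<Lambda>L \<Lambda>d \<Lambda>m])
    have ball: "x \<in> riem_ball M x0 (R + 1)" if "\<rho> x < R" for x
      using \<rho>r[OF that] that by (simp add: riem_ball_def)
    define D where "D = A * m powr p * (g R powr p * W)"
    have D: "D > 0" using A m gR W by (simp add: D_def)
    \<comment> \<open>The heart of the estimate: absorption into the left side where g(\<rho>) \<ge>
      m g(R), since \<psi> \<ge> (1 - 1/m) g(\<rho>) there, and the crude bound \<open>D\<close> in
      the remaining region.\<close>
    have ptw: "K * \<Lambda> x powr p \<le> a * (V x * \<psi> x powr p) + D * indicator (riem_ball M x0 (R + 1)) x" for x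
    proof (cases "\<rho> x < R")
      case True
      define \<omega> where "\<omega> = (\<rho> x + (b + 1/2)) powr (- \<mu>)"
      have gx: "g (\<rho> x) > 0" by (rule g(1)[OF \<rho>0])
      have "K * \<Lambda> x powr p = K * (((1 + \<epsilon>) * \<beta>) * ((\<rho> x + (b + 1/2)) powr (- \<mu> / p) * g (\<rho> x))) powr p"
        using True by (simp add: \<Lambda>_def g'abs mult_ac)
      also have "\<dots> = A * (\<omega> * g (\<rho> x) powr p)"
        using p by (simp add: powr_mult powr_powr A_def \<omega>_def)
      finally have L: "K * \<Lambda> x powr p = A * (\<omega> * g (\<rho> x) powr p)" .
      show ?thesis
      proof (cases "g (\<rho> x) < m * g R")
        case small: True
        have "A * (\<omega> * g (\<rho> x) powr p) \<le> A * (W * (m * g R) powr p)"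
          using w[OF \<rho>0 True small] A small gx p W unfolding \<omega>_def
          by (intro mult_left_mono mult_mono powr_mono2) auto
        also have "\<dots> = D" by (simp add: D_def powr_mult)
        finally show ?thesis
          using ball[OF True] a V(2)[of x] unfolding L by (simp add: add_increasing)
      next
        case False
        have "(1 - 1 / m) * g (\<rho> x) \<le> \<psi> x"
        proof -
          have "g R \<le> g (\<rho> x) / m" using False m by (simp add: field_simps)
          then show ?thesis by (simp add: \<psi>_def algebra_simps)
        qed
        moreover have m1: "0 < 1 - 1 / m" using m by simp
        ultimately have "((1 - 1 / m) * g (\<rho> x)) powr p \<le> \<psi> x powr p"
          using gx p by (intro powr_mono2) auto
        then have "g (\<rho> x) powr p \<le> (1 - 1 / m) powr (- p) * \<psi> x powr p"
        proof -
          have "y \<le> z powr (- p) * w" if "(z * g (\<rho> x)) powr p \<le> w" "y = g (\<rho> x) powr p" "0 < z" for y z w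
            using that by (simp add: powr_mult powr_minus_divide pos_le_divide_eq mult.commute)
          from this[OF _ refl m1] show ?thesis using \<open>((1 - 1 / m) * g (\<rho> x)) powr p \<le> \<psi> x powr p\<close> .
        qed
        \<comment> \<open>The shift 1/2 in the weight matches \<rho> \<ge> r - 1/2, so the weight is
          at most that of the lower bound for V.\<close>
        moreover have "\<omega> \<le> V x / l"
        proof -
          have "\<omega> \<le> (?r x + b) powr (- \<mu>)"
            unfolding \<omega>_def
          proof (rule powr_mono2')
            show "0 < ?r x + b" using b(1) riem_dist_nonneg[of x0 x] by linarith
          qed (use \<rho>r[OF True] \<mu> in auto)
          also have "\<dots> \<le> V x / l" using b(2)[of x] l by (simp add: field_simps)
          finally show ?thesis .
        qed
        ultimately have "A * (\<omega> * g (\<rho> x) powr p) \<le> A * (V x / l * ((1 - 1 / m) powr (- p) * \<psi> x powr p))"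
          using A V(2)[of x] l by (intro mult_left_mono mult_mono) auto
        also have "\<dots> = a * (V x * \<psi> x powr p)" by (simp add: a_def)
        finally show ?thesis unfolding L using D by (simp add: add_increasing2)
      qed
    next
      case False
      then have "\<Lambda> x = 0" "0 \<le> a * (V x * \<psi> x powr p)" using a V(2)[of x] by (simp_all add: \<Lambda>_def)
      then show ?thesis using D by simp
    qed
    show ?thesis
    proof (cases "?F = \<infinity>")
      case True
      have "0 < g R powr p * W" using gR W by simp
      then have "ennreal (g R powr p * W) \<noteq> 0" by (simp only: ennreal_eq_0_iff not_le)
      then show ?thesis by (simp only: True infinity_ennreal_def ennreal_mult_top if_False top_greatest)
    next
      case False
      then obtain f where f: "f \<ge> 0" "?F = ennreal f" by (cases ?F) auto
      \<comment> \<open>A bound for \<open>\<Lambda>\<close>; it shows that \<open>I\<close> is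
        finite, so that a * I can be subtracted from both sides.\<close>
      define L0 where "L0 = (1 + \<epsilon>) * (\<beta> * 1 * g (-1/2))"
      have "(\<integral>\<^sup>+x. ennreal (T x * \<Lambda> x powr p) \<partial>vol) \<le>
          (\<integral>\<^sup>+x. ennreal (L0 powr p) * (ennreal (T x) * indicator (riem_ball M x0 (R + 1)) x) \<partial>vol)"
      proof (rule nn_integral_mono)
        fix x
        show "ennreal (T x * \<Lambda> x powr p) \<le> ennreal (L0 powr p) * (ennreal (T x) * indicator (riem_ball M x0 (R + 1)) x)"
        proof (cases "\<rho> x < R")
          case True
          have "T x * \<Lambda> x powr p \<le> L0 powr p * T x"
            using T0[of x] \<Lambda>0[of x] \<Lambda>L[of x] p unfolding L0_def by (subst mult.commute) (intro mult_right_mono powr_mono2, auto)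
          then show ?thesis using ball[OF True] T0[of x] by (simp add: ennreal_mult[symmetric] ennreal_leI)
        next
          case False
          then have "\<Lambda> x = 0" by (simp add: \<Lambda>_def)
          then show ?thesis by simp
        qed
      qed
      also have "\<dots> = ennreal (L0 powr p) * ?F" unfolding F by (rule nn_integral_cmult) measurable
      also have "\<dots> < \<infinity>" unfolding f(2) by (simp add: ennreal_mult_less_top)
      finally have fin: "(\<integral>\<^sup>+x. ennreal (T x * \<Lambda> x powr p) \<partial>vol) < \<infinity>" .
      have "I < \<infinity>" by (rule le_less_trans[OF cac]) (use fin in \<open>simp add: ennreal_mult_less_top\<close>)
      then obtain i where i: "i \<ge> 0" "I = ennreal i" by (cases I) auto
      have "I \<le> (\<integral>\<^sup>+x. ennreal (a) * ennreal (V x * T x * \<psi> x powr p) + ennreal D * (ennreal (T x) * indicator (riem_ball M x0 (R + 1)) x) \<partial>vol)"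
      proof (rule order_trans[OF cac])
        have "ennreal K * (\<integral>\<^sup>+x. ennreal (T x * \<Lambda> x powr p) \<partial>vol) = (\<integral>\<^sup>+x. ennreal K * ennreal (T x * \<Lambda> x powr p) \<partial>vol)"
          by (rule nn_integral_cmult[symmetric]) measurable
        also have "\<dots> \<le> (\<integral>\<^sup>+x. ennreal (a) * ennreal (V x * T x * \<psi> x powr p) + ennreal D * (ennreal (T x) * indicator (riem_ball M x0 (R + 1)) x) \<partial>vol)"
        proof (rule nn_integral_mono)
          fix x
          let ?i = "indicator (riem_ball M x0 (R + 1)) x :: real"
          have i0: "0 \<le> ?i" by simp
          have e: "indicator (riem_ball M x0 (R + 1)) x = ennreal ?i" by (simp add: indicator_def)
          have "K * (T x * \<Lambda> x powr p) = T x * (K * \<Lambda> x powr p)" by simp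
          also have "\<dots> \<le> T x * (a * (V x * \<psi> x powr p) + D * ?i)" by (intro mult_left_mono ptw T0)
          also have "\<dots> = a * (V x * T x * \<psi> x powr p) + D * (T x * ?i)" by (simp add: algebra_simps)
          finally have "ennreal (K * (T x * \<Lambda> x powr p)) \<le> ennreal (a * (V x * T x * \<psi> x powr p) + D * (T x * ?i))"
            by (rule ennreal_leI)
          also have "\<dots> = ennreal (a * (V x * T x * \<psi> x powr p)) + ennreal (D * (T x * ?i))"
            using a(1) V(2)[of x] T0[of x] D i0 by (intro ennreal_plus mult_nonneg_nonneg) auto
          finally show "ennreal K * ennreal (T x * \<Lambda> x powr p) \<le> ennreal a * ennreal (V x * T x * \<psi> x powr p) + ennreal D * (ennreal (T x) * indicator (riem_ball M x0 (R + 1)) x)"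
            unfolding e ennreal_mult'[OF less_imp_le[OF K]] ennreal_mult'[OF a(1)] ennreal_mult'[OF less_imp_le[OF D]] ennreal_mult'[OF T0] .
        qed
        finally show "ennreal K * (\<integral>\<^sup>+x. ennreal (T x * \<Lambda> x powr p) \<partial>vol) \<le> (\<integral>\<^sup>+x. ennreal (a) * ennreal (V x * T x * \<psi> x powr p) + ennreal D * (ennreal (T x) * indicator (riem_ball M x0 (R + 1)) x) \<partial>vol)" .
      qed
      also have "\<dots> = ennreal a * I + ennreal D * ?F"
        unfolding F I_def by (subst nn_integral_add, measurable, subst (1 2) nn_integral_cmult, measurable)
      also have "\<dots> = ennreal (a * i + D * f)"
        unfolding i(2) f(2) using a(1) D i(1) f(1) by (simp add: ennreal_mult'[symmetric] ennreal_plus[symmetric] del: ennreal_plus)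
      finally have ile: "i \<le> a * i + D * f"
        unfolding i(2) using a(1) D i(1) f(1) by (subst (asm) ennreal_le_iff) auto
      have "ennreal c3 = ennreal ((g (r1 + 1) - g (r1 + 2)) powr p) * ennreal c1" unfolding c3_def by (rule ennreal_mult') simp
      also have "\<dots> \<le> ennreal ((g (r1 + 1) - g (r1 + 2)) powr p) * (\<integral>\<^sup>+x. ennreal (V x * T x) * indicator (riem_ball M x0 r1) x \<partial>vol)"
        unfolding T_def by (intro mult_left_mono c1(3)) simp
      also have "\<dots> = (\<integral>\<^sup>+x. ennreal ((g (r1 + 1) - g (r1 + 2)) powr p) * (ennreal (V x * T x) * indicator (riem_ball M x0 r1) x) \<partial>vol)"
        by (rule nn_integral_cmult[symmetric]) measurable
      also have "\<dots> \<le> I"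
        unfolding I_def
      proof (rule nn_integral_mono)
        fix x
        show "ennreal ((g (r1 + 1) - g (r1 + 2)) powr p) * (ennreal (V x * T x) * indicator (riem_ball M x0 r1) x) \<le> ennreal (V x * T x * \<psi> x powr p)"
        proof (cases "x \<in> riem_ball M x0 r1")
          case True
          then have "\<rho> x \<le> r1 + 1" using \<rho>(3)[of x] by (simp add: riem_ball_def)
          from dec'[OF \<rho>0 this] have "g (r1 + 1) - g (r1 + 2) \<le> \<psi> x"
            using dec'[of "r1 + 2" R] R c1(2) by (simp add: \<psi>_def)
          moreover have "0 \<le> g (r1 + 1) - g (r1 + 2)" using dec[of "r1 + 1" "r1 + 2"] c1(2) by simp
          ultimately have "(g (r1 + 1) - g (r1 + 2)) powr p \<le> \<psi> x powr p" using p by (intro powr_mono2) auto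
          then have "(g (r1 + 1) - g (r1 + 2)) powr p * (V x * T x) \<le> V x * T x * \<psi> x powr p"
            using V(2)[of x] T0[of x] by (subst mult.commute) (intro mult_left_mono, auto)
          then show ?thesis using True V(2)[of x] T0[of x] by (simp add: ennreal_mult'[symmetric] ennreal_leI)
        qed simp
      qed
      finally have c3i: "c3 \<le> i" unfolding i(2) using i(1) by (simp add: ennreal_le_iff)
      have "(1 - a) * c3 \<le> (1 - a) * i" using a c3i by (intro mult_left_mono) auto
      also have "\<dots> \<le> D * f" using ile by (simp add: algebra_simps)
      finally have "c \<le> g R powr p * W * f"
        unfolding c_def D_def using A m by (simp add: divide_le_eq mult_ac)
      then have "ennreal c \<le> ennreal (g R powr p * W * f)" by (rule ennreal_leI)
      also have "\<dots> = ennreal (g R powr p * W) * ?F"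
        unfolding f(2) using W by (intro ennreal_mult') simp
      finally show ?thesis .
    qed
  qed
  ultimately show thesis by (rule that)
qed

end

section \<open>Extended logarithms and the constants\<close>

lemma elog_ge:
  assumes "0 < y" "ennreal y \<le> a"
  shows "ereal (ln y) \<le> elog a"
proof (cases a)
  case (real r)
  then have "y \<le> r" using assms by (simp add: ennreal_le_iff)
  then have "ln y \<le> ln r" "r > 0" using assms(1) by auto
  then show ?thesis using real by (simp add: elog_def)
qed (simp add: elog_def)

lemma Liminf_elog_ge:
  fixes F :: "real \<Rightarrow> ennreal"
  assumes ev: "eventually (\<lambda>R. 0 < n R \<and> 0 < y R \<and> ennreal (y R) \<le> F R) at_top"
    and lim: "((\<lambda>R. ln (y R) / n R) \<longlongrightarrow> L) at_top"
  shows "ereal L \<le> Liminf at_top (\<lambda>R. ereal (1 / n R) * elog (F R))"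
proof -
  have "ereal L = Liminf at_top (\<lambda>R. ereal (ln (y R) / n R))"
    by (rule lim_imp_Liminf[symmetric]) (use lim in auto)
  also have "\<dots> \<le> Liminf at_top (\<lambda>R. ereal (1 / n R) * elog (F R))"
  proof (rule Liminf_mono, rule eventually_mono[OF ev])
    fix R assume R: "0 < n R \<and> 0 < y R \<and> ennreal (y R) \<le> F R"
    have "ereal (ln (y R) / n R) = ereal (1 / n R) * ereal (ln (y R))" by simp
    also have "\<dots> \<le> ereal (1 / n R) * elog (F R)"
      using R by (intro ereal_mult_left_mono elog_ge) auto
    finally show "ereal (ln (y R) / n R) \<le> ereal (1 / n R) * elog (F R)" .
  qed
  finally show ?thesis .
qed

lemma ennreal_divide_le_of_le_mult:
  assumes "0 < x" "ennreal c \<le> ennreal x * F"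
  shows "ennreal (c / x) \<le> F"
proof (cases F)
  case (real f)
  then have "c \<le> x * f"
    using assms by (simp add: ennreal_mult'[symmetric] ennreal_le_iff mult_nonneg_nonneg)
  then have "c / x \<le> f" using assms(1) by (simp add: divide_le_eq mult.commute)
  then show ?thesis using real by (simp add: ennreal_leI)
qed simp

lemma const_C0_pos: "1 < p \<Longrightarrow> p - 1 < q \<Longrightarrow> 0 < lam \<Longrightarrow> 0 < const_C0 p q lam"
  by (simp add: const_C0_def)

text \<open>Taking p-th powers, \<gamma> < C_0 becomes K (\<gamma>/p)^p < \<lambda> with K the
  Caccioppoli constant. The inequality is strict, so by continuity there is room for
  \<open>l\<close> below \<lambda>, for \<epsilon> near 0 and for large \<open>m\<close>.\<close>

lemma ex_small_parameters:
  assumes p: "1 < p" and q: "p - 1 < q" and lam: "0 < lam" and \<gamma>: "0 < \<gamma>" "\<gamma> < const_C0 p q lam"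
  obtains l \<epsilon> m where "0 < l" "l < lam" "0 < \<epsilon>" "\<epsilon> \<le> 1" "1 < m"
    "((p - 1) / (q - p + 1)) powr (p - 1) * ((1 + \<epsilon>) * (\<gamma> / p)) powr p * (1 - 1 / m) powr (- p) < l"
proof -
  define s where "s = q - p + 1"
  have s: "s > 0" using q by (simp add: s_def)
  define K where "K = ((p - 1) / s) powr (p - 1)"
  have K: "K > 0" using p s by (simp add: K_def)
  have "\<gamma> / p < (s / (p - 1)) powr ((p - 1) / p) * lam powr (1 / p)"
    using \<gamma>(2) p s unfolding const_C0_def conj_exp_def s_def[symmetric] by (simp add: powr_divide divide_less_eq mult_ac)
  then have "(\<gamma> / p) powr p < ((s / (p - 1)) powr ((p - 1) / p) * lam powr (1 / p)) powr p"
    using \<gamma>(1) p by (intro powr_less_mono2) auto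
  also have "\<dots> = (s / (p - 1)) powr (p - 1) * lam" using p lam by (simp add: powr_mult powr_powr)
  finally have "K * (\<gamma> / p) powr p < K * ((s / (p - 1)) powr (p - 1) * lam)" using K by simp
  also have "K * ((s / (p - 1)) powr (p - 1) * lam) = lam" using p s by (simp add: K_def powr_divide)
  finally have lt: "K * (\<gamma> / p) powr p < lam" .
  define l where "l = (K * (\<gamma> / p) powr p + lam) / 2"
  have "0 \<le> K * (\<gamma> / p) powr p" using K by simp
  then have l: "0 < l" "l < lam" "K * (\<gamma> / p) powr p < l" using lt lam by (auto simp: l_def)
  have l1: "(\<lambda>n. 1 + 1 / (real n + 1)) \<longlonglongrightarrow> 1" by real_asymp
  have l2: "(\<lambda>n. 1 - 1 / (real n + 2)) \<longlonglongrightarrow> 1" by real_asymp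
  have "(\<lambda>n. K * ((1 + 1 / (real n + 1)) * (\<gamma> / p)) powr p * (1 - 1 / (real n + 2)) powr (- p)) \<longlonglongrightarrow>
      K * (1 * (\<gamma> / p)) powr p * 1 powr (- p)"
    using \<gamma> p by (intro tendsto_intros l1 l2) auto
  then have "eventually (\<lambda>n. K * ((1 + 1 / (real n + 1)) * (\<gamma> / p)) powr p * (1 - 1 / (real n + 2)) powr (- p) < l) sequentially"
    using l(3) by (intro order_tendstoD(2)) auto
  then obtain n where "K * ((1 + 1 / (real n + 1)) * (\<gamma> / p)) powr p * (1 - 1 / (real n + 2)) powr (- p) < l"
    by (auto simp: eventually_sequentially)
  then show ?thesis
    using that[of l "1 / (real n + 1)" "real n + 2"] l(1,2) unfolding K_def s_def by simp
qed

text \<open>The function C^(1/p) (C - p)^(1/p') increases strictly from 0 at C = p. At C_0 + p it is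
  at least C_0^(1/p) C_0^(1/p') = C_0, so the value C_0 is attained exactly once, at some point not
  beyond C_0 + p.\<close>

lemma const_C1_properties:
  assumes p: "1 < p" and q: "p - 1 < q" and lam: "0 < lam"
  shows "\<exists>!C. is_const_C1 p q lam C" "p < const_C1 p q lam" "const_C1 p q lam \<le> const_C0 p q lam + p"
proof -
  let ?c = "const_C0 p q lam"
  define f where "f C = C powr (1 / p) * (C - p) powr (1 / conj_exp p)" for C
  have c: "?c > 0" using const_C0_pos[OF p q lam] .
  have e: "1 / p > 0" "1 / conj_exp p > 0" "1 / p + 1 / conj_exp p = 1"
    using p by (auto simp: conj_exp_def field_simps)
  have mono: "f C < f D" if "p < C" "C < D" for C D
    unfolding f_def using that e p by (intro mult_strict_mono powr_less_mono2) auto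
  have "?c = ?c powr (1 / p) * ?c powr (1 / conj_exp p)"
    unfolding powr_add[symmetric] e(3) using c by simp
  also have "\<dots> \<le> f (?c + p)"
    unfolding f_def using c e p by (intro mult_mono powr_mono2) auto
  finally have fc: "?c \<le> f (?c + p)" .
  have "f p \<le> ?c" using c by (simp add: f_def)
  moreover have "continuous_on {p..?c + p} f"
    unfolding f_def using e p by (intro continuous_intros continuous_on_powr') auto
  ultimately obtain C where C: "p \<le> C" "C \<le> ?c + p" "f C = ?c"
    using IVT'[of f p ?c "?c + p"] fc c by auto
  have "C \<noteq> p" using C(3) c by (auto simp: f_def)
  then have iC: "is_const_C1 p q lam C" using C by (simp add: is_const_C1_def f_def)
  have uniq: "D = C" if "is_const_C1 p q lam D" for D
    using mono[of C D] mono[of D C] that iC unfolding is_const_C1_def f_def[symmetric] by (metis linorder_less_linear less_irrefl)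
  show ex1: "\<exists>!C. is_const_C1 p q lam C" using iC uniq by blast
  have "const_C1 p q lam = C" unfolding const_C1_def using iC uniq by (rule the_equality)
  then show "p < const_C1 p q lam" "const_C1 p q lam \<le> ?c + p" using C iC by (auto simp: is_const_C1_def)
qed

section \<open>The two growth rates and the theorem\<close>

context riem_volume begin

context
  fixes p q \<mu> lam :: real and V u :: "'a \<Rightarrow> real" and X :: "('a, 'n) vfield" and x0 :: 'a
  assumes p: "1 < p" and q: "p - 1 < q" and \<mu>: "0 \<le> \<mu>" and lam: "0 < lam"
    and u: "in_W1p_loc M vol p u X"
    and V: "continuous_on UNIV V" "\<And>x. 0 < V x"
    and V0: "\<And>x. \<mu> = 0 \<Longrightarrow> lam \<le> V x"
    and V1: "\<mu> > 0 \<Longrightarrow> \<exists>o'. Liminf at_infty (\<lambda>x. ereal (riem_dist M x o' powr \<mu> * V x)) \<ge> ereal lam"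
    and weak: "p_laplacian_ge_weakly_on M vol p V u {x. u x > 0}"
    and pos: "emeasure vol {x. u x > 0} > 0"
begin

text \<open>The solution of the differential equation is an exponential of - (t + b + 1/2)^\<theta>,
  and the weight is at most 1, so W = 1 in \<open>growth_estimate\<close> and g(R)^(-p) is the
  growth.\<close>

lemma exponential_growth:
  assumes \<mu>p: "\<mu> < p" and \<gamma>: "0 < \<gamma>" "\<gamma> < const_C0 p q lam"
  defines "\<theta> \<equiv> 1 - \<mu> / p"
  obtains c where "0 < c" "\<forall>\<^sub>F R in at_top. ennreal (c * exp (\<gamma> / \<theta> * R powr \<theta>)) \<le> growth_integral M vol q u x0 R"
proof -
  obtain l \<epsilon> m where par: "0 < l" "l < lam" "0 < \<epsilon>" "\<epsilon> \<le> 1" "1 < m"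
    "((p - 1) / (q - p + 1)) powr (p - 1) * ((1 + \<epsilon>) * (\<gamma> / p)) powr p * (1 - 1 / m) powr (- p) < l"
    using ex_small_parameters[OF p q lam \<gamma>] .
  obtain b where b: "b \<ge> 1" "\<And>x. l * (riem_dist M x0 x + b) powr (- \<mu>) \<le> V x"
    using potential_lower_bound[where ?x0.0 = x0, OF V \<mu> par(1,2) V0 V1] by blast
  have \<theta>: "\<theta> > 0" using \<mu>p p by (simp add: \<theta>_def)
  define g where "g t = exp (- (\<gamma> / p) / \<theta> * (t + (b + 1/2)) powr \<theta>)" for t
  define g' where "g' t = - (\<gamma> / p) * (t + (b + 1/2)) powr (- \<mu> / p) * g t" for t
  have gd: "(g has_real_derivative g' t) (at t)" if "-1/2 \<le> t" for t
  proof -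
    have pos: "0 < t + (b + 1/2)" using that b(1) by linarith
    have "((\<lambda>t. (t + (b + 1/2)) powr \<theta>) has_real_derivative \<theta> * (t + (b + 1/2)) powr (\<theta> - 1)) (at t)"
      using pos by (auto intro!: derivative_eq_intros)
    then have "((\<lambda>t. - (\<gamma> / p) / \<theta> * (t + (b + 1/2)) powr \<theta>) has_real_derivative
        - (\<gamma> / p) / \<theta> * (\<theta> * (t + (b + 1/2)) powr (\<theta> - 1))) (at t)" by (rule DERIV_cmult)
    from DERIV_fun_exp[OF this] have "(g has_real_derivative
        g t * (- (\<gamma> / p) / \<theta> * (\<theta> * (t + (b + 1/2)) powr (\<theta> - 1)))) (at t)"
      unfolding g_def .
    moreover have "G * (x / \<theta> * (\<theta> * Q)) = x * Q * G" for G x Q using \<theta> by simp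
    moreover have "\<theta> - 1 = - \<mu> / p" by (simp add: \<theta>_def)
    ultimately show ?thesis unfolding g'_def by metis
  qed
  have g0: "0 < g t" for t by (simp add: g_def)
  obtain c R0 where c: "0 < c" "\<And>R W. R0 \<le> R \<Longrightarrow> 0 < W \<Longrightarrow>
      (\<And>t. -1/2 \<le> t \<Longrightarrow> t < R \<Longrightarrow> g t < m * g R \<Longrightarrow> (t + (b + 1/2)) powr (- \<mu>) \<le> W) \<Longrightarrow>
      ennreal c \<le> ennreal (g R powr p * W) * growth_integral M vol q u x0 (R + 1)"
    by (rule growth_estimate[where g = g and g' = g' and \<beta> = "\<gamma> / p" and \<epsilon> = \<epsilon> and m = m and \<mu> = \<mu>,
        OF p q u V weak pos \<mu> par(1) b _ g0 gd g'_def par(3-6)]) (use \<gamma>(1) p in auto)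
  have "ennreal (c * exp (\<gamma> / \<theta> * R powr \<theta>)) \<le> growth_integral M vol q u x0 R" if R: "max 0 (R0 + 1) \<le> R" for R
  proof -
    have w1: "(t + (b + 1/2)) powr (- \<mu>) \<le> 1" if "-1/2 \<le> t" for t
    proof -
      have "1 \<le> t + (b + 1/2)" using that b(1) by linarith
      then have "(t + (b + 1/2)) powr (- \<mu>) \<le> (t + (b + 1/2)) powr 0" using \<mu> by (intro powr_mono) auto
      then show ?thesis using \<open>1 \<le> t + (b + 1/2)\<close> by (simp split: if_splits)
    qed
    have "ennreal c \<le> ennreal (g (R - 1) powr p * 1) * growth_integral M vol q u x0 (R - 1 + 1)"
      by (rule c(2)) (use R w1 in auto)
    then have "ennreal (c / g (R - 1) powr p) \<le> growth_integral M vol q u x0 R"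
      using g0 by (intro ennreal_divide_le_of_le_mult) (auto simp: less_imp_neq[symmetric])
    \<comment> \<open>The estimate is used at R - 1, as it concerns the ball of radius one larger; R
      - 1 + (b + 1/2) is still at least R because b \<ge> 1.\<close>
    moreover have "c * exp (\<gamma> / \<theta> * R powr \<theta>) \<le> c / g (R - 1) powr p"
    proof -
      have gp: "g (R - 1) powr p = exp (- (\<gamma> / \<theta> * (R - 1 + (b + 1/2)) powr \<theta>))"
        using p by (simp add: g_def exp_powr_real)
      have "c / g (R - 1) powr p = c * exp (\<gamma> / \<theta> * (R - 1 + (b + 1/2)) powr \<theta>)"
        unfolding gp exp_minus by (simp only: divide_inverse inverse_inverse_eq)
      moreover have "R powr \<theta> \<le> (R - 1 + (b + 1/2)) powr \<theta>" using R b(1) \<theta> by (intro powr_mono2) auto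
      then have "\<gamma> / \<theta> * R powr \<theta> \<le> \<gamma> / \<theta> * (R - 1 + (b + 1/2)) powr \<theta>" using \<gamma>(1) \<theta> by (intro mult_left_mono) auto
      ultimately show ?thesis using c(1) by simp
    qed
    ultimately show ?thesis by (meson ennreal_leI order_trans)
  qed
  then have "\<forall>\<^sub>F R in at_top. ennreal (c * exp (\<gamma> / \<theta> * R powr \<theta>)) \<le> growth_integral M vol q u x0 R"
    by (rule eventually_at_top_linorderI)
  with c(1) show ?thesis by (rule that)
qed

text \<open>Here the solution is the power (t + b + 1/2)^(-\<beta>). If g(t) < m g(R), then t + b +
  1/2 is at least a fixed fraction of R + b + 1/2, so the weight is of order R^(-p). This gain adds
  p to the exponent p \<beta> = \<gamma>.\<close>

lemma polynomial_growth:
  assumes \<mu>p: "\<mu> = p" and \<gamma>: "0 < \<gamma>" "\<gamma> < const_C0 p q lam"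
  obtains c where "0 < c" "\<forall>\<^sub>F R in at_top. ennreal (c * R powr (\<gamma> + p)) \<le> growth_integral M vol q u x0 R"
proof -
  obtain l \<epsilon> m where par: "0 < l" "l < lam" "0 < \<epsilon>" "\<epsilon> \<le> 1" "1 < m"
    "((p - 1) / (q - p + 1)) powr (p - 1) * ((1 + \<epsilon>) * (\<gamma> / p)) powr p * (1 - 1 / m) powr (- p) < l"
    using ex_small_parameters[OF p q lam \<gamma>] .
  obtain b where b: "b \<ge> 1" "\<And>x. l * (riem_dist M x0 x + b) powr (- \<mu>) \<le> V x"
    using potential_lower_bound[where ?x0.0 = x0, OF V \<mu> par(1,2) V0 V1] by blast
  define \<beta> where "\<beta> = \<gamma> / p"
  have \<beta>: "\<beta> > 0" using \<gamma> p by (simp add: \<beta>_def)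
  define g where "g t = (t + (b + 1/2)) powr (- \<beta>)" for t
  define g' where "g' t = - \<beta> * (t + (b + 1/2)) powr (- \<mu> / p) * g t" for t
  have base: "1 \<le> t + (b + 1/2)" if "-1/2 \<le> t" for t using that b(1) by linarith
  have gd: "(g has_real_derivative g' t) (at t)" if "-1/2 \<le> t" for t
  proof -
    have pos: "0 < t + (b + 1/2)" using base[OF that] by linarith
    have "((\<lambda>t. (t + (b + 1/2)) powr (- \<beta>)) has_real_derivative - \<beta> * (t + (b + 1/2)) powr (- \<beta> - 1)) (at t)"
      using pos by (auto intro!: derivative_eq_intros)
    moreover have "(t + (b + 1/2)) powr (- \<beta> - 1) = (t + (b + 1/2)) powr (- \<mu> / p) * g t"
    proof -
      have "- \<beta> - 1 = - \<mu> / p + - \<beta>" using \<mu>p p by simp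
      then show ?thesis unfolding g_def by (simp only: powr_add)
    qed
    ultimately show ?thesis unfolding g_def[abs_def] g'_def by (simp add: g_def mult.assoc)
  qed
  have g0: "0 < g t" if "-1/2 \<le> t" for t using base[OF that] by (simp add: g_def)
  obtain c R0 where c: "0 < c" "\<And>R W. R0 \<le> R \<Longrightarrow> 0 < W \<Longrightarrow>
      (\<And>t. -1/2 \<le> t \<Longrightarrow> t < R \<Longrightarrow> g t < m * g R \<Longrightarrow> (t + (b + 1/2)) powr (- \<mu>) \<le> W) \<Longrightarrow>
      ennreal c \<le> ennreal (g R powr p * W) * growth_integral M vol q u x0 (R + 1)"
    by (rule growth_estimate[where g = g and g' = g' and \<beta> = \<beta> and \<epsilon> = \<epsilon> and m = m and \<mu> = \<mu>,
        OF p q u V weak pos \<mu> par(1) b \<beta> g0 gd g'_def par(3-5) par(6)[folded \<beta>_def]]) auto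
  define d where "d = c / m powr (p / \<beta>)"
  have d: "d > 0" using c(1) par(5) by (simp add: d_def)
  have "ennreal (d * R powr (\<gamma> + p)) \<le> growth_integral M vol q u x0 R" if R: "max 1 (R0 + 1) \<le> R" for R
  proof -
    define z where "z = R - 1 + (b + 1/2)"
    have z: "R \<le> z" "0 < z" using R b(1) by (auto simp: z_def)
    \<comment> \<open>The weight is g^(p/\<beta>), so it is below (m g(R - 1))^(p/\<beta>) on the
      leftover region; this equals \<open>W\<close>.\<close>
    define W where "W = m powr (p / \<beta>) * z powr (- p)"
    have W: "W > 0" using par(5) z by (simp add: W_def)
    have w1: "(t + (b + 1/2)) powr (- \<mu>) \<le> W" if t: "-1/2 \<le> t" "g t < m * g (R - 1)" for t
    proof -
      have "(t + (b + 1/2)) powr (- \<mu>) = g t powr (p / \<beta>)"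
        unfolding g_def using \<mu>p \<beta> by (simp add: powr_powr)
      also have "\<dots> \<le> (m * g (R - 1)) powr (p / \<beta>)"
        using t g0[OF t(1)] p \<beta> by (intro powr_mono2) auto
      also have "\<dots> = W"
        unfolding W_def g_def z_def powr_mult using \<beta> by (simp add: powr_powr)
      finally show ?thesis .
    qed
    have "ennreal c \<le> ennreal (g (R - 1) powr p * W) * growth_integral M vol q u x0 (R - 1 + 1)"
      by (rule c(2)) (use R W w1 in auto)
    then have "ennreal (c / (g (R - 1) powr p * W)) \<le> growth_integral M vol q u x0 R"
      using g0[of "R - 1"] R W by (intro ennreal_divide_le_of_le_mult) auto
    moreover have "d * R powr (\<gamma> + p) \<le> c / (g (R - 1) powr p * W)"
    proof -
      have gp: "g (R - 1) powr p = z powr (- \<gamma>)"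
        unfolding g_def z_def \<beta>_def using p by (simp add: powr_powr)
      have "c / (g (R - 1) powr p * W) = d * z powr (\<gamma> + p)"
        unfolding gp W_def d_def powr_minus powr_add
        by (simp only: divide_inverse inverse_mult_distrib inverse_inverse_eq mult_ac)
      moreover have "R powr (\<gamma> + p) \<le> z powr (\<gamma> + p)" using R z(1) \<gamma> p by (intro powr_mono2) auto
      ultimately show ?thesis using d by simp
    qed
    ultimately show ?thesis by (meson ennreal_leI order_trans)
  qed
  then have "\<forall>\<^sub>F R in at_top. ennreal (d * R powr (\<gamma> + p)) \<le> growth_integral M vol q u x0 R"
    by (rule eventually_at_top_linorderI)
  with d show ?thesis by (rule that)
qed

text \<open>After division by R^\<theta> the constant \<open>c\<close> disappears, leaving
  \<gamma>/\<theta> for every \<gamma> < C_0; then \<gamma> tends to C_0 from below.\<close>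

lemma Liminf_exponential:
  assumes \<mu>p: "\<mu> < p"
  shows "ereal (const_C0 p q lam / (1 - \<mu> / p)) \<le>
    Liminf at_top (\<lambda>R. ereal (1 / R powr (1 - \<mu> / p)) * elog (growth_integral M vol q u x0 R))" (is "_ \<le> ?L")
proof -
  define \<theta> where "\<theta> = 1 - \<mu> / p"
  have \<theta>: "\<theta> > 0" using \<mu>p p by (simp add: \<theta>_def)
  let ?c = "const_C0 p q lam"
  have "ereal (\<gamma> / \<theta>) \<le> ?L" if \<gamma>: "0 < \<gamma>" "\<gamma> < ?c" for \<gamma>
  proof -
    obtain c where c: "0 < c" "\<forall>\<^sub>F R in at_top. ennreal (c * exp (\<gamma> / \<theta> * R powr \<theta>)) \<le> growth_integral M vol q u x0 R"
      using exponential_growth[OF \<mu>p \<gamma>] unfolding \<theta>_def .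
    show ?thesis
      unfolding \<theta>_def[symmetric]
    proof (rule Liminf_elog_ge)
      show "\<forall>\<^sub>F R in at_top. 0 < R powr \<theta> \<and> 0 < c * exp (\<gamma> / \<theta> * R powr \<theta>) \<and>
          ennreal (c * exp (\<gamma> / \<theta> * R powr \<theta>)) \<le> growth_integral M vol q u x0 R"
        using c(2) eventually_gt_at_top[of 0] by eventually_elim (use c(1) in auto)
      have "((\<lambda>R. ln c * R powr (- \<theta>) + \<gamma> / \<theta>) \<longlongrightarrow> ln c * 0 + \<gamma> / \<theta>) at_top"
        using \<theta> by (intro tendsto_intros tendsto_neg_powr filterlim_ident) auto
      then have "((\<lambda>R. ln c * R powr (- \<theta>) + \<gamma> / \<theta>) \<longlongrightarrow> \<gamma> / \<theta>) at_top" by simp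
      moreover have "\<forall>\<^sub>F R in at_top. ln c * R powr (- \<theta>) + \<gamma> / \<theta> = ln (c * exp (\<gamma> / \<theta> * R powr \<theta>)) / R powr \<theta>"
        using eventually_gt_at_top[of 0]
        by eventually_elim (use c(1) in \<open>simp add: ln_mult powr_minus_divide add_divide_distrib\<close>)
      ultimately show "((\<lambda>R. ln (c * exp (\<gamma> / \<theta> * R powr \<theta>)) / R powr \<theta>) \<longlongrightarrow> \<gamma> / \<theta>) at_top"
        by (rule Lim_transform_eventually)
    qed
  qed
  then have "\<forall>\<^sub>F \<gamma> in at_left ?c. ereal (\<gamma> / \<theta>) \<le> ?L"
    using eventually_at_left_real[OF const_C0_pos[OF p q lam]] by (auto elim: eventually_mono)
  moreover have "((\<lambda>\<gamma>. ereal (\<gamma> / \<theta>)) \<longlongrightarrow> ereal (?c / \<theta>)) (at_left ?c)"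
    using \<theta> by (intro tendsto_intros) auto
  ultimately show ?thesis unfolding \<theta>_def[symmetric]
    by (intro tendsto_upperbound) auto
qed

lemma Liminf_polynomial:
  assumes \<mu>p: "\<mu> = p"
  shows "ereal (const_C0 p q lam + p) \<le>
    Liminf at_top (\<lambda>R. ereal (1 / ln R) * elog (growth_integral M vol q u x0 R))" (is "_ \<le> ?L")
proof -
  let ?c = "const_C0 p q lam"
  have "ereal (\<gamma> + p) \<le> ?L" if \<gamma>: "0 < \<gamma>" "\<gamma> < ?c" for \<gamma>
  proof -
    obtain c where c: "0 < c" "\<forall>\<^sub>F R in at_top. ennreal (c * R powr (\<gamma> + p)) \<le> growth_integral M vol q u x0 R"
      using polynomial_growth[OF \<mu>p \<gamma>] .
    show ?thesis
    proof (rule Liminf_elog_ge)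
      show "\<forall>\<^sub>F R in at_top. 0 < ln R \<and> 0 < c * R powr (\<gamma> + p) \<and>
          ennreal (c * R powr (\<gamma> + p)) \<le> growth_integral M vol q u x0 R"
        using c(2) eventually_gt_at_top[of 1] by eventually_elim (use c(1) in auto)
      have "((\<lambda>R::real. ln c / ln R + (\<gamma> + p)) \<longlongrightarrow> \<gamma> + p) at_top" by real_asymp
      moreover have "\<forall>\<^sub>F R in at_top. ln c / ln R + (\<gamma> + p) = ln (c * R powr (\<gamma> + p)) / ln R"
        using eventually_gt_at_top[of 1]
        by eventually_elim (use c(1) in \<open>simp add: ln_mult ln_powr add_divide_distrib\<close>)
      ultimately show "((\<lambda>R. ln (c * R powr (\<gamma> + p)) / ln R) \<longlongrightarrow> \<gamma> + p) at_top"
        by (rule Lim_transform_eventually)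
    qed
  qed
  then have "\<forall>\<^sub>F \<gamma> in at_left ?c. ereal (\<gamma> + p) \<le> ?L"
    using eventually_at_left_real[OF const_C0_pos[OF p q lam]] by (auto elim: eventually_mono)
  moreover have "((\<lambda>\<gamma>. ereal (\<gamma> + p)) \<longlongrightarrow> ereal (?c + p)) (at_left ?c)"
    by (intro tendsto_intros)
  ultimately show ?thesis by (intro tendsto_upperbound) auto
qed

end

end

theorem theorem1:
  fixes M :: "('a::{t2_space, second_countable_topology}, 'n::finite) riemannian"
    and vol :: "'a measure"
    and p \<mu> lam q :: real
    and V u :: "'a \<Rightarrow> real"
    and x0 :: 'a
  assumes "riemannian_manifold M"
    and "riem_complete M"
    and "connected (UNIV :: 'a set)"
    and "riemannian_volume M vol"
    and "1 < p" and "0 \<le> \<mu>" and "\<mu> \<le> p" and "0 < lam"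
    and "continuous_on UNIV V" and "\<forall>x. 0 < V x"
    and "\<mu> = 0 \<longrightarrow> (\<forall>x. V x \<ge> lam)"
    and "\<mu> > 0 \<longrightarrow>
           (\<exists>o'. Liminf at_infty (\<lambda>x. ereal (riem_dist M x o' powr \<mu> * V x)) \<ge> ereal lam)"
    and "u \<in> W1p_loc M vol p"
    and "emeasure vol {x. u x > 0} > 0"
    and "p_laplacian_ge_weakly_on M vol p V u {x. u x > 0}"
    and "p - 1 < q"
  shows "(\<mu> < p \<longrightarrow>
           Liminf at_top (\<lambda>R::real. ereal (1 / R powr (1 - \<mu> / p)) *
               elog (growth_integral M vol q u x0 R))
             \<ge> ereal (const_C0 p q lam / (1 - \<mu> / p)) \<and>
           const_C0 p q lam / (1 - \<mu> / p) > 0) \<and>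
         (\<mu> = p \<longrightarrow>
           (\<exists>!C. is_const_C1 p q lam C) \<and>
           Liminf at_top (\<lambda>R::real. ereal (1 / ln R) * elog (growth_integral M vol q u x0 R))
             \<ge> ereal (const_C1 p q lam) \<and>
           const_C1 p q lam > p) \<and>
         (\<mu> = p \<longrightarrow>
           (\<forall>l. ((\<lambda>R::real. ereal (1 / ln R) * elog (growth_integral M vol q u x0 R))
                   \<longlongrightarrow> l) at_top \<longrightarrow>
             l \<ge> ereal (const_C0 p q lam + p)))"
proof -
  have cr: "riem_volume M vol"
    using assms(1-4) by unfold_locales
  interpret riem_volume M vol by (rule cr)
  obtain X where X: "in_W1p_loc M vol p u X" using assms(13) unfolding W1p_loc_def by blast
  have V: "\<And>x. 0 < V x" and V0: "\<And>x. \<mu> = 0 \<Longrightarrow> lam \<le> V x"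
    and V1: "\<mu> > 0 \<Longrightarrow> \<exists>o'. Liminf at_infty (\<lambda>x. ereal (riem_dist M x o' powr \<mu> * V x)) \<ge> ereal lam"
    using assms(10-12) by blast+
  note ctx = assms(5,16,6,8) X assms(9) V V0 V1 assms(15,14)
  let ?c = "const_C0 p q lam"
  have c: "0 < ?c" by (rule const_C0_pos[OF assms(5,16,8)])
  show ?thesis
  proof (intro conjI impI allI)
    assume \<mu>p: "\<mu> < p"
    show "ereal (?c / (1 - \<mu> / p)) \<le> Liminf at_top (\<lambda>R. ereal (1 / R powr (1 - \<mu> / p)) * elog (growth_integral M vol q u x0 R))"
      by (rule Liminf_exponential[OF ctx \<mu>p])
    show "0 < ?c / (1 - \<mu> / p)" using c \<mu>p assms(5) by simp
  next
    assume \<mu>p: "\<mu> = p"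
    note L = Liminf_polynomial[OF ctx \<mu>p, of x0]
    note C1 = const_C1_properties[OF assms(5,16,8)]
    show "\<exists>!C. is_const_C1 p q lam C" "p < const_C1 p q lam" by (rule C1)+
    show "ereal (const_C1 p q lam) \<le> Liminf at_top (\<lambda>R. ereal (1 / ln R) * elog (growth_integral M vol q u x0 R))"
      \<comment> \<open>The lower limit is at least C_0 + p, and C_1 does not exceed this
        number.\<close>
      by (rule order_trans[OF _ L]) (use C1(3) in simp)
    fix l assume "((\<lambda>R. ereal (1 / ln R) * elog (growth_integral M vol q u x0 R)) \<longlongrightarrow> l) at_top"
    then have "Liminf at_top (\<lambda>R. ereal (1 / ln R) * elog (growth_integral M vol q u x0 R)) = l"
      by (rule lim_imp_Liminf[rotated]) simp
    then show "ereal (?c + p) \<le> l" using L by simp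
  qed
qed

end
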